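(* Let $\mathbb{S}$ be an equational theory over an $S$-sorted signature $\Sigma$. Then for each category $\mathscr{C}$, the following are equivalent: (i) $\mathscr{C}$ is monadic over $\mathbb{S}\text{-}\mathrm{Mod}$ and its monad preserves sifted colimits. (ii) $\mathscr{C}$ is equivalent to $\mathrm{Alg}(\Omega,E)$ for some $\mathbb{S}$-relative algebraic theory $(\Omega,E)$ whose operators are total and whose axioms (the judgments in $E$) have the form $\top\vdash_{\vec x}\phi$. (iii) $\mathscr{C}$ is equivalent to $\mathbb{T}\text{-}\mathrm{Mod}$ for some $S$-sorted equational theory $\mathbb{T}$ such that there exists a theory morphism $\rho:\mathbb{S}\to\mathbb{T}$ which is the identity on sorts.
   Context: Partial Horn logic. For a set $S$ of sorts, an $S$-sorted signature $\Sigma$ consists of a set of function symbols, each with an arity $f:s_1\times\dots\times s_n\to s$, and a set of relation symbols, each with an arity $R:s_1\times\dots\times s_n$ ($n\ge 0$, $s_i,s\in S$). Each sort has a fixed countably infinite set of variables, disjoint for distinct sorts. Terms are built from variables and function symbols respecting sorts. Horn formulas are built from $R(\tau_1,\dots,\tau_n)$, $\tau=\tau'$ (terms of the same type) and $\top$ by binary conjunction $\wedge$. A context $\vec x$ is a finite tuple of distinct variables; all terms $\vec x.\tau$ and formulas $\vec x.\phi$ are considered in a context containing all their variables. A Horn sequent $\phi\vdash_{\vec x}\psi$ is a pair of Horn formulas in the same context; $\phi\dashv\vdash_{\vec x}\psi$ means both sequents; $\tau{\downarrow}$ abbreviates $\tau=\tau$. A partial Horn theory over $\Sigma$ is a set of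 Horn sequents over $\Sigma$. A partial $\Sigma$-structure $M$ has a set $M_s$ for each sort, a partial map $[\![f]\!]_M:M_{s_1}\times\dots\times M_{s_n}\rightharpoonup M_s$ for each $f$, and a subset $[\![R]\!]_M\subseteq M_{s_1}\times\dots\times M_{s_n}$ for each $R$. Terms are interpreted as partial maps ($f(\tau_1,\dots,\tau_n)$ is defined at $\vec m$ iff all $\tau_i$ are defined at $\vec m$ and $[\![f]\!]_M$ is defined at the resulting tuple); $[\![\vec x.\phi]\!]_M\subseteq\prod_iM_{s_i}$ is defined by: $R(\vec\tau)$ holds at $\vec m$ iff all $\tau_i$ are defined there and the tuple of values is in $[\![R]\!]_M$; $\tau=\tau'$ holds iff both are defined and equal; $\top$ always holds; $\wedge$ is intersection. $\phi\vdash_{\vec x}\psi$ is valid in $M$ if $[\![\vec x.\phi]\!]_M\subseteq[\![\vec x.\psi]\!]_M$. A partial $\mathbb{T}$-model is a partial structure in which all sequents of $\mathbb{T}$ are valid; a PHL-theorem of $\mathbb{T}$ is a Horn sequent valid in all partial $\mathbb{T}$-models. A $\Sigma$-homomorphism $h:M\to N$ is a family of total maps $h_s:M_s\to N_s$ such that if $[\![f]\!]_M(\vec m)$ is defined then $[\![f]\!]_N(h\vec m)$ is defined and equals $h([\![f]\!]_M(\vec m))$, and $\vec m\in[\![R]\!]_M$ implies $h\vec m\in[\![R]\!]_N$. $\mathbb{T}\text{-}\mathrm{PMod}$ is the category of partial $\mathbb{T}$-models and homomorphisms. Equational theories. A partial Horn theory $\mathbb{T}$ over an $S$-sorted signature $\Sigma$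 is an ($S$-sorted) equational theory if $\Sigma$ contains no relation symbol, every function symbol $f$ in $\Sigma$ is total, i.e. $\top\vdash_{\vec x}f(\vec x){\downarrow}$ is a PHL-theorem of $\mathbb{T}$, and every sequent in $\mathbb{T}$ has the form $\top\vdash_{\vec x}\phi$. In this case $\mathbb{T}\text{-}\mathrm{PMod}$ is written $\mathbb{T}\text{-}\mathrm{Mod}$. Theory morphisms. A theory morphism $\rho:\mathbb{S}\to\mathbb{T}$ between partial Horn theories over $S$-sorted signatures $\Sigma,\Sigma'$ that is the identity on sorts assigns to each function symbol (resp. relation symbol) of $\Sigma$ a function symbol (resp. relation symbol) of $\Sigma'$ of the same arity, such that replacing each symbol by its image turns every axiom of $\mathbb{S}$ into a PHL-theorem of $\mathbb{T}$. Relative algebraic theories. An $\mathbb{S}$-relative signature $\Omega$ is a set with, for each $\omega\in\Omega$, a Horn formula-in-context $\mathrm{ar}(\omega)=\vec x.\phi$ over $\Sigma$ and a sort $\mathrm{type}(\omega)\in S$. $\Sigma+\Omega$ is $\Sigma$ with each $\omega$ added as a function symbol $s_1\times\dots\times s_n\to\mathrm{type}(\omega)$, where $s_1,\dots,s_n$ are the sorts of the context of $\mathrm{ar}(\omega)$. An $\mathbb{S}$-relative judgment is a Horn sequent $\phi\vdash_{\vec x}\psi$ over $\Sigma+\Omega$ with $\phi$ over $\Sigma$. An $\mathbb{S}$-relative algebraic theory is a pair $(\Omega,E)$ of an $\mathbb{S}$-relative signature and a set $E$ of $\mathbb{S}$-relative judgments. An $\Omega$-algebra is a partial $\mathbb{S}$-model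 $A$ with, for each $\omega\in\Omega$, a map $[\![\mathrm{ar}(\omega)]\!]_A\to A_{\mathrm{type}(\omega)}$; it is regarded as a partial $(\Sigma+\Omega)$-structure in which $\omega$ is a partial operation with domain exactly $[\![\mathrm{ar}(\omega)]\!]_A$. $\mathrm{Alg}(\Omega,E)$ is the category of $\Omega$-algebras in which all judgments of $E$ are valid, with $(\Sigma+\Omega)$-homomorphisms; it is the category of partial models of $\mathbb{T}_{\Omega,E}:=\mathbb{S}\cup\{\omega(\vec x){\downarrow}\dashv\vdash_{\vec x}\mathrm{ar}(\omega)\}_{\omega\in\Omega}\cup E$. An operator $\omega$ is total if $\top\vdash_{\vec x}\omega(\vec x){\downarrow}$ is a PHL-theorem of $\mathbb{T}_{\Omega,E}$. Categories. A small category is sifted if colimits indexed by it commute with finite products in $\mathbf{Set}$; a sifted colimit is a colimit indexed by a small sifted category. "$\mathscr{C}$ is monadic over $\mathscr{A}$ and its monad preserves sifted colimits" means that there is a functor $\mathscr{C}\to\mathscr{A}$ with a left adjoint whose comparison functor to the Eilenberg–Moore category of the induced monad is an equivalence, and the underlying endofunctor of this monad preserves sifted colimits. *)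

theory Defs
  imports Main "HOL-Library.FuncSet"
begin

unbundle cardinal_syntax

section \<open>Smallness\<close>

text \<open>
  A type \<open>'u\<close> whose cardinality \<open>\<kappa>\<close> is regular and uncountable plays the role of the universe:
  a set (over any type) is small iff its cardinality is below \<open>\<kappa>\<close>.  Carriers of structures, the
  sets of sorts and of symbols of a signature, the index categories of colimits and the objects of
  the category of sets are all required to be small.  If \<open>\<kappa>\<close> is strongly inaccessible, the small
  sets are those of a Grothendieck universe; no strong limit hypothesis is imposed, so that also
  types such as \<open>nat suc\<close> (where \<open>\<kappa>\<close> is the first uncountable cardinal) are covered.
\<close>

definition universe :: "'u itself \<Rightarrow> bool" where
  "universe U \<longleftrightarrow> regularCard |UNIV :: 'u set| \<and> natLeq <o |UNIV :: 'u set|"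

definition small :: "'u itself \<Rightarrow> 'x set \<Rightarrow> bool" where
  "small U A \<longleftrightarrow> |A| <o |UNIV :: 'u set|"


section \<open>Categories\<close>

record ('o, 'a) cat =
  Obj :: "'o set"
  Arr :: "'a set"
  Dom :: "'a \<Rightarrow> 'o"
  Cod :: "'a \<Rightarrow> 'o"
  Id :: "'o \<Rightarrow> 'a"
  Comp :: "'a \<Rightarrow> 'a \<Rightarrow> 'a"  \<comment> \<open>\<open>Comp C g f\<close> is "\<open>g\<close> after \<open>f\<close>"\<close>

definition hom :: "('o, 'a) cat \<Rightarrow> 'o \<Rightarrow> 'o \<Rightarrow> 'a set" where
  "hom C x y = {f \<in> Arr C. Dom C f = x \<and> Cod C f = y}"

locale category =
  fixes C :: "('o, 'a) cat"
  assumes Dom_in: "f \<in> Arr C \<Longrightarrow> Dom C f \<in> Obj C"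
    and Cod_in: "f \<in> Arr C \<Longrightarrow> Cod C f \<in> Obj C"
    and Id_in: "x \<in> Obj C \<Longrightarrow> Id C x \<in> hom C x x"
    and Comp_in: "\<lbrakk>f \<in> hom C x y; g \<in> hom C y z\<rbrakk> \<Longrightarrow> Comp C g f \<in> hom C x z"
    and Id_left: "f \<in> hom C x y \<Longrightarrow> Comp C (Id C y) f = f"
    and Id_right: "f \<in> hom C x y \<Longrightarrow> Comp C f (Id C x) = f"
    and assoc: "\<lbrakk>f \<in> hom C x y; g \<in> hom C y z; h \<in> hom C z w\<rbrakk>
                  \<Longrightarrow> Comp C h (Comp C g f) = Comp C (Comp C h g) f"

definition iso_arr :: "('o, 'a) cat \<Rightarrow> 'a \<Rightarrow> bool" where
  "iso_arr C f \<longleftrightarrow> f \<in> Arr C \<and>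
     (\<exists>g \<in> hom C (Cod C f) (Dom C f). Comp C g f = Id C (Dom C f) \<and> Comp C f g = Id C (Cod C f))"

record ('o, 'a, 'p, 'b) func =
  Ob :: "'o \<Rightarrow> 'p"
  Ar :: "'a \<Rightarrow> 'b"

definition is_functor :: "('o, 'a) cat \<Rightarrow> ('p, 'b) cat \<Rightarrow> ('o, 'a, 'p, 'b) func \<Rightarrow> bool" where
  "is_functor C D F \<longleftrightarrow>
     (\<forall>x \<in> Obj C. Ob F x \<in> Obj D) \<and>
     (\<forall>x \<in> Obj C. \<forall>y \<in> Obj C. \<forall>f \<in> hom C x y. Ar F f \<in> hom D (Ob F x) (Ob F y)) \<and>
     (\<forall>x \<in> Obj C. Ar F (Id C x) = Id D (Ob F x)) \<and>
     (\<forall>f \<in> Arr C. \<forall>g \<in> Arr C. Cod C f = Dom C g \<longrightarrow>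
        Ar F (Comp C g f) = Comp D (Ar F g) (Ar F f))"

definition id_func :: "('o, 'a, 'o, 'a) func" where
  "id_func = \<lparr>Ob = (\<lambda>x. x), Ar = (\<lambda>f. f)\<rparr>"

definition comp_func ::
  "('p, 'b, 'q, 'c) func \<Rightarrow> ('o, 'a, 'p, 'b) func \<Rightarrow> ('o, 'a, 'q, 'c) func" where
  "comp_func G F = \<lparr>Ob = (\<lambda>x. Ob G (Ob F x)), Ar = (\<lambda>f. Ar G (Ar F f))\<rparr>"

definition nat_trans :: "('o, 'a) cat \<Rightarrow> ('p, 'b) cat \<Rightarrow> ('o, 'a, 'p, 'b) func
    \<Rightarrow> ('o, 'a, 'p, 'b) func \<Rightarrow> ('o \<Rightarrow> 'b) \<Rightarrow> bool" where
  "nat_trans C D F G \<eta> \<longleftrightarrow>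
     (\<forall>x \<in> Obj C. \<eta> x \<in> hom D (Ob F x) (Ob G x)) \<and>
     (\<forall>f \<in> Arr C. Comp D (\<eta> (Cod C f)) (Ar F f) = Comp D (Ar G f) (\<eta> (Dom C f)))"

definition nat_iso :: "('o, 'a) cat \<Rightarrow> ('p, 'b) cat \<Rightarrow> ('o, 'a, 'p, 'b) func
    \<Rightarrow> ('o, 'a, 'p, 'b) func \<Rightarrow> ('o \<Rightarrow> 'b) \<Rightarrow> bool" where
  "nat_iso C D F G \<eta> \<longleftrightarrow> nat_trans C D F G \<eta> \<and> (\<forall>x \<in> Obj C. iso_arr D (\<eta> x))"

definition is_equivalence :: "('o, 'a) cat \<Rightarrow> ('p, 'b) cat \<Rightarrow> ('o, 'a, 'p, 'b) func \<Rightarrow> bool" where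
  "is_equivalence C D F \<longleftrightarrow> is_functor C D F \<and>
     (\<exists>G \<alpha> \<beta>. is_functor D C G \<and>
        nat_iso C C id_func (comp_func G F) \<alpha> \<and>
        nat_iso D D (comp_func F G) id_func \<beta>)"

definition equivalent_cats :: "('o, 'a) cat \<Rightarrow> ('p, 'b) cat \<Rightarrow> bool" where
  "equivalent_cats C D \<longleftrightarrow> (\<exists>F. is_equivalence C D F)"


subsection \<open>Adjunctions and monads\<close>

text \<open>\<open>F : A \<rightarrow> C\<close> is left adjoint to \<open>U : C \<rightarrow> A\<close> with unit \<open>\<eta>\<close> and counit \<open>\<epsilon>\<close>.\<close>

definition adjunction :: "('o, 'a) cat \<Rightarrow> ('p, 'b) cat \<Rightarrow> ('p, 'b, 'o, 'a) func
    \<Rightarrow> ('o, 'a, 'p, 'b) func \<Rightarrow> ('p \<Rightarrow> 'b) \<Rightarrow> ('o \<Rightarrow> 'a) \<Rightarrow> bool" where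
  "adjunction C A F U \<eta> \<epsilon> \<longleftrightarrow>
     is_functor A C F \<and> is_functor C A U \<and>
     nat_trans A A id_func (comp_func U F) \<eta> \<and>
     nat_trans C C (comp_func F U) id_func \<epsilon> \<and>
     (\<forall>x \<in> Obj A. Comp C (\<epsilon> (Ob F x)) (Ar F (\<eta> x)) = Id C (Ob F x)) \<and>
     (\<forall>c \<in> Obj C. Comp A (Ar U (\<epsilon> c)) (\<eta> (Ob U c)) = Id A (Ob U c))"

record ('p, 'b) monad =
  endo :: "('p, 'b, 'p, 'b) func"
  unit :: "'p \<Rightarrow> 'b"
  mult :: "'p \<Rightarrow> 'b"

definition induced_monad :: "('p, 'b, 'o, 'a) func \<Rightarrow> ('o, 'a, 'p, 'b) func
    \<Rightarrow> ('p \<Rightarrow> 'b) \<Rightarrow> ('o \<Rightarrow> 'a) \<Rightarrow> ('p, 'b) monad" where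
  "induced_monad F U \<eta> \<epsilon> =
     \<lparr>endo = comp_func U F, unit = \<eta>, mult = (\<lambda>x. Ar U (\<epsilon> (Ob F x)))\<rparr>"

definition EM_algebras :: "('p, 'b) cat \<Rightarrow> ('p, 'b) monad \<Rightarrow> ('p \<times> 'b) set" where
  "EM_algebras A T = {(x, a). x \<in> Obj A \<and> a \<in> hom A (Ob (endo T) x) x \<and>
     Comp A a (unit T x) = Id A x \<and>
     Comp A a (mult T x) = Comp A a (Ar (endo T) a)}"

definition EM_cat :: "('p, 'b) cat \<Rightarrow> ('p, 'b) monad
    \<Rightarrow> ('p \<times> 'b, ('p \<times> 'b) \<times> 'b \<times> ('p \<times> 'b)) cat" where
  "EM_cat A T =
     \<lparr>Obj = EM_algebras A T,
      Arr = {((x, a), f, (y, b)). (x, a) \<in> EM_algebras A T \<and> (y, b) \<in> EM_algebras A T \<and>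
               f \<in> hom A x y \<and> Comp A f a = Comp A b (Ar (endo T) f)},
      Dom = (\<lambda>(X, f, Y). X),
      Cod = (\<lambda>(X, f, Y). Y),
      Id = (\<lambda>X. (X, Id A (fst X), X)),
      Comp = (\<lambda>(Y, g, Z) (X, f, Y'). (X, Comp A g f, Z))\<rparr>"

definition comparison :: "('o, 'a) cat \<Rightarrow> ('o, 'a, 'p, 'b) func \<Rightarrow> ('o \<Rightarrow> 'a)
    \<Rightarrow> ('o, 'a, 'p \<times> 'b, ('p \<times> 'b) \<times> 'b \<times> ('p \<times> 'b)) func" where
  "comparison C U \<epsilon> =
     (let K = (\<lambda>c. (Ob U c, Ar U (\<epsilon> c)))
      in \<lparr>Ob = K, Ar = (\<lambda>f. (K (Dom C f), Ar U f, K (Cod C f)))\<rparr>)"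


text \<open>
  \<open>U\<close> has a left adjoint \<open>F\<close> whose comparison functor to the Eilenberg--Moore category of the
  induced monad is an equivalence.
\<close>

definition monadic_adjunction :: "('o, 'a) cat \<Rightarrow> ('p, 'b) cat \<Rightarrow> ('p, 'b, 'o, 'a) func
    \<Rightarrow> ('o, 'a, 'p, 'b) func \<Rightarrow> ('p \<Rightarrow> 'b) \<Rightarrow> ('o \<Rightarrow> 'a) \<Rightarrow> bool" where
  "monadic_adjunction C A F U \<eta> \<epsilon> \<longleftrightarrow> adjunction C A F U \<eta> \<epsilon> \<and>
     is_equivalence C (EM_cat A (induced_monad F U \<eta> \<epsilon>)) (comparison C U \<epsilon>)"


subsection \<open>Colimits, finite products, siftedness\<close>

definition is_cocone :: "('j, 'k) cat \<Rightarrow> ('o, 'a) cat \<Rightarrow> ('j, 'k, 'o, 'a) func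
    \<Rightarrow> 'o \<Rightarrow> ('j \<Rightarrow> 'a) \<Rightarrow> bool" where
  "is_cocone J C D c \<iota> \<longleftrightarrow> c \<in> Obj C \<and>
     (\<forall>j \<in> Obj J. \<iota> j \<in> hom C (Ob D j) c) \<and>
     (\<forall>u \<in> Arr J. Comp C (\<iota> (Cod J u)) (Ar D u) = \<iota> (Dom J u))"

definition is_colimit :: "('j, 'k) cat \<Rightarrow> ('o, 'a) cat \<Rightarrow> ('j, 'k, 'o, 'a) func
    \<Rightarrow> 'o \<Rightarrow> ('j \<Rightarrow> 'a) \<Rightarrow> bool" where
  "is_colimit J C D c \<iota> \<longleftrightarrow> is_cocone J C D c \<iota> \<and>
     (\<forall>d \<kappa>. is_cocone J C D d \<kappa> \<longrightarrow>
        (\<exists>!h. h \<in> hom C c d \<and> (\<forall>j \<in> Obj J. Comp C h (\<iota> j) = \<kappa> j)))"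

definition is_product :: "('o, 'a) cat \<Rightarrow> nat \<Rightarrow> (nat \<Rightarrow> 'o) \<Rightarrow> 'o \<Rightarrow> (nat \<Rightarrow> 'a) \<Rightarrow> bool" where
  "is_product C n X p \<pi> \<longleftrightarrow> p \<in> Obj C \<and>
     (\<forall>i<n. \<pi> i \<in> hom C p (X i)) \<and>
     (\<forall>z \<in> Obj C. \<forall>f. (\<forall>i<n. f i \<in> hom C z (X i)) \<longrightarrow>
        (\<exists>!h. h \<in> hom C z p \<and> (\<forall>i<n. Comp C (\<pi> i) h = f i)))"

definition set_cat :: "('u set, 'u set \<times> ('u \<Rightarrow> 'u) \<times> 'u set) cat" where
  "set_cat =
     \<lparr>Obj = {A. small TYPE('u) A},
      Arr = {(A, f, B). small TYPE('u) A \<and> small TYPE('u) B \<and> f \<in> A \<rightarrow>\<^sub>E B},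
      Dom = (\<lambda>(A, f, B). A),
      Cod = (\<lambda>(A, f, B). B),
      Id = (\<lambda>A. (A, restrict (\<lambda>x. x) A, A)),
      Comp = (\<lambda>(B, g, C) (A, f, B'). (A, compose A g f, C))\<rparr>"

definition small_cat :: "('u, 'u) cat \<Rightarrow> bool" where
  "small_cat J \<longleftrightarrow> category J \<and> small TYPE('u) (Obj J) \<and> small TYPE('u) (Arr J)"

text \<open>
  Colimits over \<open>J\<close> commute with finite products in the category of sets: given a finite family
  of diagrams \<open>D i\<close> with colimits \<open>(L i, \<iota> i)\<close>, and a pointwise product \<open>(P, \<pi>)\<close> of these diagrams
  with colimit \<open>(Q, \<kappa>)\<close>, the canonical maps \<open>q i : Q \<rightarrow> L i\<close> (determined by
  \<open>q i \<circ> \<kappa> j = \<iota> i j \<circ> \<pi> i j\<close>) exhibit \<open>Q\<close> as the product of the \<open>L i\<close>, that is, the comparison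
  map from the colimit of the products to the product of the colimits is invertible.
\<close>

definition sifted :: "('u, 'u) cat \<Rightarrow> bool" where
  "sifted J \<longleftrightarrow> small_cat J \<and>
     (\<forall>(n::nat) D P \<pi> L \<iota> Q \<kappa> q.
        (\<forall>i<n. is_functor J (set_cat :: ('u set, _) cat) (D i)) \<and>
        is_functor J set_cat P \<and>
        (\<forall>i<n. nat_trans J set_cat P (D i) (\<pi> i)) \<and>
        (\<forall>j \<in> Obj J. is_product set_cat n (\<lambda>i. Ob (D i) j) (Ob P j) (\<lambda>i. \<pi> i j)) \<and>
        (\<forall>i<n. is_colimit J set_cat (D i) (L i) (\<iota> i)) \<and>
        is_colimit J set_cat P Q \<kappa> \<and>
        (\<forall>i<n. q i \<in> hom set_cat Q (L i) \<and>
           (\<forall>j \<in> Obj J. Comp set_cat (q i) (\<kappa> j) = Comp set_cat (\<iota> i j) (\<pi> i j)))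
        \<longrightarrow> is_product set_cat n L Q q)"

definition preserves_sifted_colimits :: "'u itself \<Rightarrow> ('o, 'a) cat \<Rightarrow> ('p, 'b) cat
    \<Rightarrow> ('o, 'a, 'p, 'b) func \<Rightarrow> bool" where
  "preserves_sifted_colimits U A B T \<longleftrightarrow>
     (\<forall>(J :: ('u, 'u) cat) D c \<iota>. sifted J \<and> is_functor J A D \<and> is_colimit J A D c \<iota> \<longrightarrow>
        is_colimit J B (comp_func T D) (Ob T c) (\<lambda>j. Ar T (\<iota> j)))"

definition monadic_sifted :: "'u itself \<Rightarrow> ('o, 'a) cat \<Rightarrow> ('p, 'b) cat \<Rightarrow> bool" where
  "monadic_sifted V C A \<longleftrightarrow>
     (\<exists>F U \<eta> \<epsilon>. monadic_adjunction C A F U \<eta> \<epsilon> \<and>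
        preserves_sifted_colimits V A A (endo (induced_monad F U \<eta> \<epsilon>)))"


section \<open>Partial Horn logic\<close>

text \<open>
  Types \<open>'s\<close>, \<open>'f\<close>, \<open>'r\<close> contain sorts, function symbols, relation symbols.  A variable is a pair
  of a sort and a number, so that each sort has its own countably infinite supply.
\<close>

type_synonym 's var = "'s \<times> nat"

record ('s, 'f, 'r) signature =
  sorts :: "'s set"
  funs :: "'f set"
  farity :: "'f \<Rightarrow> 's list"
  fsort :: "'f \<Rightarrow> 's"
  rels :: "'r set"
  rarity :: "'r \<Rightarrow> 's list"

definition is_signature :: "'u itself \<Rightarrow> ('s, 'f, 'r) signature \<Rightarrow> bool" where
  "is_signature U \<Sigma> \<longleftrightarrow>
     small U (sorts \<Sigma>) \<and> small U (funs \<Sigma>) \<and> small U (rels \<Sigma>) \<and>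
     (\<forall>f \<in> funs \<Sigma>. set (farity \<Sigma> f) \<subseteq> sorts \<Sigma> \<and> fsort \<Sigma> f \<in> sorts \<Sigma>) \<and>
     (\<forall>R \<in> rels \<Sigma>. set (rarity \<Sigma> R) \<subseteq> sorts \<Sigma>)"

datatype (dead 's, 'f) tm = Var "'s var" | App 'f "('s, 'f) tm list"

datatype (dead 's, 'f, 'r) horn =
    Rel 'r "('s, 'f) tm list"
  | Eq "('s, 'f) tm" "('s, 'f) tm"
  | Top
  | And "('s, 'f, 'r) horn" "('s, 'f, 'r) horn"

datatype (dead 's, 'f, 'r) sequent =
  Sequent (ctx: "'s var list") (prem: "('s, 'f, 'r) horn") (concl: "('s, 'f, 'r) horn")

abbreviation defd :: "('s, 'f) tm \<Rightarrow> ('s, 'f, 'r) horn" where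
  "defd t \<equiv> Eq t t"

definition wf_ctx :: "('s, 'f, 'r) signature \<Rightarrow> 's var list \<Rightarrow> bool" where
  "wf_ctx \<Sigma> xs \<longleftrightarrow> distinct xs \<and> fst ` set xs \<subseteq> sorts \<Sigma>"

inductive wf_tm :: "('s, 'f, 'r) signature \<Rightarrow> 's var list \<Rightarrow> ('s, 'f) tm \<Rightarrow> 's \<Rightarrow> bool"
  for \<Sigma> xs where
  "v \<in> set xs \<Longrightarrow> wf_tm \<Sigma> xs (Var v) (fst v)"
| "\<lbrakk>f \<in> funs \<Sigma>; list_all2 (wf_tm \<Sigma> xs) ts (farity \<Sigma> f)\<rbrakk> \<Longrightarrow> wf_tm \<Sigma> xs (App f ts) (fsort \<Sigma> f)"

fun wf_horn :: "('s, 'f, 'r) signature \<Rightarrow> 's var list \<Rightarrow> ('s, 'f, 'r) horn \<Rightarrow> bool" where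
  "wf_horn \<Sigma> xs (Rel R ts) \<longleftrightarrow> R \<in> rels \<Sigma> \<and> list_all2 (wf_tm \<Sigma> xs) ts (rarity \<Sigma> R)"
| "wf_horn \<Sigma> xs (Eq t t') \<longleftrightarrow> (\<exists>s. wf_tm \<Sigma> xs t s \<and> wf_tm \<Sigma> xs t' s)"
| "wf_horn \<Sigma> xs Top \<longleftrightarrow> True"
| "wf_horn \<Sigma> xs (And \<phi> \<psi>) \<longleftrightarrow> wf_horn \<Sigma> xs \<phi> \<and> wf_horn \<Sigma> xs \<psi>"

definition wf_sequent :: "('s, 'f, 'r) signature \<Rightarrow> ('s, 'f, 'r) sequent \<Rightarrow> bool" where
  "wf_sequent \<Sigma> e \<longleftrightarrow>
     wf_ctx \<Sigma> (ctx e) \<and> wf_horn \<Sigma> (ctx e) (prem e) \<and> wf_horn \<Sigma> (ctx e) (concl e)"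

record ('s, 'f, 'r) pht =
  sgn :: "('s, 'f, 'r) signature"
  axs :: "('s, 'f, 'r) sequent set"

definition is_pht :: "'u itself \<Rightarrow> ('s, 'f, 'r) pht \<Rightarrow> bool" where
  "is_pht U T \<longleftrightarrow> is_signature U (sgn T) \<and> (\<forall>e \<in> axs T. wf_sequent (sgn T) e)"


subsection \<open>Partial structures and models\<close>

record ('s, 'f, 'r, 'u) pstructure =
  car :: "'s \<Rightarrow> 'u set"
  fint :: "'f \<Rightarrow> 'u list \<Rightarrow> 'u option"
  rint :: "'r \<Rightarrow> 'u list set"

text \<open>Outside the signature, the components of a structure are fixed to be empty.\<close>

definition is_pstructure :: "('s, 'f, 'r) signature \<Rightarrow> ('s, 'f, 'r, 'u) pstructure \<Rightarrow> bool" where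
  "is_pstructure \<Sigma> M \<longleftrightarrow>
     (\<forall>s. small TYPE('u) (car M s)) \<and>
     (\<forall>s. s \<notin> sorts \<Sigma> \<longrightarrow> car M s = {}) \<and>
     (\<forall>f ms m. fint M f ms = Some m \<longrightarrow>
        f \<in> funs \<Sigma> \<and> ms \<in> listset (map (car M) (farity \<Sigma> f)) \<and> m \<in> car M (fsort \<Sigma> f)) \<and>
     (\<forall>R ms. ms \<in> rint M R \<longrightarrow> R \<in> rels \<Sigma> \<and> ms \<in> listset (map (car M) (rarity \<Sigma> R)))"

text \<open>The value of a term in context \<open>xs\<close> at the tuple \<open>ms\<close>; \<open>None\<close> means undefined.\<close>

fun tval :: "('s, 'f, 'r, 'u) pstructure \<Rightarrow> 's var list \<Rightarrow> 'u list \<Rightarrow> ('s, 'f) tm \<Rightarrow> 'u option" where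
  "tval M xs ms (Var v) = map_of (zip xs ms) v"
| "tval M xs ms (App f ts) = Option.bind (those (map (tval M xs ms) ts)) (fint M f)"

fun holds :: "('s, 'f, 'r, 'u) pstructure \<Rightarrow> 's var list \<Rightarrow> 'u list \<Rightarrow> ('s, 'f, 'r) horn \<Rightarrow> bool" where
  "holds M xs ms (Rel R ts) \<longleftrightarrow> (\<exists>vs. those (map (tval M xs ms) ts) = Some vs \<and> vs \<in> rint M R)"
| "holds M xs ms (Eq t t') \<longleftrightarrow> (\<exists>v. tval M xs ms t = Some v \<and> tval M xs ms t' = Some v)"
| "holds M xs ms Top \<longleftrightarrow> True"
| "holds M xs ms (And \<phi> \<psi>) \<longleftrightarrow> holds M xs ms \<phi> \<and> holds M xs ms \<psi>"

definition interp :: "('s, 'f, 'r, 'u) pstructure \<Rightarrow> 's var list \<Rightarrow> ('s, 'f, 'r) horn \<Rightarrow> 'u list set" where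
  "interp M xs \<phi> = {ms \<in> listset (map (\<lambda>v. car M (fst v)) xs). holds M xs ms \<phi>}"

definition valid :: "('s, 'f, 'r, 'u) pstructure \<Rightarrow> ('s, 'f, 'r) sequent \<Rightarrow> bool" where
  "valid M e \<longleftrightarrow> interp M (ctx e) (prem e) \<subseteq> interp M (ctx e) (concl e)"

definition is_pmodel :: "('s, 'f, 'r) pht \<Rightarrow> ('s, 'f, 'r, 'u) pstructure \<Rightarrow> bool" where
  "is_pmodel T M \<longleftrightarrow> is_pstructure (sgn T) M \<and> (\<forall>e \<in> axs T. valid M e)"

definition phl_theorem :: "'u itself \<Rightarrow> ('s, 'f, 'r) pht \<Rightarrow> ('s, 'f, 'r) sequent \<Rightarrow> bool" where
  "phl_theorem U T e \<longleftrightarrow> wf_sequent (sgn T) e \<and>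
     (\<forall>M :: ('s, 'f, 'r, 'u) pstructure. is_pmodel T M \<longrightarrow> valid M e)"

text \<open>
  Homomorphisms are extensional (\<open>undefined\<close> off the carriers), so that two of them are equal as
  HOL functions iff they agree on the carriers.
\<close>

definition hmap :: "('s \<Rightarrow> 'u \<Rightarrow> 'u) \<Rightarrow> 's list \<Rightarrow> 'u list \<Rightarrow> 'u list" where
  "hmap h ss ms = map2 h ss ms"

definition is_hom :: "('s, 'f, 'r) signature \<Rightarrow> ('s, 'f, 'r, 'u) pstructure
    \<Rightarrow> ('s, 'f, 'r, 'u) pstructure \<Rightarrow> ('s \<Rightarrow> 'u \<Rightarrow> 'u) \<Rightarrow> bool" where
  "is_hom \<Sigma> M N h \<longleftrightarrow>
     (\<forall>s. h s \<in> car M s \<rightarrow>\<^sub>E car N s) \<and>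
     (\<forall>f \<in> funs \<Sigma>. \<forall>ms m. fint M f ms = Some m \<longrightarrow>
        fint N f (hmap h (farity \<Sigma> f) ms) = Some (h (fsort \<Sigma> f) m)) \<and>
     (\<forall>R \<in> rels \<Sigma>. \<forall>ms \<in> rint M R. hmap h (rarity \<Sigma> R) ms \<in> rint N R)"

type_synonym ('s, 'f, 'r, 'u) pstructure_cat =
  "(('s, 'f, 'r, 'u) pstructure,
    ('s, 'f, 'r, 'u) pstructure \<times> ('s \<Rightarrow> 'u \<Rightarrow> 'u) \<times> ('s, 'f, 'r, 'u) pstructure) cat"

definition pstructure_cat :: "('s, 'f, 'r) signature \<Rightarrow> ('s, 'f, 'r, 'u) pstructure set
    \<Rightarrow> ('s, 'f, 'r, 'u) pstructure_cat" where
  "pstructure_cat \<Sigma> \<M> =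
     \<lparr>Obj = \<M>,
      Arr = {(M, h, N). M \<in> \<M> \<and> N \<in> \<M> \<and> is_hom \<Sigma> M N h},
      Dom = (\<lambda>(M, h, N). M),
      Cod = (\<lambda>(M, h, N). N),
      Id = (\<lambda>M. (M, \<lambda>s. restrict (\<lambda>x. x) (car M s), M)),
      Comp = (\<lambda>(N, k, P) (M, h, N'). (M, \<lambda>s. compose (car M s) (k s) (h s), P))\<rparr>"

definition PMod :: "('s, 'f, 'r) pht \<Rightarrow> ('s, 'f, 'r, 'u) pstructure_cat" where
  "PMod T = pstructure_cat (sgn T) {M. is_pmodel T M}"


subsection \<open>Equational theories and theory morphisms\<close>

definition generic_ctx :: "'s list \<Rightarrow> 's var list" where
  "generic_ctx ss = zip ss [0..<length ss]"

definition total_fun :: "'u itself \<Rightarrow> ('s, 'f, 'r) pht \<Rightarrow> 'f \<Rightarrow> bool" where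
  "total_fun U T f \<longleftrightarrow>
     (let xs = generic_ctx (farity (sgn T) f)
      in phl_theorem U T (Sequent xs Top (defd (App f (map Var xs)))))"

definition equational_theory :: "'u itself \<Rightarrow> ('s, 'f, 'r) pht \<Rightarrow> bool" where
  "equational_theory U T \<longleftrightarrow> is_pht U T \<and> rels (sgn T) = {} \<and>
     (\<forall>f \<in> funs (sgn T). total_fun U T f) \<and>
     (\<forall>e \<in> axs T. prem e = Top)"

definition theory_morphism :: "'u itself \<Rightarrow> ('s, 'f, 'r) pht \<Rightarrow> ('s, 'g, 'q) pht
    \<Rightarrow> ('f \<Rightarrow> 'g) \<Rightarrow> ('r \<Rightarrow> 'q) \<Rightarrow> bool" where
  "theory_morphism U S T \<rho>f \<rho>r \<longleftrightarrow>
     sorts (sgn S) = sorts (sgn T) \<and>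
     (\<forall>f \<in> funs (sgn S). \<rho>f f \<in> funs (sgn T) \<and>
        farity (sgn T) (\<rho>f f) = farity (sgn S) f \<and> fsort (sgn T) (\<rho>f f) = fsort (sgn S) f) \<and>
     (\<forall>R \<in> rels (sgn S). \<rho>r R \<in> rels (sgn T) \<and> rarity (sgn T) (\<rho>r R) = rarity (sgn S) R) \<and>
     (\<forall>e \<in> axs S. phl_theorem U T (map_sequent \<rho>f \<rho>r e))"


section \<open>Relative algebraic theories\<close>

text \<open>
  In \<open>\<Sigma> + \<Omega>\<close> the symbols of \<open>\<Sigma>\<close> are tagged by \<open>Inl\<close> and the operators by \<open>Inr\<close>.
\<close>

record ('s, 'f, 'r, 'w) relsig =
  ops :: "'w set"
  opar :: "'w \<Rightarrow> 's var list \<times> ('s, 'f, 'r) horn"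
  optype :: "'w \<Rightarrow> 's"

definition is_relsig :: "'u itself \<Rightarrow> ('s, 'f, 'r) pht \<Rightarrow> ('s, 'f, 'r, 'w) relsig \<Rightarrow> bool" where
  "is_relsig U S \<Omega> \<longleftrightarrow> small U (ops \<Omega>) \<and>
     (\<forall>\<omega> \<in> ops \<Omega>. optype \<Omega> \<omega> \<in> sorts (sgn S) \<and>
        wf_ctx (sgn S) (fst (opar \<Omega> \<omega>)) \<and> wf_horn (sgn S) (fst (opar \<Omega> \<omega>)) (snd (opar \<Omega> \<omega>)))"

definition ext_sig ::
  "('s, 'f, 'r) signature \<Rightarrow> ('s, 'f, 'r, 'w) relsig \<Rightarrow> ('s, 'f + 'w, 'r) signature" where
  "ext_sig \<Sigma> \<Omega> =
     \<lparr>sorts = sorts \<Sigma>,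
      funs = Inl ` funs \<Sigma> \<union> Inr ` ops \<Omega>,
      farity = case_sum (farity \<Sigma>) (\<lambda>\<omega>. map fst (fst (opar \<Omega> \<omega>))),
      fsort = case_sum (fsort \<Sigma>) (optype \<Omega>),
      rels = rels \<Sigma>,
      rarity = rarity \<Sigma>\<rparr>"

abbreviation lift_horn :: "('s, 'f, 'r) horn \<Rightarrow> ('s, 'f + 'w, 'r) horn" where
  "lift_horn \<equiv> map_horn Inl id"

definition relative_judgment :: "('s, 'f, 'r) pht \<Rightarrow> ('s, 'f, 'r, 'w) relsig
    \<Rightarrow> ('s, 'f + 'w, 'r) sequent \<Rightarrow> bool" where
  "relative_judgment S \<Omega> e \<longleftrightarrow> wf_sequent (ext_sig (sgn S) \<Omega>) e \<and>
     (\<exists>\<phi>. wf_horn (sgn S) (ctx e) \<phi> \<and> prem e = lift_horn \<phi>)"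

definition relative_algebraic_theory :: "'u itself \<Rightarrow> ('s, 'f, 'r) pht
    \<Rightarrow> ('s, 'f, 'r, 'w) relsig \<Rightarrow> ('s, 'f + 'w, 'r) sequent set \<Rightarrow> bool" where
  "relative_algebraic_theory U S \<Omega> E \<longleftrightarrow>
     is_relsig U S \<Omega> \<and> (\<forall>e \<in> E. relative_judgment S \<Omega> e)"

definition reduct :: "('s, 'f + 'w, 'r, 'u) pstructure \<Rightarrow> ('s, 'f, 'r, 'u) pstructure" where
  "reduct A = \<lparr>car = car A, fint = (\<lambda>f. fint A (Inl f)), rint = rint A\<rparr>"

definition is_algebra :: "('s, 'f, 'r) pht \<Rightarrow> ('s, 'f, 'r, 'w) relsig
    \<Rightarrow> ('s, 'f + 'w, 'r, 'u) pstructure \<Rightarrow> bool" where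
  "is_algebra S \<Omega> A \<longleftrightarrow> is_pstructure (ext_sig (sgn S) \<Omega>) A \<and> is_pmodel S (reduct A) \<and>
     (\<forall>\<omega> \<in> ops \<Omega>. dom (fint A (Inr \<omega>)) = interp (reduct A) (fst (opar \<Omega> \<omega>)) (snd (opar \<Omega> \<omega>)))"

definition Alg :: "('s, 'f, 'r) pht \<Rightarrow> ('s, 'f, 'r, 'w) relsig
    \<Rightarrow> ('s, 'f + 'w, 'r) sequent set \<Rightarrow> ('s, 'f + 'w, 'r, 'u) pstructure_cat" where
  "Alg S \<Omega> E = pstructure_cat (ext_sig (sgn S) \<Omega>) {A. is_algebra S \<Omega> A \<and> (\<forall>e \<in> E. valid A e)}"

definition op_defd :: "('s, 'f, 'r, 'w) relsig \<Rightarrow> 'w \<Rightarrow> ('s, 'f + 'w, 'r) horn" where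
  "op_defd \<Omega> \<omega> = defd (App (Inr \<omega>) (map Var (fst (opar \<Omega> \<omega>))))"

text \<open>The partial Horn theory \<open>\<bbbT>\<^bsub>\<Omega>,E\<^esub>\<close> whose models are the \<open>(\<Omega>,E)\<close>-algebras.\<close>

definition alg_pht :: "('s, 'f, 'r) pht \<Rightarrow> ('s, 'f, 'r, 'w) relsig
    \<Rightarrow> ('s, 'f + 'w, 'r) sequent set \<Rightarrow> ('s, 'f + 'w, 'r) pht" where
  "alg_pht S \<Omega> E =
     \<lparr>sgn = ext_sig (sgn S) \<Omega>,
      axs = map_sequent Inl id ` axs S \<union>
        (\<Union>\<omega> \<in> ops \<Omega>. case opar \<Omega> \<omega> of (xs, \<phi>) \<Rightarrow>
           {Sequent xs (op_defd \<Omega> \<omega>) (lift_horn \<phi>), Sequent xs (lift_horn \<phi>) (op_defd \<Omega> \<omega>)}) \<union>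
        E\<rparr>"

definition total_op :: "'u itself \<Rightarrow> ('s, 'f, 'r) pht \<Rightarrow> ('s, 'f, 'r, 'w) relsig
    \<Rightarrow> ('s, 'f + 'w, 'r) sequent set \<Rightarrow> 'w \<Rightarrow> bool" where
  "total_op U S \<Omega> E \<omega> \<longleftrightarrow>
     phl_theorem U (alg_pht S \<Omega> E) (Sequent (fst (opar \<Omega> \<omega>)) Top (op_defd \<Omega> \<omega>))"

end

theory Submission
  imports Defs
begin

text \<open>
  An equational theory \<open>T\<close> under \<open>S\<close> has free models over models of \<open>S\<close>, and since operations are
  finitary, sifted colimits of models are computed on underlying sets for \<open>S\<close> and for \<open>T\<close> alike; so
  the monad preserves them.  Monadicity needs no splitting argument: an Eilenberg--Moore algebra
  \<open>a : T A \<rightarrow> A\<close> is the quotient of a free model of \<open>T\<close> by a homomorphism, where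
  \<open>g(x\<^sub>1, \<dots>, x\<^sub>n) := a (g (\<eta> x\<^sub>1, \<dots>, \<eta> x\<^sub>n))\<close>, and hence a model of \<open>T\<close>.

  Conversely, a monad \<open>T\<close> on models of \<open>S\<close> yields the theory whose operations of arity \<open>ss\<close> are the
  elements of \<open>T (F ss)\<close>, \<open>F ss\<close> being free on finitely many generators of sorts \<open>ss\<close>, and whose axioms
  are all equations valid in all Eilenberg--Moore algebras.  Every model \<open>X\<close> of \<open>S\<close> is the
  colimit of the finitely generated free models over it, an index category that is sifted because it has
  finite coproducts.  If \<open>T\<close> preserves this colimit, then the operations on a model of the new theory
  assemble to a map \<open>T X \<rightarrow> X\<close>, and the algebra laws can be checked on finitely generated free models.
\<close>

section \<open>Small sets\<close>

text \<open>The universe is only regular and uncountable, so power sets and function spaces of small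
  sets need not be small. Quotients are therefore built from chosen representatives, encoded by an
  injection into \<open>'u\<close>, and the index category over a model is small because a
  homomorphism out of a finitely generated free model is determined by a finite tuple. Theories, by
  contrast, carry no bound on their axioms: a theory can be defined by all premise-free sequents
  valid in a class of structures, and no deductive calculus is needed. The equivalence is proved as
  a cycle from (iii) to (ii) to (i) to (iii). Leaving (ii), one obtains an equational theory whose
  symbols have type \<open>'f + 'u\<close> and not the type \<open>'u\<close> prescribed in (iii).
  Monadicity is thus proved for theories with symbols of any type, and the theory of the monad,
  whose operations are encoded in \<open>'u\<close>, leads back to the prescribed type.\<close>

locale univ =
  fixes U :: "'u itself"
  assumes univ: "universe TYPE('u)"
begin

text \<open>Regularity enters only through \<open>stable\<close>, which bounds sums of small
  families of small sets. The strict inequality with \<open>natLeq\<close> provides the infinity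
  that the passage from \<open>regularCard\<close> to \<open>stable\<close> requires.\<close>

lemma nat_less: "natLeq <o |UNIV :: 'u set|" and stable_univ: "stable |UNIV :: 'u set|"
proof -
  show 1: "natLeq <o |UNIV :: 'u set|" using univ by (simp add: universe_def)
  have "infinite (UNIV :: 'u set)"
  proof
    assume "finite (UNIV :: 'u set)"
    then have "|UNIV :: 'u set| <o natLeq" by (simp add: finite_iff_ordLess_natLeq)
    with 1 show False using ordLess_transitive ordLess_irreflexive by blast
  qed
  then show "stable |UNIV :: 'u set|"
    using univ by (intro regularCard_stable[OF card_of_Card_order]) (auto simp: universe_def Field_card_of)
qed

lemma small_subset: "small TYPE('u) B \<Longrightarrow> A \<subseteq> B \<Longrightarrow> small TYPE('u) A"
  unfolding small_def by (meson card_of_mono1 ordLeq_ordLess_trans)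

lemma small_image: "small TYPE('u) A \<Longrightarrow> small TYPE('u) (f ` A)"
  unfolding small_def by (meson card_of_image ordLeq_ordLess_trans)

lemma small_finite: "finite A \<Longrightarrow> small TYPE('u) A"
  unfolding small_def using nat_less by (meson finite_iff_ordLess_natLeq ordLess_transitive)

text \<open>Uncountability of the universe, rather than mere infinity, is what keeps the later
  unions over lengths of lists and sizes of terms small.\<close>

lemma small_nat: "small TYPE('u) (A :: nat set)"
proof -
  have "|UNIV :: nat set| <o |UNIV :: 'u set|"
    using nat_less card_of_nat by (meson ordIso_ordLess_trans)
  then show ?thesis using small_subset[of "UNIV :: nat set" A] by (simp add: small_def)
qed

lemma small_UN: "small TYPE('u) A \<Longrightarrow> (\<And>a. a \<in> A \<Longrightarrow> small TYPE('u) (F a)) \<Longrightarrow> small TYPE('u) (\<Union>a\<in>A. F a)"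
  unfolding small_def by (rule stable_UNION[OF stable_univ])

lemma small_Sigma: "small TYPE('u) A \<Longrightarrow> (\<And>a. a \<in> A \<Longrightarrow> small TYPE('u) (F a)) \<Longrightarrow> small TYPE('u) (SIGMA a:A. F a)"
  unfolding small_def by (rule stable_elim[OF stable_univ])

lemma small_Times: "small TYPE('u) A \<Longrightarrow> small TYPE('u) B \<Longrightarrow> small TYPE('u) (A \<times> B)"
  by (rule small_Sigma)

lemma small_Un: "small TYPE('u) A \<Longrightarrow> small TYPE('u) B \<Longrightarrow> small TYPE('u) (A \<union> B)"
  using small_UN[of "{A, B}" "\<lambda>x. x"] by (simp add: small_finite) blast

lemma small_lists: assumes "small TYPE('u) A" shows "small TYPE('u) (lists A)"
proof -
  have len: "small TYPE('u) {xs. set xs \<subseteq> A \<and> length xs = n}" for n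
  proof (induction n)
    case 0
    have "{xs. set xs \<subseteq> A \<and> length xs = 0} = {[]}" by auto
    then show ?case by (simp add: small_finite)
  next
    case (Suc n)
    have "{xs. set xs \<subseteq> A \<and> length xs = Suc n} =
      (\<lambda>(x, xs). x # xs) ` (A \<times> {xs. set xs \<subseteq> A \<and> length xs = n})"
      by (auto simp: length_Suc_conv image_iff)
    then show ?case using small_image[OF small_Times[OF assms Suc]] by simp
  qed
  have "lists A = (\<Union>n. {xs. set xs \<subseteq> A \<and> length xs = n})" by auto
  then show ?thesis using small_UN[OF small_nat len] by simp
qed

lemma small_encode: "small TYPE('u) A \<Longrightarrow> \<exists>e :: 'x \<Rightarrow> 'u. inj_on e (A :: 'x set)"
proof -
  assume "small TYPE('u) A"
  then have "|A| \<le>o |UNIV :: 'u set|" by (simp add: small_def ordLess_imp_ordLeq)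
  then show ?thesis by (metis card_of_ordLeq)
qed

lemma small_inj: "small TYPE('u) (f ` A) \<Longrightarrow> inj_on f A \<Longrightarrow> small TYPE('u) A"
  using small_image[of "f ` A" "inv_into A f"] by (simp add: bij_betw_inv_into inj_on_imp_bij_betw bij_betw_imp_surj_on)

text \<open>Supplies the two values of a function that separates one element from all others, used
  to show that colimit cocones of sets are jointly surjective.\<close>

lemma two_elements: "\<exists>a b :: 'u. a \<noteq> b"
proof -
  have "small TYPE('u) {True, False}" by (simp add: small_finite)
  then obtain e :: "bool \<Rightarrow> 'u" where "inj_on e {True, False}" using small_encode by blast
  then have "e True \<noteq> e False" by (simp add: inj_on_def)
  then show ?thesis by blast
qed

end

section \<open>Functors, equivalences and adjunctions\<close>

lemma in_homD: "f \<in> hom C x y \<Longrightarrow> f \<in> Arr C \<and> Dom C f = x \<and> Cod C f = y"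
  by (simp add: hom_def)

lemma Arr_hom: "f \<in> Arr C \<Longrightarrow> f \<in> hom C (Dom C f) (Cod C f)"
  by (simp add: hom_def)

context category begin

lemma hom_Obj: "f \<in> hom C x y \<Longrightarrow> x \<in> Obj C \<and> y \<in> Obj C"
  using Dom_in Cod_in by (auto simp: hom_def)

lemma iso_arr_iff: "f \<in> hom C x y \<Longrightarrow>
    iso_arr C f \<longleftrightarrow> (\<exists>g \<in> hom C y x. Comp C g f = Id C x \<and> Comp C f g = Id C y)"
  by (auto simp: iso_arr_def hom_def)

lemma iso_cancel_left:
  assumes "iso_arr C f" "f \<in> hom C x y" "g \<in> hom C z x" "g' \<in> hom C z x" "Comp C f g = Comp C f g'"
  shows "g = g'"
proof -
  obtain k where k: "k \<in> hom C y x" "Comp C k f = Id C x" using assms(1,2) iso_arr_iff by blast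
  have "g = Comp C (Comp C k f) g" using k assms Id_left by simp
  also have "\<dots> = Comp C k (Comp C f g')" using assoc[OF assms(3,2) k(1)] assms(5) by simp
  also have "\<dots> = g'" using assoc[OF assms(4,2) k(1)] k Id_left[OF assms(4)] by simp
  finally show ?thesis .
qed

lemma iso_cancel_right:
  assumes "iso_arr C f" "f \<in> hom C x y" "g \<in> hom C y z" "g' \<in> hom C y z" "Comp C g f = Comp C g' f"
  shows "g = g'"
proof -
  obtain k where k: "k \<in> hom C y x" "Comp C f k = Id C y" using assms(1,2) iso_arr_iff by blast
  have "g = Comp C g (Comp C f k)" using k assms Id_right by simp
  also have "\<dots> = Comp C (Comp C g' f) k" using assoc[OF k(1) assms(2,3)] assms(5) by simp
  also have "\<dots> = g'" using assoc[OF k(1) assms(2,4)] k Id_right[OF assms(4)] by simp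
  finally show ?thesis .
qed

end

lemma functor_Ob: "is_functor C D F \<Longrightarrow> x \<in> Obj C \<Longrightarrow> Ob F x \<in> Obj D"
  by (simp add: is_functor_def)

lemma functor_Ar: "is_functor C D F \<Longrightarrow> category C \<Longrightarrow> f \<in> hom C x y \<Longrightarrow> Ar F f \<in> hom D (Ob F x) (Ob F y)"
  using category.hom_Obj unfolding is_functor_def by metis

lemma functor_Id: "is_functor C D F \<Longrightarrow> x \<in> Obj C \<Longrightarrow> Ar F (Id C x) = Id D (Ob F x)"
  by (simp add: is_functor_def)

lemma functor_Comp: "is_functor C D F \<Longrightarrow> f \<in> hom C x y \<Longrightarrow> g \<in> hom C y z
    \<Longrightarrow> Ar F (Comp C g f) = Comp D (Ar F g) (Ar F f)"
  by (simp add: is_functor_def hom_def)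

lemma comp_func_sel [simp]: "Ob (comp_func G F) x = Ob G (Ob F x)" "Ar (comp_func G F) f = Ar G (Ar F f)"
  by (simp_all add: comp_func_def)

lemma id_func_sel [simp]: "Ob id_func x = x" "Ar id_func f = f"
  by (simp_all add: id_func_def)

lemma is_functor_comp:
  assumes "category C" "is_functor C D F" "is_functor D E G"
  shows "is_functor C E (comp_func G F)"
  unfolding is_functor_def
proof (intro conjI ballI impI)
  fix f g assume fg: "f \<in> Arr C" "g \<in> Arr C" "Cod C f = Dom C g"
  interpret category C by fact
  have f: "f \<in> hom C (Dom C f) (Dom C g)" and g: "g \<in> hom C (Dom C g) (Cod C g)"
    using fg by (auto simp: hom_def)
  show "Ar (comp_func G F) (Comp C g f) = Comp E (Ar (comp_func G F) g) (Ar (comp_func G F) f)"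
    using functor_Comp[OF assms(2) f g]
      functor_Comp[OF assms(3) functor_Ar[OF assms(2,1) f] functor_Ar[OF assms(2,1) g]] by simp
qed (use assms in \<open>auto simp: is_functor_def\<close>)

section \<open>Equivalences as fully faithful and essentially surjective functors\<close>

definition fully_faithful :: "('o, 'a) cat \<Rightarrow> ('p, 'b) cat \<Rightarrow> ('o, 'a, 'p, 'b) func \<Rightarrow> bool" where
  "fully_faithful C D F \<longleftrightarrow>
     (\<forall>x \<in> Obj C. \<forall>y \<in> Obj C. bij_betw (Ar F) (hom C x y) (hom D (Ob F x) (Ob F y)))"

definition ess_surj :: "('o, 'a) cat \<Rightarrow> ('p, 'b) cat \<Rightarrow> ('o, 'a, 'p, 'b) func \<Rightarrow> bool" where
  "ess_surj C D F \<longleftrightarrow> (\<forall>d \<in> Obj D. \<exists>c \<in> Obj C. \<exists>f \<in> hom D (Ob F c) d. iso_arr D f)"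

lemma fully_faithfulI:
  assumes "is_functor C D F" "category C"
    and "\<And>x y f g. f \<in> hom C x y \<Longrightarrow> g \<in> hom C x y \<Longrightarrow> Ar F f = Ar F g \<Longrightarrow> f = g"
    and "\<And>x y k. x \<in> Obj C \<Longrightarrow> y \<in> Obj C \<Longrightarrow> k \<in> hom D (Ob F x) (Ob F y) \<Longrightarrow> \<exists>f \<in> hom C x y. Ar F f = k"
  shows "fully_faithful C D F"
  unfolding fully_faithful_def bij_betw_def inj_on_def
proof (intro ballI conjI)
  fix x y assume "x \<in> Obj C" "y \<in> Obj C"
  then show "Ar F ` hom C x y = hom D (Ob F x) (Ob F y)"
    using functor_Ar[OF assms(1,2)] assms(4) by blast
qed (use assms(3) in blast)

lemma full: "fully_faithful C D F \<Longrightarrow> x \<in> Obj C \<Longrightarrow> y \<in> Obj C \<Longrightarrow> k \<in> hom D (Ob F x) (Ob F y)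
   \<Longrightarrow> \<exists>f \<in> hom C x y. Ar F f = k"
  unfolding fully_faithful_def bij_betw_def by (metis (no_types, lifting) imageE)

lemma faithful: "fully_faithful C D F \<Longrightarrow> category C \<Longrightarrow> f \<in> hom C x y \<Longrightarrow> g \<in> hom C x y
   \<Longrightarrow> Ar F f = Ar F g \<Longrightarrow> f = g"
  using category.hom_Obj[of C f x y] unfolding fully_faithful_def bij_betw_def inj_on_def by blast

lemma fully_faithful_comp:
  assumes "is_functor C D F" "fully_faithful C D F" "fully_faithful D E G"
  shows "fully_faithful C E (comp_func G F)"
  unfolding fully_faithful_def
proof (intro ballI)
  fix x y assume "x \<in> Obj C" "y \<in> Obj C"
  then have "bij_betw (Ar G \<circ> Ar F) (hom C x y) (hom E (Ob G (Ob F x)) (Ob G (Ob F y)))"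
    using assms functor_Ob[OF assms(1)] unfolding fully_faithful_def by (meson bij_betw_trans)
  then show "bij_betw (Ar (comp_func G F)) (hom C x y) (hom E (Ob (comp_func G F) x) (Ob (comp_func G F) y))"
    by (simp add: comp_func_def comp_def)
qed

lemma functor_iso:
  assumes "is_functor C D F" "category C" "category D" "f \<in> hom C x y" "iso_arr C f"
  shows "iso_arr D (Ar F f)"
proof -
  obtain g where g: "g \<in> hom C y x" "Comp C g f = Id C x" "Comp C f g = Id C y"
    using assms category.iso_arr_iff by metis
  have "Comp D (Ar F g) (Ar F f) = Id D (Ob F x)" "Comp D (Ar F f) (Ar F g) = Id D (Ob F y)"
    using functor_Comp[OF assms(1)] g assms(4) category.hom_Obj[OF assms(2,4)] functor_Id[OF assms(1)] by metis+
  then show ?thesis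
    using category.iso_arr_iff[OF assms(3) functor_Ar[OF assms(1,2,4)]] functor_Ar[OF assms(1,2) g(1)] by blast
qed

lemma iso_arr_comp:
  assumes "category D" "f \<in> hom D x y" "g \<in> hom D y z" "iso_arr D f" "iso_arr D g"
  shows "iso_arr D (Comp D g f)"
proof -
  interpret category D by fact
  obtain f' g' where f': "f' \<in> hom D y x" "Comp D f' f = Id D x" "Comp D f f' = Id D y"
    and g': "g' \<in> hom D z y" "Comp D g' g = Id D y" "Comp D g g' = Id D z"
    using assms iso_arr_iff by metis
  have 1: "Comp D (Comp D f' g') (Comp D g f) = Id D x"
  proof -
    have "Comp D (Comp D f' g') (Comp D g f) = Comp D f' (Comp D g' (Comp D g f))"
      using assoc[OF Comp_in[OF assms(2,3)] g'(1) f'(1)] by simp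
    also have "\<dots> = Comp D f' f" using assoc[OF assms(2,3) g'(1)] g' Id_left[OF assms(2)] by simp
    finally show ?thesis using f' by simp
  qed
  have 2: "Comp D (Comp D g f) (Comp D f' g') = Id D z"
  proof -
    have "Comp D (Comp D g f) (Comp D f' g') = Comp D g (Comp D f (Comp D f' g'))"
      using assoc[OF Comp_in[OF g'(1) f'(1)] assms(2,3)] by simp
    also have "\<dots> = Comp D g g'" using assoc[OF g'(1) f'(1) assms(2)] f' Id_left[OF g'(1)] by simp
    finally show ?thesis using g' by simp
  qed
  show ?thesis
    using 1 2 iso_arr_iff[OF Comp_in[OF assms(2,3)]] Comp_in[OF g'(1) f'(1)] by blast
qed

lemma ess_surj_comp:
  assumes "category D" "category E" "is_functor C D F" "is_functor D E G" "ess_surj C D F" "ess_surj D E G"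
  shows "ess_surj C E (comp_func G F)"
  unfolding ess_surj_def
proof
  fix e assume "e \<in> Obj E"
  then obtain d g where d: "d \<in> Obj D" "g \<in> hom E (Ob G d) e" "iso_arr E g" using assms(6) ess_surj_def by metis
  then obtain c f where c: "c \<in> Obj C" "f \<in> hom D (Ob F c) d" "iso_arr D f" using assms(5) ess_surj_def by metis
  have Gf: "Ar G f \<in> hom E (Ob G (Ob F c)) (Ob G d)" "iso_arr E (Ar G f)"
    using functor_Ar[OF assms(4,1) c(2)] functor_iso[OF assms(4,1,2) c(2,3)] by auto
  show "\<exists>c\<in>Obj C. \<exists>f\<in>hom E (Ob (comp_func G F) c) e. iso_arr E f"
    using c(1) category.Comp_in[OF assms(2) Gf(1) d(2)] iso_arr_comp[OF assms(2) Gf(1) d(2) Gf(2) d(3)] by auto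
qed

text \<open>The quasi-inverse \<open>G\<close> and the isomorphisms \<open>\<beta> d\<close> from
  \<open>F (G d)\<close> to \<open>d\<close> are chosen together. On an arrow \<open>k\<close> from
  \<open>d\<close> to \<open>e\<close>, \<open>G k\<close> is the arrow whose image under
  \<open>F\<close> is \<open>k\<close> conjugated by \<open>\<beta>\<close>. Every equation between
  arrows into some \<open>G d\<close> is then tested by applying \<open>F\<close> and composing with
  \<open>\<beta> d\<close>, which is the content of \<open>uniq\<close>.\<close>

lemma is_equivalenceI:
  assumes C: "category C" and D: "category D" and F: "is_functor C D F"
    and ff: "fully_faithful C D F" and es: "ess_surj C D F"
  shows "is_equivalence C D F"
proof -
  interpret C: category C by fact
  interpret D: category D by fact
  define P where "P d c b \<longleftrightarrow> c \<in> Obj C \<and> b \<in> hom D (Ob F c) d \<and> iso_arr D b" for d c b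
  obtain G\<^sub>0 where G\<^sub>0: "\<And>d. d \<in> Obj D \<Longrightarrow> \<exists>b. P d (G\<^sub>0 d) b"
    using es unfolding ess_surj_def P_def by metis
  then obtain \<beta> where \<beta>: "\<And>d. d \<in> Obj D \<Longrightarrow> P d (G\<^sub>0 d) (\<beta> d)" by metis
  have \<beta>h: "\<beta> d \<in> hom D (Ob F (G\<^sub>0 d)) d" and \<beta>i: "iso_arr D (\<beta> d)" and G0: "G\<^sub>0 d \<in> Obj C" if "d \<in> Obj D" for d
    using \<beta>[OF that] by (auto simp: P_def)
  have inv: "\<exists>g. g \<in> hom D d (Ob F (G\<^sub>0 d)) \<and> Comp D g (\<beta> d) = Id D (Ob F (G\<^sub>0 d)) \<and> Comp D (\<beta> d) g = Id D d"
    if "d \<in> Obj D" for d using D.iso_arr_iff[OF \<beta>h[OF that]] \<beta>i[OF that] by blast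
  then obtain \<gamma> where \<gamma>: "\<And>d. d \<in> Obj D \<Longrightarrow> \<gamma> d \<in> hom D d (Ob F (G\<^sub>0 d)) \<and>
      Comp D (\<gamma> d) (\<beta> d) = Id D (Ob F (G\<^sub>0 d)) \<and> Comp D (\<beta> d) (\<gamma> d) = Id D d" by metis
  have lift: "\<exists>f. f \<in> hom C (G\<^sub>0 d) c \<and> Comp D b (Ar F f) = Comp D k (\<beta> d)"
    if k: "k \<in> hom D d e" and b: "b \<in> hom D (Ob F c) e" "iso_arr D b" and c: "c \<in> Obj C" for d e k b c
  proof -
    obtain b' where b': "b' \<in> hom D e (Ob F c)" "Comp D b b' = Id D e" using b D.iso_arr_iff by metis
    have d: "d \<in> Obj D" using D.hom_Obj[OF k] by simp
    have kb: "Comp D k (\<beta> d) \<in> hom D (Ob F (G\<^sub>0 d)) e" using D.Comp_in[OF \<beta>h[OF d] k] .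
    obtain f where f: "f \<in> hom C (G\<^sub>0 d) c" "Ar F f = Comp D b' (Comp D k (\<beta> d))"
      using full[OF ff G0[OF d] c D.Comp_in[OF kb b'(1)]] by blast
    have "Comp D b (Ar F f) = Comp D k (\<beta> d)"
      using f D.assoc[OF kb b'(1) b(1)] b' D.Id_left[OF kb] by simp
    with f show ?thesis by blast
  qed
  have "\<exists>f. k \<in> Arr D \<longrightarrow> f \<in> hom C (G\<^sub>0 (Dom D k)) (G\<^sub>0 (Cod D k)) \<and>
      Comp D (\<beta> (Cod D k)) (Ar F f) = Comp D k (\<beta> (Dom D k))" for k
    using lift[OF Arr_hom[of k D]] \<beta>h \<beta>i G0 D.Cod_in by blast
  then obtain G\<^sub>1 where G\<^sub>1: "\<And>k. k \<in> Arr D \<Longrightarrow> G\<^sub>1 k \<in> hom C (G\<^sub>0 (Dom D k)) (G\<^sub>0 (Cod D k)) \<and>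
      Comp D (\<beta> (Cod D k)) (Ar F (G\<^sub>1 k)) = Comp D k (\<beta> (Dom D k))" by metis
  have G1: "G\<^sub>1 k \<in> hom C (G\<^sub>0 d) (G\<^sub>0 e)" "Comp D (\<beta> e) (Ar F (G\<^sub>1 k)) = Comp D k (\<beta> d)"
    if "k \<in> hom D d e" for k d e using G\<^sub>1[of k] that by (auto simp: hom_def)
  have uniq: "f = f'" if "f \<in> hom C c (G\<^sub>0 d)" "f' \<in> hom C c (G\<^sub>0 d)" "d \<in> Obj D"
     "Comp D (\<beta> d) (Ar F f) = Comp D (\<beta> d) (Ar F f')" for f f' c d
    using D.iso_cancel_left[OF \<beta>i[OF that(3)] \<beta>h[OF that(3)] functor_Ar[OF F C that(1)] functor_Ar[OF F C that(2)] that(4)]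
      faithful[OF ff C that(1,2)] by blast
  define G where "G = \<lparr>Ob = G\<^sub>0, Ar = G\<^sub>1\<rparr>"
  have GO [simp]: "Ob G = G\<^sub>0" "Ar G = G\<^sub>1" by (simp_all add: G_def)
  have functG: "is_functor D C G"
    unfolding is_functor_def GO
  proof (intro conjI ballI impI)
    fix d assume d: "d \<in> Obj D"
    show "G\<^sub>0 d \<in> Obj C" using G0[OF d] .
    show "G\<^sub>1 (Id D d) = Id C (G\<^sub>0 d)"
      using uniq[OF G1(1)[OF D.Id_in[OF d]] C.Id_in[OF G0[OF d]] d] G1(2)[OF D.Id_in[OF d]]
        functor_Id[OF F G0[OF d]] D.Id_right[OF \<beta>h[OF d]] D.Id_left[OF \<beta>h[OF d]] by simp
  next
    fix d e k assume "k \<in> hom D d e"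
    then show "G\<^sub>1 k \<in> hom C (G\<^sub>0 d) (G\<^sub>0 e)" using G1 by blast
  next
    fix f g assume fg: "f \<in> Arr D" "g \<in> Arr D" "Cod D f = Dom D g"
    let ?x = "Dom D f" and ?y = "Dom D g" and ?z = "Cod D g"
    have f: "f \<in> hom D ?x ?y" and g: "g \<in> hom D ?y ?z" using fg by (auto simp: hom_def)
    have z: "?z \<in> Obj D" and x: "?x \<in> Obj D" and y: "?y \<in> Obj D" using D.hom_Obj[OF g] D.hom_Obj[OF f] by auto
    have "Comp D (\<beta> ?z) (Ar F (G\<^sub>1 (Comp D g f))) = Comp D (Comp D g f) (\<beta> ?x)"
      using G1(2)[OF D.Comp_in[OF f g]] .
    also have "\<dots> = Comp D g (Comp D (\<beta> ?y) (Ar F (G\<^sub>1 f)))"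
      using G1(2)[OF f] D.assoc[OF \<beta>h[OF x] f g] by simp
    also have "\<dots> = Comp D (Comp D (\<beta> ?z) (Ar F (G\<^sub>1 g))) (Ar F (G\<^sub>1 f))"
      using G1(2)[OF g] D.assoc[OF functor_Ar[OF F C G1(1)[OF f]] \<beta>h[OF y] g] by simp
    also have "\<dots> = Comp D (\<beta> ?z) (Ar F (Comp C (G\<^sub>1 g) (G\<^sub>1 f)))"
      using D.assoc[OF functor_Ar[OF F C G1(1)[OF f]] functor_Ar[OF F C G1(1)[OF g]] \<beta>h[OF z]]
        functor_Comp[OF F G1(1)[OF f] G1(1)[OF g]] by simp
    finally show "G\<^sub>1 (Comp D g f) = Comp C (G\<^sub>1 g) (G\<^sub>1 f)"
      using uniq[OF G1(1)[OF D.Comp_in[OF f g]] C.Comp_in[OF G1(1)[OF f] G1(1)[OF g]] z] by blast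
  qed
  have "\<exists>a. c \<in> Obj C \<longrightarrow> a \<in> hom C c (G\<^sub>0 (Ob F c)) \<and> Ar F a = \<gamma> (Ob F c)" for c
    using full[OF ff, of c "G\<^sub>0 (Ob F c)"] \<gamma> functor_Ob[OF F] G0 by metis
  then obtain \<alpha> where \<alpha>: "\<And>c. c \<in> Obj C \<Longrightarrow> \<alpha> c \<in> hom C c (G\<^sub>0 (Ob F c)) \<and> Ar F (\<alpha> c) = \<gamma> (Ob F c)" by metis
  have \<alpha>i: "iso_arr C (\<alpha> c)" if c: "c \<in> Obj C" for c
  proof -
    let ?d = "Ob F c"
    have d: "?d \<in> Obj D" using functor_Ob[OF F c] .
    obtain b where b: "b \<in> hom C (G\<^sub>0 ?d) c" "Ar F b = \<beta> ?d" using full[OF ff G0[OF d] c \<beta>h[OF d]] by blast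
    have a: "\<alpha> c \<in> hom C c (G\<^sub>0 ?d)" using \<alpha>[OF c] by simp
    have "Comp C b (\<alpha> c) = Id C c"
      by (rule faithful[OF ff C C.Comp_in[OF a b(1)] C.Id_in[OF c]])
        (simp add: functor_Comp[OF F a b(1)] b(2) \<alpha>[OF c] \<gamma>[OF d] functor_Id[OF F c])
    moreover have "Comp C (\<alpha> c) b = Id C (G\<^sub>0 ?d)"
      by (rule faithful[OF ff C C.Comp_in[OF b(1) a] C.Id_in[OF G0[OF d]]])
        (simp add: functor_Comp[OF F b(1) a] b(2) \<alpha>[OF c] \<gamma>[OF d] functor_Id[OF F G0[OF d]])
    ultimately show ?thesis using C.iso_arr_iff[OF a] b(1) by blast
  qed
  have "nat_iso C C id_func (comp_func G F) \<alpha>"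
    unfolding nat_iso_def nat_trans_def
  proof (intro conjI ballI)
    fix f assume "f \<in> Arr C"
    let ?x = "Dom C f" and ?y = "Cod C f"
    have f: "f \<in> hom C ?x ?y" using \<open>f \<in> Arr C\<close> by (rule Arr_hom)
    have x: "?x \<in> Obj C" and y: "?y \<in> Obj C" using C.hom_Obj[OF f] by auto
    have Ff: "Ar F f \<in> hom D (Ob F ?x) (Ob F ?y)" using functor_Ar[OF F C f] .
    have ax: "\<alpha> ?x \<in> hom C ?x (G\<^sub>0 (Ob F ?x))" and ay: "\<alpha> ?y \<in> hom C ?y (G\<^sub>0 (Ob F ?y))" using \<alpha> x y by auto
    note d = functor_Ob[OF F x] and e = functor_Ob[OF F y]
    note G1f = G1[OF Ff]
    have "Comp D (\<beta> (Ob F ?y)) (Ar F (Comp C (\<alpha> ?y) f)) = Ar F f"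
      using functor_Comp[OF F f ay] \<alpha>[OF y] \<gamma>[OF e] D.assoc[OF Ff _ \<beta>h[OF e]] D.Id_left[OF Ff] by metis
    moreover have "Comp D (\<beta> (Ob F ?y)) (Ar F (Comp C (G\<^sub>1 (Ar F f)) (\<alpha> ?x))) = Ar F f"
      using functor_Comp[OF F ax G1f(1)] \<alpha>[OF x] \<gamma>[OF d]
        D.assoc[OF functor_Ar[OF F C ax] functor_Ar[OF F C G1f(1)] \<beta>h[OF e]] G1f(2)
        D.assoc[OF functor_Ar[OF F C ax] \<beta>h[OF d] Ff] D.Id_right[OF Ff] by simp
    ultimately show "Comp C (\<alpha> (Cod C f)) (Ar id_func f) = Comp C (Ar (comp_func G F) f) (\<alpha> (Dom C f))"
      using uniq[OF C.Comp_in[OF f ay] C.Comp_in[OF ax G1f(1)] e] by simp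
  qed (use \<alpha> \<alpha>i in auto)
  moreover have "nat_iso D D (comp_func F G) id_func \<beta>"
    unfolding nat_iso_def nat_trans_def using \<beta>h \<beta>i G\<^sub>1 by auto
  ultimately show ?thesis unfolding is_equivalence_def using F functG by blast
qed

text \<open>Naturality of \<open>\<alpha>\<close> and \<open>\<beta>\<close> makes both functors
  faithful. For fullness, \<open>k\<close> is lifted by conjugating \<open>Ar G k\<close> with
  \<open>\<alpha>\<close>; the image of this lift and \<open>k\<close> agree after \<open>G\<close>,
  and faithfulness of \<open>G\<close> finishes.\<close>

lemma is_equivalenceD:
  assumes C: "category C" and D: "category D" and "is_equivalence C D F"
  shows "is_functor C D F" "fully_faithful C D F" "ess_surj C D F"
proof -
  interpret C: category C by fact
  interpret D: category D by fact
  obtain G \<alpha> \<beta> where F: "is_functor C D F" and G: "is_functor D C G"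
    and a: "nat_iso C C id_func (comp_func G F) \<alpha>" and b: "nat_iso D D (comp_func F G) id_func \<beta>"
    using assms(3) is_equivalence_def by metis
  show "is_functor C D F" by fact
  have ah: "\<alpha> x \<in> hom C x (Ob G (Ob F x))" "iso_arr C (\<alpha> x)" if "x \<in> Obj C" for x
    using a that by (auto simp: nat_iso_def nat_trans_def)
  have an: "Comp C (\<alpha> y) f = Comp C (Ar G (Ar F f)) (\<alpha> x)" if "f \<in> hom C x y" for f x y
    using a that by (auto simp: nat_iso_def nat_trans_def hom_def)
  have bh: "\<beta> x \<in> hom D (Ob F (Ob G x)) x" "iso_arr D (\<beta> x)" if "x \<in> Obj D" for x
    using b that by (auto simp: nat_iso_def nat_trans_def)
  have bn: "Comp D (\<beta> y) (Ar F (Ar G f)) = Comp D f (\<beta> x)" if "f \<in> hom D x y" for f x y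
    using b that by (auto simp: nat_iso_def nat_trans_def hom_def)
  show "ess_surj C D F" unfolding ess_surj_def using bh functor_Ob[OF G] by blast
  have faith_G: "f = g" if f: "f \<in> hom D x y" and g: "g \<in> hom D x y" and e: "Ar G f = Ar G g" for f g x y
    using D.iso_cancel_right[OF bh(2) bh(1) f g] bn[OF f] bn[OF g] e D.hom_Obj[OF f] by simp
  show "fully_faithful C D F"
  proof (rule fully_faithfulI[OF F C])
    fix x y f g assume f: "f \<in> hom C x y" and g: "g \<in> hom C x y" and e: "Ar F f = Ar F g"
    show "f = g"
      using C.iso_cancel_left[OF ah(2) ah(1) f g] an[OF f] an[OF g] e C.hom_Obj[OF f] by simp
  next
    fix x y k assume x: "x \<in> Obj C" and y: "y \<in> Obj C" and k: "k \<in> hom D (Ob F x) (Ob F y)"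
    obtain i where i: "i \<in> hom C (Ob G (Ob F y)) y" "Comp C (\<alpha> y) i = Id C (Ob G (Ob F y))"
      using C.iso_arr_iff[OF ah(1)[OF y]] ah(2)[OF y] by blast
    have Gk: "Ar G k \<in> hom C (Ob G (Ob F x)) (Ob G (Ob F y))" using functor_Ar[OF G D k] .
    note Gka = C.Comp_in[OF ah(1)[OF x] Gk]
    define f where "f = Comp C i (Comp C (Ar G k) (\<alpha> x))"
    have f: "f \<in> hom C x y" unfolding f_def using C.Comp_in[OF Gka i(1)] .
    have "Comp C (Ar G (Ar F f)) (\<alpha> x) = Comp C (\<alpha> y) f" using an[OF f] by simp
    also have "\<dots> = Comp C (Ar G k) (\<alpha> x)"
      unfolding f_def using C.assoc[OF Gka i(1) ah(1)[OF y]] i(2) C.Id_left[OF Gka] by simp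
    finally have "Ar G (Ar F f) = Ar G k"
      using C.iso_cancel_right[OF ah(2)[OF x] ah(1)[OF x] functor_Ar[OF G D functor_Ar[OF F C f]] Gk] by blast
    then have "Ar F f = k" using faith_G[OF functor_Ar[OF F C f] k] by blast
    with f show "\<exists>f\<in>hom C x y. Ar F f = k" by blast
  qed
qed

lemma equivalent_cats_trans:
  assumes "category C" "category D" "category E" "equivalent_cats C D" "equivalent_cats D E"
  shows "equivalent_cats C E"
proof -
  obtain F G where "is_equivalence C D F" "is_equivalence D E G" using assms(4,5) equivalent_cats_def by metis
  then have F: "is_functor C D F" "fully_faithful C D F" "ess_surj C D F"
    and G: "is_functor D E G" "fully_faithful D E G" "ess_surj D E G"
    using is_equivalenceD assms(1-3) by metis+
  have "is_equivalence C E (comp_func G F)"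
    using is_equivalenceI[OF assms(1,3) is_functor_comp[OF assms(1) F(1) G(1)]
      fully_faithful_comp[OF F(1,2) G(2)] ess_surj_comp[OF assms(2,3) F(1) G(1) F(3) G(3)]] .
  then show ?thesis by (auto simp: equivalent_cats_def)
qed

section \<open>Universal arrows and the adjunctions they determine\<close>

definition universal_arrow :: "('o, 'a) cat \<Rightarrow> ('p, 'b) cat \<Rightarrow> ('o, 'a, 'p, 'b) func \<Rightarrow> 'p \<Rightarrow> 'o \<Rightarrow> 'b \<Rightarrow> bool" where
  "universal_arrow C A U x c \<eta> \<longleftrightarrow> c \<in> Obj C \<and> \<eta> \<in> hom A x (Ob U c) \<and>
     (\<forall>d \<in> Obj C. \<forall>g \<in> hom A x (Ob U d). \<exists>!h. h \<in> hom C c d \<and> Comp A (Ar U h) \<eta> = g)"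

text \<open>The universal arrows reappear in the conclusion because the unit chosen here must later
  be transported along an equivalence of categories.\<close>

lemma adjunction_of_universal_arrows:
  assumes C: "category C" and A: "category A" and U: "is_functor C A U"
    and ex: "\<And>x. x \<in> Obj A \<Longrightarrow> \<exists>c \<eta>. universal_arrow C A U x c \<eta>"
  shows "\<exists>F \<eta> \<epsilon>. adjunction C A F U \<eta> \<epsilon> \<and> (\<forall>x \<in> Obj A. universal_arrow C A U x (Ob F x) (\<eta> x))"
proof -
  interpret C: category C by fact
  interpret A: category A by fact
  obtain F\<^sub>0 where "\<And>x. x \<in> Obj A \<Longrightarrow> \<exists>\<eta>. universal_arrow C A U x (F\<^sub>0 x) \<eta>" using ex by metis
  then obtain \<eta> where u: "\<And>x. x \<in> Obj A \<Longrightarrow> universal_arrow C A U x (F\<^sub>0 x) (\<eta> x)" by metis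
  have F0: "F\<^sub>0 x \<in> Obj C" and eta: "\<eta> x \<in> hom A x (Ob U (F\<^sub>0 x))" if "x \<in> Obj A" for x
    using u[OF that] by (auto simp: universal_arrow_def)
  have exi: "\<exists>h. h \<in> hom C (F\<^sub>0 x) d \<and> Comp A (Ar U h) (\<eta> x) = g"
    if "x \<in> Obj A" "d \<in> Obj C" "g \<in> hom A x (Ob U d)" for x d g
    using u[OF that(1)] that(2,3) unfolding universal_arrow_def by blast
  have uniq: "h = h'" if "h \<in> hom C (F\<^sub>0 x) d" "h' \<in> hom C (F\<^sub>0 x) d" "x \<in> Obj A"
    "Comp A (Ar U h) (\<eta> x) = Comp A (Ar U h') (\<eta> x)" for x d h h'
  proof -
    have d: "d \<in> Obj C" using C.hom_Obj[OF that(1)] by simp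
    have "Comp A (Ar U h) (\<eta> x) \<in> hom A x (Ob U d)"
      using A.Comp_in[OF eta[OF that(3)] functor_Ar[OF U C that(1)]] .
    then show ?thesis using u[OF that(3)] d that unfolding universal_arrow_def by metis
  qed
  have "\<exists>h. g \<in> Arr A \<longrightarrow> h \<in> hom C (F\<^sub>0 (Dom A g)) (F\<^sub>0 (Cod A g)) \<and>
     Comp A (Ar U h) (\<eta> (Dom A g)) = Comp A (\<eta> (Cod A g)) g" for g
    using exi[OF _ F0 A.Comp_in[OF Arr_hom eta], of g] A.Dom_in[of g] A.Cod_in[of g] by blast
  then obtain F\<^sub>1 where F\<^sub>1: "\<And>g. g \<in> Arr A \<Longrightarrow> F\<^sub>1 g \<in> hom C (F\<^sub>0 (Dom A g)) (F\<^sub>0 (Cod A g)) \<and>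
     Comp A (Ar U (F\<^sub>1 g)) (\<eta> (Dom A g)) = Comp A (\<eta> (Cod A g)) g" by metis
  have F1: "F\<^sub>1 g \<in> hom C (F\<^sub>0 x) (F\<^sub>0 y)" "Comp A (Ar U (F\<^sub>1 g)) (\<eta> x) = Comp A (\<eta> y) g"
    if "g \<in> hom A x y" for g x y using F\<^sub>1[of g] that by (auto simp: hom_def)
  have "\<exists>h. d \<in> Obj C \<longrightarrow> h \<in> hom C (F\<^sub>0 (Ob U d)) d \<and> Comp A (Ar U h) (\<eta> (Ob U d)) = Id A (Ob U d)" for d
    using exi[OF functor_Ob[OF U] _ A.Id_in[OF functor_Ob[OF U]], of d] by blast
  then obtain \<epsilon> where \<epsilon>: "\<And>d. d \<in> Obj C \<Longrightarrow> \<epsilon> d \<in> hom C (F\<^sub>0 (Ob U d)) d \<and>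
     Comp A (Ar U (\<epsilon> d)) (\<eta> (Ob U d)) = Id A (Ob U d)" by metis
  have eps: "\<epsilon> d \<in> hom C (F\<^sub>0 (Ob U d)) d" "Comp A (Ar U (\<epsilon> d)) (\<eta> (Ob U d)) = Id A (Ob U d)" if "d \<in> Obj C" for d
    using \<epsilon>[OF that] by auto
  have comp_eta: "Comp A (Ar U (Comp C k h)) (\<eta> x) = Comp A (Ar U k) (Comp A (Ar U h) (\<eta> x))"
    if "x \<in> Obj A" "h \<in> hom C (F\<^sub>0 x) c" "k \<in> hom C c d" for x h k c d
    using A.assoc[OF eta[OF that(1)] functor_Ar[OF U C that(2)] functor_Ar[OF U C that(3)]]
      functor_Comp[OF U that(2,3)] by simp
  define F where "F = \<lparr>Ob = F\<^sub>0, Ar = F\<^sub>1\<rparr>"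
  have FO [simp]: "Ob F = F\<^sub>0" "Ar F = F\<^sub>1" by (simp_all add: F_def)
  have F: "is_functor A C F"
    unfolding is_functor_def FO
  proof (intro conjI ballI impI)
    fix d assume d: "d \<in> Obj A"
    show "F\<^sub>0 d \<in> Obj C" using F0[OF d] .
    show "F\<^sub>1 (Id A d) = Id C (F\<^sub>0 d)"
      using uniq[OF F1(1)[OF A.Id_in[OF d]] C.Id_in[OF F0[OF d]] d] F1(2)[OF A.Id_in[OF d]]
        functor_Id[OF U F0[OF d]] A.Id_right[OF eta[OF d]] A.Id_left[OF eta[OF d]] by simp
  next
    fix d e k assume "k \<in> hom A d e"
    then show "F\<^sub>1 k \<in> hom C (F\<^sub>0 d) (F\<^sub>0 e)" using F1 by blast
  next
    fix f g assume fg: "f \<in> Arr A" "g \<in> Arr A" "Cod A f = Dom A g"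
    let ?x = "Dom A f" and ?y = "Dom A g" and ?z = "Cod A g"
    have f: "f \<in> hom A ?x ?y" and g: "g \<in> hom A ?y ?z" using fg by (auto simp: hom_def)
    have z: "?z \<in> Obj A" and x: "?x \<in> Obj A" and y: "?y \<in> Obj A" using A.hom_Obj[OF g] A.hom_Obj[OF f] by auto
    have "Comp A (Ar U (Comp C (F\<^sub>1 g) (F\<^sub>1 f))) (\<eta> ?x) = Comp A (Ar U (F\<^sub>1 g)) (Comp A (\<eta> ?y) f)"
      using comp_eta[OF x F1(1)[OF f] F1(1)[OF g]] F1(2)[OF f] by simp
    also have "\<dots> = Comp A (Comp A (\<eta> ?z) g) f"
      using A.assoc[OF f eta[OF y] functor_Ar[OF U C F1(1)[OF g]]] F1(2)[OF g] by simp
    also have "\<dots> = Comp A (Ar U (F\<^sub>1 (Comp A g f))) (\<eta> ?x)"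
      using A.assoc[OF f g eta[OF z]] F1(2)[OF A.Comp_in[OF f g]] by simp
    finally show "F\<^sub>1 (Comp A g f) = Comp C (F\<^sub>1 g) (F\<^sub>1 f)"
      using uniq[OF C.Comp_in[OF F1(1)[OF f] F1(1)[OF g]] F1(1)[OF A.Comp_in[OF f g]] x] by simp
  qed
  have "nat_trans A A id_func (comp_func U F) \<eta>"
    unfolding nat_trans_def using eta F\<^sub>1 by simp
  moreover have "nat_trans C C (comp_func F U) id_func \<epsilon>"
    unfolding nat_trans_def
  proof (intro conjI ballI)
    fix f assume "f \<in> Arr C"
    let ?x = "Dom C f" and ?y = "Cod C f"
    have f: "f \<in> hom C ?x ?y" using \<open>f \<in> Arr C\<close> by (rule Arr_hom)
    have x: "?x \<in> Obj C" and y: "?y \<in> Obj C" using C.hom_Obj[OF f] by auto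
    note ux = functor_Ob[OF U x] and uy = functor_Ob[OF U y]
    have Uf: "Ar U f \<in> hom A (Ob U ?x) (Ob U ?y)" using functor_Ar[OF U C f] .
    have "Comp A (Ar U (Comp C (\<epsilon> ?y) (F\<^sub>1 (Ar U f)))) (\<eta> (Ob U ?x))
        = Comp A (Ar U (\<epsilon> ?y)) (Comp A (\<eta> (Ob U ?y)) (Ar U f))"
      using comp_eta[OF ux F1(1)[OF Uf] eps(1)[OF y]] F1(2)[OF Uf] by simp
    also have "\<dots> = Ar U f"
      using A.assoc[OF Uf eta[OF uy] functor_Ar[OF U C eps(1)[OF y]]] eps(2)[OF y] A.Id_left[OF Uf] by simp
    also have "\<dots> = Comp A (Ar U (Comp C f (\<epsilon> ?x))) (\<eta> (Ob U ?x))"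
      using comp_eta[OF ux eps(1)[OF x] f] eps(2)[OF x] A.Id_right[OF Uf] by simp
    finally show "Comp C (\<epsilon> (Cod C f)) (Ar (comp_func F U) f) = Comp C (Ar id_func f) (\<epsilon> (Dom C f))"
      using uniq[OF C.Comp_in[OF F1(1)[OF Uf] eps(1)[OF y]] C.Comp_in[OF eps(1)[OF x] f] ux] by simp
  qed (use eps in auto)
  moreover have "Comp C (\<epsilon> (Ob F x)) (Ar F (\<eta> x)) = Id C (Ob F x)" if x: "x \<in> Obj A" for x
  proof -
    note e = eta[OF x] and fx = F0[OF x]
    note ux = functor_Ob[OF U fx]
    have "Comp A (Ar U (Comp C (\<epsilon> (F\<^sub>0 x)) (F\<^sub>1 (\<eta> x)))) (\<eta> x) = Comp A (Ar U (\<epsilon> (F\<^sub>0 x))) (Comp A (\<eta> (Ob U (F\<^sub>0 x))) (\<eta> x))"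
      using comp_eta[OF x F1(1)[OF e] eps(1)[OF fx]] F1(2)[OF e] by simp
    also have "\<dots> = \<eta> x"
      using A.assoc[OF e eta[OF ux] functor_Ar[OF U C eps(1)[OF fx]]] eps(2)[OF fx] A.Id_left[OF e] by simp
    also have "\<dots> = Comp A (Ar U (Id C (F\<^sub>0 x))) (\<eta> x)"
      using functor_Id[OF U fx] A.Id_left[OF e] by simp
    finally show ?thesis using uniq[OF C.Comp_in[OF F1(1)[OF e] eps(1)[OF fx]] C.Id_in[OF fx] x] by simp
  qed
  ultimately have "adjunction C A F U \<eta> \<epsilon>"
    unfolding adjunction_def using F U eps(2) by blast
  moreover have "\<forall>x\<in>Obj A. universal_arrow C A U x (Ob F x) (\<eta> x)" using u by simp
  ultimately show ?thesis by blast
qed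

section \<open>Total structures\<close>

abbreviation tup :: "('s, 'f, 'r, 'u) pstructure \<Rightarrow> 's list \<Rightarrow> 'u list set" where
  "tup M ss \<equiv> listset (map (car M) ss)"

definition opn :: "('s, 'f, 'r, 'u) pstructure \<Rightarrow> 'f \<Rightarrow> 'u list \<Rightarrow> 'u" where
  "opn M f ms = the (fint M f ms)"

definition total_str :: "('s, 'f, 'r) signature \<Rightarrow> ('s, 'f, 'r, 'u) pstructure \<Rightarrow> bool" where
  "total_str \<Sigma> M \<longleftrightarrow> is_pstructure \<Sigma> M \<and> rels \<Sigma> = {} \<and>
     (\<forall>f \<in> funs \<Sigma>. \<forall>ms \<in> tup M (farity \<Sigma> f). \<exists>m. fint M f ms = Some m)"

lemma in_listset: "ms \<in> listset As \<longleftrightarrow> list_all2 (\<in>) ms As"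
  by (induction As arbitrary: ms) (auto simp: set_Cons_def list_all2_Cons2)

lemma in_tup:
  "ms \<in> tup M ss \<longleftrightarrow> length ms = length ss \<and> (\<forall>i<length ss. ms ! i \<in> car M (ss ! i))"
  "ms \<in> listset (map (car M \<circ> fst) xs) \<longleftrightarrow> length ms = length xs \<and> (\<forall>i<length xs. ms ! i \<in> car M (fst (xs ! i)))"
  by (auto simp: in_listset list_all2_conv_all_nth)

lemma tup_fst: "listset (map (\<lambda>v. car M (fst v)) xs) = tup M (map fst xs)"
  by (simp add: comp_def)

lemma length_hmap [simp]: "length ms = length ss \<Longrightarrow> length (hmap h ss ms) = length ss"
  by (simp add: hmap_def)

lemma nth_hmap [simp]: "length ms = length ss \<Longrightarrow> i < length ss \<Longrightarrow> hmap h ss ms ! i = h (ss ! i) (ms ! i)"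
  by (simp add: hmap_def)

lemma hmap_tup: "ms \<in> tup M ss \<Longrightarrow> (\<And>s m. m \<in> car M s \<Longrightarrow> h s m \<in> car N s) \<Longrightarrow> hmap h ss ms \<in> tup N ss"
  by (simp add: in_tup)

lemma hmap_cong: "ms \<in> tup M ss \<Longrightarrow> (\<And>s m. m \<in> car M s \<Longrightarrow> h s m = k s m) \<Longrightarrow> hmap h ss ms = hmap k ss ms"
  by (intro nth_equalityI) (auto simp: in_tup)

lemma hmap_ident: "ms \<in> tup M ss \<Longrightarrow> (\<And>s m. m \<in> car M s \<Longrightarrow> h s m = m) \<Longrightarrow> hmap h ss ms = ms"
  by (intro nth_equalityI) (auto simp: in_tup)

lemma hmap_hmap: "length ms = length ss \<Longrightarrow> hmap k ss (hmap h ss ms) = hmap (\<lambda>s x. k s (h s x)) ss ms"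
  by (intro nth_equalityI) auto

lemma those_Some: "those ys = Some vs \<longleftrightarrow> ys = map Some vs"
proof
  show "those ys = Some vs \<Longrightarrow> ys = map Some vs"
    by (induction ys arbitrary: vs) (auto split: option.splits)
  show "ys = map Some vs \<Longrightarrow> those ys = Some vs"
    by (induction vs arbitrary: ys) auto
qed

lemma total_strD:
  assumes "total_str \<Sigma> M" "f \<in> funs \<Sigma>" "ms \<in> tup M (farity \<Sigma> f)"
  shows "fint M f ms = Some (opn M f ms)" "opn M f ms \<in> car M (fsort \<Sigma> f)"
proof -
  obtain m where m: "fint M f ms = Some m" using assms unfolding total_str_def by blast
  then show "fint M f ms = Some (opn M f ms)" by (simp add: opn_def)
  show "opn M f ms \<in> car M (fsort \<Sigma> f)" using assms(1) m by (simp add: total_str_def is_pstructure_def opn_def)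
qed

lemma fintD:
  assumes "is_pstructure \<Sigma> M" "fint M f ms = Some m"
  shows "f \<in> funs \<Sigma>" "ms \<in> tup M (farity \<Sigma> f)" "m = opn M f ms"
  using assms by (auto simp: is_pstructure_def opn_def)

text \<open>Structures are fixed to be empty outside their signature, so agreement of carriers and
  declared operations already is equality in HOL. Thanks to this, several constructions below are
  inverse to each other on the nose and not merely up to isomorphism.\<close>

lemma total_str_ext:
  assumes "total_str \<Sigma> M" "total_str \<Sigma> N" "car M = car N"
    and "\<And>f ms. f \<in> funs \<Sigma> \<Longrightarrow> ms \<in> tup M (farity \<Sigma> f) \<Longrightarrow> opn M f ms = opn N f ms"
  shows "M = N"
proof -
  have "fint M f ms = fint N f ms" for f ms
  proof (cases "f \<in> funs \<Sigma> \<and> ms \<in> tup M (farity \<Sigma> f)")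
    case True
    then show ?thesis using total_strD(1)[OF assms(1), of f ms] total_strD(1)[OF assms(2), of f ms] assms(3,4) by simp
  next
    case False
    then have "fint M f ms = None" "fint N f ms = None"
      using fintD[of \<Sigma> M f ms] fintD[of \<Sigma> N f ms] assms(1-3) by (auto simp: total_str_def simp del: not_None_eq intro: ccontr)
    then show ?thesis by simp
  qed
  moreover have "rint M = (\<lambda>_. {})" "rint N = (\<lambda>_. {})"
    using assms(1,2) by (auto simp: total_str_def is_pstructure_def)
  ultimately show ?thesis using assms(3) by (intro pstructure.equality) auto
qed

definition mkstr :: "('s, 'f, 'r) signature \<Rightarrow> ('s \<Rightarrow> 'u set) \<Rightarrow> ('f \<Rightarrow> 'u list \<Rightarrow> 'u) \<Rightarrow> ('s, 'f, 'r, 'u) pstructure" where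
  "mkstr \<Sigma> A p = \<lparr>car = A,
     fint = (\<lambda>f ms. if f \<in> funs \<Sigma> \<and> ms \<in> listset (map A (farity \<Sigma> f)) then Some (p f ms) else None),
     rint = (\<lambda>_. {})\<rparr>"

lemma car_mkstr [simp]: "car (mkstr \<Sigma> A p) = A"
  by (simp add: mkstr_def)

lemma opn_mkstr: "f \<in> funs \<Sigma> \<Longrightarrow> ms \<in> listset (map A (farity \<Sigma> f)) \<Longrightarrow> opn (mkstr \<Sigma> A p) f ms = p f ms"
  by (simp add: mkstr_def opn_def)

lemma total_mkstr:
  fixes A :: "'s \<Rightarrow> 'u set"
  assumes "rels \<Sigma> = {}" "\<And>s. small TYPE('u) (A s)" "\<And>s. s \<notin> sorts \<Sigma> \<Longrightarrow> A s = {}"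
    and "\<And>f ms. f \<in> funs \<Sigma> \<Longrightarrow> ms \<in> listset (map A (farity \<Sigma> f)) \<Longrightarrow> p f ms \<in> A (fsort \<Sigma> f)"
  shows "total_str \<Sigma> (mkstr \<Sigma> A p)"
  using assms by (auto simp: total_str_def is_pstructure_def mkstr_def split: if_splits)

section \<open>Terms and formulas in total structures\<close>

lemma map_of_zip_tup:
  assumes "v \<in> set xs" "ms \<in> tup M (map fst xs)"
  shows "\<exists>m \<in> car M (fst v). map_of (zip xs ms) v = Some m"
proof -
  have len: "length xs = length ms" using assms(2) by (simp add: in_tup)
  then obtain m where m: "map_of (zip xs ms) v = Some m" using assms(1) map_of_zip_is_Some[OF len] by blast
  then obtain i where "i < length xs" "xs ! i = v" "ms ! i = m"
    by (auto dest!: map_of_SomeD simp: in_set_zip)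
  then show ?thesis using m assms(2) len by (auto simp: in_tup)
qed

lemma tval_App: "map (tval M xs ms) ts = map Some vs \<Longrightarrow> tval M xs ms (App f ts) = fint M f vs"
  using those_Some[of "map (tval M xs ms) ts" vs] by simp

lemma tval_App_values:
  assumes "total_str \<Sigma> M" "f \<in> funs \<Sigma>" "list_all2 (\<lambda>t s. \<exists>v \<in> car M s. tval M xs ms t = Some v) ts (farity \<Sigma> f)"
  shows "map (the \<circ> tval M xs ms) ts \<in> tup M (farity \<Sigma> f)"
    "tval M xs ms (App f ts) = Some (opn M f (map (the \<circ> tval M xs ms) ts))"
proof -
  have "map (tval M xs ms) ts = map Some (map (the \<circ> tval M xs ms) ts)"
    using assms(3) by (fastforce simp: list_all2_conv_all_nth intro: nth_equalityI)
  then have *: "tval M xs ms (App f ts) = fint M f (map (the \<circ> tval M xs ms) ts)" by (rule tval_App)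
  show t: "map (the \<circ> tval M xs ms) ts \<in> tup M (farity \<Sigma> f)"
    using assms(3) by (fastforce simp: in_tup list_all2_conv_all_nth)
  show "tval M xs ms (App f ts) = Some (opn M f (map (the \<circ> tval M xs ms) ts))"
    using * total_strD(1)[OF assms(1,2) t] by simp
qed

lemma tval_total:
  assumes "total_str \<Sigma> M" "wf_tm \<Sigma> xs t s" "ms \<in> tup M (map fst xs)"
  shows "\<exists>v \<in> car M s. tval M xs ms t = Some v"
  using assms(2)
proof induction
  case (1 v)
  then show ?case using map_of_zip_tup[OF 1 assms(3)] by simp
next
  case (2 f ts)
  have "list_all2 (\<lambda>t s. \<exists>v \<in> car M s. tval M xs ms t = Some v) ts (farity \<Sigma> f)"
    using 2(2) by (rule list_all2_mono) blast
  from tval_App_values[OF assms(1) 2(1) this] total_strD(2)[OF assms(1) 2(1)]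
  show ?case by simp
qed

lemma tval_total_App:
  assumes "total_str \<Sigma> M" "f \<in> funs \<Sigma>" "list_all2 (wf_tm \<Sigma> xs) ts (farity \<Sigma> f)" "ms \<in> tup M (map fst xs)"
  shows "map (the \<circ> tval M xs ms) ts \<in> tup M (farity \<Sigma> f)"
    "tval M xs ms (App f ts) = Some (opn M f (map (the \<circ> tval M xs ms) ts))"
proof -
  have "list_all2 (\<lambda>t s. \<exists>v \<in> car M s. tval M xs ms t = Some v) ts (farity \<Sigma> f)"
    using assms(3) by (rule list_all2_mono) (rule tval_total[OF assms(1) _ assms(4)])
  from tval_App_values[OF assms(1,2) this]
  show "map (the \<circ> tval M xs ms) ts \<in> tup M (farity \<Sigma> f)"
    "tval M xs ms (App f ts) = Some (opn M f (map (the \<circ> tval M xs ms) ts))" by auto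
qed

lemma map_tval_Var: "distinct xs \<Longrightarrow> length ms = length xs \<Longrightarrow> map (tval M xs ms) (map Var xs) = map Some ms"
  by (intro nth_equalityI) (auto simp: map_of_zip_nth)

lemma tval_App_Var:
  "distinct xs \<Longrightarrow> length ms = length xs \<Longrightarrow> tval M xs ms (App f (map Var xs)) = fint M f ms"
  by (rule tval_App, rule map_tval_Var)

lemma wf_Vars: "list_all2 (wf_tm \<Sigma> xs) (map Var xs) (map fst xs)"
  by (auto simp: list_all2_conv_all_nth intro: wf_tm.intros)

lemma valid_Top: "prem e = Top \<Longrightarrow> valid M e \<longleftrightarrow> (\<forall>ms \<in> tup M (map fst (ctx e)). holds M (ctx e) ms (concl e))"
  by (auto simp: valid_def interp_def tup_fst)

lemma valid_defd_iff:
  assumes "distinct xs"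
  shows "valid M (Sequent xs Top (defd (App f (map Var xs)))) \<longleftrightarrow>
    (\<forall>ms \<in> tup M (map fst xs). \<exists>m. fint M f ms = Some m)"
proof -
  have "tval M xs ms (App f (map Var xs)) = fint M f ms" if "ms \<in> tup M (map fst xs)" for ms
    using tval_App_Var[OF assms, of ms M f] that by (simp add: in_tup del: tval.simps map_map)
  then show ?thesis by (simp add: valid_Top del: tval.simps map_map)
qed

lemma generic_ctx: "distinct (generic_ctx ss)" "map fst (generic_ctx ss) = ss" "length (generic_ctx ss) = length ss"
  by (auto simp: generic_ctx_def distinct_zipI2)

lemma wf_generic: "set ss \<subseteq> sorts \<Sigma> \<Longrightarrow> wf_ctx \<Sigma> (generic_ctx ss)"
  using generic_ctx(2)[of ss] by (metis wf_ctx_def generic_ctx(1) set_map)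

lemma hom_tval:
  assumes M: "total_str \<Sigma> M" and h: "is_hom \<Sigma> M N h" and "wf_tm \<Sigma> xs t s" and ms: "ms \<in> tup M (map fst xs)"
  shows "tval N xs (hmap h (map fst xs) ms) t = Some (h s (the (tval M xs ms t)))"
  using assms(3)
proof induction
  case (1 v)
  have len: "length ms = length xs" using ms by (simp add: in_tup)
  obtain m where m: "map_of (zip xs ms) v = Some m" using map_of_zip_tup[OF 1 ms] by blast
  have "map_of (zip xs (hmap h (map fst xs) ms)) v = map_option (h (fst v)) (map_of (zip xs ms) v)"
    using len by (induction xs ms rule: list_induct2') (auto simp: hmap_def)
  then show ?case using m by simp
next
  case (2 f ts)
  have wf: "list_all2 (wf_tm \<Sigma> xs) ts (farity \<Sigma> f)" using 2(2) by (rule list_all2_mono) blast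
  note v = tval_total_App[OF M 2(1) wf ms]
  have "map (tval N xs (hmap h (map fst xs) ms)) ts = map Some (hmap h (farity \<Sigma> f) (map (the \<circ> tval M xs ms) ts))"
    using 2(2) by (intro nth_equalityI) (auto simp: list_all2_conv_all_nth)
  from tval_App[OF this] show ?case
    using v h total_strD(1)[OF M 2(1) v(1)] 2(1) by (simp add: is_hom_def del: tval.simps)
qed

text \<open>Horn formulas are positive, hence preserved. As axioms of equational theories have
  trivial premises, this carries an axiom from a model to every tuple in the image of a
  homomorphism; closure under quotients and under sifted colimits both rest on it.\<close>

lemma hom_holds:
  assumes "total_str \<Sigma> M" "is_hom \<Sigma> M N h" "wf_horn \<Sigma> xs \<phi>" "ms \<in> tup M (map fst xs)" "holds M xs ms \<phi>"
  shows "holds N xs (hmap h (map fst xs) ms) \<phi>"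
  using assms(3,5)
proof (induction \<phi>)
  case (Rel R ts)
  then show ?case using assms(1) by (simp add: total_str_def)
next
  case (Eq t t')
  then obtain s where "wf_tm \<Sigma> xs t s" "wf_tm \<Sigma> xs t' s" "tval M xs ms t = tval M xs ms t'" by auto
  then show ?case using hom_tval[OF assms(1,2) _ assms(4)] by simp
qed auto

text \<open>The reduct along a map of function symbols. The case distinction matters because a
  structure must be undefined outside its signature, whereas \<open>\<rho>\<close> takes arbitrary
  values there.\<close>

definition red :: "('s, 'f, 'r) signature \<Rightarrow> ('f \<Rightarrow> 'g) \<Rightarrow> ('s, 'g, 'q, 'u) pstructure \<Rightarrow> ('s, 'f, 'r, 'u) pstructure" where
  "red \<Sigma> \<rho> M = \<lparr>car = car M, fint = (\<lambda>f. if f \<in> funs \<Sigma> then fint M (\<rho> f) else (\<lambda>_. None)), rint = (\<lambda>_. {})\<rparr>"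

lemma car_red [simp]: "car (red \<Sigma> \<rho> M) = car M"
  by (simp add: red_def)

lemma fint_red: "f \<in> funs \<Sigma> \<Longrightarrow> fint (red \<Sigma> \<rho> M) f = fint M (\<rho> f)"
  by (simp add: red_def)

lemma opn_red: "f \<in> funs \<Sigma> \<Longrightarrow> opn (red \<Sigma> \<rho> M) f = opn M (\<rho> f)"
  by (simp add: red_def opn_def fun_eq_iff)

lemma tval_red: "wf_tm \<Sigma> xs t s \<Longrightarrow> tval (red \<Sigma> \<rho> M) xs ms t = tval M xs ms (map_tm \<rho> t)"
proof (induction rule: wf_tm.induct)
  case (2 f ts)
  then have "map (tval (red \<Sigma> \<rho> M) xs ms) ts = map (tval M xs ms) (map (map_tm \<rho>) ts)"
    by (auto simp: list_all2_conv_all_nth in_set_conv_nth)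
  then show ?case using 2(1) by (simp add: fint_red del: map_map)
qed simp

lemma holds_red: "rels \<Sigma> = {} \<Longrightarrow> wf_horn \<Sigma> xs \<phi> \<Longrightarrow>
    holds (red \<Sigma> \<rho> M) xs ms \<phi> \<longleftrightarrow> holds M xs ms (map_horn \<rho> r \<phi>)"
  by (induction \<phi>) (auto simp: tval_red)

lemma valid_red:
  assumes "rels \<Sigma> = {}" "wf_sequent \<Sigma> e"
  shows "valid (red \<Sigma> \<rho> M) e \<longleftrightarrow> valid M (map_sequent \<rho> r e)"
  using assms by (cases e) (simp add: valid_def interp_def wf_sequent_def holds_red[of \<Sigma> _ _ \<rho> M _ r])

definition arity_map :: "('s, 'f, 'r) signature \<Rightarrow> ('s, 'g, 'q) signature \<Rightarrow> ('f \<Rightarrow> 'g) \<Rightarrow> bool" where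
  "arity_map \<Sigma> \<Sigma>' \<rho> \<longleftrightarrow> sorts \<Sigma> = sorts \<Sigma>' \<and>
     (\<forall>f \<in> funs \<Sigma>. \<rho> f \<in> funs \<Sigma>' \<and> farity \<Sigma>' (\<rho> f) = farity \<Sigma> f \<and> fsort \<Sigma>' (\<rho> f) = fsort \<Sigma> f)"

lemma total_red:
  assumes \<rho>: "arity_map \<Sigma> \<Sigma>' \<rho>" and r: "rels \<Sigma> = {}" and M: "total_str \<Sigma>' M"
  shows "total_str \<Sigma> (red \<Sigma> \<rho> M)"
proof -
  have "ms \<in> tup M (farity \<Sigma> f)" "m \<in> car M (fsort \<Sigma> f)"
    if "f \<in> funs \<Sigma>" "fint M (\<rho> f) ms = Some m" for f ms m
    using that \<rho> M unfolding arity_map_def total_str_def is_pstructure_def by metis+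
  moreover have "\<exists>m. fint M (\<rho> f) ms = Some m" if "f \<in> funs \<Sigma>" "ms \<in> tup M (farity \<Sigma> f)" for f ms
    using that \<rho> M unfolding arity_map_def total_str_def by metis
  ultimately show ?thesis
    using \<rho> r M by (auto simp: total_str_def is_pstructure_def red_def arity_map_def split: if_splits)
qed

lemma hom_red:
  assumes \<rho>: "arity_map \<Sigma> \<Sigma>' \<rho>" and r: "rels \<Sigma> = {}" and h: "is_hom \<Sigma>' M N h"
  shows "is_hom \<Sigma> (red \<Sigma> \<rho> M) (red \<Sigma> \<rho> N) h"
proof -
  have "fint N (\<rho> f) (hmap h (farity \<Sigma> f) ms) = Some (h (fsort \<Sigma> f) m)"
    if "f \<in> funs \<Sigma>" "fint M (\<rho> f) ms = Some m" for f ms m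
    using that \<rho> h unfolding arity_map_def is_hom_def by metis
  then show ?thesis using r h by (auto simp: is_hom_def red_def)
qed

lemma wf_map_tm: assumes "arity_map \<Sigma> \<Sigma>' \<rho>" "wf_tm \<Sigma> xs t s" shows "wf_tm \<Sigma>' xs (map_tm \<rho> t) s"
  using assms(2)
proof induction
  case (1 v)
  then show ?case by (simp add: wf_tm.intros)
next
  case (2 f ts)
  then have "list_all2 (wf_tm \<Sigma>' xs) (map (map_tm \<rho>) ts) (farity \<Sigma>' (\<rho> f))"
    using assms(1) by (auto simp: arity_map_def list_all2_conv_all_nth)
  then show ?case using wf_tm.intros(2)[of "\<rho> f" \<Sigma>' xs] 2(1) assms(1) by (simp add: arity_map_def)
qed

lemma wf_map_horn: "arity_map \<Sigma> \<Sigma>' \<rho> \<Longrightarrow> rels \<Sigma> = {} \<Longrightarrow> wf_horn \<Sigma> xs \<phi> \<Longrightarrow> wf_horn \<Sigma>' xs (map_horn \<rho> r \<phi>)"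
  by (induction \<phi>) (auto intro: wf_map_tm)

lemma wf_map_sequent: "arity_map \<Sigma> \<Sigma>' \<rho> \<Longrightarrow> rels \<Sigma> = {} \<Longrightarrow> wf_sequent \<Sigma> e \<Longrightarrow> wf_sequent \<Sigma>' (map_sequent \<rho> r e)"
  by (cases e) (simp add: wf_sequent_def wf_ctx_def wf_map_horn, simp add: arity_map_def)

section \<open>Initial structures\<close>

fun subst :: "'s var list \<Rightarrow> ('s, 'f) tm list \<Rightarrow> ('s, 'f) tm \<Rightarrow> ('s, 'f) tm" where
  "subst xs rs (Var v) = the (map_of (zip xs rs) v)"
| "subst xs rs (App f ts) = App f (map (subst xs rs) ts)"

lemma wf_subst:
  assumes "wf_tm \<Sigma> xs t s" "list_all2 (wf_tm \<Sigma> ys) rs (map fst xs)"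
  shows "wf_tm \<Sigma> ys (subst xs rs t) s"
  using assms(1)
proof induction
  case (1 v)
  have len: "length xs = length rs" using assms(2) by (simp add: list_all2_lengthD)
  then obtain r where r: "map_of (zip xs rs) v = Some r" using 1 map_of_zip_is_Some[OF len] by blast
  then obtain i where "i < length xs" "xs ! i = v" "rs ! i = r"
    by (auto dest!: map_of_SomeD simp: in_set_zip)
  then show ?case using assms(2) r by (auto simp: list_all2_conv_all_nth)
next
  case (2 f ts)
  then have "list_all2 (wf_tm \<Sigma> ys) (map (subst xs rs) ts) (farity \<Sigma> f)"
    by (auto simp: list_all2_conv_all_nth)
  then show ?case using wf_tm.intros(2)[OF 2(1)] by simp
qed

lemma tval_subst:
  assumes M: "total_str \<Sigma> M" and ms: "ms \<in> tup M (map fst ys)" and "wf_tm \<Sigma> xs t s"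
    and rs: "list_all2 (wf_tm \<Sigma> ys) rs (map fst xs)"
  shows "tval M ys ms (subst xs rs t) = tval M xs (map (the \<circ> tval M ys ms) rs) t"
  using assms(3)
proof induction
  case (1 v)
  have len: "length xs = length rs" using rs by (simp add: list_all2_lengthD)
  then obtain r where r: "map_of (zip xs rs) v = Some r" using 1 map_of_zip_is_Some[OF len] by blast
  then obtain i where i: "i < length xs" "xs ! i = v" "rs ! i = r"
    by (auto dest!: map_of_SomeD simp: in_set_zip)
  then have "wf_tm \<Sigma> ys r (fst v)" using rs by (auto simp: list_all2_conv_all_nth)
  from tval_total[OF M this ms] r show ?case by (auto simp: zip_map2 map_of_map comp_def)
next
  case (2 f ts)
  then have *: "map (tval M ys ms) (map (subst xs rs) ts) = map (tval M xs (map (the \<circ> tval M ys ms) rs)) ts"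
    by (intro nth_equalityI) (auto simp: list_all2_conv_all_nth comp_def)
  show ?case unfolding subst.simps tval.simps * ..
qed

lemma subst_closed: assumes "wf_tm \<Sigma> [] t s" shows "subst [] [] t = t"
  using assms
proof induction
  case (2 f ts)
  then have "map (subst [] []) ts = ts" by (intro nth_equalityI) (auto simp: list_all2_conv_all_nth)
  then show ?case by simp
qed simp

lemma (in univ) small_closed_terms:
  assumes "small TYPE('u) (funs \<Sigma>)"
  shows "small TYPE('u) {t. \<exists>s. wf_tm \<Sigma> [] t s}"
proof -
  \<comment> \<open>Stratification by size: a term below stage \<open>n + 1\<close> is a symbol
    applied to a list of terms below stage \<open>n\<close>. Countably many small stages exhaust all
    closed terms.\<close>
  have "small TYPE('u) {t. (\<exists>s. wf_tm \<Sigma> [] t s) \<and> size t < n}" for n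
  proof (induction n)
    case (Suc n)
    let ?A = "{t. (\<exists>s. wf_tm \<Sigma> [] t s) \<and> size t < n}"
    have "{t. (\<exists>s. wf_tm \<Sigma> [] t s) \<and> size t < Suc n} \<subseteq> (\<lambda>(f, ts). App f ts) ` (funs \<Sigma> \<times> lists ?A)"
    proof
      fix t assume "t \<in> {t. (\<exists>s. wf_tm \<Sigma> [] t s) \<and> size t < Suc n}"
      then obtain s where "wf_tm \<Sigma> [] t s" and sz: "size t < Suc n" by blast
      then obtain f ts where t: "t = App f ts" "f \<in> funs \<Sigma>" "list_all2 (wf_tm \<Sigma> []) ts (farity \<Sigma> f)"
        by (auto elim: wf_tm.cases)
      have "x \<in> ?A" if x: "x \<in> set ts" for x
      proof -
        have "size x < size (App f ts)" using size_list_estimation[OF x, of "size x" size] x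
          by (simp add: less_Suc_eq_le size_list_estimation')
        then have "size x < n" using sz t(1) by simp
        then show ?thesis using t(3) x by (auto simp: list_all2_conv_all_nth in_set_conv_nth)
      qed
      then show "t \<in> (\<lambda>(f, ts). App f ts) ` (funs \<Sigma> \<times> lists ?A)" using t by auto
    qed
    then show ?case by (rule small_subset[OF small_image[OF small_Times[OF assms small_lists[OF Suc]]]])
  qed (simp add: small_finite)
  then have "small TYPE('u) (\<Union>n. {t. (\<exists>s. wf_tm \<Sigma> [] t s) \<and> size t < n})" by (intro small_UN small_nat)
  moreover have "{t. \<exists>s. wf_tm \<Sigma> [] t s} = (\<Union>n. {t. (\<exists>s. wf_tm \<Sigma> [] t s) \<and> size t < n})" by auto
  ultimately show ?thesis by simp
qed

text \<open>
  Closed terms are identified when they agree in all structures of the given class; the equations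
  valid throughout the class then hold for the quotient without any deductive calculus.
\<close>

lemma (in univ) initial_structure:
  fixes \<C> :: "('s, 'f, 'r, 'u) pstructure set"
  assumes sg: "is_signature TYPE('u) \<Sigma>" "rels \<Sigma> = {}" and \<C>: "\<And>M. M \<in> \<C> \<Longrightarrow> total_str \<Sigma> M"
  shows "\<exists>I :: ('s, 'f, 'r, 'u) pstructure. total_str \<Sigma> I \<and> (\<forall>M \<in> \<C>. \<exists>!h. is_hom \<Sigma> I M h) \<and>
    (\<forall>e. wf_sequent \<Sigma> e \<and> prem e = Top \<and> (\<forall>M \<in> \<C>. valid M e) \<longrightarrow> valid I e)"
proof -
  define cl where "cl t s \<longleftrightarrow> wf_tm \<Sigma> [] t s" for t s
  define eqv where "eqv t t' \<longleftrightarrow> (\<forall>M\<in>\<C>. tval M [] [] t = tval M [] [] t')" for t t'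
  have small_cl: "small TYPE('u) {t. \<exists>s. cl t s}"
    unfolding cl_def using sg(1) by (intro small_closed_terms) (simp add: is_signature_def)
  then obtain enc :: "_ \<Rightarrow> 'u" where enc: "inj_on enc {t. \<exists>s. cl t s}" using small_encode by blast
  \<comment> \<open>Carriers of different sorts may overlap, so terms of different sorts can have
    equal values everywhere. The representative is therefore sought among terms of sort
    \<open>s\<close>.\<close>
  define rep where "rep s t = (SOME t'. cl t' s \<and> eqv t t')" for s t
  have rep: "cl (rep s t) s" "eqv t (rep s t)" if "cl t s" for s t
    using someI[of "\<lambda>t'. cl t' s \<and> eqv t t'" t] that by (auto simp: rep_def eqv_def)
  \<comment> \<open>The choice depends on \<open>t\<close> only through the predicate
    \<open>eqv t\<close>, and equivalent terms have the same predicate.\<close>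
  have rep_eq: "rep s t = rep s t'" if "eqv t t'" for s t t'
  proof -
    have "eqv t = eqv t'" using that by (auto simp: eqv_def fun_eq_iff)
    then show ?thesis by (simp add: rep_def)
  qed
  define cls where "cls s t = enc (rep s t)" for s t
  define \<delta> where "\<delta> = inv_into {t. \<exists>s. cl t s} enc"
  have \<delta>: "\<delta> (cls s t) = rep s t" if "cl t s" for s t
    unfolding \<delta>_def cls_def using inv_into_f_f[OF enc] rep(1)[OF that] by blast
  have \<delta>cl: "cl (\<delta> (cls s t)) s" "eqv t (\<delta> (cls s t))" "cls s (\<delta> (cls s t)) = cls s t" if "cl t s" for s t
    using \<delta>[OF that] rep[OF that] rep_eq[OF rep(2)[OF that], of s] by (auto simp: cls_def)
  define A where "A s = {cls s t | t. cl t s}" for s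
  have A: "cl (\<delta> c) s" "cls s (\<delta> c) = c" if "c \<in> A s" for c s
    using that \<delta>cl by (auto simp: A_def)
  have clA: "cls s t \<in> A s" if "cl t s" for t s using that by (auto simp: A_def)
  define I where "I = (mkstr \<Sigma> A (\<lambda>f cs. cls (fsort \<Sigma> f) (App f (map \<delta> cs))) :: ('s, 'f, 'r, 'u) pstructure)"
  have carI: "car I = A" by (simp add: I_def)
  have wf\<delta>: "list_all2 (wf_tm \<Sigma> []) (map \<delta> cs) ss" if "cs \<in> listset (map A ss)" for cs ss
    using that A(1) by (auto simp: in_listset list_all2_conv_all_nth cl_def)
  have I: "total_str \<Sigma> I"
    unfolding I_def
  proof (rule total_mkstr[OF sg(2)])
    fix s
    show "small TYPE('u) (A s)"
    proof -
      have "A s \<subseteq> cls s ` {t. \<exists>s. cl t s}" by (auto simp: A_def)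
      then show ?thesis using small_subset small_image[OF small_cl] by metis
    qed
    show "A s = {}" if "s \<notin> sorts \<Sigma>"
    proof -
      have "\<not> cl t s" for t using that sg(1) unfolding cl_def is_signature_def by (auto elim!: wf_tm.cases)
      then show ?thesis by (simp add: A_def)
    qed
  next
    fix f ms assume "f \<in> funs \<Sigma>" "ms \<in> listset (map A (farity \<Sigma> f))"
    then show "cls (fsort \<Sigma> f) (App f (map \<delta> ms)) \<in> A (fsort \<Sigma> f)"
      using clA wf\<delta> by (simp add: cl_def wf_tm.intros)
  qed
  \<comment> \<open>Evaluation in the quotient is substitution of representatives followed by taking
    the class. Hence an equation holds in \<open>I\<close> as soon as all its closed instances hold
    throughout the class, which yields both \<open>val\<close> and the universal property.\<close>
  have tvI: "tval I xs cs t = Some (cls s (subst xs (map \<delta> cs) t))"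
    if "wf_tm \<Sigma> xs t s" and cs: "cs \<in> tup I (map fst xs)" for xs cs t s
    using that(1)
  proof induction
    case (1 v)
    have len: "length xs = length cs" using cs by (simp add: in_tup)
    obtain c where "c \<in> A (fst v)" "map_of (zip xs cs) v = Some c" using map_of_zip_tup[OF 1 cs] carI by auto
    then show ?case using A(2) by (simp add: zip_map2 map_of_map)
  next
    case (2 f ts)
    have wf: "list_all2 (wf_tm \<Sigma> xs) ts (farity \<Sigma> f)" using 2(2) by (rule list_all2_mono) blast
    let ?vs = "map (the \<circ> tval I xs cs) ts" and ?us = "map (subst xs (map \<delta> cs)) ts"
    note v = tval_total_App[OF I 2(1) wf cs]
    have cs': "list_all2 (wf_tm \<Sigma> []) (map \<delta> cs) (map fst xs)" using wf\<delta> cs carI by simp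
    have len: "length ts = length (farity \<Sigma> f)" using wf by (rule list_all2_lengthD)
    have e: "eqv (?us ! i) (map \<delta> ?vs ! i)" if "i < length ts" for i
    proof -
      have i: "tval I xs cs (ts ! i) = Some (cls (farity \<Sigma> f ! i) (?us ! i))"
        "cl (?us ! i) (farity \<Sigma> f ! i)"
        using 2(2) that wf_subst[OF _ cs'] by (auto simp: list_all2_conv_all_nth cl_def)
      then show ?thesis using \<delta>cl(2)[OF i(2)] that by simp
    qed
    have "eqv (App f ?us) (App f (map \<delta> ?vs))"
    proof -
      have "map (tval M [] []) ?us = map (tval M [] []) (map \<delta> ?vs)" if "M \<in> \<C>" for M
        using e that by (intro nth_equalityI) (auto simp: eqv_def)
      then show ?thesis by (simp add: eqv_def del: map_map)
    qed
    from rep_eq[OF this] have "cls (fsort \<Sigma> f) (App f (map \<delta> ?vs)) = cls (fsort \<Sigma> f) (subst xs (map \<delta> cs) (App f ts))"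
      by (simp add: cls_def)
    moreover have "opn I f ?vs = cls (fsort \<Sigma> f) (App f (map \<delta> ?vs))"
      unfolding I_def using v(1) 2(1) by (intro opn_mkstr) (simp_all add: carI I_def)
    ultimately show ?case using v(2) by (simp del: tval.simps subst.simps)
  qed
  have tvcl: "tval I [] [] t = Some (cls s t)" if "cl t s" for t s
    using tvI[of "[]" t s "[]"] that subst_closed[of \<Sigma> t s] by (auto simp: cl_def in_tup)
  have val: "valid I e" if e: "wf_sequent \<Sigma> e" "prem e = Top" "\<And>M. M \<in> \<C> \<Longrightarrow> valid M e" for e
    unfolding valid_Top[OF e(2)]
  proof
    fix cs assume cs: "cs \<in> tup I (map fst (ctx e))"
    let ?rs = "map \<delta> cs" and ?xs = "ctx e"
    have rs: "list_all2 (wf_tm \<Sigma> []) ?rs (map fst ?xs)" using wf\<delta> cs carI by simp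
    have vals: "map (the \<circ> tval M [] []) ?rs \<in> tup M (map fst ?xs)" if "M \<in> \<C>" for M
      using tval_total[OF \<C>[OF that], of "[]" _ _ "[]"] rs
      by (fastforce simp: in_tup list_all2_conv_all_nth)
    have "wf_horn \<Sigma> ?xs \<phi> \<Longrightarrow> (\<And>M. M \<in> \<C> \<Longrightarrow> holds M ?xs (map (the \<circ> tval M [] []) ?rs) \<phi>) \<Longrightarrow> holds I ?xs cs \<phi>" for \<phi>
    proof (induction \<phi>)
      case (Rel R ts)
      then show ?case using sg by simp
    next
      case (Eq t t')
      then obtain s where s: "wf_tm \<Sigma> ?xs t s" "wf_tm \<Sigma> ?xs t' s" by auto
      have "tval M [] [] (subst ?xs ?rs t) = tval M [] [] (subst ?xs ?rs t')" if "M \<in> \<C>" for M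
        using tval_subst[OF \<C>[OF that], of "[]" "[]", OF _ s(1) rs] tval_subst[OF \<C>[OF that], of "[]" "[]", OF _ s(2) rs]
          Eq(2)[OF that] by (auto simp: comp_def)
      then have "eqv (subst ?xs ?rs t) (subst ?xs ?rs t')" by (simp add: eqv_def)
      then show ?case using tvI[OF s(1) cs] tvI[OF s(2) cs] rep_eq by (auto simp: cls_def)
    qed auto
    moreover have "holds M ?xs (map (the \<circ> tval M [] []) ?rs) (concl e)" if "M \<in> \<C>" for M
      using e(3)[OF that] vals[OF that] by (simp add: valid_Top[OF e(2)])
    ultimately show "holds I ?xs cs (concl e)" using e(1) by (simp add: wf_sequent_def)
  qed
  have hom: "\<exists>!h. is_hom \<Sigma> I M h" if M: "M \<in> \<C>" for M
  proof
    define h where "h = (\<lambda>s. restrict (\<lambda>c. the (tval M [] [] (\<delta> c))) (A s))"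
    have h: "h s (cls s t) = the (tval M [] [] t)" if "cl t s" for s t
      using clA[OF that] \<delta>cl(2)[OF that] M by (simp add: h_def eqv_def)
    have tvM: "tval M [] [] t = Some (the (tval M [] [] t))" "the (tval M [] [] t) \<in> car M s" if "cl t s" for t s
      using tval_total[OF \<C>[OF M], of "[]" t s "[]"] that by (auto simp: cl_def)
    have hA: "h s c = the (tval M [] [] (\<delta> c))" if "c \<in> A s" for s c using that by (simp add: h_def)
    show "is_hom \<Sigma> I M h"
      unfolding is_hom_def
    proof (intro conjI allI ballI impI)
      fix s show "h s \<in> car I s \<rightarrow>\<^sub>E car M s"
        unfolding carI using A(1) tvM(2) by (auto simp: h_def)
    next
      fix f ms m assume f: "f \<in> funs \<Sigma>" and m: "fint I f ms = Some m"
      have ms: "ms \<in> tup I (farity \<Sigma> f)" and m': "m = opn I f ms"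
        using fintD[OF _ m] I by (auto simp: total_str_def)
      have wf: "list_all2 (wf_tm \<Sigma> []) (map \<delta> ms) (farity \<Sigma> f)" using ms wf\<delta> carI by simp
      have "cl (App f (map \<delta> ms)) (fsort \<Sigma> f)" unfolding cl_def using f wf by (rule wf_tm.intros)
      moreover have "m = cls (fsort \<Sigma> f) (App f (map \<delta> ms))"
        unfolding m' I_def using ms f by (intro opn_mkstr) (simp_all add: carI)
      ultimately have "Some (h (fsort \<Sigma> f) m) = tval M [] [] (App f (map \<delta> ms))" using h tvM(1) by metis
      also have "\<dots> = fint M f (map (the \<circ> tval M [] []) (map \<delta> ms))"
        using tval_total_App[OF \<C>[OF M] f wf, of "[]"] total_strD(1)[OF \<C>[OF M] f] by simp
      also have "map (the \<circ> tval M [] []) (map \<delta> ms) = hmap h (farity \<Sigma> f) ms"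
        using ms[unfolded in_tup, unfolded carI] hA by (intro nth_equalityI) auto
      finally show "fint M f (hmap h (farity \<Sigma> f) ms) = Some (h (fsort \<Sigma> f) m)" by simp
    qed (use sg in simp)
    \<comment> \<open>Each element of \<open>I\<close> is the value of a closed term, and
      homomorphisms preserve such values; this leaves no freedom for \<open>k\<close>.\<close>
    fix k assume k: "is_hom \<Sigma> I M k"
    have "k s c = h s c" for s c
    proof (cases "c \<in> A s")
      case True
      note c = A[OF True]
      have "tval M [] [] (\<delta> c) = Some (k s (the (tval I [] [] (\<delta> c))))"
        using hom_tval[OF I k, of "[]" "\<delta> c" s "[]"] c(1) by (simp add: cl_def hmap_def)
      then show ?thesis using tvcl[OF c(1)] c(2) hA[OF True] by simp
    next
      case False
      have "k s \<in> A s \<rightarrow>\<^sub>E car M s" using k carI by (simp add: is_hom_def)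
      from PiE_arb[OF this False] show ?thesis using False by (simp add: h_def)
    qed
    then show "k = h" by auto
  qed
  show ?thesis
  proof (intro exI[of _ I] conjI ballI allI impI)
    show "\<exists>!h. is_hom \<Sigma> I M h" if "M \<in> \<C>" for M using hom[OF that] .
    show "valid I e" if "wf_sequent \<Sigma> e \<and> prem e = Top \<and> (\<forall>M \<in> \<C>. valid M e)" for e using that val by simp
  qed (rule I)
qed

section \<open>The category of models of an equational theory\<close>

definition ap :: "'x \<times> ('s \<Rightarrow> 'u \<Rightarrow> 'u) \<times> 'x \<Rightarrow> 's \<Rightarrow> 'u \<Rightarrow> 'u" where
  "ap f = fst (snd f)"

text \<open>Homomorphisms have to be \<open>undefined\<close> off the carriers. The restriction
  allows them to be given by a formula that is only meaningful on elements.\<close>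

definition mkarr :: "('s, 'f, 'r, 'u) pstructure \<Rightarrow> ('s \<Rightarrow> 'u \<Rightarrow> 'u) \<Rightarrow> ('s, 'f, 'r, 'u) pstructure
    \<Rightarrow> ('s, 'f, 'r, 'u) pstructure \<times> ('s \<Rightarrow> 'u \<Rightarrow> 'u) \<times> ('s, 'f, 'r, 'u) pstructure" where
  "mkarr M h N = (M, (\<lambda>s. restrict (h s) (car M s)), N)"

lemma ap_simps [simp]: "ap (M, h, N) = h"
  by (simp add: ap_def)

lemma ap_mkarr [simp]: "m \<in> car M s \<Longrightarrow> ap (mkarr M h N) s m = h s m"
  by (simp add: mkarr_def)

lemma hom_pcat: "f \<in> hom (pstructure_cat \<Sigma> \<M>) M N \<longleftrightarrow>
    M \<in> \<M> \<and> N \<in> \<M> \<and> f = (M, ap f, N) \<and> is_hom \<Sigma> M N (ap f)"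
  by (cases f) (auto simp: hom_def pstructure_cat_def)

lemma pcat_sel [simp]:
  "Obj (pstructure_cat \<Sigma> \<M>) = \<M>"
  "Dom (pstructure_cat \<Sigma> \<M>) (M, h, N) = M"
  "Cod (pstructure_cat \<Sigma> \<M>) (M, h, N) = N"
  "Id (pstructure_cat \<Sigma> \<M>) M = (M, (\<lambda>s. restrict (\<lambda>x. x) (car M s)), M)"
  "Comp (pstructure_cat \<Sigma> \<M>) (N', k, P) (M, h, N) = (M, (\<lambda>s. compose (car M s) (k s) (h s)), P)"
  by (simp_all add: pstructure_cat_def)

lemma category_pcat:
  assumes "\<And>M. M \<in> \<M> \<Longrightarrow> is_pstructure \<Sigma> M"
  shows "category (pstructure_cat \<Sigma> \<M>)"
proof
  fix x assume x: "x \<in> Obj (pstructure_cat \<Sigma> \<M>)"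
  have "hmap (\<lambda>s. restrict (\<lambda>x. x) (car x s)) ss ms = ms" if "ms \<in> tup x ss" for ss ms
    using that by (rule hmap_ident) simp
  then show "Id (pstructure_cat \<Sigma> \<M>) x \<in> hom (pstructure_cat \<Sigma> \<M>) x x"
    using x assms[of x] by (auto simp: hom_pcat is_hom_def is_pstructure_def)
next
  fix f g x y z assume "f \<in> hom (pstructure_cat \<Sigma> \<M>) x y" "g \<in> hom (pstructure_cat \<Sigma> \<M>) y z"
  then obtain h k where f: "f = (x, h, y)" "is_hom \<Sigma> x y h" and g: "g = (y, k, z)" "is_hom \<Sigma> y z k"
    and M: "x \<in> \<M>" "y \<in> \<M>" "z \<in> \<M>" by (auto simp: hom_pcat)
  have h: "h s m \<in> car y s" if "m \<in> car x s" for s m using f(2) that by (auto simp: is_hom_def)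
  have e: "hmap (\<lambda>s. compose (car x s) (k s) (h s)) ss ms = hmap k ss (hmap h ss ms)" if "ms \<in> tup x ss" for ss ms
  proof -
    have "hmap (\<lambda>s. compose (car x s) (k s) (h s)) ss ms = hmap (\<lambda>s x. k s (h s x)) ss ms"
      using that by (rule hmap_cong) (simp add: compose_def)
    then show ?thesis using that by (simp add: hmap_hmap in_tup)
  qed
  have "is_hom \<Sigma> x z (\<lambda>s. compose (car x s) (k s) (h s))"
    unfolding is_hom_def
  proof (intro conjI allI ballI impI)
    fix s show "compose (car x s) (k s) (h s) \<in> car x s \<rightarrow>\<^sub>E car z s"
      using h g(2) by (auto simp: is_hom_def compose_def)
  next
    fix F ms m assume F: "F \<in> funs \<Sigma>" "fint x F ms = Some m"
    then have t: "ms \<in> tup x (farity \<Sigma> F)" "m \<in> car x (fsort \<Sigma> F)"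
      using assms[OF M(1)] by (auto simp: is_pstructure_def)
    then show "fint z F (hmap (\<lambda>s. compose (car x s) (k s) (h s)) (farity \<Sigma> F) ms) =
      Some (compose (car x (fsort \<Sigma> F)) (k (fsort \<Sigma> F)) (h (fsort \<Sigma> F)) m)"
      using f(2) g(2) F e[OF t(1)] by (simp add: is_hom_def compose_def)
  next
    fix R ms assume R: "R \<in> rels \<Sigma>" "ms \<in> rint x R"
    then have t: "ms \<in> tup x (rarity \<Sigma> R)" using assms[OF M(1)] by (auto simp: is_pstructure_def)
    show "hmap (\<lambda>s. compose (car x s) (k s) (h s)) (rarity \<Sigma> R) ms \<in> rint z R"
      using f(2) g(2) R e[OF t] by (simp add: is_hom_def)
  qed
  then show "Comp (pstructure_cat \<Sigma> \<M>) g f \<in> hom (pstructure_cat \<Sigma> \<M>) x z"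
    using M f g by (simp add: hom_pcat)
next
  fix f x y assume "f \<in> hom (pstructure_cat \<Sigma> \<M>) x y"
  then obtain h where f: "f = (x, h, y)" "\<And>s. h s \<in> car x s \<rightarrow>\<^sub>E car y s" by (auto simp: hom_pcat is_hom_def)
  have "compose (car x s) (restrict (\<lambda>x. x) (car y s)) (h s) = h s" for s
    using f(2)[of s] by (auto simp: compose_def fun_eq_iff PiE_def extensional_def)
  then show "Comp (pstructure_cat \<Sigma> \<M>) (Id (pstructure_cat \<Sigma> \<M>) y) f = f" by (simp add: f)
  have "compose (car x s) (h s) (restrict (\<lambda>x. x) (car x s)) = h s" for s
    using f(2)[of s] by (auto simp: compose_def fun_eq_iff PiE_def extensional_def)
  then show "Comp (pstructure_cat \<Sigma> \<M>) f (Id (pstructure_cat \<Sigma> \<M>) x) = f" by (simp add: f)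
next
  fix f g h x y z w assume "f \<in> hom (pstructure_cat \<Sigma> \<M>) x y" "g \<in> hom (pstructure_cat \<Sigma> \<M>) y z"
    "h \<in> hom (pstructure_cat \<Sigma> \<M>) z w"
  then obtain f' g' h' where "f = (x, f', y)" "g = (y, g', z)" "h = (z, h', w)" "\<And>s. f' s \<in> car x s \<rightarrow>\<^sub>E car y s"
    by (auto simp: hom_pcat is_hom_def)
  then show "Comp (pstructure_cat \<Sigma> \<M>) h (Comp (pstructure_cat \<Sigma> \<M>) g f) =
      Comp (pstructure_cat \<Sigma> \<M>) (Comp (pstructure_cat \<Sigma> \<M>) h g) f"
    by (auto simp: compose_def fun_eq_iff)
qed (auto simp: pstructure_cat_def hom_def)

lemma category_PMod: "category (PMod T)"
  unfolding PMod_def by (rule category_pcat) (simp add: is_pmodel_def)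

lemma Obj_PMod [simp]: "M \<in> Obj (PMod T) \<longleftrightarrow> is_pmodel T M"
  by (simp add: PMod_def)

lemma hom_PMod: "f \<in> hom (PMod T) M N \<longleftrightarrow>
    is_pmodel T M \<and> is_pmodel T N \<and> f = (M, ap f, N) \<and> is_hom (sgn T) M N (ap f)"
  by (simp add: PMod_def hom_pcat)

lemma ap_car: "f \<in> hom (PMod T) M N \<Longrightarrow> m \<in> car M s \<Longrightarrow> ap f s m \<in> car N s"
  by (auto simp: hom_PMod is_hom_def)

lemma ap_tup: "f \<in> hom (PMod T) M N \<Longrightarrow> ms \<in> tup M ss \<Longrightarrow> hmap (ap f) ss ms \<in> tup N ss"
  using hmap_tup ap_car by metis

lemma ap_Comp: "f \<in> hom (PMod T) M N \<Longrightarrow> g \<in> hom (PMod T) N P \<Longrightarrow> m \<in> car M s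
    \<Longrightarrow> ap (Comp (PMod T) g f) s m = ap g s (ap f s m)"
  by (cases f; cases g) (simp add: PMod_def hom_pcat compose_def)

lemma ap_Id: "m \<in> car M s \<Longrightarrow> ap (Id (PMod T) M) s m = m"
  by (simp add: PMod_def)

lemma arr_eqI:
  assumes "f \<in> hom (PMod T) M N" "g \<in> hom (PMod T) M N" "\<And>s m. m \<in> car M s \<Longrightarrow> ap f s m = ap g s m"
  shows "f = g"
proof -
  have f: "f = (M, ap f, N)" "\<And>s. ap f s \<in> extensional (car M s)"
    and g: "g = (M, ap g, N)" "\<And>s. ap g s \<in> extensional (car M s)"
    using assms(1,2) by (auto simp: hom_PMod is_hom_def PiE_def)
  have "ap f s = ap g s" for s using extensionalityI[OF f(2) g(2)] assms(3) by blast
  then have "ap f = ap g" by auto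
  then show ?thesis using f(1) g(1) by simp
qed

lemma hmap_Comp: "f \<in> hom (PMod T) M N \<Longrightarrow> g \<in> hom (PMod T) N P \<Longrightarrow> ms \<in> tup M ss
    \<Longrightarrow> hmap (ap (Comp (PMod T) g f)) ss ms = hmap (ap g) ss (hmap (ap f) ss ms)"
  by (simp add: hmap_hmap in_tup, intro nth_equalityI) (auto simp: ap_Comp)

context univ begin

lemma model_total:
  fixes M :: "('s, 'f, 'r, 'u) pstructure"
  assumes T: "equational_theory TYPE('u) T" and M: "is_pmodel T M"
  shows "total_str (sgn T) M"
proof -
  have "\<exists>m. fint M f ms = Some m" if f: "f \<in> funs (sgn T)" and ms: "ms \<in> tup M (farity (sgn T) f)" for f ms
  proof -
    let ?xs = "generic_ctx (farity (sgn T) f)"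
    have "valid M (Sequent ?xs Top (defd (App f (map Var ?xs))))"
      using T M f by (simp add: equational_theory_def total_fun_def phl_theorem_def Let_def)
    then show ?thesis using valid_defd_iff[OF generic_ctx(1)] ms by (metis generic_ctx(2))
  qed
  then show ?thesis using T M by (simp add: total_str_def is_pmodel_def equational_theory_def)
qed

lemma modelI: "total_str (sgn T) M \<Longrightarrow> (\<And>e. e \<in> axs T \<Longrightarrow> valid M e) \<Longrightarrow> is_pmodel T M"
  by (simp add: is_pmodel_def total_str_def)

lemma ap_opn:
  fixes M :: "('s, 'f, 'r, 'u) pstructure"
  assumes "equational_theory TYPE('u) T" "h \<in> hom (PMod T) M N" "f \<in> funs (sgn T)" "ms \<in> tup M (farity (sgn T) f)"
  shows "ap h (fsort (sgn T) f) (opn M f ms) = opn N f (hmap (ap h) (farity (sgn T) f) ms)"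
proof -
  have "is_pmodel T M" and h: "is_hom (sgn T) M N (ap h)" using assms(2) by (auto simp: hom_PMod)
  then have "fint M f ms = Some (opn M f ms)" using total_strD(1)[OF model_total[OF assms(1)] assms(3,4)] by simp
  with h assms(3) have "fint N f (hmap (ap h) (farity (sgn T) f) ms) = Some (ap h (fsort (sgn T) f) (opn M f ms))"
    by (simp add: is_hom_def)
  then show ?thesis by (simp add: opn_def)
qed

lemma total_homI:
  assumes M: "total_str \<Sigma> M" and N: "total_str \<Sigma> N"
    and h: "\<And>s m. m \<in> car M s \<Longrightarrow> h s m \<in> car N s"
    and op: "\<And>f ms. f \<in> funs \<Sigma> \<Longrightarrow> ms \<in> tup M (farity \<Sigma> f) \<Longrightarrow>
       h (fsort \<Sigma> f) (opn M f ms) = opn N f (hmap h (farity \<Sigma> f) ms)"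
  shows "is_hom \<Sigma> M N (\<lambda>s. restrict (h s) (car M s))"
  unfolding is_hom_def
proof (intro conjI allI ballI impI)
  fix f ms m assume f: "f \<in> funs \<Sigma>" and m: "fint M f ms = Some m"
  have ms: "ms \<in> tup M (farity \<Sigma> f)" "m = opn M f ms" using fintD[OF _ m] M by (auto simp: total_str_def)
  have "hmap (\<lambda>s. restrict (h s) (car M s)) (farity \<Sigma> f) ms = hmap h (farity \<Sigma> f) ms"
    using ms(1) by (rule hmap_cong) simp
  moreover have "hmap h (farity \<Sigma> f) ms \<in> tup N (farity \<Sigma> f)" using hmap_tup ms(1) h by metis
  ultimately show "fint N f (hmap (\<lambda>s. restrict (h s) (car M s)) (farity \<Sigma> f) ms) =
      Some (restrict (h (fsort \<Sigma> f)) (car M (fsort \<Sigma> f)) m)"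
    using total_strD(1)[OF N f] op[OF f ms(1)] total_strD(2)[OF M f ms(1)] ms(2) by simp
qed (use h M in \<open>auto simp: total_str_def\<close>)

lemma mkarr_hom:
  fixes M N :: "('s, 'f, 'r, 'u) pstructure"
  assumes T: "equational_theory TYPE('u) T" and M: "is_pmodel T M" and N: "is_pmodel T N"
    and h: "\<And>s m. m \<in> car M s \<Longrightarrow> h s m \<in> car N s"
    and op: "\<And>f ms. f \<in> funs (sgn T) \<Longrightarrow> ms \<in> tup M (farity (sgn T) f) \<Longrightarrow>
       h (fsort (sgn T) f) (opn M f ms) = opn N f (hmap h (farity (sgn T) f) ms)"
  shows "mkarr M h N \<in> hom (PMod T) M N"
  unfolding hom_PMod mkarr_def
  using total_homI[OF model_total[OF T M] model_total[OF T N] h op] M N by simp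

end

definition redf :: "('s, 'f, 'r) signature \<Rightarrow> ('f \<Rightarrow> 'g) \<Rightarrow>
    (('s, 'g, 'q, 'u) pstructure, ('s, 'g, 'q, 'u) pstructure \<times> ('s \<Rightarrow> 'u \<Rightarrow> 'u) \<times> ('s, 'g, 'q, 'u) pstructure,
     ('s, 'f, 'r, 'u) pstructure, ('s, 'f, 'r, 'u) pstructure \<times> ('s \<Rightarrow> 'u \<Rightarrow> 'u) \<times> ('s, 'f, 'r, 'u) pstructure) func" where
  "redf \<Sigma> \<rho> = \<lparr>Ob = red \<Sigma> \<rho>, Ar = (\<lambda>(M, h, N). (red \<Sigma> \<rho> M, h, red \<Sigma> \<rho> N))\<rparr>"

lemma redf_sel [simp]: "Ob (redf \<Sigma> \<rho>) = red \<Sigma> \<rho>" "ap (Ar (redf \<Sigma> \<rho>) f) = ap f"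
  by (cases f; simp add: redf_def)+

text \<open>The semantic content of a theory morphism, which is all that monadicity uses. It applies
  equally to a given \<open>\<rho>\<close> and to the embedding \<open>Inl\<close> of the base
  signature into its extension by operators.\<close>

definition model_morphism :: "'u itself \<Rightarrow> ('s, 'f, 'r) pht \<Rightarrow> ('s, 'g, 'q) pht \<Rightarrow> ('f \<Rightarrow> 'g) \<Rightarrow> bool" where
  "model_morphism U S T \<rho> \<longleftrightarrow> arity_map (sgn S) (sgn T) \<rho> \<and>
     (\<forall>M :: ('s, 'g, 'q, 'u) pstructure. is_pmodel T M \<longrightarrow> is_pmodel S (red (sgn S) \<rho> M))"

context univ begin

lemma theory_morphism_red:
  fixes S :: "('s, 'f, 'r) pht" and T :: "('s, 'g, 'q) pht"
  assumes S: "equational_theory TYPE('u) S" and T: "equational_theory TYPE('u) T"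
    and m: "theory_morphism TYPE('u) S T \<rho> \<rho>r"
  shows "model_morphism TYPE('u) S T \<rho>"
  unfolding model_morphism_def
proof (intro conjI allI impI)
  show am: "arity_map (sgn S) (sgn T) \<rho>" using m by (auto simp: theory_morphism_def arity_map_def)
  fix M :: "('s, 'g, 'q, 'u) pstructure" assume M: "is_pmodel T M"
  have r: "rels (sgn S) = {}" using S by (simp add: equational_theory_def)
  show "is_pmodel S (red (sgn S) \<rho> M)"
  proof (rule modelI[OF total_red[OF am r model_total[OF T M]]])
    fix e assume e: "e \<in> axs S"
    then have "valid M (map_sequent \<rho> \<rho>r e)" using m M by (simp add: theory_morphism_def phl_theorem_def)
    then show "valid (red (sgn S) \<rho> M) e"
      using valid_red[OF r] S e by (metis equational_theory_def is_pht_def)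
  qed
qed

lemma redf_hom:
  fixes M N :: "('s, 'g, 'q, 'u) pstructure"
  assumes "equational_theory TYPE('u) S" "model_morphism TYPE('u) S T \<rho>" "f \<in> hom (PMod T) M N"
  shows "Ar (redf (sgn S) \<rho>) f \<in> hom (PMod S) (red (sgn S) \<rho> M) (red (sgn S) \<rho> N)"
  using assms hom_red[of "sgn S" "sgn T" \<rho> M N "ap f"]
  by (cases f) (auto simp: hom_PMod redf_def model_morphism_def equational_theory_def)

lemma is_functor_redf:
  assumes S: "equational_theory TYPE('u) S" and m: "model_morphism TYPE('u) S T \<rho>"
  shows "is_functor (PMod T :: ('s, 'g, 'q, 'u) pstructure_cat) (PMod S) (redf (sgn S) \<rho>)"
  unfolding is_functor_def
proof (intro conjI ballI impI)
  fix f g assume "f \<in> Arr (PMod T :: ('s, 'g, 'q, 'u) pstructure_cat)" "g \<in> Arr (PMod T :: ('s, 'g, 'q, 'u) pstructure_cat)"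
  then show "Ar (redf (sgn S) \<rho>) (Comp (PMod T) g f) = Comp (PMod S) (Ar (redf (sgn S) \<rho>) g) (Ar (redf (sgn S) \<rho>) f)"
    by (cases f; cases g) (simp add: PMod_def redf_def)
qed (use m redf_hom[OF S m] in \<open>auto simp: model_morphism_def\<close>, simp add: PMod_def redf_def)

end

section \<open>Free models\<close>

text \<open>A triple \<open>(g, ks, k)\<close> encodes the equation \<open>g(ks) = k\<close> between generators.\<close>

definition solution :: "'k set \<Rightarrow> ('k \<Rightarrow> 's) \<Rightarrow> ('g \<times> 'k list \<times> 'k) set
    \<Rightarrow> ('s, 'g, 'q, 'u) pstructure \<Rightarrow> ('k \<Rightarrow> 'u) \<Rightarrow> bool" where
  "solution K \<kappa> E M v \<longleftrightarrow> (\<forall>k \<in> K. v k \<in> car M (\<kappa> k)) \<and> (\<forall>(g, ks, k) \<in> E. opn M g (map v ks) = v k)"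

context univ begin

text \<open>A model together with a solution is a structure for the signature enlarged by one
  constant per generator, in which the given equations become closed equations. The initial
  structure of the class of all such expansions is the model presented by generators and relations.
  Without relations this gives free models on lists of sorts; with the operation tables of a model
  as relations it gives the left adjoint of the reduct functor.\<close>

lemma free_model:
  fixes T :: "('s, 'g, 'q) pht" and K :: "'k set"
  assumes T: "equational_theory TYPE('u) T" and K: "small TYPE('u) K" "\<kappa> ` K \<subseteq> sorts (sgn T)"
    and E: "\<And>g ks k. (g, ks, k) \<in> E \<Longrightarrow> g \<in> funs (sgn T) \<and> set ks \<subseteq> K \<and> map \<kappa> ks = farity (sgn T) g \<and>
       k \<in> K \<and> \<kappa> k = fsort (sgn T) g"
  shows "\<exists>F v0. is_pmodel T (F :: ('s, 'g, 'q, 'u) pstructure) \<and> solution K \<kappa> E F v0 \<and>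
    (\<forall>M v. is_pmodel T M \<longrightarrow> solution K \<kappa> E M v \<longrightarrow>
      (\<exists>!h. h \<in> hom (PMod T) F M \<and> (\<forall>k \<in> K. ap h (\<kappa> k) (v0 k) = v k)))"
proof -
  let ?\<Sigma> = "sgn T"
  define \<Sigma>' :: "('s, 'g + 'k, 'q) signature" where
    "\<Sigma>' = \<lparr>sorts = sorts ?\<Sigma>, funs = Inl ` funs ?\<Sigma> \<union> Inr ` K, farity = case_sum (farity ?\<Sigma>) (\<lambda>_. []),
       fsort = case_sum (fsort ?\<Sigma>) \<kappa>, rels = {}, rarity = (\<lambda>_. [])\<rparr>"
  define X :: "('s, 'g, 'q, 'u) pstructure \<Rightarrow> ('k \<Rightarrow> 'u) \<Rightarrow> ('s, 'g + 'k, 'q, 'u) pstructure" where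
    "X M v = \<lparr>car = car M, fint = case_sum (fint M) (\<lambda>k ms. if k \<in> K \<and> ms = [] then Some (v k) else None),
       rint = (\<lambda>_. {})\<rparr>" for M v
  define \<C> where "\<C> = {X M v | M v. is_pmodel T M \<and> solution K \<kappa> E M v}"
  have sgT: "is_signature TYPE('u) ?\<Sigma>" and rT: "rels ?\<Sigma> = {}"
    and axT: "\<And>e. e \<in> axs T \<Longrightarrow> wf_sequent ?\<Sigma> e \<and> prem e = Top"
    using T by (auto simp: equational_theory_def is_pht_def)
  have sg: "is_signature TYPE('u) \<Sigma>'"
    using sgT K by (auto simp: is_signature_def \<Sigma>'_def small_Un small_image small_finite)
  have am: "arity_map ?\<Sigma> \<Sigma>' Inl" by (simp add: arity_map_def \<Sigma>'_def)
  have Xt: "total_str \<Sigma>' (X M v)" and Xred: "red ?\<Sigma> Inl (X M v) = M"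
    and Xop: "opn (X M v) (Inl g) = opn M g"
    if "is_pmodel T M" "solution K \<kappa> E M v" for M v g
  proof -
    have t: "total_str ?\<Sigma> M" using model_total[OF T that(1)] .
    then show "total_str \<Sigma>' (X M v)" using that(2)
      by (auto simp: total_str_def is_pstructure_def X_def \<Sigma>'_def solution_def split: sum.splits if_splits)
    show "red ?\<Sigma> Inl (X M v) = M"
      using t by (intro total_str_ext[OF total_red[OF am rT \<open>total_str \<Sigma>' (X M v)\<close>] t])
        (auto simp: X_def opn_def red_def)
    show "opn (X M v) (Inl g) = opn M g" by (simp add: X_def opn_def fun_eq_iff)
  qed
  have Xk: "opn (X M v) (Inr k) [] = v k" if "k \<in> K" for M v k using that by (simp add: X_def opn_def)
  obtain I :: "('s, 'g + 'k, 'q, 'u) pstructure" where I: "total_str \<Sigma>' I"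
    and I_hom: "\<And>M v. is_pmodel T M \<Longrightarrow> solution K \<kappa> E M v \<Longrightarrow> \<exists>!h. is_hom \<Sigma>' I (X M v) h"
    and I_val: "\<And>e. wf_sequent \<Sigma>' e \<Longrightarrow> prem e = Top \<Longrightarrow> \<forall>M \<in> \<C>. valid M e \<Longrightarrow> valid I e"
  proof -
    note I_that = that
    have "\<exists>I :: ('s, 'g + 'k, 'q, 'u) pstructure. total_str \<Sigma>' I \<and> (\<forall>M \<in> \<C>. \<exists>!h. is_hom \<Sigma>' I M h) \<and>
      (\<forall>e. wf_sequent \<Sigma>' e \<and> prem e = Top \<and> (\<forall>M \<in> \<C>. valid M e) \<longrightarrow> valid I e)"
    proof (rule initial_structure[OF sg])
      show "rels \<Sigma>' = {}" by (simp add: \<Sigma>'_def)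
      show "total_str \<Sigma>' M" if "M \<in> \<C>" for M using that by (auto simp: \<C>_def Xt)
    qed
    then obtain I :: "('s, 'g + 'k, 'q, 'u) pstructure" where 1: "total_str \<Sigma>' I"
      and 2: "\<forall>M \<in> \<C>. \<exists>!h. is_hom \<Sigma>' I M h"
      and 3: "\<forall>e. wf_sequent \<Sigma>' e \<and> prem e = Top \<and> (\<forall>M \<in> \<C>. valid M e) \<longrightarrow> valid I e" by (elim exE conjE)
    have "\<exists>!h. is_hom \<Sigma>' I (X M v) h" if "is_pmodel T M" "solution K \<kappa> E M v" for M v
    proof -
      have "X M v \<in> \<C>" using that \<C>_def by blast
      with 2 show ?thesis by (rule bspec)
    qed
    moreover have "valid I e" if "wf_sequent \<Sigma>' e" "prem e = Top" "\<forall>M \<in> \<C>. valid M e" for e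
      using 3 that by simp
    ultimately show ?thesis using 1 by (intro I_that)
  qed
  define F where "F = (red ?\<Sigma> Inl I :: ('s, 'g, 'q, 'u) pstructure)"
  define v0 where "v0 k = opn I (Inr k) []" for k
  have carF: "car F = car I" by (simp add: F_def)
  have opF: "opn F g = opn I (Inl g)" if "g \<in> funs ?\<Sigma>" for g using that by (simp add: F_def opn_red)
  have F: "is_pmodel T F"
    unfolding F_def
  proof (rule modelI[OF total_red[OF am rT I]])
    fix e assume e: "e \<in> axs T"
    have "valid M (map_sequent Inl id e)" if "M \<in> \<C>" for M
      using that Xred e valid_red[OF rT, of e Inl M id] axT[OF e] unfolding \<C>_def
      by (auto simp: is_pmodel_def)
    then have "valid I (map_sequent Inl id e)"
      using I_val[OF wf_map_sequent[OF am rT, of e id]] axT[OF e] by (cases e) simp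
    then show "valid (red ?\<Sigma> Inl I) e" using valid_red[OF rT, of e Inl I id] axT[OF e] by simp
  qed
  have nil: "[] \<in> tup M []" for M :: "('s, 'g + 'k, 'q, 'u) pstructure" by simp
  have v0: "v0 k \<in> car I (\<kappa> k)" if "k \<in> K" for k
    using total_strD(2)[OF I, of "Inr k" "[]"] that by (simp add: v0_def \<Sigma>'_def)
  have tvk: "map (tval M [] []) (map (\<lambda>k. App (Inr k) []) ks) = map Some (map (\<lambda>k. opn M (Inr k) []) ks)"
    if "total_str \<Sigma>' M" "set ks \<subseteq> K" for ks and M :: "('s, 'g + 'k, 'q, 'u) pstructure"
    using total_strD(1)[OF that(1), of "Inr _" "[]"] that(2) by (auto simp: \<Sigma>'_def)
  have E_holds: "holds M [] [] (Eq (App (Inl g) (map (\<lambda>k. App (Inr k) []) ks)) (App (Inr k) [])) \<longleftrightarrow>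
      opn M (Inl g) (map (\<lambda>k. opn M (Inr k) []) ks) = opn M (Inr k) []"
    if M: "total_str \<Sigma>' M" and e: "(g, ks, k) \<in> E" for g ks k and M :: "('s, 'g + 'k, 'q, 'u) pstructure"
  proof -
    note e = E[OF e]
    have 1: "tval M [] [] (App (Inl g) (map (\<lambda>k. App (Inr k) []) ks)) = fint M (Inl g) (map (\<lambda>k. opn M (Inr k) []) ks)"
      by (rule tval_App, rule tvk[OF M]) (use e in blast)
    have *: "opn M (Inr k) [] \<in> car M (\<kappa> k)" if "k \<in> K" for k
      using total_strD(2)[OF M, of "Inr k" "[]"] that by (simp add: \<Sigma>'_def)
    have sk: "set ks \<subseteq> K" using e by blast
    have "map (\<lambda>k. opn M (Inr k) []) ks \<in> tup M (map \<kappa> ks)"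
      unfolding in_tup(1) by (auto intro!: *[OF subsetD[OF sk nth_mem]])
    then have "map (\<lambda>k. opn M (Inr k) []) ks \<in> tup M (farity \<Sigma>' (Inl g))"
      using e by (simp add: \<Sigma>'_def)
    then have 2: "fint M (Inl g) (map (\<lambda>k. opn M (Inr k) []) ks) = Some (opn M (Inl g) (map (\<lambda>k. opn M (Inr k) []) ks))"
      using total_strD(1)[OF M, of "Inl g"] e by (simp add: \<Sigma>'_def)
    have 3: "tval M [] [] (App (Inr k) []) = Some (opn M (Inr k) [])"
      using total_strD(1)[OF M, of "Inr k" "[]"] e by (simp add: \<Sigma>'_def)
    show ?thesis using 1 2 3 by (auto simp del: tval.simps)
  qed
  have sol: "solution K \<kappa> E F v0"
    unfolding solution_def
  proof (intro conjI ballI, clarsimp simp: carF v0)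
    fix t assume "t \<in> E"
    then obtain g ks k where t: "t = (g, ks, k)" and e: "(g, ks, k) \<in> E" by (cases t) auto
    note e' = E[OF e]
    let ?e = "Sequent [] Top (Eq (App (Inl g) (map (\<lambda>k. App (Inr k) []) ks)) (App (Inr k) [])) :: ('s, 'g + 'k, 'q) sequent"
    have c: "wf_tm \<Sigma>' [] (App (Inr k) []) (\<kappa> k)" if "k \<in> K" for k
      using wf_tm.intros(2)[of "Inr k" \<Sigma>' "[]" "[]"] that by (simp add: \<Sigma>'_def)
    have sk: "set ks \<subseteq> K" using e' by blast
    have "list_all2 (wf_tm \<Sigma>' []) (map (\<lambda>k. App (Inr k) []) ks) (map \<kappa> ks)"
      unfolding list_all2_conv_all_nth by (auto intro!: c[OF subsetD[OF sk nth_mem]])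
    then have "wf_tm \<Sigma>' [] (App (Inl g) (map (\<lambda>k. App (Inr k) []) ks)) (fsort ?\<Sigma> g)"
      using wf_tm.intros(2)[of "Inl g" \<Sigma>' "[]"] e' by (simp add: \<Sigma>'_def)
    then have "wf_sequent \<Sigma>' ?e" using c[of k] e' by (auto simp: wf_sequent_def wf_ctx_def)
    moreover have "\<forall>M \<in> \<C>. valid M ?e"
    proof
      fix N assume "N \<in> \<C>"
      then obtain M v where N: "N = X M v" and M: "is_pmodel T M" "solution K \<kappa> E M v" by (auto simp: \<C>_def)
      have "map (\<lambda>k. opn N (Inr k) []) ks = map v ks" "opn N (Inr k) [] = v k" using e' Xk by (auto simp: N)
      then have "opn N (Inl g) (map (\<lambda>k. opn N (Inr k) []) ks) = opn N (Inr k) []"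
      proof -
        have "opn M g (map v ks) = v k" using M(2) e by (auto simp: solution_def)
        then show ?thesis using \<open>map _ ks = map v ks\<close> \<open>opn N (Inr k) [] = v k\<close> Xop[OF M, of g] by (simp add: N cong: map_cong)
      qed
      then show "valid N ?e" using E_holds[OF Xt[OF M] e] N by (simp add: valid_Top del: holds.simps)
    qed
    ultimately have "valid I ?e" using I_val by simp
    then have "opn I (Inl g) (map v0 ks) = v0 k"
      using E_holds[OF I e] by (simp add: valid_Top v0_def[abs_def] del: holds.simps)
    then show "case t of (g, ks, k) \<Rightarrow> opn F g (map v0 ks) = v0 k" using opF e' t by simp
  qed
  \<comment> \<open>Preserving the new constants means sending the generic solution
    \<open>v0\<close> to the solution \<open>v\<close>, so initiality among expansions turns into
    the universal property of the presentation.\<close>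
  have hom_iff: "is_hom \<Sigma>' I (X M v) h \<longleftrightarrow> is_hom ?\<Sigma> F M h \<and> (\<forall>k \<in> K. h (\<kappa> k) (v0 k) = v k)"
    if M: "is_pmodel T M" "solution K \<kappa> E M v" for M v h
  proof
    assume h: "is_hom \<Sigma>' I (X M v) h"
    have "is_hom ?\<Sigma> F (red ?\<Sigma> Inl (X M v)) h" unfolding F_def by (rule hom_red[OF am rT h])
    moreover have "h (\<kappa> k) (v0 k) = v k" if k: "k \<in> K" for k
    proof -
      have "fint I (Inr k) [] = Some (v0 k)" using total_strD(1)[OF I, of "Inr k" "[]"] k by (simp add: v0_def \<Sigma>'_def)
      then have "fint (X M v) (Inr k) (hmap h [] []) = Some (h (\<kappa> k) (v0 k))"
        using h k by (force simp: is_hom_def \<Sigma>'_def)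
      then show ?thesis using k by (simp add: X_def hmap_def)
    qed
    ultimately show "is_hom ?\<Sigma> F M h \<and> (\<forall>k \<in> K. h (\<kappa> k) (v0 k) = v k)" using Xred[OF M] by simp
  next
    assume h: "is_hom ?\<Sigma> F M h \<and> (\<forall>k \<in> K. h (\<kappa> k) (v0 k) = v k)"
    have "fint (X M v) f (hmap h (farity \<Sigma>' f) ms) = Some (h (fsort \<Sigma>' f) m)"
      if f: "f \<in> funs \<Sigma>'" and m: "fint I f ms = Some m" for f ms m
    proof (cases f)
      case (Inl g)
      then have "g \<in> funs ?\<Sigma>" "fint F g ms = Some m" using f m by (auto simp: \<Sigma>'_def F_def fint_red)
      then have "fint M g (hmap h (farity ?\<Sigma> g) ms) = Some (h (fsort ?\<Sigma> g) m)" using h by (simp add: is_hom_def)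
      then show ?thesis by (simp add: Inl X_def \<Sigma>'_def)
    next
      case (Inr k)
      then have k: "k \<in> K" using f by (auto simp: \<Sigma>'_def)
      have "ms \<in> tup I (farity \<Sigma>' f)" "m = opn I f ms" using fintD[OF _ m] I by (auto simp: total_str_def)
      then have "ms = []" "m = v0 k" by (auto simp: Inr \<Sigma>'_def v0_def)
      then show ?thesis using h k by (simp add: Inr X_def \<Sigma>'_def hmap_def)
    qed
    moreover have "car (X M v) = car M" by (simp add: X_def)
    ultimately show "is_hom \<Sigma>' I (X M v) h"
      using h carF unfolding is_hom_def by (simp add: \<Sigma>'_def)
  qed
  have "\<exists>!h. h \<in> hom (PMod T) F M \<and> (\<forall>k \<in> K. ap h (\<kappa> k) (v0 k) = v k)"
    if M: "is_pmodel T M" "solution K \<kappa> E M v" for M v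
  proof -
    from I_hom[OF M, unfolded Ex1_def] obtain h where h: "is_hom \<Sigma>' I (X M v) h"
      and u: "\<forall>h'. is_hom \<Sigma>' I (X M v) h' \<longrightarrow> h' = h" by (elim exE conjE)
    note u = u[rule_format]
    show ?thesis
    proof (rule ex1I[of _ "(F, h, M)"])
      show "(F, h, M) \<in> hom (PMod T) F M \<and> (\<forall>k \<in> K. ap (F, h, M) (\<kappa> k) (v0 k) = v k)"
        using h M(1) F by (simp add: hom_PMod hom_iff[OF M])
      fix h' assume h': "h' \<in> hom (PMod T) F M \<and> (\<forall>k \<in> K. ap h' (\<kappa> k) (v0 k) = v k)"
      then have "ap h' = h" by (intro u) (simp add: hom_PMod hom_iff[OF M])
      then show "h' = (F, h, M)" using h' by (metis hom_PMod)
    qed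
  qed
  then show ?thesis by (intro exI[of _ F] exI[of _ v0] conjI F sol allI impI)
qed

lemma free_on_sorts:
  fixes T :: "('s, 'g, 'q) pht"
  assumes T: "equational_theory TYPE('u) T" and ss: "set ss \<subseteq> sorts (sgn T)"
  shows "\<exists>F gs. is_pmodel T (F :: ('s, 'g, 'q, 'u) pstructure) \<and> gs \<in> tup F ss \<and>
    (\<forall>M ms. is_pmodel T M \<longrightarrow> ms \<in> tup M ss \<longrightarrow> (\<exists>!h. h \<in> hom (PMod T) F M \<and> hmap (ap h) ss gs = ms))"
proof -
  \<comment> \<open>The generators are the positions of \<open>ss\<close> and not its entries,
    because a sort may occur several times.\<close>
  let ?K = "{..<length ss}"
  have "\<exists>F v0. is_pmodel T (F :: ('s, 'g, 'q, 'u) pstructure) \<and> solution ?K (nth ss) {} F v0 \<and>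
    (\<forall>M v. is_pmodel T M \<longrightarrow> solution ?K (nth ss) {} M v \<longrightarrow>
      (\<exists>!h. h \<in> hom (PMod T) F M \<and> (\<forall>k \<in> ?K. ap h (ss ! k) (v0 k) = v k)))"
    by (rule free_model[OF T]) (use ss in \<open>auto simp: small_finite\<close>)
  then obtain F v0 where F: "is_pmodel T (F :: ('s, 'g, 'q, 'u) pstructure)" "solution ?K (nth ss) {} F v0"
    and u: "\<forall>M v. is_pmodel T M \<longrightarrow> solution ?K (nth ss) {} M v \<longrightarrow>
      (\<exists>!h. h \<in> hom (PMod T) F M \<and> (\<forall>k \<in> ?K. ap h (ss ! k) (v0 k) = v k))" by (elim exE conjE)
  note u = u[rule_format]
  let ?gs = "map v0 [0..<length ss]"
  have "?gs \<in> tup F ss" using F(2) by (simp add: in_tup solution_def)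
  moreover have "\<exists>!h. h \<in> hom (PMod T) F M \<and> hmap (ap h) ss ?gs = ms" if M: "is_pmodel T M" "ms \<in> tup M ss" for M ms
  proof -
    have iff: "hmap (ap h) ss ?gs = ms \<longleftrightarrow> (\<forall>k \<in> ?K. ap h (ss ! k) (v0 k) = ms ! k)" for h
    proof -
      have "length ms = length ss" using M(2) by (simp add: in_tup)
      then show ?thesis by (subst list_eq_iff_nth_eq) auto
    qed
    have "solution ?K (nth ss) {} M (nth ms)" using M(2) by (simp add: solution_def in_tup)
    then show ?thesis unfolding iff by (rule u[OF M(1)])
  qed
  ultimately show ?thesis by (intro exI[of _ F] exI[of _ ?gs] conjI F(1) allI impI)
qed

text \<open>The value of the left adjoint at \<open>A\<close> is presented by the elements of
  \<open>A\<close>, tagged with their sorts because carriers may overlap, and by the operation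
  tables of \<open>A\<close> with every symbol renamed by \<open>\<rho>\<close>.\<close>

lemma free_universal:
  fixes T :: "('s, 'g, 'q) pht" and S :: "('s, 'f, 'r) pht" and A :: "('s, 'f, 'r, 'u) pstructure"
  assumes S: "equational_theory TYPE('u) S" and T: "equational_theory TYPE('u) T"
    and m: "model_morphism TYPE('u) S T \<rho>" and A: "is_pmodel S A"
  shows "\<exists>F \<eta>. universal_arrow (PMod T :: ('s, 'g, 'q, 'u) pstructure_cat) (PMod S) (redf (sgn S) \<rho>) A F \<eta>"
proof -
  let ?\<Sigma> = "sgn S"
  let ?K = "SIGMA s:sorts ?\<Sigma>. car A s"
  have am: "arity_map ?\<Sigma> (sgn T) \<rho>" using m by (simp add: model_morphism_def)
  have At: "total_str ?\<Sigma> A" using model_total[OF S A] .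
  have carA: "s \<in> sorts ?\<Sigma>" if "x \<in> car A s" for x s using At that by (auto simp: total_str_def is_pstructure_def)
  have sgS: "small TYPE('u) (sorts ?\<Sigma>)" "\<And>f. f \<in> funs ?\<Sigma> \<Longrightarrow> set (farity ?\<Sigma> f) \<subseteq> sorts ?\<Sigma> \<and> fsort ?\<Sigma> f \<in> sorts ?\<Sigma>"
    using S by (auto simp: equational_theory_def is_pht_def is_signature_def)
  define E where "E = {(\<rho> f, zip (farity ?\<Sigma> f) as, (fsort ?\<Sigma> f, opn A f as)) | f as. f \<in> funs ?\<Sigma> \<and> as \<in> tup A (farity ?\<Sigma> f)}"
  have sm: "small TYPE('u) ?K"
    using small_Sigma[OF sgS(1), of "car A"] At by (simp add: total_str_def is_pstructure_def)
  have E: "g \<in> funs (sgn T) \<and> set ks \<subseteq> ?K \<and> map fst ks = farity (sgn T) g \<and> k \<in> ?K \<and> fst k = fsort (sgn T) g"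
    if "(g, ks, k) \<in> E" for g ks k
  proof -
    obtain f as where f: "f \<in> funs ?\<Sigma>" "as \<in> tup A (farity ?\<Sigma> f)" "g = \<rho> f" "ks = zip (farity ?\<Sigma> f) as"
      "k = (fsort ?\<Sigma> f, opn A f as)" using \<open>(g, ks, k) \<in> E\<close> by (auto simp: E_def)
    have "set ks \<subseteq> ?K" using f(2) sgS(2)[OF f(1)] unfolding f(4) by (fastforce simp: in_tup in_set_zip)
    then show ?thesis using f am total_strD(2)[OF At f(1,2)] carA by (auto simp: arity_map_def in_tup)
  qed
  have "\<exists>F v0. is_pmodel T (F :: ('s, 'g, 'q, 'u) pstructure) \<and> solution ?K fst E F v0 \<and>
    (\<forall>M v. is_pmodel T M \<longrightarrow> solution ?K fst E M v \<longrightarrow>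
      (\<exists>!h. h \<in> hom (PMod T) F M \<and> (\<forall>k \<in> ?K. ap h (fst k) (v0 k) = v k)))"
    by (rule free_model[OF T sm _ E]) (use am in \<open>auto simp: arity_map_def\<close>)
  then obtain F v0 where F: "is_pmodel T (F :: ('s, 'g, 'q, 'u) pstructure)" "solution ?K fst E F v0"
    and u: "\<forall>M v. is_pmodel T M \<longrightarrow> solution ?K fst E M v \<longrightarrow>
      (\<exists>!h. h \<in> hom (PMod T) F M \<and> (\<forall>k \<in> ?K. ap h (fst k) (v0 k) = v k))" by (elim exE conjE)
  note u = u[rule_format]
  \<comment> \<open>Satisfying the operation tables says exactly that the assignment preserves the
    operations of \<open>S\<close>; solutions in \<open>M\<close> thus correspond to arrows from
    \<open>A\<close> to the reduct of \<open>M\<close>.\<close>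
  have sol_iff: "solution ?K fst E M v \<longleftrightarrow> mkarr A (\<lambda>s x. v (s, x)) (red ?\<Sigma> \<rho> M) \<in> hom (PMod S) A (red ?\<Sigma> \<rho> M)"
    if M: "is_pmodel T M" for M v
  proof -
    let ?h = "mkarr A (\<lambda>s x. v (s, x)) (red ?\<Sigma> \<rho> M)"
    have rM: "is_pmodel S (red ?\<Sigma> \<rho> M)" using m M by (simp add: model_morphism_def)
    have zip: "map v (zip ss as) = hmap (\<lambda>s x. v (s, x)) ss as" for ss as
      by (simp add: hmap_def)
    show ?thesis
    proof
      assume s: "solution ?K fst E M v"
      show "?h \<in> hom (PMod S) A (red ?\<Sigma> \<rho> M)"
      proof (rule mkarr_hom[OF S A rM])
        fix s x assume "x \<in> car A s"
        then show "v (s, x) \<in> car (red ?\<Sigma> \<rho> M) s" using s carA by (auto simp: solution_def)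
      next
        fix f as assume f: "f \<in> funs ?\<Sigma>" "as \<in> tup A (farity ?\<Sigma> f)"
        then have "(\<rho> f, zip (farity ?\<Sigma> f) as, (fsort ?\<Sigma> f, opn A f as)) \<in> E" by (auto simp: E_def)
        then have "opn M (\<rho> f) (map v (zip (farity ?\<Sigma> f) as)) = v (fsort ?\<Sigma> f, opn A f as)"
          using s unfolding solution_def by fastforce
        then show "v (fsort ?\<Sigma> f, opn A f as) = opn (red ?\<Sigma> \<rho> M) f (hmap (\<lambda>s x. v (s, x)) (farity ?\<Sigma> f) as)"
          using f(1) by (simp add: zip opn_red)
      qed
    next
      assume h: "?h \<in> hom (PMod S) A (red ?\<Sigma> \<rho> M)"
      have "v (s, x) \<in> car M s" if "x \<in> car A s" for s x using ap_car[OF h that] that by simp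
      moreover have "opn M (\<rho> f) (map v (zip (farity ?\<Sigma> f) as)) = v (fsort ?\<Sigma> f, opn A f as)"
        if f: "f \<in> funs ?\<Sigma>" "as \<in> tup A (farity ?\<Sigma> f)" for f as
      proof -
        have "hmap (ap ?h) (farity ?\<Sigma> f) as = hmap (\<lambda>s x. v (s, x)) (farity ?\<Sigma> f) as"
          using f(2) by (rule hmap_cong) simp
        then show ?thesis using ap_opn[OF S h f] f(1) total_strD(2)[OF At f] by (simp add: zip opn_red)
      qed
      ultimately show "solution ?K fst E M v" by (auto simp: solution_def E_def)
    qed
  qed
  define \<eta> where "\<eta> = mkarr A (\<lambda>s x. v0 (s, x)) (red ?\<Sigma> \<rho> F)"
  have \<eta>: "\<eta> \<in> hom (PMod S) A (red ?\<Sigma> \<rho> F)" using sol_iff[OF F(1)] F(2) by (simp add: \<eta>_def)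
  have "\<exists>!h. h \<in> hom (PMod T) F M \<and> Comp (PMod S) (Ar (redf ?\<Sigma> \<rho>) h) \<eta> = g"
    if M: "is_pmodel T M" and g: "g \<in> hom (PMod S) A (red ?\<Sigma> \<rho> M)" for M g
  proof -
    let ?v = "\<lambda>(s, x). ap g s x"
    have "mkarr A (\<lambda>s x. ?v (s, x)) (red ?\<Sigma> \<rho> M) = g"
    proof -
      have "g = (A, ap g, red ?\<Sigma> \<rho> M)" "\<And>s. restrict (ap g s) (car A s) = ap g s"
        using g by (auto simp: hom_PMod is_hom_def PiE_def extensional_restrict)
      then show ?thesis by (simp add: mkarr_def)
    qed
    then have sol: "solution ?K fst E M ?v" using sol_iff[OF M, of ?v] g by simp
    have "Comp (PMod S) (Ar (redf ?\<Sigma> \<rho>) h) \<eta> = g \<longleftrightarrow> (\<forall>k \<in> ?K. ap h (fst k) (v0 k) = ?v k)"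
      if h: "h \<in> hom (PMod T) F M" for h
    proof -
      have rh: "Ar (redf ?\<Sigma> \<rho>) h \<in> hom (PMod S) (red ?\<Sigma> \<rho> F) (red ?\<Sigma> \<rho> M)" using redf_hom[OF S m h] .
      have c: "ap (Comp (PMod S) (Ar (redf ?\<Sigma> \<rho>) h) \<eta>) s x = ap h s (v0 (s, x))" if "x \<in> car A s" for s x
        using ap_Comp[OF \<eta> rh that] that by (simp add: \<eta>_def)
      show ?thesis
      proof
        assume "Comp (PMod S) (Ar (redf ?\<Sigma> \<rho>) h) \<eta> = g"
        then show "\<forall>k \<in> ?K. ap h (fst k) (v0 k) = ?v k" using c by auto
      next
        assume "\<forall>k \<in> ?K. ap h (fst k) (v0 k) = ?v k"
        then show "Comp (PMod S) (Ar (redf ?\<Sigma> \<rho>) h) \<eta> = g"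
          using c carA by (intro arr_eqI[OF category.Comp_in[OF category_PMod \<eta> rh] g]) fastforce
      qed
    qed
    then show ?thesis using u[OF M sol] by (metis (no_types, lifting))
  qed
  then have "universal_arrow (PMod T) (PMod S) (redf ?\<Sigma> \<rho>) A F \<eta>"
    using F(1) \<eta> by (simp add: universal_arrow_def)
  then show ?thesis by blast
qed

end

lemma ex1_conjE:
  assumes "\<exists>!x. P x \<and> Q x"
  obtains x where "P x" "Q x" "\<forall>y. P y \<longrightarrow> Q y \<longrightarrow> y = x"
  using assms by blast

section \<open>Colimits of sets\<close>

definition sap :: "'x \<times> ('u \<Rightarrow> 'u) \<times> 'x \<Rightarrow> 'u \<Rightarrow> 'u" where
  "sap a = fst (snd a)"

definition mkmap :: "'u set \<Rightarrow> ('u \<Rightarrow> 'u) \<Rightarrow> 'u set \<Rightarrow> 'u set \<times> ('u \<Rightarrow> 'u) \<times> 'u set" where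
  "mkmap A f B = (A, restrict f A, B)"

lemma sap_mkmap [simp]: "x \<in> A \<Longrightarrow> sap (mkmap A f B) x = f x"
  by (simp add: sap_def mkmap_def)

lemma hom_set_cat: "a \<in> hom (set_cat :: ('u set, _) cat) A B \<longleftrightarrow>
    small TYPE('u) A \<and> small TYPE('u) B \<and> a = (A, sap a, B) \<and> sap a \<in> A \<rightarrow>\<^sub>E B"
  by (cases a) (auto simp: hom_def set_cat_def sap_def)

lemma Obj_set_cat [simp]: "A \<in> Obj (set_cat :: ('u set, _) cat) \<longleftrightarrow> small TYPE('u) A"
  by (simp add: set_cat_def)

lemma mkmap_hom: "small TYPE('u) A \<Longrightarrow> small TYPE('u) B \<Longrightarrow> (\<And>x. x \<in> A \<Longrightarrow> f x \<in> B)
    \<Longrightarrow> mkmap A f B \<in> hom (set_cat :: ('u set, _) cat) A B"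
  by (auto simp: hom_set_cat mkmap_def sap_def)

lemma sap_in: "a \<in> hom set_cat A B \<Longrightarrow> x \<in> A \<Longrightarrow> sap a x \<in> B"
  by (auto simp: hom_set_cat)

lemma Comp_set_cat: "Comp set_cat (B, g, C) (A, f, B') = (A, compose A g f, C)"
  by (simp add: set_cat_def)

lemma set_Comp: "a \<in> hom set_cat A B \<Longrightarrow> b \<in> hom set_cat B C \<Longrightarrow>
    Comp set_cat b a \<in> hom set_cat A C \<and> (\<forall>x \<in> A. sap (Comp set_cat b a) x = sap b (sap a x))"
  by (cases a; cases b) (auto simp: hom_set_cat Comp_set_cat sap_def compose_def)

lemma map_eqI:
  assumes "a \<in> hom set_cat A B" "b \<in> hom set_cat A B" "\<And>x. x \<in> A \<Longrightarrow> sap a x = sap b x"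
  shows "a = b"
proof -
  have a: "a = (A, sap a, B)" "sap a \<in> extensional A" and b: "b = (A, sap b, B)" "sap b \<in> extensional A"
    using assms(1,2) by (auto simp: hom_set_cat PiE_def)
  have "sap a = sap b" using extensionalityI[OF a(2) b(2)] assms(3) by blast
  then show ?thesis using a(1) b(1) by simp
qed

lemma Id_set_cat: "small TYPE('u) A \<Longrightarrow> Id set_cat A \<in> hom (set_cat :: ('u set, _) cat) A A \<and> (\<forall>x \<in> A. sap (Id set_cat A) x = x)"
  by (auto simp: hom_set_cat) (auto simp: set_cat_def sap_def)

text \<open>A cocone on the diagram with transition maps \<open>m\<close>, as a bare family of
  functions without a codomain.\<close>

definition invariant :: "('j, 'k) cat \<Rightarrow> ('j \<Rightarrow> 'x set) \<Rightarrow> ('k \<Rightarrow> 'x \<Rightarrow> 'x) \<Rightarrow> ('j \<Rightarrow> 'x \<Rightarrow> 'v) \<Rightarrow> bool" where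
  "invariant J X m \<psi> \<longleftrightarrow> (\<forall>u \<in> Arr J. \<forall>x \<in> X (Dom J u). \<psi> (Cod J u) (m u x) = \<psi> (Dom J u) x)"

text \<open>
  The colimit of a diagram of sets as the quotient of the disjoint union by the relation "no
  invariant function separates the two elements"; \<open>cls j x\<close> is the class of \<open>x\<close> at \<open>j\<close>.
\<close>

definition class_map :: "('j, 'k) cat \<Rightarrow> ('j \<Rightarrow> 'u set) \<Rightarrow> ('k \<Rightarrow> 'u \<Rightarrow> 'u) \<Rightarrow> ('j \<Rightarrow> 'u \<Rightarrow> 'u) \<Rightarrow> bool" where
  "class_map J X m cls \<longleftrightarrow> invariant J X m cls \<and>
     (\<forall>\<psi> :: 'j \<Rightarrow> 'u \<Rightarrow> 'u. invariant J X m \<psi> \<longrightarrow> (\<forall>j \<in> Obj J. \<forall>j' \<in> Obj J. \<forall>x \<in> X j. \<forall>x' \<in> X j'.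
        cls j x = cls j' x' \<longrightarrow> \<psi> j x = \<psi> j' x'))"

lemma class_mapD: "class_map J X m cls \<Longrightarrow> invariant J X m \<psi> \<Longrightarrow> j \<in> Obj J \<Longrightarrow> j' \<in> Obj J \<Longrightarrow> x \<in> X j
    \<Longrightarrow> x' \<in> X j' \<Longrightarrow> cls j x = cls j' x' \<Longrightarrow> \<psi> j x = (\<psi> j' x' :: 'u)" for X :: "_ \<Rightarrow> 'u set"
  unfolding class_map_def by blast

lemma class_map_inv: "class_map J X m cls \<Longrightarrow> u \<in> Arr J \<Longrightarrow> x \<in> X (Dom J u) \<Longrightarrow> cls (Cod J u) (m u x) = cls (Dom J u) x"
  by (simp add: class_map_def invariant_def)

definition mkdiag :: "('j, 'k) cat \<Rightarrow> ('j \<Rightarrow> 'u set) \<Rightarrow> ('k \<Rightarrow> 'u \<Rightarrow> 'u) \<Rightarrow> ('j, 'k, 'u set, 'u set \<times> ('u \<Rightarrow> 'u) \<times> 'u set) func" where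
  "mkdiag J X m = \<lparr>Ob = X, Ar = (\<lambda>u. mkmap (X (Dom J u)) (m u) (X (Cod J u)))\<rparr>"

lemma mkdiag_sel [simp]: "Ob (mkdiag J X m) = X" "Ar (mkdiag J X m) u = mkmap (X (Dom J u)) (m u) (X (Cod J u))"
  by (simp_all add: mkdiag_def)

lemma mkdiag_functor:
  fixes X :: "'j \<Rightarrow> 'u set"
  assumes J: "category J" and X: "\<And>j. j \<in> Obj J \<Longrightarrow> small TYPE('u) (X j)"
    and m: "\<And>u j j' x. u \<in> hom J j j' \<Longrightarrow> x \<in> X j \<Longrightarrow> m u x \<in> X j'"
    and i: "\<And>j x. j \<in> Obj J \<Longrightarrow> x \<in> X j \<Longrightarrow> m (Id J j) x = x"
    and c: "\<And>u v j j' j'' x. u \<in> hom J j j' \<Longrightarrow> v \<in> hom J j' j'' \<Longrightarrow> x \<in> X j \<Longrightarrow> m (Comp J v u) x = m v (m u x)"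
  shows "is_functor J set_cat (mkdiag J X m)"
  unfolding is_functor_def
proof (intro conjI ballI impI)
  interpret category J by fact
  have h: "Ar (mkdiag J X m) u \<in> hom set_cat (X j) (X j')" if "u \<in> hom J j j'" for u j j'
    using mkmap_hom[OF X X m[OF that]] hom_Obj[OF that] in_homD[OF that] by simp
  show "Ob (mkdiag J X m) j \<in> Obj set_cat" if "j \<in> Obj J" for j using X[OF that] by simp
  show "Ar (mkdiag J X m) u \<in> hom set_cat (Ob (mkdiag J X m) j) (Ob (mkdiag J X m) j')"
    if "u \<in> hom J j j'" for u j j' using h[OF that] by simp
  show "Ar (mkdiag J X m) (Id J j) = Id set_cat (Ob (mkdiag J X m) j)" if j: "j \<in> Obj J" for j
    using h[OF Id_in[OF j]] Id_set_cat[OF X[OF j]] Id_in[OF j] i[OF j]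
    by (intro map_eqI[of _ "X j" "X j"]) (auto simp: hom_def[of J])
  fix u v assume uv: "u \<in> Arr J" "v \<in> Arr J" "Cod J u = Dom J v"
  let ?x = "Dom J u" and ?y = "Dom J v" and ?z = "Cod J v"
  have u: "u \<in> hom J ?x ?y" and v: "v \<in> hom J ?y ?z" using uv by (auto simp: hom_def)
  have vu: "Comp J v u \<in> hom J ?x ?z" using Comp_in[OF u v] .
  show "Ar (mkdiag J X m) (Comp J v u) = Comp set_cat (Ar (mkdiag J X m) v) (Ar (mkdiag J X m) u)"
    using set_Comp[OF h[OF u] h[OF v]] h[OF vu] c[OF u v] m[OF u] in_homD[OF u] in_homD[OF vu]
    by (intro map_eqI[of _ "X ?x" "X ?z"]) auto
qed

context univ begin

text \<open>Representatives are encoded in \<open>'u\<close>, so the resulting class map has the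
  same type as the functions it is tested against. It is itself invariant, and therefore identifies
  two elements exactly when no invariant function separates them.\<close>

lemma class_map_exists:
  fixes X :: "'j \<Rightarrow> 'u set"
  assumes "category J" "small TYPE('u) (Obj J)" "\<And>j. j \<in> Obj J \<Longrightarrow> small TYPE('u) (X j)"
    and m: "\<And>u j j' x. u \<in> hom J j j' \<Longrightarrow> x \<in> X j \<Longrightarrow> m u x \<in> X j'"
  shows "\<exists>cls. class_map J X m cls"
proof -
  interpret category J by fact
  let ?Z = "SIGMA j:Obj J. X j"
  have "small TYPE('u) ?Z" by (rule small_Sigma) fact+
  then obtain e :: "_ \<Rightarrow> 'u" where e: "inj_on e ?Z" using small_encode by blast
  define R where "R z z' \<longleftrightarrow> (\<forall>\<psi> :: 'j \<Rightarrow> 'u \<Rightarrow> 'u. invariant J X m \<psi> \<longrightarrow> case_prod \<psi> z = case_prod \<psi> z')" for z z'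
  define rep where "rep z = (SOME z'. z' \<in> ?Z \<and> R z z')" for z
  have rep: "rep z \<in> ?Z \<and> R z (rep z)" if "z \<in> ?Z" for z
    unfolding rep_def by (rule someI[of _ z]) (use that in \<open>auto simp: R_def\<close>)
  have rep_eq: "rep z = rep z'" if "R z z'" for z z'
  proof -
    have "R z = R z'" using that by (auto simp: R_def fun_eq_iff)
    then show ?thesis by (simp add: rep_def)
  qed
  have "class_map J X m (\<lambda>j x. e (rep (j, x)))"
    unfolding class_map_def
  proof (intro conjI allI impI ballI)
    show "invariant J X m (\<lambda>j x. e (rep (j, x)))"
      unfolding invariant_def
    proof (intro ballI)
      fix u x assume "u \<in> Arr J" "x \<in> X (Dom J u)"
      then have "R (Cod J u, m u x) (Dom J u, x)" by (auto simp: R_def invariant_def)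
      then show "e (rep (Cod J u, m u x)) = e (rep (Dom J u, x))" using rep_eq by simp
    qed
    fix \<psi> :: "'j \<Rightarrow> 'u \<Rightarrow> 'u" and j j' x x'
    assume \<psi>: "invariant J X m \<psi>" and j: "j \<in> Obj J" "j' \<in> Obj J" "x \<in> X j" "x' \<in> X j'"
      and eq: "e (rep (j, x)) = e (rep (j', x'))"
    then have "rep (j, x) = rep (j', x')" using rep[of "(j, x)"] rep[of "(j', x')"] e by (auto dest: inj_onD)
    then have "R (j, x) (rep (j, x))" "R (j', x') (rep (j, x))" using rep[of "(j, x)"] rep[of "(j', x')"] j by auto
    then show "\<psi> j x = \<psi> j' x'" using \<psi> unfolding R_def by fastforce
  qed
  then show ?thesis by blast
qed

lemma set_colimit:
  fixes X :: "'j \<Rightarrow> 'u set"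
  assumes J: "category J" "small TYPE('u) (Obj J)" and X: "\<And>j. j \<in> Obj J \<Longrightarrow> small TYPE('u) (X j)"
    and m: "\<And>u j j' x. u \<in> hom J j j' \<Longrightarrow> x \<in> X j \<Longrightarrow> m u x \<in> X j'"
    and cls: "class_map J X m cls" and L: "L = (\<Union>j\<in>Obj J. cls j ` X j)"
  shows "small TYPE('u) L" "is_colimit J set_cat (mkdiag J X m) L (\<lambda>j. mkmap (X j) (cls j) L)"
proof -
  interpret category J by fact
  show Ls: "small TYPE('u) L" unfolding L by (intro small_UN J small_image X)
  have \<iota>: "mkmap (X j) (cls j) L \<in> hom set_cat (X j) L" if "j \<in> Obj J" for j
    using mkmap_hom[OF X Ls, of j "cls j"] that L by blast
  have hm: "mkmap (X (Dom J u)) (m u) (X (Cod J u)) \<in> hom set_cat (X (Dom J u)) (X (Cod J u))" if "u \<in> Arr J" for u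
    using mkmap_hom[OF X[OF Dom_in[OF that]] X[OF Cod_in[OF that]] m[OF Arr_hom[OF that]]] .
  have coc: "is_cocone J set_cat (mkdiag J X m) L (\<lambda>j. mkmap (X j) (cls j) L)"
    unfolding is_cocone_def
  proof (intro conjI ballI)
    fix u assume u: "u \<in> Arr J"
    show "Comp set_cat (mkmap (X (Cod J u)) (cls (Cod J u)) L) (Ar (mkdiag J X m) u) = mkmap (X (Dom J u)) (cls (Dom J u)) L"
      using set_Comp[OF hm[OF u] \<iota>[OF Cod_in[OF u]]] \<iota>[OF Dom_in[OF u]] cls u m[OF Arr_hom[OF u]]
      by (intro map_eqI[of _ "X (Dom J u)" L]) (auto simp: class_map_def invariant_def)
  qed (use Ls \<iota> in auto)
  show "is_colimit J set_cat (mkdiag J X m) L (\<lambda>j. mkmap (X j) (cls j) L)"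
    unfolding is_colimit_def
  proof (intro conjI coc allI impI)
    fix d \<kappa> assume co: "is_cocone J set_cat (mkdiag J X m) d \<kappa>"
    then have \<kappa>: "\<kappa> j \<in> hom set_cat (X j) d" if "j \<in> Obj J" for j using that by (simp add: is_cocone_def)
    have ds: "small TYPE('u) d" using co by (simp add: is_cocone_def)
    have inv: "invariant J X m (\<lambda>j. sap (\<kappa> j))"
      unfolding invariant_def
    proof (intro ballI)
      fix u x assume u: "u \<in> Arr J" and x: "x \<in> X (Dom J u)"
      have "Comp set_cat (\<kappa> (Cod J u)) (mkmap (X (Dom J u)) (m u) (X (Cod J u))) = \<kappa> (Dom J u)"
        using co u by (simp add: is_cocone_def)
      then show "sap (\<kappa> (Cod J u)) (m u x) = sap (\<kappa> (Dom J u)) x"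
        using set_Comp[OF hm[OF u] \<kappa>[OF Cod_in[OF u]]] x by (metis sap_mkmap)
    qed
    have "\<exists>y. l \<in> L \<longrightarrow> (\<forall>j \<in> Obj J. \<forall>x \<in> X j. cls j x = l \<longrightarrow> sap (\<kappa> j) x = y) \<and> y \<in> d" for l
    proof (cases "l \<in> L")
      case True
      then obtain j x where j: "j \<in> Obj J" "x \<in> X j" "l = cls j x" unfolding L by blast
      show ?thesis
        by (rule exI[of _ "sap (\<kappa> j) x"]) (use class_mapD[OF cls inv _ j(1) _ j(2)] j sap_in[OF \<kappa>[OF j(1)]] in blast)
    qed blast
    then obtain h where h: "\<And>l. l \<in> L \<Longrightarrow> (\<forall>j \<in> Obj J. \<forall>x \<in> X j. cls j x = l \<longrightarrow> sap (\<kappa> j) x = h l) \<and> h l \<in> d" by metis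
    have hh: "mkmap L h d \<in> hom set_cat L d" using mkmap_hom[OF Ls ds] h by blast
    have clsL: "cls j x \<in> L" if "j \<in> Obj J" "x \<in> X j" for j x using that L by blast
    show "\<exists>!k. k \<in> hom set_cat L d \<and> (\<forall>j\<in>Obj J. Comp set_cat k (mkmap (X j) (cls j) L) = \<kappa> j)"
    proof (rule ex1I[of _ "mkmap L h d"], intro conjI hh ballI)
      fix j assume j: "j \<in> Obj J"
      show "Comp set_cat (mkmap L h d) (mkmap (X j) (cls j) L) = \<kappa> j"
      proof -
        have "h (cls j x) = sap (\<kappa> j) x" if "x \<in> X j" for x using h[OF clsL[OF j that]] j that by simp
        then show ?thesis using set_Comp[OF \<iota>[OF j] hh] clsL[OF j] by (intro map_eqI[OF _ \<kappa>[OF j]]) auto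
      qed
    next
      fix k assume k: "k \<in> hom set_cat L d \<and> (\<forall>j\<in>Obj J. Comp set_cat k (mkmap (X j) (cls j) L) = \<kappa> j)"
      show "k = mkmap L h d"
      proof (rule map_eqI[OF conjunct1[OF k] hh])
        fix l assume l: "l \<in> L"
        then obtain j x where j: "j \<in> Obj J" "x \<in> X j" "l = cls j x" unfolding L by blast
        have "sap k (cls j x) = sap (\<kappa> j) x" using set_Comp[OF \<iota>[OF j(1)] conjunct1[OF k]] k j by (metis sap_mkmap)
        then show "sap k l = sap (mkmap L h d) l" using h[OF l] j l by simp
      qed
    qed
  qed
qed

text \<open>An arbitrary colimit of sets has the same elementwise description as the constructed
  one. Both halves test the universal property against well-chosen cocones.\<close>

lemma set_colimitD:
  assumes J: "category J" "small TYPE('u) (Obj J)" and D: "is_functor J (set_cat :: ('u set, _) cat) D"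
    and co: "is_colimit J set_cat D L \<iota>"
  shows "\<And>l. l \<in> L \<Longrightarrow> \<exists>j\<in>Obj J. \<exists>x\<in>Ob D j. sap (\<iota> j) x = l"
    and "class_map J (Ob D) (\<lambda>u. sap (Ar D u)) (\<lambda>j. sap (\<iota> j))"
proof -
  interpret category J by fact
  have \<iota>: "\<And>j. j \<in> Obj J \<Longrightarrow> \<iota> j \<in> hom set_cat (Ob D j) L"
    and nat: "\<And>u. u \<in> Arr J \<Longrightarrow> Comp set_cat (\<iota> (Cod J u)) (Ar D u) = \<iota> (Dom J u)"
    and Ls: "small TYPE('u) L" using co by (auto simp: is_colimit_def is_cocone_def)
  have univ: "\<exists>!h. h \<in> hom set_cat L d \<and> (\<forall>j \<in> Obj J. Comp set_cat h (\<iota> j) = \<kappa> j)"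
    if "is_cocone J set_cat D d \<kappa>" for d \<kappa> using co that unfolding is_colimit_def by simp
  have Du: "Ar D u \<in> hom set_cat (Ob D (Dom J u)) (Ob D (Cod J u))" if "u \<in> Arr J" for u
    using functor_Ar[OF D J(1) Arr_hom[OF that]] .
  obtain a b :: 'u where ab: "a \<noteq> b" using two_elements by blast
  let ?d = "{a, b}"
  have ds: "small TYPE('u) ?d" by (simp add: small_finite)
  show "\<exists>j\<in>Obj J. \<exists>x\<in>Ob D j. sap (\<iota> j) x = l" if l: "l \<in> L" for l
  proof (rule ccontr)
    assume no: "\<not> ?thesis"
    \<comment> \<open>If \<open>l\<close> were missed by the cocone, the constant map and the map
      altered only at \<open>l\<close> would both mediate the same cocone into two points.\<close>
    let ?k1 = "mkmap L (\<lambda>_. a) ?d" and ?k2 = "mkmap L (\<lambda>x. if x = l then b else a) ?d"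
    have k: "?k1 \<in> hom set_cat L ?d" "?k2 \<in> hom set_cat L ?d" by (intro mkmap_hom Ls ds; simp)+
    let ?\<kappa> = "\<lambda>j. mkmap (Ob D j) (\<lambda>_. a) ?d"
    have Ds: "small TYPE('u) (Ob D j)" if "j \<in> Obj J" for j using functor_Ob[OF D that] by simp
    have \<kappa>: "?\<kappa> j \<in> hom set_cat (Ob D j) ?d" if "j \<in> Obj J" for j by (intro mkmap_hom Ds that ds) simp
    have "is_cocone J set_cat D ?d ?\<kappa>"
      unfolding is_cocone_def
    proof (intro conjI ballI)
      fix u assume u: "u \<in> Arr J"
      show "Comp set_cat (?\<kappa> (Cod J u)) (Ar D u) = ?\<kappa> (Dom J u)"
        using set_Comp[OF Du[OF u] \<kappa>[OF Cod_in[OF u]]] sap_in[OF Du[OF u]]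
        by (intro map_eqI[OF _ \<kappa>[OF Dom_in[OF u]]]) auto
    qed (use ds \<kappa> in auto)
    from univ[OF this] obtain h where
      h: "\<forall>k. k \<in> hom set_cat L ?d \<longrightarrow> (\<forall>j\<in>Obj J. Comp set_cat k (\<iota> j) = ?\<kappa> j) \<longrightarrow> k = h"
      by (rule ex1_conjE)
    have e1: "Comp set_cat ?k1 (\<iota> j) = ?\<kappa> j" if j: "j \<in> Obj J" for j
      using set_Comp[OF \<iota>[OF j] k(1)] sap_in[OF \<iota>[OF j]] by (intro map_eqI[OF _ \<kappa>[OF j]]) auto
    have e2: "Comp set_cat ?k2 (\<iota> j) = ?\<kappa> j" if j: "j \<in> Obj J" for j
      using set_Comp[OF \<iota>[OF j] k(2)] sap_in[OF \<iota>[OF j]] no j by (intro map_eqI[OF _ \<kappa>[OF j]]) auto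
    have un: "?k1 = ?k2" using h[rule_format, OF k(1) e1] h[rule_format, OF k(2) e2] by simp
    have "sap ?k1 l = a" "sap ?k2 l = b" using l by simp_all
    then show False using un ab by simp
  qed
  show "class_map J (Ob D) (\<lambda>u. sap (Ar D u)) (\<lambda>j. sap (\<iota> j))"
    unfolding class_map_def
  proof (intro conjI allI impI ballI)
    show "invariant J (Ob D) (\<lambda>u. sap (Ar D u)) (\<lambda>j. sap (\<iota> j))"
      unfolding invariant_def using set_Comp[OF Du \<iota>[OF Cod_in]] nat by metis
    fix \<psi> :: "_ \<Rightarrow> 'u \<Rightarrow> 'u" and j j' x x'
    assume \<psi>: "invariant J (Ob D) (\<lambda>u. sap (Ar D u)) \<psi>" and j: "j \<in> Obj J" "j' \<in> Obj J" "x \<in> Ob D j" "x' \<in> Ob D j'"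
      and eq: "sap (\<iota> j) x = sap (\<iota> j') x'"
    \<comment> \<open>The values of \<open>\<psi>\<close> on the small diagram form a small set, so
      \<open>\<psi>\<close> becomes a cocone in the category of sets and factors through the
      colimit.\<close>
    let ?e = "\<Union>j\<in>Obj J. \<psi> j ` Ob D j"
    have Ds: "small TYPE('u) (Ob D j)" if "j \<in> Obj J" for j using functor_Ob[OF D that] by simp
    have es: "small TYPE('u) ?e" by (intro small_UN J small_image Ds)
    let ?\<kappa> = "\<lambda>j. mkmap (Ob D j) (\<psi> j) ?e"
    have \<kappa>: "?\<kappa> j \<in> hom set_cat (Ob D j) ?e" if "j \<in> Obj J" for j by (intro mkmap_hom Ds that es) (use that in blast)
    have "is_cocone J set_cat D ?e ?\<kappa>"
      unfolding is_cocone_def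
    proof (intro conjI ballI)
      fix u assume u: "u \<in> Arr J"
      show "Comp set_cat (?\<kappa> (Cod J u)) (Ar D u) = ?\<kappa> (Dom J u)"
        using set_Comp[OF Du[OF u] \<kappa>[OF Cod_in[OF u]]] sap_in[OF Du[OF u]] \<psi> u
        by (intro map_eqI[OF _ \<kappa>[OF Dom_in[OF u]]]) (auto simp: invariant_def)
    qed (use es \<kappa> in auto)
    from univ[OF this] obtain h where h: "h \<in> hom set_cat L ?e" "\<forall>j\<in>Obj J. Comp set_cat h (\<iota> j) = ?\<kappa> j"
      by (rule ex1_conjE)
    have hi: "sap h (sap (\<iota> j) x) = \<psi> j x" if "j \<in> Obj J" "x \<in> Ob D j" for j x
      using conjunct2[OF set_Comp[OF \<iota>[OF that(1)] h(1)]] h(2) that by simp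
    show "\<psi> j x = \<psi> j' x'" using hi[OF j(1,3)] hi[OF j(2,4)] eq by simp
  qed
qed

text \<open>Elements are maps out of a one-point set. This translates siftedness, which is stated
  with products in the category of sets, into a statement about tuples.\<close>

lemma set_product_iff:
  fixes Q :: "'u set"
  assumes Q: "small TYPE('u) Q" and q: "\<And>i. i < n \<Longrightarrow> q i \<in> hom set_cat Q (L i)"
  shows "is_product set_cat n L Q q \<longleftrightarrow>
    (\<forall>l. (\<forall>i<n. l i \<in> L i) \<longrightarrow> (\<exists>!x. x \<in> Q \<and> (\<forall>i<n. sap (q i) x = l i)))" (is "?P \<longleftrightarrow> ?R")
proof
  assume P: ?P
  have L: "small TYPE('u) (L i)" if "i < n" for i using q[OF that] by (simp add: hom_set_cat)
  show ?R
  proof (intro allI impI)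
    fix l assume l: "\<forall>i<n. l i \<in> L i"
    fix a :: 'u
    let ?z = "{a}"
    have zs: "small TYPE('u) ?z" by (simp add: small_finite)
    let ?f = "\<lambda>i. mkmap ?z (\<lambda>_. l i) (L i)"
    have f: "?f i \<in> hom set_cat ?z (L i)" if "i < n" for i by (intro mkmap_hom zs L that) (use l that in simp)
    have "\<exists>!h. h \<in> hom set_cat ?z Q \<and> (\<forall>i<n. Comp set_cat (q i) h = ?f i)"
      using P f zs unfolding is_product_def by simp
    then obtain h where h: "h \<in> hom set_cat ?z Q" "\<forall>i<n. Comp set_cat (q i) h = ?f i"
      and u: "\<forall>k. k \<in> hom set_cat ?z Q \<longrightarrow> (\<forall>i<n. Comp set_cat (q i) k = ?f i) \<longrightarrow> k = h"
      by (rule ex1_conjE)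
    show "\<exists>!x. x \<in> Q \<and> (\<forall>i<n. sap (q i) x = l i)"
    proof (rule ex1I[of _ "sap h a"], intro conjI allI impI)
      show "sap h a \<in> Q" using sap_in[OF h(1)] by simp
      show "sap (q i) (sap h a) = l i" if "i < n" for i
      proof -
        have "sap (Comp set_cat (q i) h) a = l i" using h(2) that by simp
        then show ?thesis using set_Comp[OF h(1) q[OF that]] by simp
      qed
      fix x assume x: "x \<in> Q \<and> (\<forall>i<n. sap (q i) x = l i)"
      have k: "mkmap ?z (\<lambda>_. x) Q \<in> hom set_cat ?z Q" by (intro mkmap_hom zs Q) (use x in simp)
      have "Comp set_cat (q i) (mkmap ?z (\<lambda>_. x) Q) = ?f i" if "i < n" for i
        using set_Comp[OF k q[OF that]] x that by (intro map_eqI[OF _ f[OF that]]) auto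
      then have "mkmap ?z (\<lambda>_. x) Q = h" using u k by blast
      then show "x = sap h a" using sap_mkmap[of a ?z "\<lambda>_. x" Q] by simp
    qed
  qed
next
  assume R: ?R
  show ?P
    unfolding is_product_def
  proof (intro conjI allI impI ballI)
    fix z f assume z: "z \<in> Obj (set_cat :: ('u set, _) cat)" and f: "\<forall>i<n. f i \<in> hom set_cat z (L i)"
    have ex: "\<exists>!x. x \<in> Q \<and> (\<forall>i<n. sap (q i) x = sap (f i) y)" if "y \<in> z" for y
      by (rule R[rule_format]) (rule sap_in[OF f[rule_format] that])
    define h where "h y = (THE x. x \<in> Q \<and> (\<forall>i<n. sap (q i) x = sap (f i) y))" for y
    have h: "h y \<in> Q \<and> (\<forall>i<n. sap (q i) (h y) = sap (f i) y)" if "y \<in> z" for y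
      unfolding h_def by (rule theI'[OF ex[OF that]])
    have hh: "mkmap z h Q \<in> hom set_cat z Q" using mkmap_hom[of z Q h] z Q h by simp
    show "\<exists>!h. h \<in> hom set_cat z Q \<and> (\<forall>i<n. Comp set_cat (q i) h = f i)"
    proof (rule ex1I[of _ "mkmap z h Q"], intro conjI hh allI impI)
      show "Comp set_cat (q i) (mkmap z h Q) = f i" if "i < n" for i
        using set_Comp[OF hh q[OF that]] f that h by (intro map_eqI[of _ z "L i"]) auto
      fix k assume k: "k \<in> hom set_cat z Q \<and> (\<forall>i<n. Comp set_cat (q i) k = f i)"
      show "k = mkmap z h Q"
      proof (rule map_eqI[OF conjunct1[OF k] hh])
        fix y assume y: "y \<in> z"
        have "sap (q i) (sap k y) = sap (f i) y" if "i < n" for i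
          using set_Comp[OF conjunct1[OF k] q[OF that]] k that y by metis
        moreover have "sap k y \<in> Q" using sap_in[OF conjunct1[OF k] y] .
        ultimately have "sap k y = h y" using ex[OF y] h[OF y] by blast
        then show "sap k y = sap (mkmap z h Q) y" using y by simp
      qed
    qed
  qed (use Q q in auto)
qed

end

section \<open>Sifted colimits of models\<close>

context univ begin

text \<open>Siftedness is applied to the diagrams \<open>?X i\<close> of carriers at the positions
  of \<open>ss\<close> and to the diagram \<open>?P\<close> of their products, whose elements are
  tuples encoded in \<open>'u\<close>. Surjectivity of the comparison map yields a common stage for
  any finite tuple of classes. Injectivity says that two tuples with the same classes already agree
  in the colimit of \<open>?P\<close>, so no invariant function \<open>\<phi>\<close> of tuples
  tells them apart.\<close>

lemma sifted_tuples:
  fixes J :: "('u, 'u) cat" and D :: "('u, 'u, ('s, 'f, 'r, 'u) pstructure, _) func"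
  assumes J: "sifted J" and T: "equational_theory TYPE('u) T" and D: "is_functor J (PMod T) D"
    and cls: "\<And>s. class_map J (\<lambda>j. car (Ob D j) s) (\<lambda>u. ap (Ar D u) s) (cls s)"
    and L: "\<And>s. L s = (\<Union>j\<in>Obj J. cls s j ` car (Ob D j) s)"
  shows "ls \<in> listset (map L ss) \<Longrightarrow> \<exists>j\<in>Obj J. \<exists>ds\<in>tup (Ob D j) ss. hmap (\<lambda>s. cls s j) ss ds = ls"
    and "(\<And>u ds. u \<in> Arr J \<Longrightarrow> ds \<in> tup (Ob D (Dom J u)) ss \<Longrightarrow> \<phi> (Cod J u) (hmap (ap (Ar D u)) ss ds) = \<phi> (Dom J u) ds)
      \<Longrightarrow> j \<in> Obj J \<Longrightarrow> j' \<in> Obj J \<Longrightarrow> ds \<in> tup (Ob D j) ss \<Longrightarrow> ds' \<in> tup (Ob D j') ss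
      \<Longrightarrow> hmap (\<lambda>s. cls s j) ss ds = hmap (\<lambda>s. cls s j') ss ds' \<Longrightarrow> \<phi> j ds = (\<phi> j' ds' :: 'u)"
proof -
  have Jc: "category J" and Js: "small TYPE('u) (Obj J)" using J by (auto simp: sifted_def small_cat_def)
  interpret category J by fact
  have Dm: "is_pmodel T (Ob D j)" if "j \<in> Obj J" for j using functor_Ob[OF D that] by simp
  have Ds: "small TYPE('u) (car (Ob D j) s)" if "j \<in> Obj J" for j s
    using Dm[OF that] by (simp add: is_pmodel_def is_pstructure_def)
  note Da = functor_Ar[OF D Jc]
  have Did: "ap (Ar D (Id J j)) s x = x" if "j \<in> Obj J" "x \<in> car (Ob D j) s" for j s x
    using functor_Id[OF D that(1)] ap_Id[OF that(2)] by metis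
  have Dc: "ap (Ar D (Comp J v u)) s x = ap (Ar D v) s (ap (Ar D u) s x)"
    if "u \<in> hom J j j'" "v \<in> hom J j' j''" "x \<in> car (Ob D j) s" for u v j j' j'' s x
    using functor_Comp[OF D that(1,2)] ap_Comp[OF Da[OF that(1)] Da[OF that(2)] that(3)] by simp
  let ?n = "length ss"
  let ?X = "\<lambda>i j. car (Ob D j) (ss ! i)" and ?m = "\<lambda>i u. ap (Ar D u) (ss ! i)"
  have mX: "?m i u x \<in> ?X i j'" if "u \<in> hom J j j'" "x \<in> ?X i j" for i u j j' x
    using ap_car[OF Da[OF that(1)] that(2)] .
  have X: "is_functor J set_cat (mkdiag J (?X i) (?m i))" for i
    by (rule mkdiag_functor[OF Jc Ds mX Did Dc])
  have Lc: "small TYPE('u) (L (ss ! i))"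
    "is_colimit J set_cat (mkdiag J (?X i) (?m i)) (L (ss ! i)) (\<lambda>j. mkmap (?X i j) (cls (ss ! i) j) (L (ss ! i)))" for i
    by (rule set_colimit[where X = "?X i" and m = "?m i", OF Jc Js Ds mX cls L]; assumption)+
  let ?Z = "\<Union>j\<in>Obj J. tup (Ob D j) ss"
  have "small TYPE('u) ?Z"
  proof (rule small_UN[OF Js])
    fix j assume j: "j \<in> Obj J"
    have "tup (Ob D j) ss \<subseteq> lists (\<Union>s\<in>set ss. car (Ob D j) s)"
      by (auto simp: in_tup in_set_conv_nth intro!: bexI[OF _ nth_mem])
    moreover have "small TYPE('u) (lists (\<Union>s\<in>set ss. car (Ob D j) s))"
      by (intro small_lists small_UN small_finite Ds j) simp
    ultimately show "small TYPE('u) (tup (Ob D j) ss)" using small_subset by blast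
  qed
  then obtain enc :: "_ \<Rightarrow> 'u" where enc: "inj_on enc ?Z" using small_encode by blast
  define dec where "dec = inv_into ?Z enc"
  let ?P = "\<lambda>j. enc ` tup (Ob D j) ss" and ?p = "\<lambda>u x. enc (hmap (ap (Ar D u)) ss (dec x))"
  have dec: "dec (enc ds) = ds" if "j \<in> Obj J" "ds \<in> tup (Ob D j) ss" for j ds
    unfolding dec_def by (rule inv_into_f_f[OF enc]) (use that in blast)
  have decP: "dec x \<in> tup (Ob D j) ss \<and> enc (dec x) = x" if "j \<in> Obj J" "x \<in> ?P j" for j x
    using that dec by auto
  have Ps: "small TYPE('u) (?P j)" if "j \<in> Obj J" for j
    using small_subset[OF \<open>small TYPE('u) ?Z\<close>] that by (intro small_image) blast
  have mP: "?p u x \<in> ?P j'" if "u \<in> hom J j j'" "x \<in> ?P j" for u j j' x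
    using ap_tup[OF Da[OF that(1)]] decP that(2) hom_Obj[OF that(1)] by blast
  have P: "is_functor J set_cat (mkdiag J ?P ?p)"
  proof (rule mkdiag_functor[OF Jc Ps mP])
    show "?p (Id J j) x = x" if j: "j \<in> Obj J" and x: "x \<in> ?P j" for j x
    proof -
      have "hmap (ap (Ar D (Id J j))) ss (dec x) = dec x"
        using conjunct1[OF decP[OF j x]] by (rule hmap_ident) (use Did j in blast)
      then show ?thesis using decP[OF j x] by simp
    qed
    show "?p (Comp J v u) x = ?p v (?p u x)" if u: "u \<in> hom J j j'" and v: "v \<in> hom J j' j''" and x: "x \<in> ?P j" for u v j j' j'' x
    proof -
      have j: "j \<in> Obj J" "j' \<in> Obj J" using hom_Obj[OF u] by auto
      note t = conjunct1[OF decP[OF j(1) x]]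
      have "hmap (ap (Ar D (Comp J v u))) ss (dec x) = hmap (ap (Ar D v)) ss (hmap (ap (Ar D u)) ss (dec x))"
        using hmap_Comp[OF Da[OF u] Da[OF v] t] functor_Comp[OF D u v] by simp
      then show ?thesis using dec[OF j(2) ap_tup[OF Da[OF u] t]] by simp
    qed
  qed
  have "\<exists>clsP. class_map J ?P ?p clsP"
    by (rule class_map_exists[OF Jc Js]) (rule Ps mP; assumption)+
  then obtain clsP where clsP: "class_map J ?P ?p clsP" by blast
  define Q where "Q = (\<Union>j\<in>Obj J. clsP j ` ?P j)"
  have clsPQ: "clsP j x \<in> Q" if "j \<in> Obj J" "x \<in> ?P j" for j x unfolding Q_def using that by blast
  have Qc: "small TYPE('u) Q" "is_colimit J set_cat (mkdiag J ?P ?p) Q (\<lambda>j. mkmap (?P j) (clsP j) Q)"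
    by (rule set_colimit[where X = ?P and m = ?p, OF Jc Js Ps mP clsP Q_def]; assumption)+
  \<comment> \<open>Taking the class of the \<open>i\<close>-th entry is an invariant function of
    tuples, so it descends to the colimit \<open>Q\<close>. The comparison map \<open>q\<close> is
    defined below from a chosen representative and is correct because of this.\<close>
  have wd: "cls (ss ! i) j (dec x ! i) = cls (ss ! i) j' (dec x' ! i)"
    if i: "i < ?n" and j: "j \<in> Obj J" "j' \<in> Obj J" "x \<in> ?P j" "x' \<in> ?P j'" "clsP j x = clsP j' x'" for i j j' x x'
  proof (rule class_mapD[OF clsP _ j])
    show "invariant J ?P ?p (\<lambda>j x. cls (ss ! i) j (dec x ! i))"
      unfolding invariant_def
    proof (intro ballI)
      fix u x assume u: "u \<in> Arr J" and x: "x \<in> ?P (Dom J u)"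
      note uh = Arr_hom[OF u]
      note t = conjunct1[OF decP[OF Dom_in[OF u] x]]
      have "dec (?p u x) ! i = ap (Ar D u) (ss ! i) (dec x ! i)"
        using dec[OF Cod_in[OF u] ap_tup[OF Da[OF uh] t]] t i by (simp add: in_tup)
      then show "cls (ss ! i) (Cod J u) (dec (?p u x) ! i) = cls (ss ! i) (Dom J u) (dec x ! i)"
        using cls[of "ss ! i"] u t i by (simp add: class_map_def invariant_def in_tup)
    qed
  qed
  define r where "r x = (SOME z. fst z \<in> Obj J \<and> snd z \<in> ?P (fst z) \<and> clsP (fst z) (snd z) = x)" for x
  have r: "fst (r (clsP j p)) \<in> Obj J \<and> snd (r (clsP j p)) \<in> ?P (fst (r (clsP j p))) \<and>
      clsP (fst (r (clsP j p))) (snd (r (clsP j p))) = clsP j p" if "j \<in> Obj J" "p \<in> ?P j" for j p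
    unfolding r_def by (rule someI[of _ "(j, p)"]) (use that in simp)
  define q where "q i x = cls (ss ! i) (fst (r x)) (dec (snd (r x)) ! i)" for i x
  have q: "cls (ss ! i) j (dec p ! i) = q i (clsP j p)" if i: "i < ?n" and j: "j \<in> Obj J" "p \<in> ?P j" for i j p
    unfolding q_def by (rule wd[OF i j(1) _ j(2)]) (use r[OF j] in simp_all)
  have decX: "dec p ! i \<in> ?X i j" if "i < ?n" "j \<in> Obj J" "p \<in> ?P j" for i j p
    using decP[OF that(2,3)] that(1) by (simp add: in_tup)
  let ?q = "\<lambda>i. mkmap Q (q i) (L (ss ! i))"
  have qh: "?q i \<in> hom set_cat Q (L (ss ! i))" if "i < ?n" for i
  proof (rule mkmap_hom[OF Qc(1) Lc(1)])
    fix x assume "x \<in> Q"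
    then obtain j p where j: "j \<in> Obj J" "p \<in> ?P j" "x = clsP j p" unfolding Q_def by blast
    have "cls (ss ! i) j (dec p ! i) \<in> L (ss ! i)" unfolding L using decX[OF that j(1,2)] j(1) by blast
    then show "q i x \<in> L (ss ! i)" using q[OF that j(1,2)] j(3) by simp
  qed
  let ?\<pi> = "\<lambda>i j. mkmap (?P j) (\<lambda>p. dec p ! i) (?X i j)"
  have \<pi>h: "?\<pi> i j \<in> hom set_cat (?P j) (?X i j)" if "i < ?n" "j \<in> Obj J" for i j
    by (intro mkmap_hom Ps Ds that decX)
  have prod: "is_product set_cat ?n (\<lambda>i. L (ss ! i)) Q ?q"
  proof -
    have 1: "nat_trans J set_cat (mkdiag J ?P ?p) (mkdiag J (?X i) (?m i)) (?\<pi> i)" if i: "i < ?n" for i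
      unfolding nat_trans_def
    proof (intro conjI ballI)
      fix u assume u: "u \<in> Arr J"
      note uh = Arr_hom[OF u]
      have a: "Ar (mkdiag J ?P ?p) u \<in> hom set_cat (?P (Dom J u)) (?P (Cod J u))"
        using functor_Ar[OF P Jc uh] by simp
      have b: "Ar (mkdiag J (?X i) (?m i)) u \<in> hom set_cat (?X i (Dom J u)) (?X i (Cod J u))"
        using functor_Ar[OF X Jc uh] by simp
      note c = set_Comp[OF a \<pi>h[OF i Cod_in[OF u]]] and d = set_Comp[OF \<pi>h[OF i Dom_in[OF u]] b]
      show "Comp set_cat (?\<pi> i (Cod J u)) (Ar (mkdiag J ?P ?p) u) = Comp set_cat (Ar (mkdiag J (?X i) (?m i)) u) (?\<pi> i (Dom J u))"
      proof (rule map_eqI[OF conjunct1[OF c] conjunct1[OF d]])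
        fix x assume x: "x \<in> ?P (Dom J u)"
        note t = conjunct1[OF decP[OF Dom_in[OF u] x]]
        have "dec (?p u x) ! i = ap (Ar D u) (ss ! i) (dec x ! i)"
          using dec[OF Cod_in[OF u] ap_tup[OF Da[OF uh] t]] t i by (simp add: in_tup)
        then show "sap (Comp set_cat (?\<pi> i (Cod J u)) (Ar (mkdiag J ?P ?p) u)) x =
            sap (Comp set_cat (Ar (mkdiag J (?X i) (?m i)) u) (?\<pi> i (Dom J u))) x"
          using bspec[OF conjunct2[OF c] x] bspec[OF conjunct2[OF d] x] x mP[OF uh x] decX[OF i Dom_in[OF u] x] by simp
      qed
    qed (use \<pi>h i in auto)
    have 2: "is_product set_cat ?n (\<lambda>i. Ob (mkdiag J (?X i) (?m i)) j) (Ob (mkdiag J ?P ?p) j) (\<lambda>i. ?\<pi> i j)" if j: "j \<in> Obj J" for j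
    proof -
      have "is_product set_cat ?n (\<lambda>i. ?X i j) (?P j) (\<lambda>i. ?\<pi> i j)"
      proof (subst set_product_iff[OF Ps[OF j] \<pi>h[OF _ j]], assumption, intro allI impI)
        fix l assume l: "\<forall>i<?n. l i \<in> ?X i j"
        let ?ds = "map l [0..<?n]"
        have t: "?ds \<in> tup (Ob D j) ss" using l by (simp add: in_tup)
        show "\<exists>!x. x \<in> ?P j \<and> (\<forall>i<?n. sap (?\<pi> i j) x = l i)"
        proof (rule ex1I[of _ "enc ?ds"])
          show "enc ?ds \<in> ?P j \<and> (\<forall>i<?n. sap (?\<pi> i j) (enc ?ds) = l i)" using t dec[OF j t] by simp
          fix x assume x: "x \<in> ?P j \<and> (\<forall>i<?n. sap (?\<pi> i j) x = l i)"
          then have "dec x = ?ds" using decP[OF j] by (intro nth_equalityI) (auto simp: in_tup)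
          then show "x = enc ?ds" using decP[OF j] x by metis
        qed
      qed
      then show ?thesis by simp
    qed
    have 3: "?q i \<in> hom set_cat Q (L (ss ! i)) \<and> (\<forall>j\<in>Obj J. Comp set_cat (?q i) (mkmap (?P j) (clsP j) Q) =
        Comp set_cat (mkmap (?X i j) (cls (ss ! i) j) (L (ss ! i))) (?\<pi> i j))" if i: "i < ?n" for i
    proof (intro conjI qh[OF i] ballI)
      fix j assume j: "j \<in> Obj J"
      have a: "mkmap (?P j) (clsP j) Q \<in> hom set_cat (?P j) Q"
        by (intro mkmap_hom Ps j Qc(1)) (rule clsPQ[OF j])
      have b: "mkmap (?X i j) (cls (ss ! i) j) (L (ss ! i)) \<in> hom set_cat (?X i j) (L (ss ! i))"
        by (intro mkmap_hom Ds j Lc(1)) (use L j in blast)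
      note c = set_Comp[OF a qh[OF i]] and d = set_Comp[OF \<pi>h[OF i j] b]
      show "Comp set_cat (?q i) (mkmap (?P j) (clsP j) Q) = Comp set_cat (mkmap (?X i j) (cls (ss ! i) j) (L (ss ! i))) (?\<pi> i j)"
      proof (rule map_eqI[OF conjunct1[OF c] conjunct1[OF d]])
        fix x assume x: "x \<in> ?P j"
        have "clsP j x \<in> Q" using clsPQ[OF j x] .
        then show "sap (Comp set_cat (?q i) (mkmap (?P j) (clsP j) Q)) x =
          sap (Comp set_cat (mkmap (?X i j) (cls (ss ! i) j) (L (ss ! i))) (?\<pi> i j)) x"
          using bspec[OF conjunct2[OF c] x] bspec[OF conjunct2[OF d] x] x decX[OF i j x] q[OF i j x] by simp
      qed
    qed
    note sif = conjunct2[OF J[unfolded sifted_def], rule_format, of ?n "\<lambda>i. mkdiag J (?X i) (?m i)" "mkdiag J ?P ?p"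
      ?\<pi> "\<lambda>i. L (ss ! i)" "\<lambda>i j. mkmap (?X i j) (cls (ss ! i) j) (L (ss ! i))" Q "\<lambda>j. mkmap (?P j) (clsP j) Q" ?q]
    show ?thesis
      by (rule sif) (intro conjI allI impI ballI X P 1 2 Lc(2) Qc(2) conjunct1[OF 3] conjunct2[OF 3, rule_format]; assumption)
  qed
  have "\<forall>l. (\<forall>i<?n. l i \<in> L (ss ! i)) \<longrightarrow> (\<exists>!x. x \<in> Q \<and> (\<forall>i<?n. sap (?q i) x = l i))"
    by (rule iffD1[OF set_product_iff[OF Qc(1) qh] prod])
  note bij = this[rule_format]
  show "\<exists>j\<in>Obj J. \<exists>ds\<in>tup (Ob D j) ss. hmap (\<lambda>s. cls s j) ss ds = ls" if ls: "ls \<in> listset (map L ss)"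
  proof -
    have len: "length ls = ?n" and "\<forall>i<?n. ls ! i \<in> L (ss ! i)" using ls by (auto simp: in_listset list_all2_conv_all_nth)
    have "\<exists>!x. x \<in> Q \<and> (\<forall>i<?n. sap (?q i) x = ls ! i)" by (rule bij) (use \<open>\<forall>i<?n. _\<close> in blast)
    then obtain x where x: "x \<in> Q" "\<forall>i<?n. sap (?q i) x = ls ! i" by (rule ex1_conjE)
    then obtain j p where j: "j \<in> Obj J" "p \<in> ?P j" "x = clsP j p" unfolding Q_def by blast
    have t: "dec p \<in> tup (Ob D j) ss" using decP[OF j(1,2)] by simp
    have "hmap (\<lambda>s. cls s j) ss (dec p) = ls"
    proof (rule nth_equalityI)
      show "length (hmap (\<lambda>s. cls s j) ss (dec p)) = length ls" using t len by (simp add: in_tup)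
      fix i assume "i < length (hmap (\<lambda>s. cls s j) ss (dec p))"
      then have i: "i < ?n" using t by (simp add: in_tup)
      then show "hmap (\<lambda>s. cls s j) ss (dec p) ! i = ls ! i"
        using t x(1) x(2)[rule_format, OF i] q[OF i j(1,2)] j(3) by (simp add: in_tup)
    qed
    then show ?thesis using j(1) t by blast
  qed
  show "\<phi> j ds = \<phi> j' ds'"
    if \<phi>: "\<And>u ds. u \<in> Arr J \<Longrightarrow> ds \<in> tup (Ob D (Dom J u)) ss \<Longrightarrow> \<phi> (Cod J u) (hmap (ap (Ar D u)) ss ds) = \<phi> (Dom J u) ds"
      and j: "j \<in> Obj J" "j' \<in> Obj J" "ds \<in> tup (Ob D j) ss" "ds' \<in> tup (Ob D j') ss"
      and eq: "hmap (\<lambda>s. cls s j) ss ds = hmap (\<lambda>s. cls s j') ss ds'"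
  proof -
    let ?x = "clsP j (enc ds)" and ?x' = "clsP j' (enc ds')"
    have xQ: "?x \<in> Q" "?x' \<in> Q" using clsPQ[OF j(1) imageI[OF j(3)]] clsPQ[OF j(2) imageI[OF j(4)]] by auto
    have l: "length ds = ?n" "length ds' = ?n" using j by (simp_all add: in_tup)
    have s: "sap (?q i) ?x = cls (ss ! i) j (ds ! i)" "sap (?q i) ?x' = cls (ss ! i) j (ds ! i)" if i: "i < ?n" for i
    proof -
      have "cls (ss ! i) j (ds ! i) = cls (ss ! i) j' (ds' ! i)"
        using arg_cong[OF eq, of "\<lambda>xs. xs ! i"] i l by simp
      then show "sap (?q i) ?x = cls (ss ! i) j (ds ! i)" "sap (?q i) ?x' = cls (ss ! i) j (ds ! i)"
        using q[OF i j(1), of "enc ds"] q[OF i j(2), of "enc ds'"] j dec xQ by simp_all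
    qed
    have "\<forall>i<?n. cls (ss ! i) j (ds ! i) \<in> L (ss ! i)"
      using j(1,3) unfolding L in_tup by blast
    then have "\<exists>!x. x \<in> Q \<and> (\<forall>i<?n. sap (?q i) x = cls (ss ! i) j (ds ! i))" by (intro bij) blast
    then obtain y where "\<forall>x. x \<in> Q \<longrightarrow> (\<forall>i<?n. sap (?q i) x = cls (ss ! i) j (ds ! i)) \<longrightarrow> x = y" by (rule ex1_conjE)
    note y = this[rule_format]
    have "?x = ?x'" using y[OF xQ(1) s(1)] y[OF xQ(2) s(2)] by simp
    \<comment> \<open>The two tuples have become equal in \<open>Q\<close>, and every invariant
      function of encoded tuples is constant on the classes that form \<open>Q\<close>.\<close>
    have "\<phi> j (dec (enc ds)) = \<phi> j' (dec (enc ds'))"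
    proof (rule class_mapD[OF clsP _ j(1,2) imageI[OF j(3)] imageI[OF j(4)] \<open>?x = ?x'\<close>])
      show "invariant J ?P ?p (\<lambda>j x. \<phi> j (dec x))"
        unfolding invariant_def
      proof (intro ballI)
        fix u x assume u: "u \<in> Arr J" and x: "x \<in> ?P (Dom J u)"
        note t = conjunct1[OF decP[OF Dom_in[OF u] x]]
        show "\<phi> (Cod J u) (dec (?p u x)) = \<phi> (Dom J u) (dec x)"
          using dec[OF Cod_in[OF u] ap_tup[OF Da[OF Arr_hom[OF u]] t]] \<phi>[OF u t] by simp
      qed
    qed
    then show ?thesis using dec j by simp
  qed
qed

end

text \<open>
  A cocone of models whose underlying sets form colimits compatible with finite products.  For
  sifted index categories this characterizes colimits, and it does not mention the operations.
\<close>

definition set_like :: "('j, 'k) cat \<Rightarrow> ('j, 'k, ('s, 'f, 'r, 'u) pstructure, _) func \<Rightarrow> ('s, 'f, 'r, 'u) pstructure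
    \<Rightarrow> ('j \<Rightarrow> 'x \<times> ('s \<Rightarrow> 'u \<Rightarrow> 'u) \<times> 'x) \<Rightarrow> bool" where
  "set_like J D c \<iota> \<longleftrightarrow>
     (\<forall>ss. \<forall>ls \<in> tup c ss. \<exists>j \<in> Obj J. \<exists>ds \<in> tup (Ob D j) ss. hmap (ap (\<iota> j)) ss ds = ls) \<and>
     (\<forall>s. class_map J (\<lambda>j. car (Ob D j) s) (\<lambda>u. ap (Ar D u) s) (\<lambda>j. ap (\<iota> j) s))"

lemma set_likeD:
  assumes "set_like J D c \<iota>"
  shows "ls \<in> tup c ss \<Longrightarrow> \<exists>j \<in> Obj J. \<exists>ds \<in> tup (Ob D j) ss. hmap (ap (\<iota> j)) ss ds = ls"
    and "class_map J (\<lambda>j. car (Ob D j) s) (\<lambda>u. ap (Ar D u) s) (\<lambda>j. ap (\<iota> j) s)"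
    and "x \<in> car c s \<Longrightarrow> \<exists>j \<in> Obj J. \<exists>d \<in> car (Ob D j) s. ap (\<iota> j) s d = x"
proof -
  show *: "\<exists>j \<in> Obj J. \<exists>ds \<in> tup (Ob D j) ss. hmap (ap (\<iota> j)) ss ds = ls" if "ls \<in> tup c ss" for ls ss
    using assms that unfolding set_like_def by blast
  show "class_map J (\<lambda>j. car (Ob D j) s) (\<lambda>u. ap (Ar D u) s) (\<lambda>j. ap (\<iota> j) s)"
    using assms unfolding set_like_def by blast
  assume x: "x \<in> car c s"
  then have "[x] \<in> tup c [s]" by (simp add: in_tup)
  from *[OF this] obtain j ds where j: "j \<in> Obj J" "ds \<in> tup (Ob D j) [s]" "hmap (ap (\<iota> j)) [s] ds = [x]" by blast
  then obtain d where "ds = [d]" "d \<in> car (Ob D j) s" by (cases ds) (auto simp: in_tup)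
  then show "\<exists>j \<in> Obj J. \<exists>d \<in> car (Ob D j) s. ap (\<iota> j) s d = x" using j by (auto simp: hmap_def)
qed

context univ begin

text \<open>The underlying functions of the mediating map are forced by the classes. They preserve
  an operation because its arguments lift together to one stage, where the given cocone consists of
  homomorphisms.\<close>

lemma set_like_colimit:
  fixes D :: "('j, 'k, ('s, 'f, 'r, 'u) pstructure, _) func"
  assumes J: "category J" and T: "equational_theory TYPE('u) T" and D: "is_functor J (PMod T) D"
    and co: "is_cocone J (PMod T) D c \<iota>" and sl: "set_like J D c \<iota>"
  shows "is_colimit J (PMod T) D c \<iota>"
  unfolding is_colimit_def
proof (intro conjI co allI impI)
  interpret category J by fact
  fix N \<kappa> assume coN: "is_cocone J (PMod T) D N \<kappa>"
  have \<iota>: "\<iota> j \<in> hom (PMod T) (Ob D j) c" and \<kappa>: "\<kappa> j \<in> hom (PMod T) (Ob D j) N" if "j \<in> Obj J" for j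
    using co coN that by (auto simp: is_cocone_def)
  have c: "is_pmodel T c" and N: "is_pmodel T N" using co coN by (auto simp: is_cocone_def)
  have inv: "invariant J (\<lambda>j. car (Ob D j) s) (\<lambda>u. ap (Ar D u) s) (\<lambda>j. ap (\<kappa> j) s)" for s
    unfolding invariant_def
  proof (intro ballI)
    fix u x assume u: "u \<in> Arr J" and x: "x \<in> car (Ob D (Dom J u)) s"
    have "Comp (PMod T) (\<kappa> (Cod J u)) (Ar D u) = \<kappa> (Dom J u)" using coN u by (simp add: is_cocone_def)
    then show "ap (\<kappa> (Cod J u)) s (ap (Ar D u) s x) = ap (\<kappa> (Dom J u)) s x"
      using ap_Comp[OF functor_Ar[OF D J Arr_hom[OF u]] \<kappa>[OF Cod_in[OF u]] x] by simp
  qed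
  define z where "z s x = (SOME p. fst p \<in> Obj J \<and> snd p \<in> car (Ob D (fst p)) s \<and> ap (\<iota> (fst p)) s (snd p) = x)" for s x
  have z: "fst (z s x) \<in> Obj J \<and> snd (z s x) \<in> car (Ob D (fst (z s x))) s \<and> ap (\<iota> (fst (z s x))) s (snd (z s x)) = x"
    if x: "x \<in> car c s" for s x
  proof -
    obtain j d where "j \<in> Obj J" "d \<in> car (Ob D j) s" "ap (\<iota> j) s d = x" using set_likeD(3)[OF sl x] by blast
    then show ?thesis unfolding z_def by - (rule someI[of _ "(j, d)"], simp)
  qed
  define h where "h s x = ap (\<kappa> (fst (z s x))) s (snd (z s x))" for s x
  have h: "h s (ap (\<iota> j) s d) = ap (\<kappa> j) s d" if j: "j \<in> Obj J" "d \<in> car (Ob D j) s" for j s d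
  proof -
    have x: "ap (\<iota> j) s d \<in> car c s" using ap_car[OF \<iota>[OF j(1)] j(2)] .
    show ?thesis unfolding h_def
      by (rule class_mapD[OF set_likeD(2)[OF sl] inv]) (use z[OF x] j in simp_all)
  qed
  have hh: "mkarr c h N \<in> hom (PMod T) c N"
  proof (rule mkarr_hom[OF T c N])
    show "h s x \<in> car N s" if "x \<in> car c s" for s x
      unfolding h_def using z[OF that] ap_car[OF \<kappa>] by simp
    fix f ms assume f: "f \<in> funs (sgn T)" and ms: "ms \<in> tup c (farity (sgn T) f)"
    obtain j ds where j: "j \<in> Obj J" and ds: "ds \<in> tup (Ob D j) (farity (sgn T) f)"
      and eq: "hmap (ap (\<iota> j)) (farity (sgn T) f) ds = ms" using set_likeD(1)[OF sl ms] by blast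
    have Dj: "total_str (sgn T) (Ob D j)" using model_total[OF T] functor_Ob[OF D j] by simp
    have "h (fsort (sgn T) f) (opn c f ms) = h (fsort (sgn T) f) (ap (\<iota> j) (fsort (sgn T) f) (opn (Ob D j) f ds))"
      using ap_opn[OF T \<iota>[OF j] f ds] eq by simp
    also have "\<dots> = opn N f (hmap (ap (\<kappa> j)) (farity (sgn T) f) ds)"
      using h[OF j total_strD(2)[OF Dj f ds]] ap_opn[OF T \<kappa>[OF j] f ds] by simp
    also have "hmap (ap (\<kappa> j)) (farity (sgn T) f) ds = hmap h (farity (sgn T) f) ms"
    proof -
      have "hmap (ap (\<kappa> j)) (farity (sgn T) f) ds = hmap (\<lambda>s x. h s (ap (\<iota> j) s x)) (farity (sgn T) f) ds"
        using ds by (rule hmap_cong) (simp add: h[OF j])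
      then show ?thesis using eq ds by (auto simp: hmap_hmap in_tup)
    qed
    finally show "h (fsort (sgn T) f) (opn c f ms) = opn N f (hmap h (farity (sgn T) f) ms)" .
  qed
  show "\<exists>!k. k \<in> hom (PMod T) c N \<and> (\<forall>j\<in>Obj J. Comp (PMod T) k (\<iota> j) = \<kappa> j)"
  proof (rule ex1I[of _ "mkarr c h N"], intro conjI hh ballI)
    fix j assume j: "j \<in> Obj J"
    show "Comp (PMod T) (mkarr c h N) (\<iota> j) = \<kappa> j"
    proof (rule arr_eqI[OF category.Comp_in[OF category_PMod \<iota>[OF j] hh] \<kappa>[OF j]])
      fix s m assume m: "m \<in> car (Ob D j) s"
      show "ap (Comp (PMod T) (mkarr c h N) (\<iota> j)) s m = ap (\<kappa> j) s m"
        using ap_Comp[OF \<iota>[OF j] hh m] ap_car[OF \<iota>[OF j] m] h[OF j m] by simp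
    qed
  next
    fix k assume k: "k \<in> hom (PMod T) c N \<and> (\<forall>j\<in>Obj J. Comp (PMod T) k (\<iota> j) = \<kappa> j)"
    show "k = mkarr c h N"
    proof (rule arr_eqI[OF conjunct1[OF k] hh])
      fix s x assume x: "x \<in> car c s"
      obtain j d where j: "j \<in> Obj J" "d \<in> car (Ob D j) s" "ap (\<iota> j) s d = x" using set_likeD(3)[OF sl x] by blast
      have "ap k s x = ap (\<kappa> j) s d" using ap_Comp[OF \<iota>[OF j(1)] conjunct1[OF k] j(2)] k j by simp
      then show "ap k s x = ap (mkarr c h N) s x" using h[OF j(1,2)] j(3) x by simp
    qed
  qed
qed

text \<open>Arguments of an operation are lifted to a common stage and the operation is computed
  there; independence of the stage is the second half of \<open>sifted_tuples\<close>. An axiom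
  holds at a tuple because it holds at a lift of that tuple and homomorphisms preserve it.\<close>

lemma set_like_exists:
  fixes J :: "('u, 'u) cat" and D :: "('u, 'u, ('s, 'f, 'r, 'u) pstructure, _) func"
  assumes J: "sifted J" and T: "equational_theory TYPE('u) T" and D: "is_functor J (PMod T) D"
  shows "\<exists>c \<iota>. is_cocone J (PMod T) D c \<iota> \<and> set_like J D c \<iota>"
proof -
  have Jc: "category J" and Js: "small TYPE('u) (Obj J)" using J by (auto simp: sifted_def small_cat_def)
  interpret category J by fact
  let ?\<Sigma> = "sgn T"
  have Dm: "is_pmodel T (Ob D j)" if "j \<in> Obj J" for j using functor_Ob[OF D that] by simp
  have Dt: "total_str ?\<Sigma> (Ob D j)" if "j \<in> Obj J" for j using model_total[OF T Dm[OF that]] .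
  have Ds: "small TYPE('u) (car (Ob D j) s)" "s \<notin> sorts ?\<Sigma> \<Longrightarrow> car (Ob D j) s = {}" if "j \<in> Obj J" for j s
    using Dm[OF that] by (auto simp: is_pmodel_def is_pstructure_def)
  note Da = functor_Ar[OF D Jc]
  have "\<exists>cls. class_map J (\<lambda>j. car (Ob D j) s) (\<lambda>u. ap (Ar D u) s) cls" for s
    by (rule class_map_exists[OF Jc Js Ds(1)]) (auto intro: ap_car[OF Da])
  then obtain cls where cls: "\<And>s. class_map J (\<lambda>j. car (Ob D j) s) (\<lambda>u. ap (Ar D u) s) (cls s)" by metis
  define L where "L s = (\<Union>j\<in>Obj J. cls s j ` car (Ob D j) s)" for s
  note tups = sifted_tuples[OF J T D cls L_def]
  have clsL: "cls s j x \<in> L s" if "j \<in> Obj J" "x \<in> car (Ob D j) s" for s j x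
    unfolding L_def using that by blast
  have Ltup: "hmap (\<lambda>s. cls s j) ss ds \<in> listset (map L ss)" if "j \<in> Obj J" "ds \<in> tup (Ob D j) ss" for j ss ds
    using that clsL by (auto simp: in_listset list_all2_conv_all_nth in_tup)
  define w where "w ss ls = (SOME p. fst p \<in> Obj J \<and> snd p \<in> tup (Ob D (fst p)) ss \<and> hmap (\<lambda>s. cls s (fst p)) ss (snd p) = ls)" for ss ls
  have w: "fst (w ss ls) \<in> Obj J \<and> snd (w ss ls) \<in> tup (Ob D (fst (w ss ls))) ss \<and> hmap (\<lambda>s. cls s (fst (w ss ls))) ss (snd (w ss ls)) = ls"
    if ls: "ls \<in> listset (map L ss)" for ss ls
  proof -
    obtain j ds where "j \<in> Obj J" "ds \<in> tup (Ob D j) ss" "hmap (\<lambda>s. cls s j) ss ds = ls" using tups(1)[OF ls] by blast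
    then show ?thesis unfolding w_def by - (rule someI[of _ "(j, ds)"], simp)
  qed
  \<comment> \<open>Computed at the stage and tuple selected by \<open>w\<close>; that any other
    lift gives the same class is shown in \<open>p\<close>, with the class of the operation's value
    as the invariant function of tuples.\<close>
  define p where "p f ls = cls (fsort ?\<Sigma> f) (fst (w (farity ?\<Sigma> f) ls)) (opn (Ob D (fst (w (farity ?\<Sigma> f) ls))) f (snd (w (farity ?\<Sigma> f) ls)))" for f ls
  define c where "c = (mkstr ?\<Sigma> L p :: ('s, 'f, 'r, 'u) pstructure)"
  have carc: "car c = L" by (simp add: c_def)
  have p: "p f (hmap (\<lambda>s. cls s j) (farity ?\<Sigma> f) ds) = cls (fsort ?\<Sigma> f) j (opn (Ob D j) f ds)"
    if f: "f \<in> funs ?\<Sigma>" and j: "j \<in> Obj J" and ds: "ds \<in> tup (Ob D j) (farity ?\<Sigma> f)" for f j ds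
    unfolding p_def
  proof (rule tups(2)[where ss = "farity ?\<Sigma> f" and \<phi> = "\<lambda>j ds. cls (fsort ?\<Sigma> f) j (opn (Ob D j) f ds)"])
    fix u es assume u: "u \<in> Arr J" and es: "es \<in> tup (Ob D (Dom J u)) (farity ?\<Sigma> f)"
    show "cls (fsort ?\<Sigma> f) (Cod J u) (opn (Ob D (Cod J u)) f (hmap (ap (Ar D u)) (farity ?\<Sigma> f) es))
      = cls (fsort ?\<Sigma> f) (Dom J u) (opn (Ob D (Dom J u)) f es)"
      using class_map_inv[OF cls u total_strD(2)[OF Dt[OF Dom_in[OF u]] f es]] ap_opn[OF T Da[OF Arr_hom[OF u]] f es]
      by simp
  qed (use w[OF Ltup[OF j ds]] j ds in simp_all)
  have ct: "total_str ?\<Sigma> c"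
    unfolding c_def
  proof (rule total_mkstr)
    show "rels ?\<Sigma> = {}" using T by (simp add: equational_theory_def)
    show "small TYPE('u) (L s)" for s unfolding L_def by (intro small_UN Js small_image Ds)
    show "L s = {}" if "s \<notin> sorts ?\<Sigma>" for s unfolding L_def using Ds(2) that by simp
    show "p f ls \<in> L (fsort ?\<Sigma> f)" if "f \<in> funs ?\<Sigma>" "ls \<in> listset (map L (farity ?\<Sigma> f))" for f ls
      unfolding p_def using w[OF that(2)] that(1) by (intro clsL) (auto intro: total_strD(2)[OF Dt])
  qed
  have hom: "is_hom ?\<Sigma> (Ob D j) c (\<lambda>s. restrict (cls s j) (car (Ob D j) s))" if j: "j \<in> Obj J" for j
  proof (rule total_homI[OF Dt[OF j] ct])
    show "cls s j m \<in> car c s" if "m \<in> car (Ob D j) s" for s m using clsL[OF j that] carc by simp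
    fix f ds assume f: "f \<in> funs ?\<Sigma>" and ds: "ds \<in> tup (Ob D j) (farity ?\<Sigma> f)"
    show "cls (fsort ?\<Sigma> f) j (opn (Ob D j) f ds) = opn c f (hmap (\<lambda>s. cls s j) (farity ?\<Sigma> f) ds)"
      unfolding c_def using opn_mkstr[OF f Ltup[OF j ds]] p[OF f j ds] by simp
  qed
  have cls_r: "hmap (\<lambda>s. restrict (cls s j) (car (Ob D j) s)) ss ds = hmap (\<lambda>s. cls s j) ss ds"
    if "ds \<in> tup (Ob D j) ss" for j ss ds using that by (rule hmap_cong) simp
  have cm: "is_pmodel T c"
  proof (rule modelI[OF ct])
    fix e assume e: "e \<in> axs T"
    have te: "prem e = Top" "wf_horn ?\<Sigma> (ctx e) (concl e)"
      using T e by (auto simp: equational_theory_def is_pht_def wf_sequent_def)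
    show "valid c e" unfolding valid_Top[OF te(1)]
    proof
      fix ls assume "ls \<in> tup c (map fst (ctx e))"
      then have "ls \<in> listset (map L (map fst (ctx e)))" using carc by simp
      then obtain j ds where j: "j \<in> Obj J" and ds: "ds \<in> tup (Ob D j) (map fst (ctx e))"
        and eq: "hmap (\<lambda>s. cls s j) (map fst (ctx e)) ds = ls" using tups(1) by blast
      have "holds (Ob D j) (ctx e) ds (concl e)"
        using Dm[OF j] e ds unfolding is_pmodel_def by (auto simp: valid_Top[OF te(1)])
      from hom_holds[OF Dt[OF j] hom[OF j] te(2) ds this] show "holds c (ctx e) ls (concl e)"
        using eq cls_r[OF ds] by simp
    qed
  qed
  let ?\<iota> = "\<lambda>j. mkarr (Ob D j) (\<lambda>s. cls s j) c"
  have \<iota>: "?\<iota> j \<in> hom (PMod T) (Ob D j) c" if "j \<in> Obj J" for j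
    using hom[OF that] Dm[OF that] cm by (simp add: hom_PMod mkarr_def)
  have "is_cocone J (PMod T) D c ?\<iota>"
    unfolding is_cocone_def
  proof (intro conjI ballI)
    fix u assume u: "u \<in> Arr J"
    note uh = Da[OF Arr_hom[OF u]]
    show "Comp (PMod T) (?\<iota> (Cod J u)) (Ar D u) = ?\<iota> (Dom J u)"
    proof (rule arr_eqI[OF category.Comp_in[OF category_PMod uh \<iota>[OF Cod_in[OF u]]] \<iota>[OF Dom_in[OF u]]])
      fix s m assume m: "m \<in> car (Ob D (Dom J u)) s"
      show "ap (Comp (PMod T) (?\<iota> (Cod J u)) (Ar D u)) s m = ap (?\<iota> (Dom J u)) s m"
        using ap_Comp[OF uh \<iota>[OF Cod_in[OF u]] m] ap_car[OF uh m] m cls[of s] u by (simp add: class_map_def invariant_def)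
    qed
  qed (use cm \<iota> in auto)
  moreover have "set_like J D c ?\<iota>"
    unfolding set_like_def
  proof (intro conjI allI ballI)
    fix ss ls assume "ls \<in> tup c ss"
    then have "ls \<in> listset (map L ss)" using carc by simp
    then obtain j ds where j: "j \<in> Obj J" "ds \<in> tup (Ob D j) ss" "hmap (\<lambda>s. cls s j) ss ds = ls" using tups(1) by blast
    moreover have "hmap (ap (?\<iota> j)) ss ds = hmap (\<lambda>s. cls s j) ss ds" using j(2) by (rule hmap_cong) simp
    ultimately show "\<exists>j\<in>Obj J. \<exists>ds\<in>tup (Ob D j) ss. hmap (ap (?\<iota> j)) ss ds = ls" by metis
  next
    fix s
    have i: "ap (Ar D u) s x \<in> car (Ob D (Cod J u)) s" if "u \<in> Arr J" "x \<in> car (Ob D (Dom J u)) s" for u x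
      using ap_car[OF Da[OF Arr_hom[OF that(1)]] that(2)] .
    show "class_map J (\<lambda>j. car (Ob D j) s) (\<lambda>u. ap (Ar D u) s) (\<lambda>j. ap (?\<iota> j) s)"
      using cls[of s] i unfolding class_map_def invariant_def by simp
  qed
  ultimately show ?thesis by blast
qed

lemma colimit_iso:
  assumes C: "category C" and c: "is_colimit J C D c \<iota>" and d: "is_colimit J C D d \<kappa>"
  shows "\<exists>f \<in> hom C c d. \<exists>g \<in> hom C d c. Comp C g f = Id C c \<and> Comp C f g = Id C d \<and> (\<forall>j \<in> Obj J. Comp C f (\<iota> j) = \<kappa> j)"
proof -
  interpret category C by fact
  have coc: "is_cocone J C D c \<iota>" and cod: "is_cocone J C D d \<kappa>" using c d by (auto simp: is_colimit_def)
  have \<iota>: "\<iota> j \<in> hom C (Ob D j) c" and \<kappa>: "\<kappa> j \<in> hom C (Ob D j) d" if "j \<in> Obj J" for j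
    using coc cod that by (auto simp: is_cocone_def)
  have cO: "c \<in> Obj C" and dO: "d \<in> Obj C" using coc cod by (auto simp: is_cocone_def)
  have u: "\<exists>!h. h \<in> hom C c e \<and> (\<forall>j \<in> Obj J. Comp C h (\<iota> j) = \<mu> j)" if "is_cocone J C D e \<mu>" for e \<mu>
    using c that unfolding is_colimit_def by simp
  have v: "\<exists>!h. h \<in> hom C d e \<and> (\<forall>j \<in> Obj J. Comp C h (\<kappa> j) = \<mu> j)" if "is_cocone J C D e \<mu>" for e \<mu>
    using d that unfolding is_colimit_def by simp
  from u[OF cod] obtain f where f: "f \<in> hom C c d" "\<forall>j \<in> Obj J. Comp C f (\<iota> j) = \<kappa> j" by (rule ex1_conjE)
  from v[OF coc] obtain g where g: "g \<in> hom C d c" "\<forall>j \<in> Obj J. Comp C g (\<kappa> j) = \<iota> j" by (rule ex1_conjE)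
  from u[OF coc] obtain h where h: "\<forall>k. k \<in> hom C c c \<longrightarrow> (\<forall>j \<in> Obj J. Comp C k (\<iota> j) = \<iota> j) \<longrightarrow> k = h" by (rule ex1_conjE)
  from v[OF cod] obtain h' where h': "\<forall>k. k \<in> hom C d d \<longrightarrow> (\<forall>j \<in> Obj J. Comp C k (\<kappa> j) = \<kappa> j) \<longrightarrow> k = h'" by (rule ex1_conjE)
  have "Comp C g f = Id C c"
    using h[rule_format, OF Comp_in[OF f(1) g(1)]] h[rule_format, OF Id_in[OF cO]] assoc[OF \<iota> f(1) g(1)] f(2) g(2) Id_left[OF \<iota>]
    by metis
  moreover have "Comp C f g = Id C d"
    using h'[rule_format, OF Comp_in[OF g(1) f(1)]] h'[rule_format, OF Id_in[OF dO]] assoc[OF \<kappa> g(1) f(1)] f(2) g(2) Id_left[OF \<kappa>]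
    by metis
  ultimately show ?thesis using f g by blast
qed

text \<open>Any colimit is isomorphic, compatibly with the cocones, to the one just constructed, and
  the elementwise description is stable under such an isomorphism.\<close>

lemma sifted_colimit_set_like:
  fixes J :: "('u, 'u) cat" and D :: "('u, 'u, ('s, 'f, 'r, 'u) pstructure, _) func"
  assumes J: "sifted J" and T: "equational_theory TYPE('u) T" and D: "is_functor J (PMod T) D"
    and co: "is_colimit J (PMod T) D c \<iota>"
  shows "set_like J D c \<iota>"
proof -
  have Jc: "category J" using J by (auto simp: sifted_def small_cat_def)
  interpret category J by fact
  obtain c' \<iota>' where c': "is_cocone J (PMod T) D c' \<iota>'" and sl: "set_like J D c' \<iota>'" using set_like_exists[OF J T D] by blast
  have co': "is_colimit J (PMod T) D c' \<iota>'" using set_like_colimit[OF Jc T D c' sl] .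
  obtain f g where f: "f \<in> hom (PMod T) c' c" and g: "g \<in> hom (PMod T) c c'"
    and gf: "Comp (PMod T) g f = Id (PMod T) c'" and fg: "Comp (PMod T) f g = Id (PMod T) c"
    and fi: "\<forall>j \<in> Obj J. Comp (PMod T) f (\<iota>' j) = \<iota> j"
    using colimit_iso[OF category_PMod co' co] by blast
  have \<iota>': "\<iota>' j \<in> hom (PMod T) (Ob D j) c'" if "j \<in> Obj J" for j using c' that by (simp add: is_cocone_def)
  have \<iota>: "ap (\<iota> j) s x = ap f s (ap (\<iota>' j) s x)" if "j \<in> Obj J" "x \<in> car (Ob D j) s" for j s x
    using ap_Comp[OF \<iota>'[OF that(1)] f that(2)] fi that by simp
  have fgx: "ap f s (ap g s x) = x" if "x \<in> car c s" for s x
    using ap_Comp[OF g f that] fg ap_Id[OF that, of T] by simp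
  have gfx: "ap g s (ap f s x) = x" if "x \<in> car c' s" for s x
    using ap_Comp[OF f g that] gf ap_Id[OF that, of T] by simp
  show ?thesis
    unfolding set_like_def
  proof (intro conjI allI ballI)
    fix ss ls assume ls: "ls \<in> tup c ss"
    have t: "hmap (ap g) ss ls \<in> tup c' ss" using ap_tup[OF g ls] .
    obtain j ds where j: "j \<in> Obj J" and ds: "ds \<in> tup (Ob D j) ss" and eq: "hmap (ap (\<iota>' j)) ss ds = hmap (ap g) ss ls"
      using set_likeD(1)[OF sl t] by blast
    have l: "length ds = length ss" "length ls = length ss" using ds ls by (simp_all add: in_tup)
    have "hmap (ap (\<iota> j)) ss ds = hmap (\<lambda>s x. ap f s (ap (\<iota>' j) s x)) ss ds"
      using ds by (rule hmap_cong) (rule \<iota>[OF j])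
    also have "\<dots> = hmap (\<lambda>s x. ap f s (ap g s x)) ss ls"
      using l eq hmap_hmap[OF l(1), of "ap f" "ap (\<iota>' j)"] hmap_hmap[OF l(2), of "ap f" "ap g"] by simp
    also have "\<dots> = ls" using ls by (rule hmap_ident) (rule fgx)
    finally show "\<exists>j\<in>Obj J. \<exists>ds\<in>tup (Ob D j) ss. hmap (ap (\<iota> j)) ss ds = ls" using j ds by blast
  next
    fix s
    have inj: "ap (\<iota>' j) s x = ap (\<iota>' j') s x'" if "j \<in> Obj J" "j' \<in> Obj J" "x \<in> car (Ob D j) s" "x' \<in> car (Ob D j') s"
      "ap (\<iota> j) s x = ap (\<iota> j') s x'" for j j' x x'
      using \<iota>[OF that(1,3)] \<iota>[OF that(2,4)] that(5) gfx[OF ap_car[OF \<iota>'[OF that(1)] that(3)]] gfx[OF ap_car[OF \<iota>'[OF that(2)] that(4)]]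
      by simp
    show "class_map J (\<lambda>j. car (Ob D j) s) (\<lambda>u. ap (Ar D u) s) (\<lambda>j. ap (\<iota> j) s)"
      unfolding class_map_def
    proof (intro conjI allI impI ballI)
      show "invariant J (\<lambda>j. car (Ob D j) s) (\<lambda>u. ap (Ar D u) s) (\<lambda>j. ap (\<iota> j) s)"
        unfolding invariant_def
      proof (intro ballI)
        fix u x assume u: "u \<in> Arr J" and x: "x \<in> car (Ob D (Dom J u)) s"
        have "ap (\<iota>' (Cod J u)) s (ap (Ar D u) s x) = ap (\<iota>' (Dom J u)) s x"
          using set_likeD(2)[OF sl, of s] u x by (simp add: class_map_def invariant_def)
        then show "ap (\<iota> (Cod J u)) s (ap (Ar D u) s x) = ap (\<iota> (Dom J u)) s x"
          using \<iota>[OF Cod_in[OF u] ap_car[OF functor_Ar[OF D Jc Arr_hom[OF u]] x]] \<iota>[OF Dom_in[OF u] x] by simp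
      qed
      fix \<psi> :: "'u \<Rightarrow> 'u \<Rightarrow> 'u" and j j' x x'
      assume \<psi>: "invariant J (\<lambda>j. car (Ob D j) s) (\<lambda>u. ap (Ar D u) s) \<psi>"
        and j: "j \<in> Obj J" "j' \<in> Obj J" "x \<in> car (Ob D j) s" "x' \<in> car (Ob D j') s"
          "ap (\<iota> j) s x = ap (\<iota> j') s x'"
      show "\<psi> j x = \<psi> j' x'" by (rule class_mapD[OF set_likeD(2)[OF sl] \<psi> j(1-4) inj[OF j]])
    qed
  qed
qed

end

section \<open>Weak finite coproducts imply siftedness\<close>

text \<open>Finite coproducts with existence but no uniqueness of copairings. The case
  \<open>n = 0\<close> is a weakly initial object, so the definition also covers empty
  products.\<close>

definition weak_coproducts :: "('j, 'k) cat \<Rightarrow> bool" where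
  "weak_coproducts J \<longleftrightarrow> (\<forall>n (fam :: nat \<Rightarrow> 'j). (\<forall>i<n. fam i \<in> Obj J) \<longrightarrow>
     (\<exists>c \<in> Obj J. \<exists>inc. (\<forall>i<n. inc i \<in> hom J (fam i) c) \<and>
        (\<forall>d \<in> Obj J. \<forall>g. (\<forall>i<n. g i \<in> hom J (fam i) d) \<longrightarrow>
           (\<exists>h \<in> hom J c d. \<forall>i<n. Comp J h (inc i) = g i))))"

context univ begin

text \<open>
  The tuple at the weak coproduct of a family of elements is invariant in each component
  separately; injectivity of the comparison map follows by changing one component at a time.
\<close>

lemma weak_coproducts_sifted:
  fixes J :: "('u, 'u) cat"
  assumes J: "small_cat J" and w: "weak_coproducts J"
  shows "sifted J"
  unfolding sifted_def
proof (intro conjI J allI impI, elim conjE)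
  have Jc: "category J" and Js: "small TYPE('u) (Obj J)" using J by (auto simp: small_cat_def)
  interpret category J by fact
  fix n :: nat and D :: "nat \<Rightarrow> ('u, 'u, 'u set, _) func" and P \<pi> L \<iota> Q \<kappa> q
  assume D: "\<forall>i<n. is_functor J set_cat (D i)" and P: "is_functor J set_cat P"
    and \<pi>: "\<forall>i<n. nat_trans J set_cat P (D i) (\<pi> i)"
    and pr: "\<forall>j \<in> Obj J. is_product set_cat n (\<lambda>i. Ob (D i) j) (Ob P j) (\<lambda>i. \<pi> i j)"
    and L: "\<forall>i<n. is_colimit J set_cat (D i) (L i) (\<iota> i)" and Q: "is_colimit J set_cat P Q \<kappa>"
    and q: "\<forall>i<n. q i \<in> hom set_cat Q (L i) \<and> (\<forall>j \<in> Obj J. Comp set_cat (q i) (\<kappa> j) = Comp set_cat (\<iota> i j) (\<pi> i j))"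
  have \<pi>h: "\<pi> i j \<in> hom set_cat (Ob P j) (Ob (D i) j)" if "i < n" "j \<in> Obj J" for i j
    using \<pi> that by (simp add: nat_trans_def)
  have \<iota>h: "\<iota> i j \<in> hom set_cat (Ob (D i) j) (L i)" if "i < n" "j \<in> Obj J" for i j
    using L that by (simp add: is_colimit_def is_cocone_def)
  have \<kappa>h: "\<kappa> j \<in> hom set_cat (Ob P j) Q" if "j \<in> Obj J" for j
    using Q that by (simp add: is_colimit_def is_cocone_def)
  have qh: "q i \<in> hom set_cat Q (L i)" if "i < n" for i using q that by simp
  have Qs: "small TYPE('u) Q" using Q by (simp add: is_colimit_def is_cocone_def)
  have Ps: "small TYPE('u) (Ob P j)" if "j \<in> Obj J" for j using functor_Ob[OF P that] by simp
  have q\<kappa>: "sap (q i) (sap (\<kappa> j) p) = sap (\<iota> i j) (sap (\<pi> i j) p)" if "i < n" "j \<in> Obj J" "p \<in> Ob P j" for i j p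
    using bspec[OF conjunct2[OF set_Comp[OF \<kappa>h[OF that(2)] qh[OF that(1)]]] that(3)]
      bspec[OF conjunct2[OF set_Comp[OF \<pi>h[OF that(1,2)] \<iota>h[OF that(1,2)]]] that(3)] q that by simp
  have D\<pi>: "sap (\<pi> i j') (sap (Ar P u) p) = sap (Ar (D i) u) (sap (\<pi> i j) p)"
    if i: "i < n" and u: "u \<in> hom J j j'" and p: "p \<in> Ob P j" for i u j j' p
  proof -
    have o: "j \<in> Obj J" "j' \<in> Obj J" using hom_Obj[OF u] by auto
    have "Comp set_cat (\<pi> i j') (Ar P u) = Comp set_cat (Ar (D i) u) (\<pi> i j)"
      using \<pi> i in_homD[OF u] by (simp add: nat_trans_def) blast
    then show ?thesis
      using bspec[OF conjunct2[OF set_Comp[OF functor_Ar[OF P Jc u] \<pi>h[OF i o(2)]]] p]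
        bspec[OF conjunct2[OF set_Comp[OF \<pi>h[OF i o(1)] functor_Ar[OF D[rule_format, OF i] Jc u]]] p] by simp
  qed
  have pair: "\<exists>!p. p \<in> Ob P j \<and> (\<forall>i<n. sap (\<pi> i j) p = l i)" if j: "j \<in> Obj J" and l: "\<forall>i<n. l i \<in> Ob (D i) j" for j l
  proof -
    have "\<forall>l. (\<forall>i<n. l i \<in> Ob (D i) j) \<longrightarrow> (\<exists>!p. p \<in> Ob P j \<and> (\<forall>i<n. sap (\<pi> i j) p = l i))"
      by (rule iffD1[OF set_product_iff[OF Ps[OF j] \<pi>h[OF _ j]] pr[rule_format, OF j]])
    then show ?thesis using l by simp
  qed
  have \<kappa>u: "sap (\<kappa> j') (sap (Ar P u) p) = sap (\<kappa> j) p" if "u \<in> hom J j j'" "p \<in> Ob P j" for u j j' p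
    using set_colimitD(2)[OF Jc Js P Q] in_homD[OF that(1)] that(2) by (auto simp: class_map_def invariant_def)
  note Lsurj = set_colimitD(1)[OF Jc Js D[rule_format] L[rule_format]]
  note Lcls = set_colimitD(2)[OF Jc Js D[rule_format] L[rule_format]]
  have "\<exists>c inc. (\<forall>i<n. fam i \<in> Obj J) \<longrightarrow> c \<in> Obj J \<and> (\<forall>i<n. inc i \<in> hom J (fam i) c) \<and>
        (\<forall>d \<in> Obj J. \<forall>g. (\<forall>i<n. g i \<in> hom J (fam i) d) \<longrightarrow> (\<exists>h \<in> hom J c d. \<forall>i<n. Comp J h (inc i) = g i))" for fam
  proof (cases "\<forall>i<n. fam i \<in> Obj J")
    case True
    from mp[OF spec[OF spec[OF w[unfolded weak_coproducts_def], of n], of fam] True]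
    obtain c inc where "c \<in> Obj J" "\<forall>i<n. inc i \<in> hom J (fam i) c"
      "\<forall>d \<in> Obj J. \<forall>g. (\<forall>i<n. g i \<in> hom J (fam i) d) \<longrightarrow> (\<exists>h \<in> hom J c d. \<forall>i<n. Comp J h (inc i) = g i)"
      by (elim bexE exE conjE)
    then show ?thesis by (intro exI[of _ c] exI[of _ inc] impI conjI)
  next
    case False
    then show ?thesis by (intro exI impI) (erule notE)
  qed
  then obtain cop inc where ci: "\<And>fam. (\<forall>i<n. fam i \<in> Obj J) \<longrightarrow> cop fam \<in> Obj J \<and> (\<forall>i<n. inc fam i \<in> hom J (fam i) (cop fam)) \<and>
        (\<forall>d \<in> Obj J. \<forall>g. (\<forall>i<n. g i \<in> hom J (fam i) d) \<longrightarrow> (\<exists>h \<in> hom J (cop fam) d. \<forall>i<n. Comp J h (inc fam i) = g i))"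
    by metis
  \<comment> \<open>\<open>F\<close> selects one element from the disjoint union underlying each
    \<open>D i\<close>. \<open>tp F\<close> collects the images of these elements at the weak
    coproduct of their indices, and \<open>\<Phi> F\<close> is the class of that tuple; it will be
    the inverse of the comparison map.\<close>
  define good where "good F \<longleftrightarrow> (\<forall>i<n. fst (F i) \<in> Obj J \<and> snd (F i) \<in> Ob (D i) (fst (F i)))" for F :: "nat \<Rightarrow> 'u \<times> 'u"
  let ?c = "\<lambda>F. cop (\<lambda>i. fst (F i))" and ?in = "\<lambda>F. inc (\<lambda>i. fst (F i))"
  have cO: "?c F \<in> Obj J" and inh: "i < n \<Longrightarrow> ?in F i \<in> hom J (fst (F i)) (?c F)"
    and lift: "d \<in> Obj J \<Longrightarrow> (\<And>i. i < n \<Longrightarrow> g i \<in> hom J (fst (F i)) d) \<Longrightarrow> \<exists>h \<in> hom J (?c F) d. \<forall>i<n. Comp J h (?in F i) = g i"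
    if "good F" for F i d g
    using ci[of "\<lambda>i. fst (F i)"] that unfolding good_def by auto
  define tp where "tp F = (THE p. p \<in> Ob P (?c F) \<and> (\<forall>i<n. sap (\<pi> i (?c F)) p = sap (Ar (D i) (?in F i)) (snd (F i))))" for F
  have Din: "sap (Ar (D i) (?in F i)) (snd (F i)) \<in> Ob (D i) (?c F)" if "good F" "i < n" for F i
    using sap_in[OF functor_Ar[OF D[rule_format, OF that(2)] Jc inh[OF that]]] that by (simp add: good_def)
  have tp: "tp F \<in> Ob P (?c F) \<and> (\<forall>i<n. sap (\<pi> i (?c F)) (tp F) = sap (Ar (D i) (?in F i)) (snd (F i)))" if "good F" for F
    unfolding tp_def by (rule theI', rule pair[OF cO[OF that]]) (use Din[OF that] in blast)
  define \<Phi> where "\<Phi> F = sap (\<kappa> (?c F)) (tp F)" for F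
  have \<Phi>Q: "\<Phi> F \<in> Q" if "good F" for F unfolding \<Phi>_def using sap_in[OF \<kappa>h[OF cO[OF that]]] tp[OF that] by blast
  \<comment> \<open>Any tuple \<open>p\<close> whose entries are reached from those of
    \<open>F\<close> along arrows \<open>g i\<close> represents \<open>\<Phi> F\<close>: a copairing
    of the \<open>g i\<close> carries \<open>tp F\<close> to \<open>p\<close>. The choice of the
    copairing is immaterial because \<open>p\<close> is determined by its projections.\<close>
  have \<Phi>_map: "\<Phi> F = sap (\<kappa> d) p"
    if F: "good F" and d: "d \<in> Obj J" and p: "p \<in> Ob P d" and g: "\<And>i. i < n \<Longrightarrow> g i \<in> hom J (fst (F i)) d"
      and gp: "\<And>i. i < n \<Longrightarrow> sap (Ar (D i) (g i)) (snd (F i)) = sap (\<pi> i d) p" for F d p g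
  proof -
    obtain h where h: "h \<in> hom J (?c F) d" "\<forall>i<n. Comp J h (?in F i) = g i" using lift[OF F d, of g] g by blast
    have hp: "sap (Ar P h) (tp F) \<in> Ob P d" using sap_in[OF functor_Ar[OF P Jc h(1)]] tp[OF F] by blast
    have "sap (\<pi> i d) (sap (Ar P h) (tp F)) = sap (\<pi> i d) p" if i: "i < n" for i
    proof -
      note Di = D[rule_format, OF i] and ii = inh[OF F i]
      have x: "snd (F i) \<in> Ob (D i) (fst (F i))" using F i by (simp add: good_def)
      have "sap (\<pi> i d) (sap (Ar P h) (tp F)) = sap (Ar (D i) h) (sap (Ar (D i) (?in F i)) (snd (F i)))"
        using D\<pi>[OF i h(1)] tp[OF F] i by simp
      also have "\<dots> = sap (Ar (D i) (g i)) (snd (F i))"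
        using functor_Comp[OF Di ii h(1)] h(2) i
          bspec[OF conjunct2[OF set_Comp[OF functor_Ar[OF Di Jc ii] functor_Ar[OF Di Jc h(1)]]] x] by simp
      finally show ?thesis using gp[OF i] by simp
    qed
    moreover have "\<exists>!r. r \<in> Ob P d \<and> (\<forall>i<n. sap (\<pi> i d) r = sap (\<pi> i d) p)"
      by (rule pair[OF d]) (use sap_in[OF \<pi>h[OF _ d] p] in blast)
    ultimately have "sap (Ar P h) (tp F) = p" using hp p by blast
    then show ?thesis unfolding \<Phi>_def using \<kappa>u[OF h(1)] tp[OF F] by metis
  qed
  \<comment> \<open>With the other entries fixed, \<open>\<Phi>\<close> is an invariant function of
    the \<open>k\<close>-th entry, so it depends only on the class of that entry in
    \<open>L k\<close>.\<close>
  have \<Phi>_upd: "\<Phi> (F(k := (j, x))) = \<Phi> (F(k := (j', x')))"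
    if F: "good F" and k: "k < n" and j: "j \<in> Obj J" "j' \<in> Obj J" "x \<in> Ob (D k) j" "x' \<in> Ob (D k) j'"
      and eq: "sap (\<iota> k j) x = sap (\<iota> k j') x'" for F k j x j' x'
  proof -
    have gd: "good (F(k := (j, x)))" if "j \<in> Obj J" "x \<in> Ob (D k) j" for j x using F that by (simp add: good_def)
    have "invariant J (Ob (D k)) (\<lambda>u. sap (Ar (D k) u)) (\<lambda>j x. \<Phi> (F(k := (j, x))))"
      unfolding invariant_def
    proof (intro ballI)
      fix u x assume u: "u \<in> Arr J" and x: "x \<in> Ob (D k) (Dom J u)"
      note uh = Arr_hom[OF u]
      note Dk = D[rule_format, OF k]
      have ux: "sap (Ar (D k) u) x \<in> Ob (D k) (Cod J u)" using sap_in[OF functor_Ar[OF Dk Jc uh] x] .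
      let ?F = "F(k := (Dom J u, x))" and ?F' = "F(k := (Cod J u, sap (Ar (D k) u) x))"
      note g = gd[OF Dom_in[OF u] x] and g' = gd[OF Cod_in[OF u] ux]
      \<comment> \<open>Arrows from the indices of the old family to the coproduct of the new one:
        the injections, preceded by \<open>u\<close> at the changed position.\<close>
      let ?g = "\<lambda>i. if i = k then Comp J (?in ?F' k) u else ?in ?F' i"
      have ink: "?in ?F' k \<in> hom J (Cod J u) (?c ?F')" using inh[OF g' k] by simp
      have "\<Phi> ?F = sap (\<kappa> (?c ?F')) (tp ?F')"
      proof (rule \<Phi>_map[OF g cO[OF g'] conjunct1[OF tp[OF g']], of ?g])
        show "?g i \<in> hom J (fst (?F i)) (?c ?F')" if "i < n" for i
          using inh[OF g' that] Comp_in[OF uh ink] by (cases "i = k") (simp_all del: fun_upd_apply, simp_all)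
        show "sap (Ar (D i) (?g i)) (snd (?F i)) = sap (\<pi> i (?c ?F')) (tp ?F')" if i: "i < n" for i
        proof (cases "i = k")
          case True
          have "sap (Ar (D k) (Comp J (?in ?F' k) u)) x = sap (Ar (D k) (?in ?F' k)) (sap (Ar (D k) u) x)"
            using functor_Comp[OF Dk uh ink]
              bspec[OF conjunct2[OF set_Comp[OF functor_Ar[OF Dk Jc uh] functor_Ar[OF Dk Jc ink]]] x] by simp
          moreover have "sap (\<pi> k (?c ?F')) (tp ?F') = sap (Ar (D k) (?in ?F' k)) (snd (?F' k))" using tp[OF g'] k by blast
          ultimately show ?thesis using True by simp
        next
          case False
          have "sap (\<pi> i (?c ?F')) (tp ?F') = sap (Ar (D i) (?in ?F' i)) (snd (?F' i))" using tp[OF g'] i by blast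
          then show ?thesis using False by simp
        qed
      qed
      then show "\<Phi> ?F' = \<Phi> ?F" by (simp only: \<Phi>_def)
    qed
    from class_mapD[OF Lcls[OF k k] this j eq] show ?thesis .
  qed
  show "is_product set_cat n L Q q"
  proof (subst set_product_iff[OF Qs qh], assumption, intro allI impI)
    fix l assume l: "\<forall>i<n. l i \<in> L i"
    have "\<exists>p. i < n \<longrightarrow> fst p \<in> Obj J \<and> snd p \<in> Ob (D i) (fst p) \<and> sap (\<iota> i (fst p)) (snd p) = l i" for i
      using Lsurj[of i "l i"] l by fastforce
    then obtain F where F: "\<And>i. i < n \<Longrightarrow> fst (F i) \<in> Obj J \<and> snd (F i) \<in> Ob (D i) (fst (F i)) \<and> sap (\<iota> i (fst (F i))) (snd (F i)) = l i"
      by metis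
    have gF: "good F" using F by (simp add: good_def)
    have uniq: "x = \<Phi> F" if x: "x \<in> Q" "\<forall>i<n. sap (q i) x = l i" for x
    proof -
      obtain j p where j: "j \<in> Obj J" "p \<in> Ob P j" "sap (\<kappa> j) p = x" using set_colimitD(1)[OF Jc Js P Q x(1)] by blast
      define G where "G i = (j, sap (\<pi> i j) p)" for i
      have G: "i < n \<Longrightarrow> fst (G i) \<in> Obj J \<and> snd (G i) \<in> Ob (D i) (fst (G i)) \<and> sap (\<iota> i (fst (G i))) (snd (G i)) = l i" for i
        using j sap_in[OF \<pi>h[OF _ j(1)] j(2)] q\<kappa>[OF _ j(1,2)] x(2) by (simp add: G_def)
      \<comment> \<open>Hybrid families that interpolate between \<open>G\<close> at
        \<open>k = 0\<close> and \<open>F\<close> at \<open>k = n\<close>; neighbours differ in one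
        entry without changing its class.\<close>
      let ?H = "\<lambda>k i. if i < k then F i else G i"
      have gH: "good (?H k)" for k using F G by (simp add: good_def)
      have "k \<le> n \<Longrightarrow> \<Phi> (?H k) = \<Phi> G" for k
      proof (induction k)
        case (Suc k)
        then have k: "k < n" by simp
        have H1: "?H (Suc k) = (?H k)(k := (fst (F k), snd (F k)))" and H2: "?H k = (?H k)(k := (fst (G k), snd (G k)))"
          by (auto simp: fun_eq_iff less_Suc_eq)
        have "\<Phi> ((?H k)(k := (fst (F k), snd (F k)))) = \<Phi> ((?H k)(k := (fst (G k), snd (G k))))"
          using F[OF k] G[OF k] by (intro \<Phi>_upd[OF gH k]) auto
        then show ?case using Suc H1 H2 by simp
      qed simp
      from this[of n] have "\<Phi> (?H n) = \<Phi> G" by simp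
      moreover have "\<Phi> F = \<Phi> (?H n)"
      proof -
        note cn = cO[OF gH[of n]] and tn = tp[OF gH[of n]]
        have "\<Phi> F = sap (\<kappa> (?c (?H n))) (tp (?H n))"
          by (rule \<Phi>_map[OF gF cn conjunct1[OF tn], of "?in (?H n)"]) (use inh[OF gH[of n]] tn in auto)
        then show ?thesis by (simp only: \<Phi>_def)
      qed
      \<comment> \<open>All entries of \<open>G\<close> live at the same index \<open>j\<close>, so
        identities exhibit \<open>p\<close> as a representative of \<open>\<Phi> G\<close>.\<close>
      moreover have "\<Phi> G = sap (\<kappa> j) p"
      proof (rule \<Phi>_map[of G j p "\<lambda>_. Id J j"])
        show "good G" using G by (simp add: good_def)
        show "sap (Ar (D i) (Id J j)) (snd (G i)) = sap (\<pi> i j) p" if "i < n" for i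
          using functor_Id[OF D[rule_format, OF that] j(1)] functor_Ob[OF D[rule_format, OF that] j(1)]
            Id_set_cat[of "Ob (D i) j"] sap_in[OF \<pi>h[OF that j(1)] j(2)] by (simp add: G_def)
      qed (use j Id_in in \<open>auto simp: G_def\<close>)
      ultimately show ?thesis using j by simp
    qed
    show "\<exists>!x. x \<in> Q \<and> (\<forall>i<n. sap (q i) x = l i)"
    proof (rule ex1I[of _ "\<Phi> F"])
      have "sap (q i) (\<Phi> F) = l i" if i: "i < n" for i
      proof -
        have "sap (q i) (\<Phi> F) = sap (\<iota> i (?c F)) (sap (Ar (D i) (?in F i)) (snd (F i)))"
          unfolding \<Phi>_def using q\<kappa>[OF i cO[OF gF]] tp[OF gF] i by simp
        also have "\<dots> = sap (\<iota> i (fst (F i))) (snd (F i))"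
          using Lcls[OF i i] in_homD[OF inh[OF gF i]] F[OF i] unfolding class_map_def invariant_def by metis
        finally show ?thesis using F[OF i] by simp
      qed
      then show "\<Phi> F \<in> Q \<and> (\<forall>i<n. sap (q i) (\<Phi> F) = l i)" using \<Phi>Q[OF gF] by blast
    qed (use uniq in blast)
  qed
qed

end

section \<open>Eilenberg--Moore categories and left adjoints\<close>

lemma universal_ext:
  assumes u: "universal_arrow C A U x c \<eta>" and A: "category A" and U: "is_functor C A U" and C: "category C"
    and "h \<in> hom C c d" "h' \<in> hom C c d" "Comp A (Ar U h) \<eta> = Comp A (Ar U h') \<eta>"
  shows "h = h'"
proof -
  have d: "d \<in> Obj C" using category.hom_Obj[OF C assms(5)] by simp
  have \<eta>: "\<eta> \<in> hom A x (Ob U c)" using u by (simp add: universal_arrow_def)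
  have "Comp A (Ar U h) \<eta> \<in> hom A x (Ob U d)" using category.Comp_in[OF A \<eta> functor_Ar[OF U C assms(5)]] .
  then have "\<exists>!k. k \<in> hom C c d \<and> Comp A (Ar U k) \<eta> = Comp A (Ar U h) \<eta>"
    using u d by (simp add: universal_arrow_def)
  then obtain z where "\<forall>k. k \<in> hom C c d \<longrightarrow> Comp A (Ar U k) \<eta> = Comp A (Ar U h) \<eta> \<longrightarrow> k = z" by (rule ex1_conjE)
  then show ?thesis using assms(5-7) by metis
qed

lemma universal_lift:
  assumes "universal_arrow C A U x c \<eta>" "d \<in> Obj C" "g \<in> hom A x (Ob U d)"
  shows "\<exists>h \<in> hom C c d. Comp A (Ar U h) \<eta> = g"
  using assms unfolding universal_arrow_def by blast

lemma universal_arrowI: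
  assumes "c \<in> Obj C" "\<eta> \<in> hom A x (Ob U c)"
    and "\<And>d g. d \<in> Obj C \<Longrightarrow> g \<in> hom A x (Ob U d) \<Longrightarrow> \<exists>h \<in> hom C c d. Comp A (Ar U h) \<eta> = g"
    and "\<And>d h h'. h \<in> hom C c d \<Longrightarrow> h' \<in> hom C c d \<Longrightarrow> Comp A (Ar U h) \<eta> = Comp A (Ar U h') \<eta> \<Longrightarrow> h = h'"
  shows "universal_arrow C A U x c \<eta>"
  unfolding universal_arrow_def
proof (intro conjI assms(1,2) ballI)
  fix d g assume "d \<in> Obj C" "g \<in> hom A x (Ob U d)"
  then obtain h where h: "h \<in> hom C c d" "Comp A (Ar U h) \<eta> = g" using assms(3) by blast
  show "\<exists>!h. h \<in> hom C c d \<and> Comp A (Ar U h) \<eta> = g"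
  proof (rule ex1I[of _ h])
    show "h \<in> hom C c d \<and> Comp A (Ar U h) \<eta> = g" using h by simp
    fix k assume k: "k \<in> hom C c d \<and> Comp A (Ar U k) \<eta> = g"
    show "k = h" by (rule assms(4)[OF conjunct1[OF k] h(1)]) (use h k in simp)
  qed
qed

text \<open>The right adjoint on \<open>C\<close> is only given as a reduct functor after an
  equivalence \<open>K\<close>. Free models provide universal arrows into the reduct functor; they
  are moved to \<open>C\<close> by replacing a universal object with an isomorphic one in the image
  of \<open>K\<close> and adjusting the unit.\<close>

lemma universal_arrow_pullback:
  assumes C: "category C" and D: "category D" and A: "category A" and U: "is_functor D A U"
    and K: "is_functor C D K" "fully_faithful C D K" "ess_surj C D K" and u: "universal_arrow D A U x d \<eta>"
  shows "\<exists>c \<eta>'. universal_arrow C A (comp_func U K) x c \<eta>'"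
proof -
  interpret C: category C by fact
  interpret D: category D by fact
  interpret A: category A by fact
  have d: "d \<in> Obj D" and \<eta>: "\<eta> \<in> hom A x (Ob U d)" using u by (auto simp: universal_arrow_def)
  obtain c \<theta> where c: "c \<in> Obj C" and \<theta>: "\<theta> \<in> hom D (Ob K c) d" "iso_arr D \<theta>" using K(3) d unfolding ess_surj_def by blast
  obtain \<theta>' where \<theta>': "\<theta>' \<in> hom D d (Ob K c)" "Comp D \<theta>' \<theta> = Id D (Ob K c)" "Comp D \<theta> \<theta>' = Id D d"
    using D.iso_arr_iff[OF \<theta>(1)] \<theta>(2) by blast
  note U\<theta>' = functor_Ar[OF U D \<theta>'(1)]
  let ?\<eta> = "Comp A (Ar U \<theta>') \<eta>"
  have \<eta>': "?\<eta> \<in> hom A x (Ob U (Ob K c))" using A.Comp_in[OF \<eta> U\<theta>'] .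
  have *: "Comp A (Ar U k) ?\<eta> = Comp A (Ar U (Comp D k \<theta>')) \<eta>" if "k \<in> hom D (Ob K c) e" for k e
    using A.assoc[OF \<eta> U\<theta>' functor_Ar[OF U D that]] functor_Comp[OF U \<theta>'(1) that] by simp
  have "universal_arrow C A (comp_func U K) x c ?\<eta>"
  proof (rule universal_arrowI[OF c])
    show "?\<eta> \<in> hom A x (Ob (comp_func U K) c)" using \<eta>' by simp
    fix e g assume e: "e \<in> Obj C" and g: "g \<in> hom A x (Ob (comp_func U K) e)"
    then obtain h where h: "h \<in> hom D d (Ob K e)" "Comp A (Ar U h) \<eta> = g"
      using universal_lift[OF u functor_Ob[OF K(1) e]] by auto
    obtain k where k: "k \<in> hom C c e" "Ar K k = Comp D h \<theta>"
      using full[OF K(2) c e D.Comp_in[OF \<theta>(1) h(1)]] by blast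
    have "Comp D (Comp D h \<theta>) \<theta>' = h"
      using D.assoc[OF \<theta>'(1) \<theta>(1) h(1)] \<theta>'(3) D.Id_right[OF h(1)] by simp
    then have "Comp A (Ar (comp_func U K) k) ?\<eta> = g"
      using *[OF functor_Ar[OF K(1) C k(1)]] k(2) h(2) by simp
    then show "\<exists>h\<in>hom C c e. Comp A (Ar (comp_func U K) h) ?\<eta> = g" using k(1) by blast
  next
    fix e h h' assume h: "h \<in> hom C c e" "h' \<in> hom C c e"
      and eq: "Comp A (Ar (comp_func U K) h) ?\<eta> = Comp A (Ar (comp_func U K) h') ?\<eta>"
    note Kh = functor_Ar[OF K(1) C h(1)] functor_Ar[OF K(1) C h(2)]
    have "Comp D (Ar K h) \<theta>' = Comp D (Ar K h') \<theta>'"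
      using universal_ext[OF u A U D D.Comp_in[OF \<theta>'(1) Kh(1)] D.Comp_in[OF \<theta>'(1) Kh(2)]]
        *[OF Kh(1)] *[OF Kh(2)] eq by simp
    moreover have "iso_arr D \<theta>'" using D.iso_arr_iff[OF \<theta>'(1)] \<theta>' \<theta>(1) by blast
    ultimately have "Ar K h = Ar K h'" using D.iso_cancel_right[OF _ \<theta>'(1) Kh] by blast
    then show "h = h'" using faithful[OF K(2) C h] by blast
  qed
  then show ?thesis by blast
qed

text \<open>The way back, with the unit unchanged. It shows that \<open>K\<close> after the left
  adjoint chosen on \<open>C\<close> is free over the reduct functor, although its values are not
  the free models originally constructed.\<close>

lemma universal_arrow_pushforward:
  assumes C: "category C" and D: "category D" and A: "category A" and U: "is_functor D A U"
    and K: "is_functor C D K" "fully_faithful C D K" "ess_surj C D K"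
    and u: "universal_arrow C A (comp_func U K) x c \<eta>"
  shows "universal_arrow D A U x (Ob K c) \<eta>"
proof -
  interpret C: category C by fact
  interpret D: category D by fact
  interpret A: category A by fact
  have c: "c \<in> Obj C" and \<eta>: "\<eta> \<in> hom A x (Ob U (Ob K c))" using u by (auto simp: universal_arrow_def)
  show ?thesis
  proof (rule universal_arrowI[OF functor_Ob[OF K(1) c] \<eta>])
    fix d g assume d: "d \<in> Obj D" and g: "g \<in> hom A x (Ob U d)"
    obtain e \<theta> where e: "e \<in> Obj C" and \<theta>: "\<theta> \<in> hom D (Ob K e) d" "iso_arr D \<theta>" using K(3) d unfolding ess_surj_def by blast
    obtain \<theta>' where \<theta>': "\<theta>' \<in> hom D d (Ob K e)" "Comp D \<theta> \<theta>' = Id D d" using D.iso_arr_iff[OF \<theta>(1)] \<theta>(2) by blast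
    note U\<theta>' = functor_Ar[OF U D \<theta>'(1)] and U\<theta> = functor_Ar[OF U D \<theta>(1)]
    obtain h where h: "h \<in> hom C c e" "Comp A (Ar (comp_func U K) h) \<eta> = Comp A (Ar U \<theta>') g"
      using universal_lift[OF u e] A.Comp_in[OF g U\<theta>'] by auto
    note Kh = functor_Ar[OF K(1) C h(1)]
    have "Comp A (Ar U (Comp D \<theta> (Ar K h))) \<eta> = Comp A (Ar U \<theta>) (Comp A (Ar U \<theta>') g)"
      using A.assoc[OF \<eta> functor_Ar[OF U D Kh] U\<theta>] functor_Comp[OF U Kh \<theta>(1)] h(2) by simp
    also have "\<dots> = g"
      using A.assoc[OF g U\<theta>' U\<theta>] functor_Comp[OF U \<theta>'(1) \<theta>(1)] \<theta>'(2) functor_Id[OF U d] A.Id_left[OF g] by simp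
    finally show "\<exists>h\<in>hom D (Ob K c) d. Comp A (Ar U h) \<eta> = g" using D.Comp_in[OF Kh \<theta>(1)] by blast
  next
    fix d h h' assume h: "h \<in> hom D (Ob K c) d" "h' \<in> hom D (Ob K c) d" and eq: "Comp A (Ar U h) \<eta> = Comp A (Ar U h') \<eta>"
    have d: "d \<in> Obj D" using D.hom_Obj[OF h(1)] by simp
    obtain e \<theta> where e: "e \<in> Obj C" and \<theta>: "\<theta> \<in> hom D (Ob K e) d" "iso_arr D \<theta>" using K(3) d unfolding ess_surj_def by blast
    obtain \<theta>' where \<theta>': "\<theta>' \<in> hom D d (Ob K e)" "Comp D \<theta>' \<theta> = Id D (Ob K e)" "Comp D \<theta> \<theta>' = Id D d"
      using D.iso_arr_iff[OF \<theta>(1)] \<theta>(2) by blast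
    have i: "iso_arr D \<theta>'" using D.iso_arr_iff[OF \<theta>'(1)] \<theta>' \<theta>(1) by blast
    note th = D.Comp_in[OF h(1) \<theta>'(1)] D.Comp_in[OF h(2) \<theta>'(1)]
    obtain k k' where k: "k \<in> hom C c e" "Ar K k = Comp D \<theta>' h" and k': "k' \<in> hom C c e" "Ar K k' = Comp D \<theta>' h'"
      using full[OF K(2) c e th(1)] full[OF K(2) c e th(2)] by blast
    have "Comp A (Ar U (Comp D \<theta>' h)) \<eta> = Comp A (Ar U (Comp D \<theta>' h')) \<eta>"
      using A.assoc[OF \<eta> functor_Ar[OF U D h(1)] functor_Ar[OF U D \<theta>'(1)]]
        A.assoc[OF \<eta> functor_Ar[OF U D h(2)] functor_Ar[OF U D \<theta>'(1)]] functor_Comp[OF U h(1) \<theta>'(1)] functor_Comp[OF U h(2) \<theta>'(1)] eq by simp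
    then have "k = k'"
      using universal_ext[OF u A is_functor_comp[OF C K(1) U] C k(1) k'(1)] k(2) k'(2) by simp
    then have "Comp D \<theta>' h = Comp D \<theta>' h'" using k(2) k'(2) by simp
    then show "h = h'" using D.iso_cancel_left[OF i \<theta>'(1) h] by blast
  qed
qed

lemma cocone_functor:
  assumes J: "category J" and A: "category A" and D: "is_functor J A D" and G: "is_functor A B G" and co: "is_cocone J A D c \<iota>"
  shows "is_cocone J B (comp_func G D) (Ob G c) (\<lambda>j. Ar G (\<iota> j))"
  unfolding is_cocone_def
proof (intro conjI ballI)
  interpret category J by fact
  have \<iota>: "\<iota> j \<in> hom A (Ob D j) c" if "j \<in> Obj J" for j using co that by (simp add: is_cocone_def)
  show "Ob G c \<in> Obj B" using functor_Ob[OF G] co by (simp add: is_cocone_def)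
  show "Ar G (\<iota> j) \<in> hom B (Ob (comp_func G D) j) (Ob G c)" if "j \<in> Obj J" for j
    using functor_Ar[OF G A \<iota>[OF that]] by simp
  show "Comp B (Ar G (\<iota> (Cod J u))) (Ar (comp_func G D) u) = Ar G (\<iota> (Dom J u))" if u: "u \<in> Arr J" for u
  proof -
    have "Comp A (\<iota> (Cod J u)) (Ar D u) = \<iota> (Dom J u)" using co u by (simp add: is_cocone_def)
    then show ?thesis
      using functor_Comp[OF G functor_Ar[OF D J Arr_hom[OF u]] \<iota>[OF Cod_in[OF u]]] by simp
  qed
qed

text \<open>Preservation of colimits by left adjoints, phrased through units alone. It will be
  applied to \<open>K\<close> after the left adjoint, for which a unit but no counit has been
  produced.\<close>

lemma universal_arrows_preserve_colimits:
  assumes J: "category J" and A: "category A" and B: "category B" and D: "is_functor J A D"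
    and G: "is_functor A B G" and U: "is_functor B A U"
    and u: "\<And>x. x \<in> Obj A \<Longrightarrow> universal_arrow B A U x (Ob G x) (\<eta> x)"
    and nat: "\<And>f x y. f \<in> hom A x y \<Longrightarrow> Comp A (Ar U (Ar G f)) (\<eta> x) = Comp A (\<eta> y) f"
    and co: "is_colimit J A D c \<iota>"
  shows "is_colimit J B (comp_func G D) (Ob G c) (\<lambda>j. Ar G (\<iota> j))"
  unfolding is_colimit_def
proof (intro conjI allI impI)
  interpret J: category J by fact
  interpret A: category A by fact
  interpret B: category B by fact
  have coc: "is_cocone J A D c \<iota>" using co by (simp add: is_colimit_def)
  show "is_cocone J B (comp_func G D) (Ob G c) (\<lambda>j. Ar G (\<iota> j))" by (rule cocone_functor[OF J A D G coc])
  have \<iota>: "\<iota> j \<in> hom A (Ob D j) c" if "j \<in> Obj J" for j using coc that by (simp add: is_cocone_def)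
  have cO: "c \<in> Obj A" using coc by (simp add: is_cocone_def)
  have \<eta>: "\<eta> x \<in> hom A x (Ob U (Ob G x))" if "x \<in> Obj A" for x using u[OF that] by (simp add: universal_arrow_def)
  note UG = functor_Ar[OF U B functor_Ar[OF G A]]
  fix d \<kappa> assume cod: "is_cocone J B (comp_func G D) d \<kappa>"
  have \<kappa>: "\<kappa> j \<in> hom B (Ob G (Ob D j)) d" if "j \<in> Obj J" for j using cod that by (simp add: is_cocone_def)
  have dO: "d \<in> Obj B" using cod by (simp add: is_cocone_def)
  let ?\<kappa> = "\<lambda>j. Comp A (Ar U (\<kappa> j)) (\<eta> (Ob D j))"
  have DO: "Ob D j \<in> Obj A" if "j \<in> Obj J" for j using functor_Ob[OF D that] .
  have \<kappa>': "?\<kappa> j \<in> hom A (Ob D j) (Ob U d)" if "j \<in> Obj J" for j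
    using A.Comp_in[OF \<eta>[OF DO[OF that]] functor_Ar[OF U B \<kappa>[OF that]]] .
  have "is_cocone J A D (Ob U d) ?\<kappa>"
    unfolding is_cocone_def
  proof (intro conjI ballI)
    fix v assume v: "v \<in> Arr J"
    let ?x = "Dom J v" and ?y = "Cod J v"
    note Dv = functor_Ar[OF D J Arr_hom[OF v]] and x = J.Dom_in[OF v] and y = J.Cod_in[OF v]
    note GDv = functor_Ar[OF G A Dv]
    have "Comp A (?\<kappa> ?y) (Ar D v) = Comp A (Ar U (\<kappa> ?y)) (Comp A (Ar U (Ar G (Ar D v))) (\<eta> (Ob D ?x)))"
      using A.assoc[OF Dv \<eta>[OF DO[OF y]] functor_Ar[OF U B \<kappa>[OF y]]] nat[OF Dv] by simp
    also have "\<dots> = Comp A (Ar U (Comp B (\<kappa> ?y) (Ar G (Ar D v)))) (\<eta> (Ob D ?x))"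
      using A.assoc[OF \<eta>[OF DO[OF x]] UG[OF Dv] functor_Ar[OF U B \<kappa>[OF y]]] functor_Comp[OF U GDv \<kappa>[OF y]] by simp
    also have "\<dots> = ?\<kappa> ?x" using cod v by (simp add: is_cocone_def)
    finally show "Comp A (?\<kappa> (Cod J v)) (Ar D v) = ?\<kappa> (Dom J v)" .
  qed (use functor_Ob[OF U dO] \<kappa>' in auto)
  then have "\<exists>!h. h \<in> hom A c (Ob U d) \<and> (\<forall>j \<in> Obj J. Comp A h (\<iota> j) = ?\<kappa> j)" using co by (simp add: is_colimit_def)
  then obtain h where h: "h \<in> hom A c (Ob U d)" "\<forall>j \<in> Obj J. Comp A h (\<iota> j) = ?\<kappa> j"
    and hu: "\<forall>k. k \<in> hom A c (Ob U d) \<longrightarrow> (\<forall>j \<in> Obj J. Comp A k (\<iota> j) = ?\<kappa> j) \<longrightarrow> k = h" by (rule ex1_conjE)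
  have key: "Comp A (Ar U (Comp B k (Ar G (\<iota> j)))) (\<eta> (Ob D j)) = Comp A (Comp A (Ar U k) (\<eta> c)) (\<iota> j)"
    if k: "k \<in> hom B (Ob G c) d" and j: "j \<in> Obj J" for k j
  proof -
    note i = \<iota>[OF j]
    note Gi = functor_Ar[OF G A i] and Uk = functor_Ar[OF U B k]
    show ?thesis
      using functor_Comp[OF U Gi k] A.assoc[OF \<eta>[OF DO[OF j]] UG[OF i] Uk] nat[OF i] A.assoc[OF i \<eta>[OF cO] Uk] by simp
  qed
  obtain k where k: "k \<in> hom B (Ob G c) d" "Comp A (Ar U k) (\<eta> c) = h" using universal_lift[OF u[OF cO] dO h(1)] by blast
  show "\<exists>!k. k \<in> hom B (Ob G c) d \<and> (\<forall>j\<in>Obj J. Comp B k (Ar G (\<iota> j)) = \<kappa> j)"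
  proof (rule ex1I[of _ k], intro conjI k(1) ballI)
    fix j assume j: "j \<in> Obj J"
    note Gi = functor_Ar[OF G A \<iota>[OF j]]
    show "Comp B k (Ar G (\<iota> j)) = \<kappa> j"
      using universal_ext[OF u[OF DO[OF j]] A U B B.Comp_in[OF Gi k(1)] \<kappa>[OF j]] key[OF k(1) j] k(2) h(2) j by simp
  next
    fix k' assume k': "k' \<in> hom B (Ob G c) d \<and> (\<forall>j\<in>Obj J. Comp B k' (Ar G (\<iota> j)) = \<kappa> j)"
    have "Comp A (Ar U k') (\<eta> c) \<in> hom A c (Ob U d)" using A.Comp_in[OF \<eta>[OF cO] functor_Ar[OF U B conjunct1[OF k']]] .
    then have "Comp A (Ar U k') (\<eta> c) = h" using hu key[OF conjunct1[OF k']] k' by simp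
    then show "k' = k" using universal_ext[OF u[OF cO] A U B conjunct1[OF k'] k(1)] k(2) by simp
  qed
qed

section \<open>Eilenberg--Moore categories and the comparison functor\<close>

lemma hom_EM: "F \<in> hom (EM_cat A T) (x, a) (y, b) \<longleftrightarrow> (\<exists>f. F = ((x, a), f, (y, b)) \<and> (x, a) \<in> EM_algebras A T \<and>
    (y, b) \<in> EM_algebras A T \<and> f \<in> hom A x y \<and> Comp A f a = Comp A b (Ar (endo T) f))"
  by (cases F) (auto simp: hom_def EM_cat_def)

lemma EM_sel [simp]: "Obj (EM_cat A T) = EM_algebras A T" "Id (EM_cat A T) X = (X, Id A (fst X), X)"
  "Comp (EM_cat A T) (Y, g, Z) (X, f, Y') = (X, Comp A g f, Z)"
  by (simp_all add: EM_cat_def)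

lemma category_EM:
  assumes A: "category A" and T: "is_functor A A (endo T)"
  shows "category (EM_cat A T)"
proof -
  interpret category A by fact
  have alg: "x \<in> Obj A" "a \<in> hom A (Ob (endo T) x) x" if "(x, a) \<in> EM_algebras A T" for x a
    using that by (auto simp: EM_algebras_def)
  show ?thesis
  proof
    fix X assume "X \<in> Obj (EM_cat A T)"
    then obtain x a where X: "X = (x, a)" "(x, a) \<in> EM_algebras A T" by (cases X) auto
    note xa = alg[OF X(2)]
    have "Comp A (Id A x) a = Comp A a (Ar (endo T) (Id A x))"
      using functor_Id[OF T xa(1)] Id_left[OF xa(2)] Id_right[OF xa(2)] by simp
    then show "Id (EM_cat A T) X \<in> hom (EM_cat A T) X X" using X Id_in[OF xa(1)] by (simp add: hom_EM)
  next
    fix F G X Y Z assume FG: "F \<in> hom (EM_cat A T) X Y" "G \<in> hom (EM_cat A T) Y Z"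
    obtain x a y b z c where XYZ: "X = (x, a)" "Y = (y, b)" "Z = (z, c)" by (cases X, cases Y, cases Z)
    obtain f g where f: "F = (X, f, Y)" "f \<in> hom A x y" "Comp A f a = Comp A b (Ar (endo T) f)"
      and g: "G = (Y, g, Z)" "g \<in> hom A y z" "Comp A g b = Comp A c (Ar (endo T) g)"
      and O: "(x, a) \<in> EM_algebras A T" "(y, b) \<in> EM_algebras A T" "(z, c) \<in> EM_algebras A T"
      using FG unfolding XYZ hom_EM by blast
    note a = alg(2)[OF O(1)] and b = alg(2)[OF O(2)] and c = alg(2)[OF O(3)]
    note Tf = functor_Ar[OF T A f(2)] and Tg = functor_Ar[OF T A g(2)]
    have "Comp A (Comp A g f) a = Comp A g (Comp A b (Ar (endo T) f))" using assoc[OF a f(2) g(2)] f(3) by simp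
    also have "\<dots> = Comp A c (Comp A (Ar (endo T) g) (Ar (endo T) f))"
      using assoc[OF Tf b g(2)] g(3) assoc[OF Tf Tg c] by simp
    also have "\<dots> = Comp A c (Ar (endo T) (Comp A g f))" using functor_Comp[OF T f(2) g(2)] by simp
    finally show "Comp (EM_cat A T) G F \<in> hom (EM_cat A T) X Z"
      using f g O Comp_in[OF f(2) g(2)] unfolding XYZ by (simp add: hom_EM)
  next
    fix F X Y assume F: "F \<in> hom (EM_cat A T) X Y"
    obtain x a y b where XY: "X = (x, a)" "Y = (y, b)" by (cases X, cases Y)
    show "Comp (EM_cat A T) (Id (EM_cat A T) Y) F = F" "Comp (EM_cat A T) F (Id (EM_cat A T) X) = F"
      using F Id_left Id_right unfolding XY hom_EM by auto
  next
    fix F G H X Y Z W assume "F \<in> hom (EM_cat A T) X Y" "G \<in> hom (EM_cat A T) Y Z" "H \<in> hom (EM_cat A T) Z W"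
    then show "Comp (EM_cat A T) H (Comp (EM_cat A T) G F) = Comp (EM_cat A T) (Comp (EM_cat A T) H G) F"
      using assoc by (cases X; cases Y; cases Z; cases W) (auto simp: hom_EM)
  qed (auto simp: EM_cat_def)
qed

lemma EM_iso:
  assumes A: "category A" and T: "is_functor A A (endo T)"
    and F: "((x, a), f, (y, b)) \<in> hom (EM_cat A T) (x, a) (y, b)" and i: "iso_arr A f"
  shows "iso_arr (EM_cat A T) ((x, a), f, (y, b))"
proof -
  interpret category A by fact
  interpret E: category "EM_cat A T" by (rule category_EM[OF A T])
  have f: "f \<in> hom A x y" "Comp A f a = Comp A b (Ar (endo T) f)"
    and O: "(x, a) \<in> EM_algebras A T" "(y, b) \<in> EM_algebras A T" using F by (auto simp: hom_EM)
  have a: "a \<in> hom A (Ob (endo T) x) x" and b: "b \<in> hom A (Ob (endo T) y) y" and y: "y \<in> Obj A"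
    using O by (auto simp: EM_algebras_def)
  obtain g where g: "g \<in> hom A y x" "Comp A g f = Id A x" "Comp A f g = Id A y" using iso_arr_iff[OF f(1)] i by blast
  note Tf = functor_Ar[OF T A f(1)] and Tg = functor_Ar[OF T A g(1)]
  have "Comp A g b = Comp A g (Comp A b (Comp A (Ar (endo T) f) (Ar (endo T) g)))"
    using functor_Comp[OF T g(1) f(1)] g(3) functor_Id[OF T y] Id_right[OF b] by simp
  also have "\<dots> = Comp A g (Comp A (Comp A f a) (Ar (endo T) g))" using assoc[OF Tg Tf b] f(2) by simp
  also have "\<dots> = Comp A (Comp A g f) (Comp A a (Ar (endo T) g))"
    using assoc[OF Tg a f(1)] assoc[OF Comp_in[OF Tg a] f(1) g(1)] by simp
  also have "\<dots> = Comp A a (Ar (endo T) g)" using g(2) Id_left[OF Comp_in[OF Tg a]] by simp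
  finally have "((y, b), g, (x, a)) \<in> hom (EM_cat A T) (y, b) (x, a)" using O g(1) by (simp add: hom_EM)
  then show ?thesis
    unfolding E.iso_arr_iff[OF F] using g by (intro bexI[of _ "((y, b), g, (x, a))"]) auto
qed

lemma comparison_sel [simp]: "Ob (comparison C U \<epsilon>) c = (Ob U c, Ar U (\<epsilon> c))"
  "Ar (comparison C U \<epsilon>) f = ((Ob U (Dom C f), Ar U (\<epsilon> (Dom C f))), Ar U f, (Ob U (Cod C f), Ar U (\<epsilon> (Cod C f))))"
  by (simp_all add: comparison_def Let_def)

lemma induced_monad_sel [simp]: "endo (induced_monad F U \<eta> \<epsilon>) = comp_func U F" "unit (induced_monad F U \<eta> \<epsilon>) = \<eta>"
  "mult (induced_monad F U \<eta> \<epsilon>) x = Ar U (\<epsilon> (Ob F x))"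
  by (simp_all add: induced_monad_def)

locale adj = C: category C + A: category A for C :: "('o, 'a) cat" and A :: "('p, 'b) cat" +
  fixes F U \<eta> \<epsilon>
  assumes adj: "adjunction C A F U \<eta> \<epsilon>"
begin

lemma F: "is_functor A C F" and U: "is_functor C A U"
  using adj by (auto simp: adjunction_def)

lemmas FO = functor_Ob[OF F] and FA = functor_Ar[OF F A.category_axioms]
  and UO = functor_Ob[OF U] and UA = functor_Ar[OF U C.category_axioms]

lemma \<eta>: "x \<in> Obj A \<Longrightarrow> \<eta> x \<in> hom A x (Ob U (Ob F x))"
  and \<epsilon>: "c \<in> Obj C \<Longrightarrow> \<epsilon> c \<in> hom C (Ob F (Ob U c)) c"
  and \<eta>_nat: "f \<in> hom A x y \<Longrightarrow> Comp A (\<eta> y) f = Comp A (Ar U (Ar F f)) (\<eta> x)"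
  and \<epsilon>_nat: "g \<in> hom C c d \<Longrightarrow> Comp C (\<epsilon> d) (Ar F (Ar U g)) = Comp C g (\<epsilon> c)"
  and tri_F: "x \<in> Obj A \<Longrightarrow> Comp C (\<epsilon> (Ob F x)) (Ar F (\<eta> x)) = Id C (Ob F x)"
  and tri_U: "c \<in> Obj C \<Longrightarrow> Comp A (Ar U (\<epsilon> c)) (\<eta> (Ob U c)) = Id A (Ob U c)"
  using adj by (auto simp: adjunction_def nat_trans_def hom_def)

lemma UF: "is_functor A A (comp_func U F)"
  by (rule is_functor_comp[OF A.category_axioms F U])

abbreviation "Mon \<equiv> induced_monad F U \<eta> \<epsilon>"

lemma category_EM_Mon: "category (EM_cat A Mon)"
  by (rule category_EM[OF A.category_axioms]) (simp add: UF)

lemma comparison_Obj: "c \<in> Obj C \<Longrightarrow> (Ob U c, Ar U (\<epsilon> c)) \<in> EM_algebras A Mon"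
proof -
  assume c: "c \<in> Obj C"
  note e = \<epsilon>[OF c] and ux = UO[OF c]
  note Fe = FA[OF UA[OF e]]
  have "Comp A (Ar U (\<epsilon> c)) (Ar U (\<epsilon> (Ob F (Ob U c)))) = Comp A (Ar U (\<epsilon> c)) (Ar U (Ar F (Ar U (\<epsilon> c))))"
    using functor_Comp[OF U \<epsilon>[OF FO[OF ux]] e] functor_Comp[OF U Fe e] \<epsilon>_nat[OF e] by simp
  then show ?thesis using UA[OF e] ux tri_U[OF c] by (simp add: EM_algebras_def)
qed

lemma comparison_hom: "f \<in> hom C c d \<Longrightarrow> Ar (comparison C U \<epsilon>) f \<in> hom (EM_cat A Mon) (Ob (comparison C U \<epsilon>) c) (Ob (comparison C U \<epsilon>) d)"
proof -
  assume f: "f \<in> hom C c d"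
  have c: "c \<in> Obj C" and d: "d \<in> Obj C" using C.hom_Obj[OF f] by auto
  have "Comp A (Ar U f) (Ar U (\<epsilon> c)) = Comp A (Ar U (\<epsilon> d)) (Ar U (Ar F (Ar U f)))"
    using functor_Comp[OF U \<epsilon>[OF c] f] functor_Comp[OF U FA[OF UA[OF f]] \<epsilon>[OF d]] \<epsilon>_nat[OF f] by simp
  then show ?thesis using comparison_Obj[OF c] comparison_Obj[OF d] UA[OF f] in_homD[OF f] by (simp add: hom_EM)
qed

lemma comparison_functor: "is_functor C (EM_cat A Mon) (comparison C U \<epsilon>)"
  unfolding is_functor_def
proof (intro conjI ballI impI)
  fix c assume c: "c \<in> Obj C"
  show "Ob (comparison C U \<epsilon>) c \<in> Obj (EM_cat A Mon)" using comparison_Obj[OF c] by simp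
  show "Ar (comparison C U \<epsilon>) (Id C c) = Id (EM_cat A Mon) (Ob (comparison C U \<epsilon>) c)"
    using functor_Id[OF U c] in_homD[OF C.Id_in[OF c]] by simp
next
  fix f g assume fg: "f \<in> Arr C" "g \<in> Arr C" "Cod C f = Dom C g"
  have f: "f \<in> hom C (Dom C f) (Dom C g)" and g: "g \<in> hom C (Dom C g) (Cod C g)"
    using fg by (auto simp: hom_def)
  show "Ar (comparison C U \<epsilon>) (Comp C g f) = Comp (EM_cat A Mon) (Ar (comparison C U \<epsilon>) g) (Ar (comparison C U \<epsilon>) f)"
    using functor_Comp[OF U f g] in_homD[OF C.Comp_in[OF f g]] fg by simp
qed (rule comparison_hom)

end

section \<open>Categories of models are monadic\<close>

context univ begin

text \<open>The right adjoint \<open>U\<close> is the reduct functor \<open>R\<close> after an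
  equivalence \<open>K\<close>, so everything is computed with elements in \<open>Ob K c\<close>.
  Preservation of the operations of \<open>T\<close>, which the category of models of
  \<open>S\<close> does not see, is forced by the algebra laws applied to the values of these
  operations in free models.\<close>

lemma monadic_of_equivalence:
  fixes S :: "('s, 'f, 'r) pht" and T :: "('s, 'g, 'q) pht" and C :: "('o, 'a) cat"
  assumes S: "equational_theory TYPE('u) S" and T: "equational_theory TYPE('u) T"
    and m: "model_morphism TYPE('u) S T \<rho>" and C: "category C"
    and eq: "equivalent_cats C (PMod T :: ('s, 'g, 'q, 'u) pstructure_cat)"
  shows "monadic_sifted TYPE('u) C (PMod S :: ('s, 'f, 'r, 'u) pstructure_cat)"
proof -
  let ?A = "PMod S :: ('s, 'f, 'r, 'u) pstructure_cat" and ?D = "PMod T :: ('s, 'g, 'q, 'u) pstructure_cat"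
  define R :: "(('s, 'g, 'q, 'u) pstructure, _, ('s, 'f, 'r, 'u) pstructure, _) func" where "R = redf (sgn S) \<rho>"
  have RO: "Ob R = red (sgn S) \<rho>" and Rap: "ap (Ar R f) = ap f" for f by (simp_all add: R_def)
  have R: "is_functor ?D ?A R" unfolding R_def by (rule is_functor_redf[OF S m])
  note cA = category_PMod[of S] and cD = category_PMod[of T]
  interpret C: category C by (rule C)
  interpret A: category ?A by (rule cA)
  interpret D: category ?D by (rule cD)
  have am: "arity_map (sgn S) (sgn T) \<rho>" using m by (simp add: model_morphism_def)
  have rS: "rels (sgn S) = {}" using S by (simp add: equational_theory_def)
  obtain K where "is_equivalence C ?D K" using eq equivalent_cats_def by blast
  note K = is_equivalenceD[OF C cD this]
  define U where "U = comp_func R K"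
  have U: "is_functor C ?A U" unfolding U_def by (rule is_functor_comp[OF C K(1) R])
  have "\<exists>c \<eta>. universal_arrow C ?A U x c \<eta>" if x: "x \<in> Obj ?A" for x
  proof -
    obtain F \<eta> where "universal_arrow ?D ?A R x F \<eta>" using free_universal[OF S T m, of x] x unfolding R_def Obj_PMod by blast
    then show ?thesis unfolding U_def by (rule universal_arrow_pullback[OF C cD cA R K])
  qed
  then obtain F \<eta> \<epsilon> where adj: "adjunction C ?A F U \<eta> \<epsilon>" and uC: "\<forall>x \<in> Obj ?A. universal_arrow C ?A U x (Ob F x) (\<eta> x)"
    using adjunction_of_universal_arrows[OF C cA U] by blast
  interpret adj C ?A F U \<eta> \<epsilon> by unfold_locales (rule adj)
  have uD: "universal_arrow ?D ?A R x (Ob K (Ob F x)) (\<eta> x)" if "x \<in> Obj ?A" for x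
    using universal_arrow_pushforward[OF C cD cA R K] uC that unfolding U_def by blast
  have UR: "Ob U c = red (sgn S) \<rho> (Ob K c)" "ap (Ar U f) = ap (Ar K f)" for c f by (simp_all add: U_def RO Rap)
  have carU: "car (Ob U c) = car (Ob K c)" for c by (simp add: UR)
  have Km: "is_pmodel T (Ob K c)" if "c \<in> Obj C" for c using functor_Ob[OF K(1) that] by simp
  note KA = functor_Ar[OF K(1) C]
  have \<epsilon>\<eta>: "ap (Ar K (\<epsilon> c)) s (ap (\<eta> (Ob U c)) s x) = x" if "c \<in> Obj C" "x \<in> car (Ob K c) s" for c s x
    using ap_Comp[OF \<eta>[OF UO[OF that(1)]] UA[OF \<epsilon>[OF that(1)]], of x s] tri_U[OF that(1)] ap_Id[of x "Ob U c" s S] that(2)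
    by (simp add: carU UR(2))
  have \<eta>n: "ap (\<eta> y) s (ap f s x) = ap (Ar K (Ar F f)) s (ap (\<eta> x') s x)" if f: "f \<in> hom ?A x' y" and x: "x \<in> car x' s" for f x' y s x
  proof -
    have o: "x' \<in> Obj ?A" "y \<in> Obj ?A" using A.hom_Obj[OF f] by auto
    show ?thesis
      using ap_Comp[OF f \<eta>[OF o(2)] x] ap_Comp[OF \<eta>[OF o(1)] UA[OF FA[OF f]] x] \<eta>_nat[OF f] by (simp add: UR(2))
  qed
  have \<eta>c: "ap (\<eta> x') s x \<in> car (Ob K (Ob F x')) s" if "x' \<in> Obj ?A" "x \<in> car x' s" for x' s x
    using ap_car[OF \<eta>[OF that(1)] that(2)] by (simp add: carU)
  have \<eta>t: "hmap (ap (\<eta> x')) ss xs \<in> tup (Ob K (Ob F x')) ss" if "x' \<in> Obj ?A" "xs \<in> tup x' ss" for x' ss xs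
    using hmap_tup[OF that(2)] \<eta>c[OF that(1)] by metis
  have Kt: "total_str (sgn T) (Ob K c)" if "c \<in> Obj C" for c using model_total[OF T Km[OF that]] .

  have alg: "\<exists>B. is_pmodel T B \<and> Ob R B = X \<and> (Ob K (Ob F X), ap a, B) \<in> hom ?D (Ob K (Ob F X)) B"
    if Xa: "(X, a) \<in> EM_algebras ?A Mon" for X a
  proof -
    have X: "X \<in> Obj ?A" and a: "a \<in> hom ?A (Ob U (Ob F X)) X" and a1: "Comp ?A a (\<eta> X) = Id ?A X"
      and a2: "Comp ?A a (Ar U (\<epsilon> (Ob F X))) = Comp ?A a (Ar U (Ar F a))"
      using Xa by (auto simp: EM_algebras_def)
    let ?G = "Ob K (Ob F X)" and ?W = "Ob U (Ob F X)"
    note FX = FO[OF X]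
    have W: "?W \<in> Obj ?A" using UO[OF FX] .
    have Xt: "total_str (sgn S) X" using model_total[OF S] X by simp
    have aeta: "ap a s (ap (\<eta> X) s x) = x" if "x \<in> car X s" for s x
      using ap_Comp[OF \<eta>[OF X] a that] a1 ap_Id[OF that, of S] by simp
    have acar: "ap a s z \<in> car X s" if "z \<in> car ?G s" for s z using ap_car[OF a] that by (simp add: carU)
    have amu: "ap a s (ap (Ar K (\<epsilon> (Ob F X))) s w) = ap a s (ap (Ar K (Ar F a)) s w)" if "w \<in> car (Ob K (Ob F ?W)) s" for s w
      using ap_Comp[OF UA[OF \<epsilon>[OF FX]] a, of w s] ap_Comp[OF UA[OF FA[OF a]] a, of w s] a2 that by (simp add: carU UR(2))
    define p where "p g xs = ap a (fsort (sgn T) g) (opn ?G g (hmap (ap (\<eta> X)) (farity (sgn T) g) xs))" for g xs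
    define B where "B = (mkstr (sgn T) (car X) p :: ('s, 'g, 'q, 'u) pstructure)"
    have carB: "car B = car X" by (simp add: B_def)
    have opB: "opn B g xs = p g xs" if "g \<in> funs (sgn T)" "xs \<in> tup X (farity (sgn T) g)" for g xs
      unfolding B_def by (rule opn_mkstr[OF that])
    have Bt: "total_str (sgn T) B"
      unfolding B_def
    proof (rule total_mkstr)
      show "rels (sgn T) = {}" using T by (simp add: equational_theory_def)
      show "small TYPE('u) (car X s)" for s using Xt by (simp add: total_str_def is_pstructure_def)
      show "car X s = {}" if "s \<notin> sorts (sgn T)" for s
        using Xt that am by (simp add: total_str_def is_pstructure_def arity_map_def)
      show "p g xs \<in> car X (fsort (sgn T) g)" if "g \<in> funs (sgn T)" "xs \<in> listset (map (car X) (farity (sgn T) g))" for g xs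
        unfolding p_def by (intro acar total_strD(2)[OF Kt[OF FX] that(1)] \<eta>t[OF X that(2)])
    qed
    \<comment> \<open>Both sides are values of \<open>a\<close> derived from the single element
      \<open>?w\<close>, an operation applied to generators in the doubly free model. The counit
      sends \<open>?w\<close> to \<open>g\<close> evaluated at \<open>zs\<close>, the free extension
      of \<open>a\<close> sends it to \<open>g\<close> evaluated at the units of the entries
      \<open>a(zs)\<close>, and associativity of \<open>a\<close> equates the results.\<close>
    have key: "ap a (fsort (sgn T) g) (opn ?G g zs) = opn B g (hmap (ap a) (farity (sgn T) g) zs)"
      if g: "g \<in> funs (sgn T)" and zs: "zs \<in> tup ?G (farity (sgn T) g)" for g zs
    proof -
      let ?ss = "farity (sgn T) g" and ?s = "fsort (sgn T) g"
      let ?H = "Ob K (Ob F ?W)"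
      have zW: "zs \<in> tup ?W ?ss" using zs by (simp add: carU)
      let ?ys = "hmap (ap (\<eta> ?W)) ?ss zs"
      have ys: "?ys \<in> tup ?H ?ss" using \<eta>t[OF W zW] .
      let ?w = "opn ?H g ?ys"
      have w: "?w \<in> car ?H ?s" using total_strD(2)[OF Kt[OF FO[OF W]] g ys] .
      have "hmap (ap (Ar K (\<epsilon> (Ob F X)))) ?ss ?ys = hmap (\<lambda>s x. ap (Ar K (\<epsilon> (Ob F X))) s (ap (\<eta> ?W) s x)) ?ss zs"
        using zs by (simp add: hmap_hmap in_tup)
      also have "\<dots> = zs" using zs by (rule hmap_ident) (rule \<epsilon>\<eta>[OF FX])
      finally have 1: "ap (Ar K (\<epsilon> (Ob F X))) ?s ?w = opn ?G g zs" using ap_opn[OF T KA[OF \<epsilon>[OF FX]] g ys] by simp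
      have "hmap (ap (Ar K (Ar F a))) ?ss ?ys = hmap (\<lambda>s x. ap (Ar K (Ar F a)) s (ap (\<eta> ?W) s x)) ?ss zs"
        using zs by (simp add: hmap_hmap in_tup)
      also have "\<dots> = hmap (\<lambda>s x. ap (\<eta> X) s (ap a s x)) ?ss zs"
        using zW by (rule hmap_cong) (simp add: \<eta>n[OF a])
      also have "\<dots> = hmap (ap (\<eta> X)) ?ss (hmap (ap a) ?ss zs)" using zs by (simp add: hmap_hmap in_tup)
      finally have 2: "ap (Ar K (Ar F a)) ?s ?w = opn ?G g (hmap (ap (\<eta> X)) ?ss (hmap (ap a) ?ss zs))"
        using ap_opn[OF T KA[OF FA[OF a]] g ys] by simp
      have "hmap (ap a) ?ss zs \<in> tup X ?ss" using zs acar by (rule hmap_tup)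
      from opB[OF g this] show ?thesis using amu[OF w] 1 2 by (simp add: p_def)
    qed
    have ext: "restrict (ap a s) (car ?G s) = ap a s" for s
      using a by (auto simp: hom_PMod is_hom_def PiE_def extensional_restrict carU)
    have hom: "is_hom (sgn T) ?G B (ap a)"
      using total_homI[OF Kt[OF FX] Bt, of "ap a"] acar key by (simp add: ext carB)
    \<comment> \<open>Each tuple of \<open>X\<close> is the image under \<open>a\<close> of its
      image under the unit, so axioms pass from the free model to \<open>B\<close>.\<close>
    have Bm: "is_pmodel T B"
    proof (rule modelI[OF Bt])
      fix e assume e: "e \<in> axs T"
      have te: "prem e = Top" "wf_horn (sgn T) (ctx e) (concl e)"
        using T e by (auto simp: equational_theory_def is_pht_def wf_sequent_def)
      show "valid B e" unfolding valid_Top[OF te(1)]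
      proof
        fix xs assume "xs \<in> tup B (map fst (ctx e))"
        then have xs: "xs \<in> tup X (map fst (ctx e))" using carB by simp
        note ys = \<eta>t[OF X xs]
        have "holds ?G (ctx e) (hmap (ap (\<eta> X)) (map fst (ctx e)) xs) (concl e)"
          using Km[OF FX] e ys unfolding is_pmodel_def by (auto simp: valid_Top[OF te(1)])
        from hom_holds[OF Kt[OF FX] hom te(2) ys this]
        have "holds B (ctx e) (hmap (ap a) (map fst (ctx e)) (hmap (ap (\<eta> X)) (map fst (ctx e)) xs)) (concl e)" .
        moreover have "hmap (ap a) (map fst (ctx e)) (hmap (ap (\<eta> X)) (map fst (ctx e)) xs) = xs"
        proof -
          have "length xs = length (map fst (ctx e))" using xs by (simp add: in_tup)
          moreover have "hmap (\<lambda>s x. ap a s (ap (\<eta> X) s x)) (map fst (ctx e)) xs = xs"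
            using xs by (rule hmap_ident) (rule aeta)
          ultimately show ?thesis by (simp only: hmap_hmap)
        qed
        ultimately show "holds B (ctx e) xs (concl e)" by simp
      qed
    qed
    \<comment> \<open>For symbols coming from \<open>S\<close> the new operation is the old one: the
      unit is a homomorphism of models of \<open>S\<close>, and \<open>a\<close> retracts
      it.\<close>
    have "red (sgn S) \<rho> B = X"
    proof (rule total_str_ext[OF total_red[OF am rS Bt] Xt])
      show "car (red (sgn S) \<rho> B) = car X" by (simp add: carB)
      fix f xs assume f: "f \<in> funs (sgn S)" and "xs \<in> tup (red (sgn S) \<rho> B) (farity (sgn S) f)"
      then have xs: "xs \<in> tup X (farity (sgn S) f)" by (simp add: carB)
      have \<rho>f: "\<rho> f \<in> funs (sgn T)" "farity (sgn T) (\<rho> f) = farity (sgn S) f" "fsort (sgn T) (\<rho> f) = fsort (sgn S) f"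
        using am f by (auto simp: arity_map_def)
      have "opn B (\<rho> f) xs = ap a (fsort (sgn S) f) (opn ?G (\<rho> f) (hmap (ap (\<eta> X)) (farity (sgn S) f) xs))"
        using opB[OF \<rho>f(1)] xs \<rho>f by (simp add: p_def)
      also have "opn ?G (\<rho> f) (hmap (ap (\<eta> X)) (farity (sgn S) f) xs) = ap (\<eta> X) (fsort (sgn S) f) (opn X f xs)"
        using ap_opn[OF S \<eta>[OF X] f xs] f by (simp add: UR opn_red)
      finally show "opn (red (sgn S) \<rho> B) f xs = opn X f xs"
        using f aeta[OF total_strD(2)[OF Xt f xs]] by (simp add: opn_red)
    qed
    then show ?thesis using Bm hom Km[OF FX] by (intro exI[of _ B]) (simp add: hom_PMod RO)
  qed

  have Rinj: "f = g" if "f \<in> hom ?D M N" "g \<in> hom ?D M N" "Ar R f = Ar R g" for f g M N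
    using that Rap by (intro arr_eqI[OF that(1,2)]) metis
  have "is_equivalence C (EM_cat ?A Mon) (comparison C U \<epsilon>)"
  proof (rule is_equivalenceI[OF C category_EM_Mon comparison_functor])
    show "fully_faithful C (EM_cat ?A Mon) (comparison C U \<epsilon>)"
    proof (rule fully_faithfulI[OF comparison_functor C])
      fix x y f g assume f: "f \<in> hom C x y" and g: "g \<in> hom C x y" and e: "Ar (comparison C U \<epsilon>) f = Ar (comparison C U \<epsilon>) g"
      then have "Ar R (Ar K f) = Ar R (Ar K g)" by (simp add: U_def)
      then have "Ar K f = Ar K g" by (rule Rinj[OF KA[OF f] KA[OF g]])
      then show "f = g" by (rule faithful[OF K(2) C f g])
    next
      fix x y k assume x: "x \<in> Obj C" and y: "y \<in> Obj C"
        and "k \<in> hom (EM_cat ?A Mon) (Ob (comparison C U \<epsilon>) x) (Ob (comparison C U \<epsilon>) y)"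
      then obtain h where k: "k = (Ob (comparison C U \<epsilon>) x, h, Ob (comparison C U \<epsilon>) y)" and h: "h \<in> hom ?A (Ob U x) (Ob U y)"
        and he: "Comp ?A h (Ar U (\<epsilon> x)) = Comp ?A (Ar U (\<epsilon> y)) (Ar U (Ar F h))" by (auto simp: hom_EM)
      have hc: "ap h s m \<in> car (Ob K y) s" if "m \<in> car (Ob K x) s" for s m using ap_car[OF h] that by (simp add: carU)
      have hw: "ap h s (ap (Ar K (\<epsilon> x)) s w) = ap (Ar K (\<epsilon> y)) s (ap (Ar K (Ar F h)) s w)"
        if "w \<in> car (Ob K (Ob F (Ob U x))) s" for s w
        using ap_Comp[OF UA[OF \<epsilon>[OF x]] h, of w s] ap_Comp[OF UA[OF FA[OF h]] UA[OF \<epsilon>[OF y]], of w s] he that by (simp add: carU UR(2))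
      \<comment> \<open>The same device for morphisms: \<open>?w\<close> is the operation applied to
        generators in the free model over \<open>Ob U x\<close>. Computing \<open>h\<close> of its
        counit value in the two ways allowed by \<open>hw\<close> gives the two sides.\<close>
      have "ap h (fsort (sgn T) g) (opn (Ob K x) g ms) = opn (Ob K y) g (hmap (ap h) (farity (sgn T) g) ms)"
        if g: "g \<in> funs (sgn T)" and ms: "ms \<in> tup (Ob K x) (farity (sgn T) g)" for g ms
      proof -
        let ?ss = "farity (sgn T) g" and ?s = "fsort (sgn T) g"
        have mU: "ms \<in> tup (Ob U x) ?ss" using ms by (simp add: carU)
        let ?ys = "hmap (ap (\<eta> (Ob U x))) ?ss ms"
        have ys: "?ys \<in> tup (Ob K (Ob F (Ob U x))) ?ss" using \<eta>t[OF UO[OF x] mU] .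
        let ?w = "opn (Ob K (Ob F (Ob U x))) g ?ys"
        have w: "?w \<in> car (Ob K (Ob F (Ob U x))) ?s" using total_strD(2)[OF Kt[OF FO[OF UO[OF x]]] g ys] .
        have "hmap (ap (Ar K (\<epsilon> x))) ?ss ?ys = hmap (\<lambda>s m. ap (Ar K (\<epsilon> x)) s (ap (\<eta> (Ob U x)) s m)) ?ss ms"
          using ms by (simp add: hmap_hmap in_tup)
        also have "\<dots> = ms" using ms by (rule hmap_ident) (rule \<epsilon>\<eta>[OF x])
        finally have 1: "ap (Ar K (\<epsilon> x)) ?s ?w = opn (Ob K x) g ms" using ap_opn[OF T KA[OF \<epsilon>[OF x]] g ys] by simp
        have "hmap (ap (Ar K (Ar F h))) ?ss ?ys = hmap (\<lambda>s m. ap (Ar K (Ar F h)) s (ap (\<eta> (Ob U x)) s m)) ?ss ms"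
          using ms by (simp add: hmap_hmap in_tup)
        also have "\<dots> = hmap (\<lambda>s m. ap (\<eta> (Ob U y)) s (ap h s m)) ?ss ms"
          using mU by (rule hmap_cong) (simp add: \<eta>n[OF h])
        finally have "hmap (ap (Ar K (\<epsilon> y))) ?ss (hmap (ap (Ar K (Ar F h))) ?ss ?ys)
           = hmap (\<lambda>s m. ap (Ar K (\<epsilon> y)) s (ap (\<eta> (Ob U y)) s (ap h s m))) ?ss ms"
          using ms by (simp add: hmap_hmap in_tup)
        also have "\<dots> = hmap (ap h) ?ss ms" using ms by (rule hmap_cong) (simp add: \<epsilon>\<eta>[OF y] hc)
        finally have "ap (Ar K (\<epsilon> y)) ?s (ap (Ar K (Ar F h)) ?s ?w) = opn (Ob K y) g (hmap (ap h) ?ss ms)"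
          using ap_opn[OF T KA[OF FA[OF h]] g ys] ap_opn[OF T KA[OF \<epsilon>[OF y]] g ap_tup[OF KA[OF FA[OF h]] ys]] by simp
        then show ?thesis using hw[OF w] 1 by simp
      qed
      moreover have ext: "restrict (ap h s) (car (Ob K x) s) = ap h s" for s
        using h by (auto simp: hom_PMod is_hom_def PiE_def extensional_restrict carU)
      ultimately have "is_hom (sgn T) (Ob K x) (Ob K y) (ap h)"
        using total_homI[OF Kt[OF x] Kt[OF y], of "ap h"] hc by (simp add: ext)
      then have h': "(Ob K x, ap h, Ob K y) \<in> hom ?D (Ob K x) (Ob K y)" using Km[OF x] Km[OF y] by (simp add: hom_PMod)
      then obtain j where j: "j \<in> hom C x y" "Ar K j = (Ob K x, ap h, Ob K y)" using full[OF K(2) x y] by blast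
      have "Ar U j = h"
      proof -
        have "h = (Ob U x, ap h, Ob U y)" using h by (simp add: hom_PMod)
        moreover have "Ar U j = (Ob U x, ap h, Ob U y)" using j(2) by (simp add: U_def R_def redf_def)
        ultimately show ?thesis by simp
      qed
      then show "\<exists>f\<in>hom C x y. Ar (comparison C U \<epsilon>) f = k" using j(1) in_homD[OF j(1)] k by (intro bexI[of _ j]) auto
    qed
    show "ess_surj C (EM_cat ?A Mon) (comparison C U \<epsilon>)"
      unfolding ess_surj_def
    proof
      fix Xa assume "Xa \<in> Obj (EM_cat ?A Mon)"
      then obtain X a where Xa: "Xa = (X, a)" "(X, a) \<in> EM_algebras ?A Mon" by (cases Xa) auto
      obtain B where B: "is_pmodel T B" "Ob R B = X" "(Ob K (Ob F X), ap a, B) \<in> hom ?D (Ob K (Ob F X)) B" using alg[OF Xa(2)] by blast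
      have X: "X \<in> Obj ?A" and a: "a \<in> hom ?A (Ob U (Ob F X)) X" and a1: "Comp ?A a (\<eta> X) = Id ?A X"
        using Xa(2) by (auto simp: EM_algebras_def)
      let ?a = "(Ob K (Ob F X), ap a, B)"
      have Ra: "Ar R ?a = a"
      proof -
        have "a = (Ob U (Ob F X), ap a, X)" using a by (simp add: hom_PMod)
        then show ?thesis using B(2) by (simp add: R_def redf_def UR)
      qed
      obtain c \<theta> where c: "c \<in> Obj C" and \<theta>: "\<theta> \<in> hom ?D (Ob K c) B" "iso_arr ?D \<theta>" 
        using K(3)[unfolded ess_surj_def, rule_format, of B] B(1) unfolding Obj_PMod by blast
      have R\<theta>: "Ar R \<theta> \<in> hom ?A (Ob U c) X" using functor_Ar[OF R cD \<theta>(1)] B(2) by (simp add: U_def)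
      note FR = FA[OF R\<theta>]
      \<comment> \<open>Whether the isomorphism \<open>\<theta>\<close> respects the algebra
        structures is a question about two homomorphisms of models out of a free object. They are
        compared by their restrictions along the unit.\<close>
      let ?l = "Comp ?D \<theta> (Ar K (\<epsilon> c))" and ?r = "Comp ?D ?a (Ar K (Ar F (Ar R \<theta>)))"
      have l: "?l \<in> hom ?D (Ob K (Ob F (Ob U c))) B" using D.Comp_in[OF KA[OF \<epsilon>[OF c]] \<theta>(1)] .
      have r: "?r \<in> hom ?D (Ob K (Ob F (Ob U c))) B" using D.Comp_in[OF KA[OF FR] B(3)] .
      have Rl: "Ar R ?l = Comp ?A (Ar R \<theta>) (Ar U (\<epsilon> c))" using functor_Comp[OF R KA[OF \<epsilon>[OF c]] \<theta>(1)] by (simp add: U_def)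
      have Rr: "Ar R ?r = Comp ?A a (Ar U (Ar F (Ar R \<theta>)))" using functor_Comp[OF R KA[OF FR] B(3)] Ra by (simp add: U_def)
      have "Comp ?A (Ar R ?l) (\<eta> (Ob U c)) = Ar R \<theta>"
        unfolding Rl using A.assoc[OF \<eta>[OF UO[OF c]] UA[OF \<epsilon>[OF c]] R\<theta>] tri_U[OF c] A.Id_right[OF R\<theta>] by simp
      moreover have "Comp ?A (Ar R ?r) (\<eta> (Ob U c)) = Ar R \<theta>"
        unfolding Rr using A.assoc[OF \<eta>[OF UO[OF c]] UA[OF FR] a] \<eta>_nat[OF R\<theta>] A.assoc[OF R\<theta> \<eta>[OF X] a] a1 A.Id_left[OF R\<theta>] by simp
      ultimately have "?l = ?r" using universal_ext[OF uD[OF UO[OF c]] cA R cD l r] by simp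
      then have eq: "Comp ?A (Ar R \<theta>) (Ar U (\<epsilon> c)) = Comp ?A a (Ar U (Ar F (Ar R \<theta>)))" using Rl Rr by simp
      have E: "((Ob U c, Ar U (\<epsilon> c)), Ar R \<theta>, (X, a)) \<in> hom (EM_cat ?A Mon) (Ob U c, Ar U (\<epsilon> c)) (X, a)"
        using comparison_Obj[OF c] Xa(2) R\<theta> eq by (simp add: hom_EM)
      moreover have "iso_arr (EM_cat ?A Mon) ((Ob U c, Ar U (\<epsilon> c)), Ar R \<theta>, (X, a))"
        by (rule EM_iso[OF cA _ E functor_iso[OF R cD cA \<theta>]]) (simp add: UF)
      ultimately show "\<exists>c\<in>Obj C. \<exists>f\<in>hom (EM_cat ?A Mon) (Ob (comparison C U \<epsilon>) c) Xa. iso_arr (EM_cat ?A Mon) f"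
        using c Xa(1) by auto
    qed
  qed
  then have mon: "monadic_adjunction C ?A F U \<eta> \<epsilon>" using adj by (simp add: monadic_adjunction_def)
  have "preserves_sifted_colimits TYPE('u) ?A ?A (endo Mon)"
    unfolding preserves_sifted_colimits_def
  proof (intro allI impI, elim conjE)
    fix J :: "('u, 'u) cat" and X c \<iota>
    assume J: "sifted J" and X: "is_functor J ?A X" and co: "is_colimit J ?A X c \<iota>"
    have Jc: "category J" using J by (simp add: sifted_def small_cat_def)
    let ?G = "comp_func K F"
    have G: "is_functor ?A ?D ?G" by (rule is_functor_comp[OF cA F K(1)])
    \<comment> \<open>The colimit is first formed among models of \<open>T\<close>, where it is
      preserved because the functor is a left adjoint. Siftedness of \<open>J\<close> is then used
      there to reduce it to underlying sets.\<close>
    have coT: "is_colimit J ?D (comp_func ?G X) (Ob ?G c) (\<lambda>j. Ar ?G (\<iota> j))"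
    proof (rule universal_arrows_preserve_colimits[OF Jc cA cD X G R _ _ co])
      show "universal_arrow ?D ?A R x (Ob ?G x) (\<eta> x)" if "x \<in> Obj ?A" for x using uD[OF that] by simp
      show "Comp ?A (Ar R (Ar ?G f)) (\<eta> x) = Comp ?A (\<eta> y) f" if "f \<in> hom ?A x y" for f x y
        using \<eta>_nat[OF that] by (simp add: U_def)
    qed
    have GX: "is_functor J ?D (comp_func ?G X)" by (rule is_functor_comp[OF Jc X G])
    have sl: "set_like J (comp_func ?G X) (Ob ?G c) (\<lambda>j. Ar ?G (\<iota> j))" by (rule sifted_colimit_set_like[OF J T GX coT])
    have T': "is_functor ?A ?A (endo Mon)" by (simp add: UF)
    \<comment> \<open>Reducts keep carriers and underlying functions, and \<open>set_like\<close>
      speaks of nothing else. The description obtained for \<open>T\<close> is therefore literally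
      the one required for \<open>S\<close>.\<close>
    have "set_like J (comp_func (endo Mon) X) (Ob (endo Mon) c) (\<lambda>j. Ar (endo Mon) (\<iota> j))"
      using sl unfolding set_like_def by (simp add: UR)
    moreover have "is_cocone J ?A (comp_func (endo Mon) X) (Ob (endo Mon) c) (\<lambda>j. Ar (endo Mon) (\<iota> j))"
      by (rule cocone_functor[OF Jc cA X T']) (use co in \<open>simp add: is_colimit_def\<close>)
    ultimately show "is_colimit J ?A (comp_func (endo Mon) X) (Ob (endo Mon) c) (\<lambda>j. Ar (endo Mon) (\<iota> j))"
      by (intro set_like_colimit[OF Jc S is_functor_comp[OF Jc X T']])
  qed
  then show ?thesis unfolding monadic_sifted_def using mon by blast
qed

end

section \<open>Every model is a canonical sifted colimit of free models\<close>

lemma colimit_jointly_epic: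
  assumes C: "category C" and co: "is_colimit J C D c \<iota>" and f: "f \<in> hom C c d" and g: "g \<in> hom C c d"
    and e: "\<And>j. j \<in> Obj J \<Longrightarrow> Comp C f (\<iota> j) = Comp C g (\<iota> j)" and J: "category J" and D: "is_functor J C D"
  shows "f = g"
proof -
  interpret category C by fact
  interpret J: category J by fact
  have coc: "is_cocone J C D c \<iota>" using co by (simp add: is_colimit_def)
  have \<iota>: "\<iota> j \<in> hom C (Ob D j) c" if "j \<in> Obj J" for j using coc that by (simp add: is_cocone_def)
  have "is_cocone J C D d (\<lambda>j. Comp C f (\<iota> j))"
    unfolding is_cocone_def
  proof (intro conjI ballI)
    show "d \<in> Obj C" using hom_Obj[OF f] by simp
    show "Comp C f (\<iota> j) \<in> hom C (Ob D j) d" if "j \<in> Obj J" for j using Comp_in[OF \<iota>[OF that] f] .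
    fix u assume u: "u \<in> Arr J"
    show "Comp C (Comp C f (\<iota> (Cod J u))) (Ar D u) = Comp C f (\<iota> (Dom J u))"
      using assoc[OF functor_Ar[OF D J Arr_hom[OF u]] \<iota>[OF J.Cod_in[OF u]] f] coc u by (simp add: is_cocone_def)
  qed
  then have "\<exists>!h. h \<in> hom C c d \<and> (\<forall>j \<in> Obj J. Comp C h (\<iota> j) = Comp C f (\<iota> j))" using co by (simp add: is_colimit_def)
  then obtain h where "\<forall>k. k \<in> hom C c d \<longrightarrow> (\<forall>j \<in> Obj J. Comp C k (\<iota> j) = Comp C f (\<iota> j)) \<longrightarrow> k = h" by (rule ex1_conjE)
  then show ?thesis using f g e by metis
qed

lemma weak_coproducts_binary:
  assumes J: "category J" and ini: "z \<in> Obj J" "\<And>d. d \<in> Obj J \<Longrightarrow> \<exists>h. h \<in> hom J z d"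
    and bin: "\<And>a b. a \<in> Obj J \<Longrightarrow> b \<in> Obj J \<Longrightarrow> \<exists>c i j. i \<in> hom J a c \<and> j \<in> hom J b c \<and>
      (\<forall>d f g. f \<in> hom J a d \<and> g \<in> hom J b d \<longrightarrow> (\<exists>h \<in> hom J c d. Comp J h i = f \<and> Comp J h j = g))"
  shows "weak_coproducts J"
  unfolding weak_coproducts_def
proof (intro allI impI)
  interpret category J by fact
  fix n and fam :: "nat \<Rightarrow> _"
  assume "\<forall>i<n. fam i \<in> Obj J"
  then show "\<exists>c \<in> Obj J. \<exists>inc. (\<forall>i<n. inc i \<in> hom J (fam i) c) \<and>
        (\<forall>d \<in> Obj J. \<forall>g. (\<forall>i<n. g i \<in> hom J (fam i) d) \<longrightarrow> (\<exists>h \<in> hom J c d. \<forall>i<n. Comp J h (inc i) = g i))"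
  proof (induction n)
    case 0
    then show ?case using ini by (intro bexI[of _ z]) auto
  next
    case (Suc n)
    then obtain c inc where c: "c \<in> Obj J" and inc: "\<forall>i<n. inc i \<in> hom J (fam i) c"
      and lift: "\<forall>d \<in> Obj J. \<forall>g. (\<forall>i<n. g i \<in> hom J (fam i) d) \<longrightarrow> (\<exists>h \<in> hom J c d. \<forall>i<n. Comp J h (inc i) = g i)"
      by auto
    obtain c' i j where i: "i \<in> hom J c c'" and j: "j \<in> hom J (fam n) c'"
      and lift': "\<forall>d f g. f \<in> hom J c d \<and> g \<in> hom J (fam n) d \<longrightarrow> (\<exists>h \<in> hom J c' d. Comp J h i = f \<and> Comp J h j = g)"
      using bin[OF c, of "fam n"] Suc(2) by blast
    let ?inc = "\<lambda>k. if k < n then Comp J i (inc k) else j"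
    show ?case
    proof (rule bexI[of _ c'], rule exI[of _ ?inc], intro conjI allI impI ballI)
      show "c' \<in> Obj J" using hom_Obj[OF i] by simp
      show "?inc k \<in> hom J (fam k) c'" if "k < Suc n" for k
        using that inc j Comp_in[OF _ i] by (cases "k = n") auto
      fix d g assume d: "d \<in> Obj J" and g: "\<forall>k<Suc n. g k \<in> hom J (fam k) d"
      then obtain h where h: "h \<in> hom J c d" "\<forall>k<n. Comp J h (inc k) = g k" using lift by (meson less_Suc_eq)
      obtain h' where h': "h' \<in> hom J c' d" "Comp J h' i = h" "Comp J h' j = g n" using lift' h(1) g by blast
      have "Comp J h' (?inc k) = g k" if "k < Suc n" for k
      proof (cases "k = n")
        case False
        then have k: "k < n" using that by simp
        show ?thesis using k assoc[OF inc[rule_format, OF k] i h'(1)] h(2) h'(2) by simp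
      qed (simp add: h'(3))
      then show "\<exists>h\<in>hom J c' d. \<forall>k<Suc n. Comp J h (?inc k) = g k" using h'(1) by blast
    qed
  qed
qed

text \<open>Renaming objects and arrows of the index category along injections. The index functions
  \<open>do\<close> and \<open>da\<close> are only left inverses, hence the restriction of all
  comparisons to actual objects and arrows.\<close>

lemma colimit_reindex:
  fixes E :: "('j, 'k, 'o, 'a) func"
  assumes "category J" and J': "Obj J' = eo ` Obj J" "Arr J' = ea ` Arr J"
      "\<And>k. k \<in> Arr J \<Longrightarrow> Dom J' (ea k) = eo (Dom J k) \<and> Cod J' (ea k) = eo (Cod J k)"
    and do: "\<And>j. j \<in> Obj J \<Longrightarrow> do (eo j) = j" and da: "\<And>k. k \<in> Arr J \<Longrightarrow> da (ea k) = k"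
  shows "is_colimit J' X \<lparr>Ob = (\<lambda>x. Ob E (do x)), Ar = (\<lambda>k. Ar E (da k))\<rparr> d (\<lambda>x. \<mu> (do x)) \<longleftrightarrow> is_colimit J X E d \<mu>"
    (is "is_colimit J' X ?E d ?\<mu> \<longleftrightarrow> _")
proof -
  interpret category J by fact
  have coc: "is_cocone J' X ?E e \<kappa> \<longleftrightarrow> is_cocone J X E e (\<lambda>j. \<kappa> (eo j))" for e \<kappa>
    using do da J'(3) Dom_in Cod_in unfolding is_cocone_def J'(1,2) by auto
  have cong: "is_cocone J X E e (\<lambda>j. \<kappa> (do (eo j))) \<longleftrightarrow> is_cocone J X E e \<kappa>" for e \<kappa>
    using do Dom_in Cod_in unfolding is_cocone_def by auto
  have all: "(\<forall>j \<in> Obj J'. Comp X h (\<mu> (do j)) = \<kappa> j) \<longleftrightarrow> (\<forall>j \<in> Obj J. Comp X h (\<mu> j) = \<kappa> (eo j))" for h \<kappa>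
    using do unfolding J'(1) by auto
  have all': "(\<forall>j \<in> Obj J. Comp X h (\<mu> j) = \<kappa> (do (eo j))) \<longleftrightarrow> (\<forall>j \<in> Obj J. Comp X h (\<mu> j) = \<kappa> j)" for h \<kappa>
    using do by auto
  show ?thesis
  proof
    assume l: "is_colimit J' X ?E d ?\<mu>"
    show "is_colimit J X E d \<mu>"
      unfolding is_colimit_def
    proof (intro conjI allI impI)
      show "is_cocone J X E d \<mu>" using l cong unfolding is_colimit_def coc by blast
      fix e \<kappa> assume "is_cocone J X E e \<kappa>"
      then have "is_cocone J' X ?E e (\<lambda>x. \<kappa> (do x))" unfolding coc cong .
      then have "\<exists>!h. h \<in> hom X d e \<and> (\<forall>j \<in> Obj J'. Comp X h (\<mu> (do j)) = \<kappa> (do j))"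
        using l unfolding is_colimit_def by simp
      then show "\<exists>!h. h \<in> hom X d e \<and> (\<forall>j \<in> Obj J. Comp X h (\<mu> j) = \<kappa> j)" unfolding all all' .
    qed
  next
    assume r: "is_colimit J X E d \<mu>"
    show "is_colimit J' X ?E d ?\<mu>"
      unfolding is_colimit_def
    proof (intro conjI allI impI)
      show "is_cocone J' X ?E d ?\<mu>" unfolding coc cong using r by (simp add: is_colimit_def)
      fix e \<kappa> assume "is_cocone J' X ?E e \<kappa>"
      then have "is_cocone J X E e (\<lambda>j. \<kappa> (eo j))" unfolding coc .
      then show "\<exists>!h. h \<in> hom X d e \<and> (\<forall>j \<in> Obj J'. Comp X h (?\<mu> j) = \<kappa> j)"
        using r unfolding all is_colimit_def by simp
    qed
  qed
qed

context univ begin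

text \<open>Preservation is assumed only for index categories whose objects and arrows have type
  \<open>'u\<close>, while the categories used below have lists and triples there. Since they are
  small, they can be copied into \<open>'u\<close>; the copy inherits weak coproducts and so is
  sifted.\<close>

lemma preserves_weak_coproducts:
  fixes J :: "('j, 'k) cat"
  assumes T: "preserves_sifted_colimits TYPE('u) A B T"
    and J: "category J" "small TYPE('u) (Obj J)" "small TYPE('u) (Arr J)" "weak_coproducts J"
    and D: "is_functor J A D" and co: "is_colimit J A D c \<iota>"
  shows "is_colimit J B (comp_func T D) (Ob T c) (\<lambda>j. Ar T (\<iota> j))"
proof -
  interpret category J by fact
  obtain eo :: "'j \<Rightarrow> 'u" where eo: "inj_on eo (Obj J)" using small_encode[OF J(2)] by blast
  obtain ea :: "'k \<Rightarrow> 'u" where ea: "inj_on ea (Arr J)" using small_encode[OF J(3)] by blast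
  define do where "do = inv_into (Obj J) eo"
  define da where "da = inv_into (Arr J) ea"
  have do: "do (eo j) = j" if "j \<in> Obj J" for j unfolding do_def using inv_into_f_f[OF eo that] .
  have da: "da (ea k) = k" if "k \<in> Arr J" for k unfolding da_def using inv_into_f_f[OF ea that] .
  define J' :: "('u, 'u) cat" where "J' = \<lparr>Obj = eo ` Obj J, Arr = ea ` Arr J, Dom = (\<lambda>k. eo (Dom J (da k))),
    Cod = (\<lambda>k. eo (Cod J (da k))), Id = (\<lambda>j. ea (Id J (do j))), Comp = (\<lambda>g f. ea (Comp J (da g) (da f)))\<rparr>"
  have homI: "ea u \<in> hom J' (eo x) (eo y)" if "u \<in> hom J x y" for u x y
    using that da by (auto simp: hom_def J'_def)
  have homE: "\<exists>u x y. f = ea u \<and> X = eo x \<and> Y = eo y \<and> u \<in> hom J x y" if "f \<in> hom J' X Y" for f X Y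
    using that da by (auto simp: hom_def J'_def)
  have eoD: "x = y" if "eo x = eo y" "x \<in> Obj J" "y \<in> Obj J" for x y using inj_onD[OF eo that] .
  have comp: "Comp J' (ea v) (ea u) = ea (Comp J v u)" if "u \<in> hom J x y" "v \<in> hom J y z" for u v x y z
    using that da by (auto simp: J'_def hom_def)
  have cJ': "category J'"
  proof
    fix f assume "f \<in> Arr J'"
    then obtain u where "u \<in> Arr J" "f = ea u" by (auto simp: J'_def)
    then show "Dom J' f \<in> Obj J'" "Cod J' f \<in> Obj J'" using da Dom_in Cod_in by (auto simp: J'_def)
  next
    fix X assume "X \<in> Obj J'"
    then obtain x where x: "x \<in> Obj J" "X = eo x" by (auto simp: J'_def)
    have "Id J' X = ea (Id J x)" using x do by (simp add: J'_def)
    then show "Id J' X \<in> hom J' X X" using homI[OF Id_in[OF x(1)]] x(2) by simp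
  next
    fix f g X Y Z assume f: "f \<in> hom J' X Y" and g: "g \<in> hom J' Y Z"
    obtain u x y where u: "f = ea u" "X = eo x" "Y = eo y" "u \<in> hom J x y" using homE[OF f] by blast
    obtain v y' z where v: "g = ea v" "Y = eo y'" "Z = eo z" "v \<in> hom J y' z" using homE[OF g] by blast
    have y: "y' = y" using eoD[of y' y] u(3) v(2) hom_Obj[OF u(4)] hom_Obj[OF v(4)] by simp
    show "Comp J' g f \<in> hom J' X Z" using comp[OF u(4) v(4)[unfolded y]] homI[OF Comp_in[OF u(4) v(4)[unfolded y]]] u v by simp
  next
    fix f X Y assume f: "f \<in> hom J' X Y"
    obtain u x y where u: "f = ea u" "X = eo x" "Y = eo y" "u \<in> hom J x y" using homE[OF f] by blast
    have o: "x \<in> Obj J" "y \<in> Obj J" using hom_Obj[OF u(4)] by auto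
    have i: "Id J' X = ea (Id J x)" "Id J' Y = ea (Id J y)" using u o do by (simp_all add: J'_def)
    show "Comp J' (Id J' Y) f = f" unfolding i u(1) using comp[OF u(4) Id_in[OF o(2)]] Id_left[OF u(4)] by simp
    show "Comp J' f (Id J' X) = f" unfolding i u(1) using comp[OF Id_in[OF o(1)] u(4)] Id_right[OF u(4)] by simp
  next
    fix f g h X Y Z W assume f: "f \<in> hom J' X Y" and g: "g \<in> hom J' Y Z" and h: "h \<in> hom J' Z W"
    obtain u x y where u: "f = ea u" "X = eo x" "Y = eo y" "u \<in> hom J x y" using homE[OF f] by blast
    obtain v y' z where v: "g = ea v" "Y = eo y'" "Z = eo z" "v \<in> hom J y' z" using homE[OF g] by blast
    obtain w z' t where w: "h = ea w" "Z = eo z'" "W = eo t" "w \<in> hom J z' t" using homE[OF h] by blast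
    have y: "y' = y" using eoD[of y' y] u(3) v(2) hom_Obj[OF u(4)] hom_Obj[OF v(4)] by simp
    have z: "z' = z" using eoD[of z' z] v(3) w(2) hom_Obj[OF v(4)] hom_Obj[OF w(4)] by simp
    note v' = v(4)[unfolded y] and w' = w(4)[unfolded z]
    show "Comp J' h (Comp J' g f) = Comp J' (Comp J' h g) f"
      unfolding u(1) v(1) w(1)
      using comp[OF u(4) v'] comp[OF v' w'] comp[OF Comp_in[OF u(4) v'] w'] comp[OF u(4) Comp_in[OF v' w']] assoc[OF u(4) v' w'] by simp
  qed
  have "weak_coproducts J'"
    unfolding weak_coproducts_def
  proof (intro allI impI)
    fix n and fam :: "nat \<Rightarrow> 'u" assume fam: "\<forall>i<n. fam i \<in> Obj J'"
    then have fam': "\<forall>i<n. do (fam i) \<in> Obj J" "\<forall>i<n. eo (do (fam i)) = fam i" using do by (auto simp: J'_def)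
    from mp[OF spec[OF spec[OF J(4)[unfolded weak_coproducts_def], of n], of "\<lambda>i. do (fam i)"] fam'(1)]
    obtain c inc where c: "c \<in> Obj J" and inc: "\<forall>i<n. inc i \<in> hom J (do (fam i)) c"
      and lift: "\<forall>d \<in> Obj J. \<forall>g. (\<forall>i<n. g i \<in> hom J (do (fam i)) d) \<longrightarrow> (\<exists>h \<in> hom J c d. \<forall>i<n. Comp J h (inc i) = g i)"
      by (elim bexE exE conjE)
    show "\<exists>c \<in> Obj J'. \<exists>inc. (\<forall>i<n. inc i \<in> hom J' (fam i) c) \<and>
        (\<forall>d \<in> Obj J'. \<forall>g. (\<forall>i<n. g i \<in> hom J' (fam i) d) \<longrightarrow> (\<exists>h \<in> hom J' c d. \<forall>i<n. Comp J' h (inc i) = g i))"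
    proof (rule bexI[of _ "eo c"], rule exI[of _ "\<lambda>i. ea (inc i)"], intro conjI allI impI ballI)
      show "ea (inc i) \<in> hom J' (fam i) (eo c)" if "i < n" for i
        using homI[OF inc[rule_format, OF that]] fam'(2) that by simp
      fix d g assume d: "d \<in> Obj J'" and g: "\<forall>i<n. g i \<in> hom J' (fam i) d"
      have dd: "do d \<in> Obj J" "eo (do d) = d" using d do by (auto simp: J'_def)
      have g': "da (g i) \<in> hom J (do (fam i)) (do d) \<and> ea (da (g i)) = g i" if i: "i < n" for i
      proof -
        obtain u x y where u: "g i = ea u" "fam i = eo x" "d = eo y" "u \<in> hom J x y" using homE[OF g[rule_format, OF i]] by blast
        then show ?thesis using hom_Obj[OF u(4)] do da in_homD[OF u(4)] by simp
      qed
      then have "\<forall>i<n. da (g i) \<in> hom J (do (fam i)) (do d)" by simp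
      from mp[OF spec[OF bspec[OF lift dd(1)], of "\<lambda>i. da (g i)"] this]
      obtain h where h: "h \<in> hom J c (do d)" "\<forall>i<n. Comp J h (inc i) = da (g i)" by blast
      show "\<exists>h \<in> hom J' (eo c) d. \<forall>i<n. Comp J' h (ea (inc i)) = g i"
      proof (intro bexI[of _ "ea h"] allI impI)
        show "Comp J' (ea h) (ea (inc i)) = g i" if "i < n" for i
          using comp[OF inc[rule_format, OF that] h(1)] h(2) g'[OF that] that by simp
        show "ea h \<in> hom J' (eo c) d" using homI[OF h(1)] dd(2) by simp
      qed
    qed (use c in \<open>simp add: J'_def\<close>)
  qed
  moreover have "small_cat J'"
    unfolding small_cat_def using cJ' small_image[OF J(2), of eo] small_image[OF J(3), of ea] by (simp add: J'_def)
  ultimately have sJ': "sifted J'" by (intro weak_coproducts_sifted)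
  let ?D = "\<lparr>Ob = (\<lambda>x. Ob D (do x)), Ar = (\<lambda>k. Ar D (da k))\<rparr>"
  have D': "is_functor J' A ?D"
    unfolding is_functor_def
  proof (intro conjI ballI impI)
    show "Ob ?D x \<in> Obj A" if "x \<in> Obj J'" for x
      using functor_Ob[OF D] that do by (auto simp: J'_def)
    show "Ar ?D f \<in> hom A (Ob ?D X) (Ob ?D Y)" if f: "f \<in> hom J' X Y" for X Y f
    proof -
      obtain u x y where u: "f = ea u" "X = eo x" "Y = eo y" "u \<in> hom J x y" using homE[OF f] by blast
      then show ?thesis using functor_Ar[OF D J(1) u(4)] hom_Obj[OF u(4)] do da in_homD[OF u(4)] by simp
    qed
    show "Ar ?D (Id J' x) = Id A (Ob ?D x)" if "x \<in> Obj J'" for x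
      using that do da functor_Id[OF D] in_homD[OF Id_in] by (auto simp: J'_def)
    show "Ar ?D (Comp J' g f) = Comp A (Ar ?D g) (Ar ?D f)"
      if fg: "f \<in> Arr J'" "g \<in> Arr J'" "Cod J' f = Dom J' g" for f g
    proof -
      obtain u v where u: "f = ea u" "u \<in> Arr J" and v: "g = ea v" "v \<in> Arr J" using fg by (auto simp: J'_def)
      have "Cod J u = Dom J v" using fg(3) u v da eoD[OF _ Cod_in Dom_in] by (simp add: J'_def)
      then have uh: "u \<in> hom J (Dom J u) (Dom J v)" and vh: "v \<in> hom J (Dom J v) (Cod J v)" using u v by (auto simp: hom_def)
      show ?thesis using u v comp[OF uh vh] functor_Comp[OF D uh vh] da in_homD[OF Comp_in[OF uh vh]] by simp
    qed
  qed
  have re: "Obj J' = eo ` Obj J" "Arr J' = ea ` Arr J"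
    "\<And>k. k \<in> Arr J \<Longrightarrow> Dom J' (ea k) = eo (Dom J k) \<and> Cod J' (ea k) = eo (Cod J k)"
    using da by (simp_all add: J'_def)
  have "is_colimit J' A ?D c (\<lambda>x. \<iota> (do x)) \<longleftrightarrow> is_colimit J A D c \<iota>"
    by (rule colimit_reindex[OF J(1) re]) (simp_all add: do da)
  with co have "is_colimit J' A ?D c (\<lambda>x. \<iota> (do x))" by simp
  then have 1: "is_colimit J' B (comp_func T ?D) (Ob T c) (\<lambda>x. Ar T (\<iota> (do x)))"
    using T sJ' D' unfolding preserves_sifted_colimits_def by blast
  have "comp_func T ?D = \<lparr>Ob = (\<lambda>x. Ob (comp_func T D) (do x)), Ar = (\<lambda>k. Ar (comp_func T D) (da k))\<rparr>"
    by (simp add: comp_func_def)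
  note 1 = 1[unfolded this]
  have "is_colimit J' B \<lparr>Ob = (\<lambda>x. Ob (comp_func T D) (do x)), Ar = (\<lambda>k. Ar (comp_func T D) (da k))\<rparr> (Ob T c)
      (\<lambda>x. Ar T (\<iota> (do x))) \<longleftrightarrow> is_colimit J B (comp_func T D) (Ob T c) (\<lambda>j. Ar T (\<iota> j))"
    by (rule colimit_reindex[OF J(1) re]) (simp_all add: do da)
  with 1 show ?thesis by simp
qed

end

section \<open>Finitely generated free models over a given model\<close>

lemma hmap_append: "length xs = length ss \<Longrightarrow> hmap h (ss @ tt) (xs @ ys) = hmap h ss xs @ hmap h tt ys"
  by (simp add: hmap_def)

lemma tup_append: "xs \<in> tup M ss \<Longrightarrow> ys \<in> tup M tt \<Longrightarrow> xs @ ys \<in> tup M (ss @ tt)"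
  by (simp add: in_listset list_all2_appendI)

lemma tup_append_split:
  assumes "zs \<in> tup M (ss @ tt)"
  shows "take (length ss) zs \<in> tup M ss" "drop (length ss) zs \<in> tup M tt"
  using assms by (auto simp: in_listset list_all2_append2)

locale free_models = univ U for U :: "'u itself" +
  fixes S :: "('s, 'f, 'r) pht" and Fr :: "'s list \<Rightarrow> ('s, 'f, 'r, 'u) pstructure" and gs :: "'s list \<Rightarrow> 'u list"
  assumes S: "equational_theory TYPE('u) S"
    and Fr: "set ss \<subseteq> sorts (sgn S) \<Longrightarrow> is_pmodel S (Fr ss)"
    and gs: "set ss \<subseteq> sorts (sgn S) \<Longrightarrow> gs ss \<in> tup (Fr ss) ss"
    and free: "set ss \<subseteq> sorts (sgn S) \<Longrightarrow> is_pmodel S M \<Longrightarrow> ms \<in> tup M ss \<Longrightarrow>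
      \<exists>!h. h \<in> hom (PMod S) (Fr ss) M \<and> hmap (ap h) ss (gs ss) = ms"
begin

abbreviation A :: "('s, 'f, 'r, 'u) pstructure_cat" where "A \<equiv> PMod S"

lemma tup_sorts: assumes "is_pmodel S (M :: ('s, 'f, 'r, 'u) pstructure)" "ms \<in> tup M ss" shows "set ss \<subseteq> sorts (sgn S)"
proof
  fix s assume "s \<in> set ss"
  then obtain i where "i < length ss" "ss ! i = s" by (auto simp: in_set_conv_nth)
  then have "ms ! i \<in> car M s" using assms(2) by (auto simp: in_tup)
  then show "s \<in> sorts (sgn S)" using assms(1) by (auto simp: is_pmodel_def is_pstructure_def)
qed

text \<open>The homomorphism out of \<open>Fr ss\<close> classified by a tuple. Such homomorphisms
  and tuples are used interchangeably from here on, composition with \<open>h\<close> becoming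
  application of \<open>h\<close> to the tuple.\<close>

definition ev :: "('s, 'f, 'r, 'u) pstructure \<Rightarrow> 's list \<Rightarrow> 'u list \<Rightarrow> _" where
  "ev M ss ms = (THE h. h \<in> hom A (Fr ss) M \<and> hmap (ap h) ss (gs ss) = ms)"

lemma ev: assumes "is_pmodel S M" "ms \<in> tup M ss"
  shows "ev M ss ms \<in> hom A (Fr ss) M" "hmap (ap (ev M ss ms)) ss (gs ss) = ms"
  using theI'[OF free[OF tup_sorts[OF assms] assms]] unfolding ev_def by auto

lemma ev_unique: assumes h: "h \<in> hom A (Fr ss) M" and ss: "set ss \<subseteq> sorts (sgn S)"
  shows "ev M ss (hmap (ap h) ss (gs ss)) = h"
proof -
  have M: "is_pmodel S M" using h by (simp add: hom_PMod)
  have "hmap (ap h) ss (gs ss) \<in> tup M ss" using ap_tup[OF h gs[OF ss]] .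
  then show ?thesis unfolding ev_def by (intro the1_equality free ss M) (simp_all add: h)
qed

lemma free_ext: assumes "h \<in> hom A (Fr ss) M" "h' \<in> hom A (Fr ss) M" "set ss \<subseteq> sorts (sgn S)"
   "hmap (ap h) ss (gs ss) = hmap (ap h') ss (gs ss)" shows "h = h'"
  by (subst ev_unique[OF assms(1,3), symmetric], subst assms(4), rule ev_unique[OF assms(2,3)])

lemma ev_comp: assumes M: "is_pmodel S M" "ms \<in> tup M ss" and h: "h \<in> hom A M N"
  shows "Comp A h (ev M ss ms) = ev N ss (hmap (ap h) ss ms)"
proof -
  note e = ev[OF M] and ss = tup_sorts[OF M]
  have "hmap (ap (Comp A h (ev M ss ms))) ss (gs ss) = hmap (ap h) ss ms"
    using hmap_Comp[OF e(1) h gs[OF ss]] e(2) by simp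
  then show ?thesis using ev_unique[OF category.Comp_in[OF category_PMod e(1) h] ss] by simp
qed

text \<open>
  An object \<open>(ss, xs)\<close> stands for the morphism \<open>Fr ss \<rightarrow> X\<close> that sends the generators to \<open>xs\<close>.
\<close>

definition over :: "('s, 'f, 'r, 'u) pstructure \<Rightarrow> ('s list \<times> 'u list, ('s list \<times> 'u list) \<times>
    (('s, 'f, 'r, 'u) pstructure \<times> ('s \<Rightarrow> 'u \<Rightarrow> 'u) \<times> ('s, 'f, 'r, 'u) pstructure) \<times> ('s list \<times> 'u list)) cat" where
  "over X = \<lparr>Obj = {(ss, xs). xs \<in> tup X ss},
     Arr = {((ss, xs), u, (tt, ys)) | ss xs u tt ys. xs \<in> tup X ss \<and> ys \<in> tup X tt \<and> u \<in> hom A (Fr ss) (Fr tt) \<and>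
        Comp A (ev X tt ys) u = ev X ss xs},
     Dom = (\<lambda>(p, u, q). p), Cod = (\<lambda>(p, u, q). q), Id = (\<lambda>p. (p, Id A (Fr (fst p)), p)),
     Comp = (\<lambda>(q, v, r) (p, u, q'). (p, Comp A v u, r))\<rparr>"

definition over_diag :: "('s list \<times> 'u list, ('s list \<times> 'u list) \<times>
    (('s, 'f, 'r, 'u) pstructure \<times> ('s \<Rightarrow> 'u \<Rightarrow> 'u) \<times> ('s, 'f, 'r, 'u) pstructure) \<times> ('s list \<times> 'u list), _, _) func" where
  "over_diag = \<lparr>Ob = (\<lambda>(ss, xs). Fr ss), Ar = (\<lambda>(p, u, q). u)\<rparr>"

lemma over_diag_sel [simp]: "Ob over_diag (ss, xs) = Fr ss" "Ar over_diag (p, u, q) = u"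
  by (simp_all add: over_diag_def)

lemma over_sel [simp]: "(ss, xs) \<in> Obj (over X) \<longleftrightarrow> xs \<in> tup X ss" "Id (over X) p = (p, Id A (Fr (fst p)), p)"
  "Comp (over X) (q, v, r) (p, u, q') = (p, Comp A v u, r)"
  "Dom (over X) (p, u, q) = p" "Cod (over X) (p, u, q) = q"
  by (simp_all add: over_def)

lemma hom_over: "k \<in> hom (over X) (ss, xs) (tt, ys) \<longleftrightarrow> (\<exists>u. k = ((ss, xs), u, (tt, ys)) \<and> xs \<in> tup X ss \<and> ys \<in> tup X tt \<and>
   u \<in> hom A (Fr ss) (Fr tt) \<and> Comp A (ev X tt ys) u = ev X ss xs)"
proof -
  have "k \<in> hom (over X) (ss, xs) (tt, ys) \<longleftrightarrow> k \<in> Arr (over X) \<and> Dom (over X) k = (ss, xs) \<and> Cod (over X) k = (tt, ys)"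
    by (simp add: hom_def)
  then show ?thesis by (cases k) (auto simp: over_def)
qed

lemma category_over: assumes X: "is_pmodel S X" shows "category (over X)"
proof -
  interpret A: category A by (rule category_PMod)
  show ?thesis
  proof
    fix p assume "p \<in> Obj (over X)"
    then obtain ss xs where p: "p = (ss, xs)" "xs \<in> tup X ss" by (cases p) auto
    have "Id A (Fr ss) \<in> hom A (Fr ss) (Fr ss)" using A.Id_in Fr[OF tup_sorts[OF X p(2)]] by simp
    moreover have "Comp A (ev X ss xs) (Id A (Fr ss)) = ev X ss xs" using A.Id_right[OF ev(1)[OF X p(2)]] .
    ultimately show "Id (over X) p \<in> hom (over X) p p" using p by (simp add: hom_over)
  next
    fix f g P Q R assume fg: "f \<in> hom (over X) P Q" "g \<in> hom (over X) Q R"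
    obtain ss xs tt ys rr zs where PQR: "P = (ss, xs)" "Q = (tt, ys)" "R = (rr, zs)" by (cases P, cases Q, cases R)
    obtain u where u: "f = (P, u, Q)" "xs \<in> tup X ss" "ys \<in> tup X tt" "u \<in> hom A (Fr ss) (Fr tt)" "Comp A (ev X tt ys) u = ev X ss xs"
      using fg(1) unfolding PQR hom_over by blast
    obtain v where v: "g = (Q, v, R)" "zs \<in> tup X rr" "v \<in> hom A (Fr tt) (Fr rr)" "Comp A (ev X rr zs) v = ev X tt ys"
      using fg(2) unfolding PQR hom_over by blast
    have "Comp A (ev X rr zs) (Comp A v u) = ev X ss xs" using A.assoc[OF u(4) v(3) ev(1)[OF X v(2)]] u v by simp
    then show "Comp (over X) g f \<in> hom (over X) P R" using u v A.Comp_in[OF u(4) v(3)] unfolding PQR by (simp add: hom_over)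
  next
    fix f P Q assume f: "f \<in> hom (over X) P Q"
    obtain ss xs tt ys where PQ: "P = (ss, xs)" "Q = (tt, ys)" by (cases P, cases Q)
    show "Comp (over X) (Id (over X) Q) f = f" "Comp (over X) f (Id (over X) P) = f"
      using f A.Id_left A.Id_right unfolding PQ hom_over by auto
  next
    fix f g h P Q R W assume fgh: "f \<in> hom (over X) P Q" "g \<in> hom (over X) Q R" "h \<in> hom (over X) R W"
    then show "Comp (over X) h (Comp (over X) g f) = Comp (over X) (Comp (over X) h g) f"
      using A.assoc by (cases P; cases Q; cases R; cases W) (auto simp: hom_over)
  qed (auto simp: over_def)
qed

lemma over_functor: assumes X: "is_pmodel S X" shows "is_functor (over X) A over_diag"
  unfolding is_functor_def
proof (intro conjI ballI impI)
  show "Ob over_diag p \<in> Obj A" if "p \<in> Obj (over X)" for p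
    using that Fr[OF tup_sorts[OF X]] by (cases p) auto
  show "Ar over_diag f \<in> hom A (Ob over_diag p) (Ob over_diag q)" if "f \<in> hom (over X) p q" for p q f
    using that by (cases p; cases q) (auto simp: hom_over)
  show "Ar over_diag (Id (over X) p) = Id A (Ob over_diag p)" for p by (cases p) simp
  show "Ar over_diag (Comp (over X) g f) = Comp A (Ar over_diag g) (Ar over_diag f)" for f g
    by (cases f; cases g) simp
qed

text \<open>One-generator free models detect elements and thus determine the mediating map; the
  remaining free models make it a homomorphism, because an operation at \<open>xs\<close> is the
  image under \<open>ev X ss xs\<close> of the operation applied to the generators of
  \<open>Fr ss\<close>.\<close>

lemma over_colimit: assumes X: "is_pmodel S X"
  shows "is_colimit (over X) A over_diag X (\<lambda>(ss, xs). ev X ss xs)"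
  unfolding is_colimit_def
proof (intro conjI allI impI)
  interpret A: category A by (rule category_PMod)
  show "is_cocone (over X) A over_diag X (\<lambda>(ss, xs). ev X ss xs)"
    unfolding is_cocone_def using X ev(1)[OF X] by (auto simp: over_def over_diag_def)
  fix N \<kappa> assume co: "is_cocone (over X) A over_diag N \<kappa>"
  have N: "is_pmodel S N" using co by (simp add: is_cocone_def)
  have \<kappa>: "\<kappa> (ss, xs) \<in> hom A (Fr ss) N" if "xs \<in> tup X ss" for ss xs
  proof -
    have "(ss, xs) \<in> Obj (over X)" using that by simp
    then have "\<kappa> (ss, xs) \<in> hom A (Ob over_diag (ss, xs)) N" using co unfolding is_cocone_def by blast
    then show ?thesis by simp
  qed
  have \<kappa>n: "Comp A (\<kappa> (tt, ys)) u = \<kappa> (ss, xs)"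
    if "xs \<in> tup X ss" "ys \<in> tup X tt" "u \<in> hom A (Fr ss) (Fr tt)" "Comp A (ev X tt ys) u = ev X ss xs" for ss xs tt ys u
  proof -
    have "((ss, xs), u, (tt, ys)) \<in> Arr (over X)" using that by (cases u) (auto simp: over_def)
    then have "Comp A (\<kappa> (Cod (over X) ((ss, xs), u, (tt, ys)))) (Ar over_diag ((ss, xs), u, (tt, ys))) = \<kappa> (Dom (over X) ((ss, xs), u, (tt, ys)))"
      using co unfolding is_cocone_def by blast
    then show ?thesis by simp
  qed
  \<comment> \<open>Read off at the object that picks out the single element \<open>x\<close>, by
    evaluating the cocone component there on the one generator.\<close>
  define h where "h s x = ap (\<kappa> ([s], [x])) s (hd (gs [s]))" for s x
  have one: "[x] \<in> tup X [s]" if "x \<in> car X s" for s x using that by (simp add: in_tup)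
  have hk: "ap (\<kappa> (ss, xs)) s w = h s (ap (ev X ss xs) s w)" if xs: "xs \<in> tup X ss" and w: "w \<in> car (Fr ss) s" for ss xs s w
  proof -
    have F: "is_pmodel S (Fr ss)" using Fr[OF tup_sorts[OF X xs]] .
    have w1: "[w] \<in> tup (Fr ss) [s]" using w by (simp add: in_tup)
    note e = ev[OF F w1] and e2 = ev[OF X xs]
    let ?x = "ap (ev X ss xs) s w"
    have x: "?x \<in> car X s" using ap_car[OF e2(1) w] .
    have "Comp A (ev X ss xs) (ev (Fr ss) [s] [w]) = ev X [s] [?x]" using ev_comp[OF F w1 e2(1)] by (simp add: hmap_def)
    then have k: "Comp A (\<kappa> (ss, xs)) (ev (Fr ss) [s] [w]) = \<kappa> ([s], [?x])" by (rule \<kappa>n[OF one[OF x] xs e(1)])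
    have g: "gs [s] \<in> tup (Fr [s]) [s]" by (rule gs[OF tup_sorts[OF F w1]])
    then obtain y where y: "gs [s] = [y]" "y \<in> car (Fr [s]) s" by (cases "gs [s]") (auto simp: in_tup)
    have "ap (ev (Fr ss) [s] [w]) s y = w" using e(2) y by (simp add: hmap_def)
    then show ?thesis using ap_Comp[OF e(1) \<kappa>[OF xs] y(2)] k y(1) by (simp add: h_def)
  qed
  have hx: "h s x \<in> car N s" if x: "x \<in> car X s" for s x
  proof -
    have g: "gs [s] \<in> tup (Fr [s]) [s]" by (rule gs[OF tup_sorts[OF X one[OF x]]])
    then have "hd (gs [s]) \<in> car (Fr [s]) s" by (cases "gs [s]") (auto simp: in_tup)
    then show ?thesis unfolding h_def using ap_car[OF \<kappa>[OF one[OF x]]] by blast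
  qed
  have hh: "mkarr X h N \<in> hom A X N"
  proof (rule mkarr_hom[OF S X N hx])
    fix f xs assume f: "f \<in> funs (sgn S)" and xs: "xs \<in> tup X (farity (sgn S) f)"
    let ?ss = "farity (sgn S) f" and ?s = "fsort (sgn S) f"
    note e = ev[OF X xs]
    have g: "gs ?ss \<in> tup (Fr ?ss) ?ss" by (rule gs[OF tup_sorts[OF X xs]])
    have Ft: "total_str (sgn S) (Fr ?ss)" using model_total[OF S Fr[OF tup_sorts[OF X xs]]] .
    have "h ?s (opn X f xs) = h ?s (ap (ev X ?ss xs) ?s (opn (Fr ?ss) f (gs ?ss)))" using ap_opn[OF S e(1) f g] e(2) by simp
    also have "\<dots> = opn N f (hmap (ap (\<kappa> (?ss, xs))) ?ss (gs ?ss))"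
      using hk[OF xs total_strD(2)[OF Ft f g]] ap_opn[OF S \<kappa>[OF xs] f g] by simp
    also have "hmap (ap (\<kappa> (?ss, xs))) ?ss (gs ?ss) = hmap (\<lambda>s w. h s (ap (ev X ?ss xs) s w)) ?ss (gs ?ss)"
      using g by (rule hmap_cong) (rule hk[OF xs])
    also have "\<dots> = hmap h ?ss xs" using g e(2) hmap_hmap[of "gs ?ss" ?ss h "ap (ev X ?ss xs)"] by (simp add: in_tup)
    finally show "h ?s (opn X f xs) = opn N f (hmap h ?ss xs)" .
  qed
  show "\<exists>!k. k \<in> hom A X N \<and> (\<forall>p\<in>Obj (over X). Comp A k (case p of (ss, xs) \<Rightarrow> ev X ss xs) = \<kappa> p)"
  proof (rule ex1I[of _ "mkarr X h N"], intro conjI hh ballI)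
    fix p assume "p \<in> Obj (over X)"
    then obtain ss xs where p: "p = (ss, xs)" "xs \<in> tup X ss" by (cases p) auto
    note e = ev(1)[OF X p(2)]
    have "Comp A (mkarr X h N) (ev X ss xs) = \<kappa> (ss, xs)"
      by (rule arr_eqI[OF A.Comp_in[OF e hh] \<kappa>[OF p(2)]]) (use ap_Comp[OF e hh] ap_car[OF e] hk[OF p(2)] in simp)
    then show "Comp A (mkarr X h N) (case p of (ss, xs) \<Rightarrow> ev X ss xs) = \<kappa> p" using p by simp
  next
    fix k assume k: "k \<in> hom A X N \<and> (\<forall>p\<in>Obj (over X). Comp A k (case p of (ss, xs) \<Rightarrow> ev X ss xs) = \<kappa> p)"
    show "k = mkarr X h N"
    proof (rule arr_eqI[OF conjunct1[OF k] hh])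
      fix s x assume x: "x \<in> car X s"
      have "([s], [x]) \<in> Obj (over X)" using one[OF x] by simp
      from bspec[OF conjunct2[OF k] this] have c: "Comp A k (ev X [s] [x]) = \<kappa> ([s], [x])" by simp
      note e = ev[OF X one[OF x]]
      have g: "gs [s] \<in> tup (Fr [s]) [s]" by (rule gs[OF tup_sorts[OF X one[OF x]]])
      then obtain y where y: "gs [s] = [y]" "y \<in> car (Fr [s]) s" by (cases "gs [s]") (auto simp: in_tup)
      have "ap (ev X [s] [x]) s y = x" using e(2) y by (simp add: hmap_def)
      then show "ap k s x = ap (mkarr X h N) s x" using ap_Comp[OF e(1) conjunct1[OF k] y(2)] c y(1) x by (simp add: h_def)
    qed
  qed
qed

text \<open>An arrow is determined by its end points and by the images of finitely many generators,
  so smallness of lists is enough and no function space of carriers is ever measured.\<close>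

lemma small_over: assumes X: "is_pmodel S X" shows "small TYPE('u) (Obj (over X))" "small TYPE('u) (Arr (over X))"
proof -
  have sS: "small TYPE('u) (sorts (sgn S))" using S by (simp add: equational_theory_def is_pht_def is_signature_def)
  have sc: "small TYPE('u) (\<Union>s\<in>sorts (sgn S). car M s)" if "is_pmodel S M" for M :: "('s, 'f, 'r, 'u) pstructure"
    using that by (intro small_UN sS) (simp add: is_pmodel_def is_pstructure_def)
  have tl: "tup M ss \<subseteq> lists (\<Union>s\<in>sorts (sgn S). car M s)" if "is_pmodel S M" for M :: "('s, 'f, 'r, 'u) pstructure" and ss
  proof
    fix ms assume ms: "ms \<in> tup M ss"
    note ss = tup_sorts[OF that ms]
    show "ms \<in> lists (\<Union>s\<in>sorts (sgn S). car M s)"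
      using ms ss by (auto simp: in_tup in_set_conv_nth intro!: bexI[OF _ subsetD[OF ss nth_mem]])
  qed
  have "Obj (over X) \<subseteq> lists (sorts (sgn S)) \<times> lists (\<Union>s\<in>sorts (sgn S). car X s)"
  proof
    fix p assume p: "p \<in> Obj (over X)"
    obtain ss xs where "p = (ss, xs)" "xs \<in> tup X ss" using p by (cases p) auto
    then show "p \<in> lists (sorts (sgn S)) \<times> lists (\<Union>s\<in>sorts (sgn S). car X s)"
      using tup_sorts[OF X, of xs ss] tl[OF X, of ss] by auto
  qed
  then show so: "small TYPE('u) (Obj (over X))"
    by (rule small_subset[OF small_Times[OF small_lists[OF sS] small_lists[OF sc[OF X]]]])
  let ?f = "\<lambda>(p, u, q). ((p, q), hmap (ap u) (fst p) (gs (fst p)))"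
  let ?B = "SIGMA pq : Obj (over X) \<times> Obj (over X). lists (\<Union>s\<in>sorts (sgn S). car (Fr (fst (snd pq))) s)"
  have E: "\<exists>ss xs u tt ys. k = ((ss, xs), u, (tt, ys)) \<and> xs \<in> tup X ss \<and> ys \<in> tup X tt \<and> u \<in> hom A (Fr ss) (Fr tt)"
    if "k \<in> Arr (over X)" for k using that unfolding over_def by auto
  have "small TYPE('u) ?B"
  proof (rule small_Sigma[OF small_Times[OF so so]])
    fix pq assume pq: "pq \<in> Obj (over X) \<times> Obj (over X)"
    obtain p tt ys where "pq = (p, (tt, ys))" "ys \<in> tup X tt" using pq by (cases pq; cases "snd pq") auto
    then show "small TYPE('u) (lists (\<Union>s\<in>sorts (sgn S). car (Fr (fst (snd pq))) s))"
      using small_lists[OF sc[OF Fr[OF tup_sorts[OF X]]]] by simp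
  qed
  moreover have "?f ` Arr (over X) \<subseteq> ?B"
  proof
    fix z assume "z \<in> ?f ` Arr (over X)"
    then obtain k where k: "k \<in> Arr (over X)" "z = ?f k" by blast
    obtain ss xs u tt ys where u: "k = ((ss, xs), u, (tt, ys))" "xs \<in> tup X ss" "ys \<in> tup X tt" "u \<in> hom A (Fr ss) (Fr tt)" using E[OF k(1)] by blast
    have "hmap (ap u) ss (gs ss) \<in> tup (Fr tt) ss" using ap_tup[OF u(4) gs[OF tup_sorts[OF X u(2)]]] .
    then have "hmap (ap u) ss (gs ss) \<in> lists (\<Union>s\<in>sorts (sgn S). car (Fr tt) s)" using tl[OF Fr[OF tup_sorts[OF X u(3)]]] by blast
    then show "z \<in> ?B" using k(2) u by simp
  qed
  ultimately have "small TYPE('u) (?f ` Arr (over X))" by (rule small_subset)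
  moreover have "inj_on ?f (Arr (over X))"
  proof (rule inj_onI)
    fix k k' assume k: "k \<in> Arr (over X)" "k' \<in> Arr (over X)" and eq: "?f k = ?f k'"
    obtain ss xs u tt ys where u: "k = ((ss, xs), u, (tt, ys))" "xs \<in> tup X ss" "u \<in> hom A (Fr ss) (Fr tt)" using E[OF k(1)] by blast
    obtain ss' xs' u' tt' ys' where u': "k' = ((ss', xs'), u', (tt', ys'))" "u' \<in> hom A (Fr ss') (Fr tt')" using E[OF k(2)] by blast
    have s: "ss' = ss" "xs' = xs" "tt' = tt" "ys' = ys" and h: "hmap (ap u) ss (gs ss) = hmap (ap u') ss (gs ss)"
      using eq unfolding u(1) u'(1) by auto
    have "u = u'" by (rule free_ext[OF u(3) _ tup_sorts[OF X u(2)] h]) (use u'(2) s in simp)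
    then show "k = k'" using u(1) u'(1) s by simp
  qed
  ultimately show "small TYPE('u) (Arr (over X))" by (rule small_inj)
qed

text \<open>Concatenation of lists of sorts gives coproducts of free models, and concatenation of
  tuples gives the corresponding objects over \<open>X\<close>. The empty list provides the initial
  object, and finite families reduce to the binary case.\<close>

lemma weak_coproducts_over: assumes X: "is_pmodel S X" shows "weak_coproducts (over X)"
proof (rule weak_coproducts_binary[OF category_over[OF X]])
  interpret A: category A by (rule category_PMod)
  have nil: "[] \<in> tup M []" for M :: "('s, 'f, 'r, 'u) pstructure" by simp
  show "([], []) \<in> Obj (over X)" by simp
  fix d assume d: "d \<in> Obj (over X)"
  obtain tt ys where d: "d = (tt, ys)" "ys \<in> tup X tt" using d by (cases d) auto
  have F: "is_pmodel S (Fr tt)" using Fr[OF tup_sorts[OF X d(2)]] .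
  have "Comp A (ev X tt ys) (ev (Fr tt) [] []) = ev X [] []"
    using ev_comp[OF F nil ev(1)[OF X d(2)]] by (simp add: hmap_def)
  then show "\<exists>h. h \<in> hom (over X) ([], []) d" unfolding d(1) hom_over using nil d(2) ev(1)[OF F nil] by blast
next
  interpret A: category A by (rule category_PMod)
  fix a b assume a: "a \<in> Obj (over X)" and b: "b \<in> Obj (over X)"
  obtain ss xs where a: "a = (ss, xs)" "xs \<in> tup X ss" using a by (cases a) auto
  obtain tt ys where b: "b = (tt, ys)" "ys \<in> tup X tt" using b by (cases b) auto
  let ?r = "ss @ tt" and ?z = "xs @ ys"
  have sS: "set ss \<subseteq> sorts (sgn S)" "set tt \<subseteq> sorts (sgn S)" using tup_sorts[OF X a(2)] tup_sorts[OF X b(2)] by auto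
  then have rS: "set ?r \<subseteq> sorts (sgn S)" by simp
  have z: "?z \<in> tup X ?r" using tup_append[OF a(2) b(2)] .
  have FR: "is_pmodel S (Fr ?r)" using Fr[OF rS] .
  note g = gs[OF rS]
  note g1 = tup_append_split(1)[OF g] and g2 = tup_append_split(2)[OF g]
  let ?g1 = "take (length ss) (gs ?r)" and ?g2 = "drop (length ss) (gs ?r)"
  have l1: "length ?g1 = length ss" using g1 by (rule in_tup(1)[THEN iffD1, THEN conjunct1])
  have split: "hmap k ?r (gs ?r) = hmap k ss ?g1 @ hmap k tt ?g2" for k
    using hmap_append[OF l1, of k tt ?g2] by simp
  note i = ev[OF FR g1] and j = ev[OF FR g2]
  have l: "length (hmap k ss ?g1) = length ss" for k using length_hmap[OF l1] .
  have lx: "length xs = length ss" using a(2) by (simp add: in_tup)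
  note ez = ev[OF X z]
  have eq: "hmap (ap (ev X ?r ?z)) ss ?g1 = xs" "hmap (ap (ev X ?r ?z)) tt ?g2 = ys"
    using ez(2) l[of "ap (ev X ?r ?z)"] lx unfolding split append_eq_append_conv[OF disjI1[OF trans[OF l lx[symmetric]]]] by auto
  have I: "((ss, xs), ev (Fr ?r) ss ?g1, (?r, ?z)) \<in> hom (over X) (ss, xs) (?r, ?z)"
    unfolding hom_over using a(2) z i(1) ev_comp[OF FR g1 ez(1)] eq(1) by metis
  have J: "((tt, ys), ev (Fr ?r) tt ?g2, (?r, ?z)) \<in> hom (over X) (tt, ys) (?r, ?z)"
    unfolding hom_over using b(2) z j(1) ev_comp[OF FR g2 ez(1)] eq(2) by metis
  have "\<exists>h\<in>hom (over X) (?r, ?z) d. Comp (over X) h ((ss, xs), ev (Fr ?r) ss ?g1, (?r, ?z)) = f \<and>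
     Comp (over X) h ((tt, ys), ev (Fr ?r) tt ?g2, (?r, ?z)) = k" if f: "f \<in> hom (over X) (ss, xs) d" and k: "k \<in> hom (over X) (tt, ys) d" for d f k
  proof -
    obtain rr zs where d: "d = (rr, zs)" by (cases d)
    obtain u where u: "f = ((ss, xs), u, d)" "zs \<in> tup X rr" "u \<in> hom A (Fr ss) (Fr rr)" "Comp A (ev X rr zs) u = ev X ss xs"
      using f unfolding d hom_over by blast
    obtain v where v: "k = ((tt, ys), v, d)" "v \<in> hom A (Fr tt) (Fr rr)" "Comp A (ev X rr zs) v = ev X tt ys"
      using k unfolding d hom_over by blast
    have Frr: "is_pmodel S (Fr rr)" using Fr[OF tup_sorts[OF X u(2)]] .
    let ?p = "hmap (ap u) ss (gs ss)" and ?q = "hmap (ap v) tt (gs tt)"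
    have p: "?p \<in> tup (Fr rr) ss" and q: "?q \<in> tup (Fr rr) tt" using ap_tup[OF u(3) gs[OF sS(1)]] ap_tup[OF v(2) gs[OF sS(2)]] by auto
    have pq: "?p @ ?q \<in> tup (Fr rr) ?r" using tup_append[OF p q] .
    note w = ev[OF Frr pq]
    let ?w = "ev (Fr rr) ?r (?p @ ?q)"
    note er = ev[OF X u(2)]
    have lp: "length ?p = length ss" using p by (simp add: in_tup)
    have wg: "hmap (ap ?w) ss ?g1 = ?p" "hmap (ap ?w) tt ?g2 = ?q"
      using w(2) unfolding split append_eq_append_conv[OF disjI1[OF trans[OF l lp[symmetric]]]] by auto
    have "Comp A (ev X rr zs) ?w = ev X ?r ?z"
    proof -
      have "hmap (ap (ev X rr zs)) ss ?p = xs"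
        using hmap_Comp[OF u(3) er(1) gs[OF sS(1)]] u(4) ev(2)[OF X a(2)] by simp
      moreover have "hmap (ap (ev X rr zs)) tt ?q = ys"
        using hmap_Comp[OF v(2) er(1) gs[OF sS(2)]] v(3) ev(2)[OF X b(2)] by simp
      ultimately show ?thesis using ev_comp[OF Frr pq er(1)] hmap_append[OF lp] by simp
    qed
    then have W: "((?r, ?z), ?w, d) \<in> hom (over X) (?r, ?z) d" unfolding d hom_over using z u(2) w(1) by blast
    have "Comp A ?w (ev (Fr ?r) ss ?g1) = u"
      using ev_comp[OF FR g1 w(1)] wg(1) ev_unique[OF u(3) sS(1)] by simp
    moreover have "Comp A ?w (ev (Fr ?r) tt ?g2) = v"
      using ev_comp[OF FR g2 w(1)] wg(2) ev_unique[OF v(2) sS(2)] by simp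
    ultimately show ?thesis using W u(1) v(1) by (intro bexI[OF _ W]) simp
  qed
  then show "\<exists>c i j. i \<in> hom (over X) a c \<and> j \<in> hom (over X) b c \<and>
      (\<forall>d f g. f \<in> hom (over X) a d \<and> g \<in> hom (over X) b d \<longrightarrow> (\<exists>h \<in> hom (over X) c d. Comp (over X) h i = f \<and> Comp (over X) h j = g))"
    unfolding a(1) b(1) using I J
    by (intro exI[of _ "(?r, ?z)"] exI[of _ "((ss, xs), ev (Fr ?r) ss ?g1, (?r, ?z))"] exI[of _ "((tt, ys), ev (Fr ?r) tt ?g2, (?r, ?z))"]) blast
qed

end

section \<open>The equational theory of a monad\<close>

lemma map_eq_Some: "map f xs = map Some ys \<longleftrightarrow> length xs = length ys \<and> (\<forall>i<length ys. f (xs ! i) = Some (ys ! i))"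
  by (auto simp: list_eq_iff_nth_eq)

locale sifted_monad = free_models V S Fr gs + adj C "PMod S :: ('s, 'f, 'r, 'u) pstructure_cat" F U \<eta> \<epsilon>
  for V :: "'u itself" and S :: "('s, 'f, 'r) pht" and Fr gs and C :: "('o, 'a) cat" and F U \<eta> \<epsilon> +
  assumes pres: "preserves_sifted_colimits TYPE('u) (PMod S :: ('s, 'f, 'r, 'u) pstructure_cat) (PMod S) (comp_func U F)"
begin

abbreviation "TO x \<equiv> Ob U (Ob F x)"
abbreviation "TA f \<equiv> Ar U (Ar F f)"
abbreviation "\<mu> x \<equiv> Ar U (\<epsilon> (Ob F x))"

lemma TA_hom: "f \<in> hom A x y \<Longrightarrow> TA f \<in> hom A (TO x) (TO y)"
  using UA[OF FA] by simp

lemma TO_model: "is_pmodel S x \<Longrightarrow> is_pmodel S (TO x)"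
  using UO[OF FO] by simp

lemma TA_comp: "f \<in> hom A x y \<Longrightarrow> g \<in> hom A y z \<Longrightarrow> TA (Comp A g f) = Comp A (TA g) (TA f)"
  using functor_Comp[OF F] functor_Comp[OF U FA FA] by metis

lemma \<mu>_hom: "is_pmodel S x \<Longrightarrow> \<mu> x \<in> hom A (TO (TO x)) (TO x)"
  using UA[OF \<epsilon>[OF FO]] by simp

lemma \<eta>_hom: "is_pmodel S x \<Longrightarrow> \<eta> x \<in> hom A x (TO x)"
  using \<eta> by simp

lemma \<mu>_nat: assumes "f \<in> hom A x y" shows "Comp A (\<mu> y) (TA (TA f)) = Comp A (TA f) (\<mu> x)"
proof -
  have x: "x \<in> Obj A" and y: "y \<in> Obj A" using A.hom_Obj[OF assms] by auto
  note Ff = FA[OF assms]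
  show ?thesis
    using \<epsilon>_nat[OF Ff] functor_Comp[OF U FA[OF UA[OF Ff]] \<epsilon>[OF FO[OF y]]] functor_Comp[OF U \<epsilon>[OF FO[OF x]] Ff] by simp
qed

lemma \<mu>_T\<eta>: "is_pmodel S x \<Longrightarrow> w \<in> car (TO x) s \<Longrightarrow> ap (\<mu> x) s (ap (TA (\<eta> x)) s w) = w"
proof -
  assume x: "is_pmodel S x" and w: "w \<in> car (TO x) s"
  have xO: "x \<in> Obj A" using x by simp
  have "Comp A (\<mu> x) (TA (\<eta> x)) = Id A (TO x)"
    using tri_F[OF xO] functor_Comp[OF U FA[OF \<eta>[OF xO]] \<epsilon>[OF FO[OF xO]]] functor_Id[OF U FO[OF xO]] by simp
  then show ?thesis using ap_Comp[OF TA_hom[OF \<eta>_hom[OF x]] \<mu>_hom[OF x] w] ap_Id[OF w, of S] by simp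
qed

lemma \<mu>_\<eta>: "is_pmodel S x \<Longrightarrow> w \<in> car (TO x) s \<Longrightarrow> ap (\<mu> x) s (ap (\<eta> (TO x)) s w) = w"
  using ap_Comp[OF \<eta>_hom[OF TO_model] \<mu>_hom, of x w s] tri_U[OF FO, of x] ap_Id[of w "TO x" s S] by simp

lemma \<eta>_el: "f \<in> hom A x y \<Longrightarrow> v \<in> car x s \<Longrightarrow> ap (TA f) s (ap (\<eta> x) s v) = ap (\<eta> y) s (ap f s v)"
proof -
  assume f: "f \<in> hom A x y" and v: "v \<in> car x s"
  have xy: "is_pmodel S x" "is_pmodel S y" using f by (auto simp: hom_PMod)
  show ?thesis using ap_Comp[OF \<eta>_hom[OF xy(1)] TA_hom[OF f] v] ap_Comp[OF f \<eta>_hom[OF xy(2)] v] \<eta>_nat[OF f] by simp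
qed

text \<open>The monad preserves the canonical colimit of \<open>X\<close>, so the arrows
  \<open>TA (ev X ss xs)\<close> are jointly epic. Equations between arrows out of
  \<open>TO X\<close> are thereby checked on finitely generated free models, that is, operation by
  operation.\<close>

lemma T_joint: assumes X: "is_pmodel S X" and f: "f \<in> hom A (TO X) Y" and g: "g \<in> hom A (TO X) Y"
    and e: "\<And>ss xs. xs \<in> tup X ss \<Longrightarrow> Comp A f (TA (ev X ss xs)) = Comp A g (TA (ev X ss xs))"
  shows "f = g"
proof -
  note co = preserves_weak_coproducts[OF pres category_over[OF X] small_over[OF X] weak_coproducts_over[OF X] over_functor[OF X] over_colimit[OF X]]
  show ?thesis
    by (rule colimit_jointly_epic[OF A.category_axioms co _ _ _ category_over[OF X] is_functor_comp[OF category_over[OF X] over_functor[OF X] UF]])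
      (use f g e in auto)
qed

text \<open>The preserved colimit has the same sifted index category, so preservation may be applied
  to it once more. This serves the associativity law of an algebra, whose two sides start at
  \<open>TO (TO X)\<close>.\<close>

lemma TT_joint: assumes X: "is_pmodel S X" and f: "f \<in> hom A (TO (TO X)) Y" and g: "g \<in> hom A (TO (TO X)) Y"
    and e: "\<And>ss xs. xs \<in> tup X ss \<Longrightarrow> Comp A f (TA (TA (ev X ss xs))) = Comp A g (TA (TA (ev X ss xs)))"
  shows "f = g"
proof -
  note co = preserves_weak_coproducts[OF pres category_over[OF X] small_over[OF X] weak_coproducts_over[OF X] over_functor[OF X] over_colimit[OF X]]
  note D = is_functor_comp[OF category_over[OF X] over_functor[OF X] UF]
  note co2 = preserves_weak_coproducts[OF pres category_over[OF X] small_over[OF X] weak_coproducts_over[OF X] D co]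
  show ?thesis
    by (rule colimit_jointly_epic[OF A.category_axioms co2 _ _ _ category_over[OF X] is_functor_comp[OF category_over[OF X] D UF]])
      (use f g e in auto)
qed

text \<open>An element \<open>w\<close> of \<open>TO (Fr ss)\<close> acts as an operation with
  arguments of sorts \<open>ss\<close>. Arity and result sort are stored in the symbol because the
  same element of \<open>'u\<close> may lie in several carriers and over several arities.\<close>

definition opset :: "('s list \<times> 's \<times> 'u) set" where
  "opset = {(ss, s, w). set ss \<subseteq> sorts (sgn S) \<and> s \<in> sorts (sgn S) \<and> w \<in> car (TO (Fr ss)) s}"

definition enc :: "'s list \<times> 's \<times> 'u \<Rightarrow> 'u" where
  "enc = (SOME e. inj_on e opset)"

lemma small_opset: "small TYPE('u) opset"
proof -
  have sS: "small TYPE('u) (sorts (sgn S))" using S by (simp add: equational_theory_def is_pht_def is_signature_def)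
  have "small TYPE('u) (SIGMA ss : {ss. set ss \<subseteq> sorts (sgn S)}. SIGMA s : sorts (sgn S). car (TO (Fr ss)) s)"
  proof (intro small_Sigma)
    show "small TYPE('u) {ss. set ss \<subseteq> sorts (sgn S)}" using small_lists[OF sS] by (simp add: lists_eq_set)
    show "small TYPE('u) (car (TO (Fr ss)) s)" if "ss \<in> {ss. set ss \<subseteq> sorts (sgn S)}" for ss s
      using TO_model[OF Fr] that by (simp add: is_pmodel_def is_pstructure_def)
  qed (rule sS)
  moreover have "opset = (SIGMA ss : {ss. set ss \<subseteq> sorts (sgn S)}. SIGMA s : sorts (sgn S). car (TO (Fr ss)) s)"
    by (auto simp: opset_def)
  ultimately show ?thesis by simp
qed

lemma inj_enc: "inj_on enc opset"
  unfolding enc_def by (rule someI_ex[OF small_encode[OF small_opset]])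

definition dec :: "'u \<Rightarrow> 's list \<times> 's \<times> 'u" where "dec = inv_into opset enc"

lemma dec_enc: "p \<in> opset \<Longrightarrow> dec (enc p) = p"
  unfolding dec_def by (rule inv_into_f_f[OF inj_enc])

abbreviation sym :: "'s list \<Rightarrow> 's \<Rightarrow> 'u \<Rightarrow> 'u" where "sym ss s w \<equiv> enc (ss, s, w)"

definition sgT :: "('s, 'u, 'u) signature" where
  "sgT = \<lparr>sorts = sorts (sgn S), funs = enc ` opset, farity = (\<lambda>f. fst (dec f)), fsort = (\<lambda>f. fst (snd (dec f))),
     rels = {}, rarity = (\<lambda>_. [])\<rparr>"

lemma sgT_sym: assumes "(ss, s, w) \<in> opset"
  shows "sym ss s w \<in> funs sgT" "farity sgT (sym ss s w) = ss" "fsort sgT (sym ss s w) = s"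
  using assms dec_enc[OF assms] by (auto simp: sgT_def)

lemma sgT_cases: assumes "f \<in> funs sgT" obtains ss s w where "f = sym ss s w" "(ss, s, w) \<in> opset"
  using assms by (auto simp: sgT_def)

lemma sgT_sel [simp]: "rels sgT = {}" "sorts sgT = sorts (sgn S)"
  by (simp_all add: sgT_def)

lemma sgT_sig: "is_signature TYPE('u) sgT"
proof -
  have "small TYPE('u) (sorts (sgn S))" using S by (simp add: equational_theory_def is_pht_def is_signature_def)
  then show ?thesis using small_image[OF small_opset, of enc] dec_enc
    by (auto simp: is_signature_def sgT_def small_finite) (auto simp: opset_def)
qed

lemma opsetI: "set ss \<subseteq> sorts (sgn S) \<Longrightarrow> w \<in> car (TO (Fr ss)) s \<Longrightarrow> (ss, s, w) \<in> opset"
  using TO_model[OF Fr, of ss] by (auto simp: opset_def is_pmodel_def is_pstructure_def)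

lemma opsetD: "(ss, s, w) \<in> opset \<Longrightarrow> set ss \<subseteq> sorts (sgn S) \<and> w \<in> car (TO (Fr ss)) s"
  by (auto simp: opset_def)

text \<open>An Eilenberg--Moore algebra as a structure: the argument tuple classifies a homomorphism
  \<open>Fr ss \<rightarrow> X\<close>, the symbol's element \<open>w\<close> is pushed along its
  image under the monad into \<open>TO X\<close>, and \<open>a\<close> evaluates the result.\<close>

definition mst :: "('s, 'f, 'r, 'u) pstructure \<Rightarrow> _ \<Rightarrow> ('s, 'u, 'u, 'u) pstructure" where
  "mst X a = mkstr sgT (car X) (\<lambda>f xs. case dec f of (ss, s, w) \<Rightarrow> ap a s (ap (TA (ev X ss xs)) s w))"

lemma EM_algebraD:
  assumes "(X, a) \<in> EM_algebras A Mon"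
  shows "is_pmodel S X" "a \<in> hom A (TO X) X" "v \<in> car X s \<Longrightarrow> ap a s (ap (\<eta> X) s v) = v"
    "Comp A a (\<mu> X) = Comp A a (TA a)"
proof -
  show X: "is_pmodel S X" and a: "a \<in> hom A (TO X) X" and "Comp A a (\<mu> X) = Comp A a (TA a)"
    using assms by (auto simp: EM_algebras_def)
  assume v: "v \<in> car X s"
  have "Comp A a (\<eta> X) = Id A X" using assms by (simp add: EM_algebras_def)
  then show "ap a s (ap (\<eta> X) s v) = v" using ap_Comp[OF \<eta>_hom[OF X] a v] ap_Id[OF v, of S] by simp
qed

lemma car_mst [simp]: "car (mst X a) = car X"
  by (simp add: mst_def)

lemma opn_mst: assumes "(ss, s, w) \<in> opset" "xs \<in> tup X ss"
  shows "opn (mst X a) (sym ss s w) xs = ap a s (ap (TA (ev X ss xs)) s w)"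
  unfolding mst_def using opn_mkstr[OF sgT_sym(1)[OF assms(1)], of xs "car X"] assms sgT_sym(2)[OF assms(1)] dec_enc[OF assms(1)] by simp

lemma total_mst: assumes "(X, a) \<in> EM_algebras A Mon" shows "total_str sgT (mst X a)"
  unfolding mst_def
proof (rule total_mkstr)
  note X = EM_algebraD(1)[OF assms] and a = EM_algebraD(2)[OF assms]
  show "small TYPE('u) (car X s)" for s using X by (simp add: is_pmodel_def is_pstructure_def)
  show "car X s = {}" if "s \<notin> sorts sgT" for s using X that by (simp add: is_pmodel_def is_pstructure_def)
  fix f xs assume f: "f \<in> funs sgT" and xs: "xs \<in> listset (map (car X) (farity sgT f))"
  obtain ss s w where sw: "f = sym ss s w" "(ss, s, w) \<in> opset" using sgT_cases[OF f] .
  have xs: "xs \<in> tup X ss" using xs sgT_sym(2)[OF sw(2)] sw(1) by simp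
  have "ap (TA (ev X ss xs)) s w \<in> car (TO X) s" using ap_car[OF TA_hom[OF ev(1)[OF X xs]]] opsetD[OF sw(2)] by blast
  then show "(case dec f of (ss, s, w) \<Rightarrow> ap a s (ap (TA (ev X ss xs)) s w)) \<in> car X (fsort sgT f)"
    using ap_car[OF a] sw dec_enc[OF sw(2)] sgT_sym(3)[OF sw(2)] by simp
qed simp

text \<open>All premise-free sequents valid in every algebra are taken as axioms. Four kinds of them
  are extracted afterwards: totality of the operations, \<open>projection\<close>,
  \<open>composition\<close>, and the translated axioms of \<open>S\<close>.\<close>

definition Th :: "('s, 'u, 'u) pht" where
  "Th = \<lparr>sgn = sgT, axs = {e. wf_sequent sgT e \<and> prem e = Top \<and> (\<forall>(X, a) \<in> EM_algebras A Mon. valid (mst X a) e)}\<rparr>"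

lemma sgn_Th [simp]: "sgn Th = sgT"
  by (simp add: Th_def)

lemma Th_valid: "is_pmodel Th B \<Longrightarrow> wf_sequent sgT e \<Longrightarrow> prem e = Top \<Longrightarrow>
    (\<And>X a. (X, a) \<in> EM_algebras A Mon \<Longrightarrow> valid (mst X a) e) \<Longrightarrow> valid B e"
  by (auto simp: is_pmodel_def Th_def)

lemma mst_model: "(X, a) \<in> EM_algebras A Mon \<Longrightarrow> is_pmodel Th (mst X a)"
  by (rule modelI) (auto simp: Th_def total_mst)

lemma wf_sym: assumes "(ss, s, w) \<in> opset"
  shows "wf_tm sgT (generic_ctx ss) (App (sym ss s w) (map Var (generic_ctx ss))) s"
  using wf_tm.intros(2)[OF sgT_sym(1)[OF assms], of "generic_ctx ss" "map Var (generic_ctx ss)"]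
    wf_Vars[of sgT "generic_ctx ss"] sgT_sym[OF assms] by (simp add: generic_ctx)

lemma equational_Th: "equational_theory TYPE('u) Th"
  unfolding equational_theory_def
proof (intro conjI ballI)
  show "is_pht TYPE('u) Th" using sgT_sig by (auto simp: is_pht_def Th_def)
  show "rels (sgn Th) = {}" by simp
  show "prem e = Top" if "e \<in> axs Th" for e using that by (auto simp: Th_def)
  fix f assume f: "f \<in> funs (sgn Th)"
  then have "f \<in> funs sgT" by simp
  then obtain ss s w where sw: "f = sym ss s w" "(ss, s, w) \<in> opset" by (rule sgT_cases)
  let ?e = "Sequent (generic_ctx ss) Top (defd (App f (map Var (generic_ctx ss)))) :: ('s, 'u, 'u) sequent"
  have wf: "wf_sequent sgT ?e"
    using wf_sym[OF sw(2)] wf_generic[of ss sgT] opsetD[OF sw(2)] sw(1) by (auto simp: wf_sequent_def)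
  have val: "valid (mst X a) ?e" if "(X, a) \<in> EM_algebras A Mon" for X a
    unfolding valid_defd_iff[OF generic_ctx(1)] generic_ctx(2)
    using total_strD(1)[OF total_mst[OF that], of f] f sgT_sym(2)[OF sw(2)] sw(1) by auto
  have "valid B ?e" if "is_pmodel Th B" for B :: "('s, 'u, 'u, 'u) pstructure"
    by (rule Th_valid[OF that wf _ val]) simp_all
  then show "total_fun TYPE('u) Th f"
    using wf sgT_sym(2)[OF sw(2)] sw(1) by (simp add: total_fun_def phl_theorem_def Let_def)
qed

lemma Th_total: "is_pmodel Th B \<Longrightarrow> total_str sgT B" for B :: "('s, 'u, 'u, 'u) pstructure"
  using model_total[OF equational_Th] by simp

text \<open>For a fixed tuple \<open>xs\<close>, all operations of arity \<open>ss\<close> evaluated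
  at \<open>xs\<close> at once. In a model this function will be an arrow from
  \<open>TO (Fr ss)\<close>, namely a free extension of the tuple.\<close>

abbreviation q :: "('s, 'u, 'u, 'u) pstructure \<Rightarrow> 's list \<Rightarrow> 'u list \<Rightarrow> 's \<Rightarrow> 'u \<Rightarrow> 'u" where
  "q M ss xs \<equiv> (\<lambda>s w. opn M (sym ss s w) xs)"

lemma q_car: assumes "total_str sgT M" "set ss \<subseteq> sorts (sgn S)" "xs \<in> tup M ss" "w \<in> car (TO (Fr ss)) s"
  shows "q M ss xs s w \<in> car M s" "tval M (generic_ctx ss) xs (App (sym ss s w) (map Var (generic_ctx ss))) = Some (q M ss xs s w)"
proof -
  note o = opsetI[OF assms(2,4)]
  have xs: "xs \<in> tup M (farity sgT (sym ss s w))" using assms(3) sgT_sym(2)[OF o] by simp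
  show "q M ss xs s w \<in> car M s" using total_strD(2)[OF assms(1) sgT_sym(1)[OF o] xs] sgT_sym(3)[OF o] by simp
  have "tval M (generic_ctx ss) xs (App (sym ss s w) (map Var (generic_ctx ss))) = fint M (sym ss s w) xs"
    by (rule tval_App_Var[OF generic_ctx(1)]) (use assms(3) in \<open>simp add: in_tup generic_ctx\<close>)
  then show "tval M (generic_ctx ss) xs (App (sym ss s w) (map Var (generic_ctx ss))) = Some (q M ss xs s w)"
    using total_strD(1)[OF assms(1) sgT_sym(1)[OF o] xs] by simp
qed

text \<open>The unit law of the monad seen syntactically: the unit at the \<open>i\<close>-th
  generator names the \<open>i\<close>-th projection. The equation holds in algebras by naturality
  of the unit and the unit law of \<open>a\<close>, hence in all models of
  \<open>Th\<close>.\<close>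

lemma projection:
  assumes B: "is_pmodel Th B" and ss: "set ss \<subseteq> sorts (sgn S)" and xs: "xs \<in> tup B ss" and i: "i < length ss"
  shows "q B ss xs (ss ! i) (ap (\<eta> (Fr ss)) (ss ! i) (gs ss ! i)) = xs ! i"
proof -
  let ?c = "generic_ctx ss" and ?w = "ap (\<eta> (Fr ss)) (ss ! i) (gs ss ! i)"
  let ?e = "Sequent ?c Top (Eq (App (sym ss (ss ! i) ?w) (map Var ?c)) (Var (?c ! i))) :: ('s, 'u, 'u) sequent"
  have g: "gs ss ! i \<in> car (Fr ss) (ss ! i)" using gs[OF ss] i by (simp add: in_tup)
  have w: "?w \<in> car (TO (Fr ss)) (ss ! i)" using ap_car[OF \<eta>_hom[OF Fr[OF ss]] g] .
  have ci: "fst (?c ! i) = ss ! i" using i by (simp add: generic_ctx_def)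
  have "wf_tm sgT ?c (Var (?c ! i)) (ss ! i)" using wf_tm.intros(1)[of "?c ! i" ?c sgT] i ci by (simp add: generic_ctx(3))
  then have wf: "wf_sequent sgT ?e" using wf_sym[OF opsetI[OF ss w]] wf_generic[of ss sgT] ss by (auto simp: wf_sequent_def)
  have iff: "valid M ?e \<longleftrightarrow> (\<forall>ys \<in> tup M ss. q M ss ys (ss ! i) ?w = ys ! i)" if M: "total_str sgT M" for M :: "('s, 'u, 'u, 'u) pstructure"
  proof -
    have "tval M ?c ys (Var (?c ! i)) = Some (ys ! i)" if "ys \<in> tup M ss" for ys
      using that i by (simp add: map_of_zip_nth generic_ctx in_tup)
    then show ?thesis using q_car(2)[OF M ss _ w] by (auto simp: valid_Top generic_ctx(2) simp del: tval.simps)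
  qed
  have "valid (mst X a) ?e" if Xa: "(X, a) \<in> EM_algebras A Mon" for X a
    unfolding iff[OF total_mst[OF Xa]]
  proof
    fix ys assume "ys \<in> tup (mst X a) ss"
    then have ys: "ys \<in> tup X ss" by simp
    note X = EM_algebraD(1)[OF Xa]
    note e = ev[OF X ys]
    have 1: "ap (ev X ss ys) (ss ! i) (gs ss ! i) = ys ! i"
      using arg_cong[OF e(2), of "\<lambda>xs. xs ! i"] gs[OF ss] i by (simp add: in_tup)
    have "ap (TA (ev X ss ys)) (ss ! i) ?w = ap (\<eta> X) (ss ! i) (ys ! i)" using \<eta>_el[OF e(1) g] 1 by simp
    then show "q (mst X a) ss ys (ss ! i) ?w = ys ! i"
      using opn_mst[OF opsetI[OF ss w] ys, of a] EM_algebraD(3)[OF Xa, of "ys ! i" "ss ! i"] ys i by (simp add: in_tup)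
  qed
  then have "valid B ?e" using Th_valid[OF B wf] by simp
  then show ?thesis using iff[OF Th_total[OF B]] xs by simp
qed

text \<open>The multiplication of the monad seen syntactically: substituting the operations
  \<open>ws\<close> into \<open>v\<close> yields the operation obtained by pushing \<open>v\<close>
  along the homomorphism classified by \<open>ws\<close> and then multiplying.\<close>

lemma composition:
  assumes B: "is_pmodel Th B" and ss: "set ss \<subseteq> sorts (sgn S)" and xs: "xs \<in> tup B ss"
    and tt: "set tt \<subseteq> sorts (sgn S)" and v: "v \<in> car (TO (Fr tt)) s" and ws: "ws \<in> tup (TO (Fr ss)) tt"
  shows "opn B (sym tt s v) (hmap (q B ss xs) tt ws) = q B ss xs s (ap (\<mu> (Fr ss)) s (ap (TA (ev (TO (Fr ss)) tt ws)) s v))"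
proof -
  let ?c = "generic_ctx ss" and ?w = "ap (\<mu> (Fr ss)) s (ap (TA (ev (TO (Fr ss)) tt ws)) s v)"
  let ?ts = "map2 (\<lambda>r w. App (sym ss r w) (map Var ?c)) tt ws"
  let ?e = "Sequent ?c Top (Eq (App (sym tt s v) ?ts) (App (sym ss s ?w) (map Var ?c))) :: ('s, 'u, 'u) sequent"
  note FM = Fr[OF ss]
  note TM = TO_model[OF FM]
  note ew = ev[OF TM ws]
  have v': "ap (TA (ev (TO (Fr ss)) tt ws)) s v \<in> car (TO (TO (Fr ss))) s" using ap_car[OF TA_hom[OF ew(1)] v] .
  have w: "?w \<in> car (TO (Fr ss)) s" using ap_car[OF \<mu>_hom[OF FM] v'] .
  note ov = opsetI[OF tt v] and ow = opsetI[OF ss w]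
  have lw: "length ws = length tt" and wi: "\<And>i. i < length tt \<Longrightarrow> ws ! i \<in> car (TO (Fr ss)) (tt ! i)" using ws by (auto simp: in_tup)
  have "list_all2 (wf_tm sgT ?c) ?ts tt"
    using lw wf_sym[OF opsetI[OF ss wi]] by (auto simp: list_all2_conv_all_nth)
  then have "wf_tm sgT ?c (App (sym tt s v) ?ts) s"
    using wf_tm.intros(2)[OF sgT_sym(1)[OF ov]] sgT_sym[OF ov] by simp
  then have wf: "wf_sequent sgT ?e" using wf_sym[OF ow] wf_generic[of ss sgT] ss by (auto simp: wf_sequent_def)
  have qt: "hmap (q M ss ys) tt ws \<in> tup M tt" if M: "total_str sgT M" and ys: "ys \<in> tup M ss" for M ys
    using lw q_car(1)[OF M ss ys wi] by (auto simp: in_tup)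
  have iff: "valid M ?e \<longleftrightarrow> (\<forall>ys \<in> tup M ss. opn M (sym tt s v) (hmap (q M ss ys) tt ws) = q M ss ys s ?w)"
    if M: "total_str sgT M" for M :: "('s, 'u, 'u, 'u) pstructure"
  proof -
    have "tval M ?c ys (App (sym tt s v) ?ts) = Some (opn M (sym tt s v) (hmap (q M ss ys) tt ws))" if ys: "ys \<in> tup M ss" for ys
    proof -
      have "map (tval M ?c ys) ?ts = map Some (hmap (q M ss ys) tt ws)"
        unfolding map_eq_Some using lw q_car(2)[OF M ss ys wi] by (simp del: tval.simps)
      from tval_App[OF this] show ?thesis
        using total_strD(1)[OF M sgT_sym(1)[OF ov]] qt[OF M ys] sgT_sym(2)[OF ov] by simp
    qed
    then show ?thesis using q_car(2)[OF M ss _ w] by (auto simp: valid_Top generic_ctx(2) simp del: tval.simps)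
  qed
  have "valid (mst X a) ?e" if Xa: "(X, a) \<in> EM_algebras A Mon" for X a
    unfolding iff[OF total_mst[OF Xa]]
  proof
    fix ys assume ys': "ys \<in> tup (mst X a) ss"
    then have ys: "ys \<in> tup X ss" by simp
    note X = EM_algebraD(1)[OF Xa] and a = EM_algebraD(2)[OF Xa]
    note e = ev[OF X ys]
    note Te = TA_hom[OF e(1)]
    \<comment> \<open>The homomorphism that evaluates operations of arity \<open>ss\<close> at
      \<open>ys\<close> in the algebra. The required equation amounts to \<open>?k\<close> being a
      morphism of algebras from the free algebra on \<open>Fr ss\<close>, which follows from
      associativity of \<open>a\<close> and naturality of \<open>\<mu>\<close>.\<close>
    let ?k = "Comp A a (TA (ev X ss ys))"
    have k: "?k \<in> hom A (TO (Fr ss)) X" using A.Comp_in[OF Te a] .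
    have qk: "q (mst X a) ss ys r u = ap ?k r u" if "u \<in> car (TO (Fr ss)) r" for r u
      using opn_mst[OF opsetI[OF ss that] ys] ap_Comp[OF Te a that] by simp
    have hq: "hmap (q (mst X a) ss ys) tt ws = hmap (ap ?k) tt ws" using ws by (rule hmap_cong) (rule qk)
    have kt: "hmap (ap ?k) tt ws \<in> tup X tt" using ap_tup[OF k ws] .
    have "opn (mst X a) (sym tt s v) (hmap (q (mst X a) ss ys) tt ws) = ap a s (ap (TA (ev X tt (hmap (ap ?k) tt ws))) s v)"
      unfolding hq by (rule opn_mst[OF ov kt])
    also have "ev X tt (hmap (ap ?k) tt ws) = Comp A ?k (ev (TO (Fr ss)) tt ws)" using ev_comp[OF TM ws k] by simp
    also have "ap a s (ap (TA (Comp A ?k (ev (TO (Fr ss)) tt ws))) s v) = ap (Comp A a (TA ?k)) s (ap (TA (ev (TO (Fr ss)) tt ws)) s v)"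
      using TA_comp[OF ew(1) k] ap_Comp[OF TA_hom[OF ew(1)] TA_hom[OF k] v] ap_Comp[OF TA_hom[OF k] a v'] by simp
    also have "Comp A a (TA ?k) = Comp A ?k (\<mu> (Fr ss))"
    proof -
      have "Comp A a (TA ?k) = Comp A (Comp A a (TA a)) (TA (TA (ev X ss ys)))"
        using TA_comp[OF Te a] A.assoc[OF TA_hom[OF Te] TA_hom[OF a] a] by simp
      also have "\<dots> = Comp A a (Comp A (\<mu> X) (TA (TA (ev X ss ys))))"
        using EM_algebraD(4)[OF Xa] A.assoc[OF TA_hom[OF Te] \<mu>_hom[OF X] a] by simp
      also have "\<dots> = Comp A ?k (\<mu> (Fr ss))" using \<mu>_nat[OF e(1)] A.assoc[OF \<mu>_hom[OF FM] Te a] by simp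
      finally show ?thesis .
    qed
    also have "ap (Comp A ?k (\<mu> (Fr ss))) s (ap (TA (ev (TO (Fr ss)) tt ws)) s v) = q (mst X a) ss ys s ?w"
      using ap_Comp[OF \<mu>_hom[OF FM] k v'] qk[OF w] by simp
    finally show "opn (mst X a) (sym tt s v) (hmap (q (mst X a) ss ys) tt ws) = q (mst X a) ss ys s ?w" .
  qed
  then have "valid B ?e" using Th_valid[OF B wf] by simp
  then show ?thesis using iff[OF Th_total[OF B]] xs by simp
qed

text \<open>A symbol of \<open>S\<close> is represented by its generic value, the operation applied
  to the generators of the free model on its arity, included into the monad by the unit.\<close>

definition \<rho> :: "'f \<Rightarrow> 'u" where
  "\<rho> g = sym (farity (sgn S) g) (fsort (sgn S) g)
     (ap (\<eta> (Fr (farity (sgn S) g))) (fsort (sgn S) g) (opn (Fr (farity (sgn S) g)) g (gs (farity (sgn S) g))))"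

lemma farity_sorts: "g \<in> funs (sgn S) \<Longrightarrow> set (farity (sgn S) g) \<subseteq> sorts (sgn S)"
  using S by (auto simp: equational_theory_def is_pht_def is_signature_def)

lemma generic_value_car: assumes "g \<in> funs (sgn S)" shows "opn (Fr (farity (sgn S) g)) g (gs (farity (sgn S) g)) \<in> car (Fr (farity (sgn S) g)) (fsort (sgn S) g)"
  using total_strD(2)[OF model_total[OF S Fr[OF farity_sorts[OF assms]]] assms gs[OF farity_sorts[OF assms]]] .

lemma generic_op_car: assumes "g \<in> funs (sgn S)"
  shows "ap (\<eta> (Fr (farity (sgn S) g))) (fsort (sgn S) g) (opn (Fr (farity (sgn S) g)) g (gs (farity (sgn S) g)))
     \<in> car (TO (Fr (farity (sgn S) g))) (fsort (sgn S) g)"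
  using ap_car[OF \<eta>_hom[OF Fr[OF farity_sorts[OF assms]]] generic_value_car[OF assms]] .

lemma arity_\<rho>: "arity_map (sgn S) sgT \<rho>"
  using sgT_sym[OF opsetI[OF farity_sorts generic_op_car]] by (simp add: arity_map_def \<rho>_def)

lemma relsS: "rels (sgn S) = {}"
  using S by (simp add: equational_theory_def)

text \<open>Pushing the generic value of \<open>g\<close> along \<open>ev X ?ss xs\<close> gives the
  unit of the value of \<open>g\<close> at \<open>xs\<close>, and \<open>a\<close> retracts the
  unit. Equality of the reduct with \<open>X\<close> also shows that the axioms of \<open>S\<close>
  are valid in all these structures.\<close>

lemma red_mst: assumes Xa: "(X, a) \<in> EM_algebras A Mon" shows "red (sgn S) \<rho> (mst X a) = X"
proof (rule total_str_ext[OF total_red[OF arity_\<rho> relsS total_mst[OF Xa]] model_total[OF S EM_algebraD(1)[OF Xa]]])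
  show "car (red (sgn S) \<rho> (mst X a)) = car X" by simp
  fix g xs assume g: "g \<in> funs (sgn S)" and "xs \<in> tup (red (sgn S) \<rho> (mst X a)) (farity (sgn S) g)"
  then have xs: "xs \<in> tup X (farity (sgn S) g)" by simp
  let ?ss = "farity (sgn S) g" and ?s = "fsort (sgn S) g"
  note X = EM_algebraD(1)[OF Xa]
  note e = ev[OF X xs]
  have "ap (ev X ?ss xs) ?s (opn (Fr ?ss) g (gs ?ss)) = opn X g xs" using ap_opn[OF S e(1) g gs[OF farity_sorts[OF g]]] e(2) by simp
  then have "opn (mst X a) (\<rho> g) xs = ap a ?s (ap (\<eta> X) ?s (opn X g xs))"
    unfolding \<rho>_def using opn_mst[OF opsetI[OF farity_sorts[OF g] generic_op_car[OF g]] xs] \<eta>_el[OF e(1) generic_value_car[OF g]] by simp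
  then show "opn (red (sgn S) \<rho> (mst X a)) g xs = opn X g xs"
    using EM_algebraD(3)[OF Xa total_strD(2)[OF model_total[OF S X] g xs]] g by (simp add: opn_red)
qed

lemma theory_morphism_\<rho>: "theory_morphism TYPE('u) S Th \<rho> \<rho>r"
  unfolding theory_morphism_def
proof (intro conjI ballI)
  fix e assume e: "e \<in> axs S"
  have wf: "wf_sequent (sgn S) e" "prem e = Top" using S e by (auto simp: equational_theory_def is_pht_def)
  have 1: "wf_sequent sgT (map_sequent \<rho> \<rho>r e)" using wf_map_sequent[OF arity_\<rho> relsS wf(1)] .
  have 2: "prem (map_sequent \<rho> \<rho>r e) = Top" using wf(2) by (cases e) simp
  have "valid (mst X a) (map_sequent \<rho> \<rho>r e)" if Xa: "(X, a) \<in> EM_algebras A Mon" for X a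
    using valid_red[OF relsS wf(1), of \<rho> "mst X a" \<rho>r] red_mst[OF Xa] EM_algebraD(1)[OF Xa] e by (simp add: is_pmodel_def)
  then show "phl_theorem TYPE('u) Th (map_sequent \<rho> \<rho>r e)"
    using Th_valid[OF _ 1 2] 1 by (auto simp: phl_theorem_def)
qed (use arity_\<rho> relsS in \<open>auto simp: arity_map_def\<close>)

abbreviation "rd \<equiv> red (sgn S) \<rho>"

lemma rd_model: "is_pmodel Th B \<Longrightarrow> is_pmodel S (rd B)" for B :: "('s, 'u, 'u, 'u) pstructure"
  using theory_morphism_red[OF S equational_Th theory_morphism_\<rho>] by (simp add: model_morphism_def)

text \<open>The components \<open>c ss xs\<close> prescribe what \<open>a\<close> must be on each
  finitely generated part of \<open>TO (rd B)\<close>. Compatibility of these components is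
  \<open>cnat\<close>, and preservation of the canonical colimit then produces \<open>a\<close>. The
  two algebra laws reflect \<open>projection\<close> and \<open>composition\<close>.\<close>

lemma algebra_of_model:
  fixes B :: "('s, 'u, 'u, 'u) pstructure"
  assumes B: "is_pmodel Th B"
  shows "\<exists>a. (rd B, a) \<in> EM_algebras A Mon \<and> mst (rd B) a = B"
proof -
  let ?X = "rd B"
  have X: "is_pmodel S ?X" using rd_model[OF B] .
  note Bt = Th_total[OF B] and Xt = model_total[OF S X]
  have tX: "xs \<in> tup B ss" if "xs \<in> tup ?X ss" for xs ss using that by simp
  define c where "c ss xs = mkarr (TO (Fr ss)) (q B ss xs) ?X" for ss xs
  have comp: "opn B (sym tt s v) (hmap (q B ss xs) tt ws) = q B ss xs s (ap (\<mu> (Fr ss)) s (ap (TA (ev (TO (Fr ss)) tt ws)) s v))"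
    if xs: "xs \<in> tup ?X ss" and "set tt \<subseteq> sorts (sgn S)" "v \<in> car (TO (Fr tt)) s" "ws \<in> tup (TO (Fr ss)) tt" for ss xs tt s v ws
    using composition[OF B tup_sorts[OF X xs] tX[OF xs]] that by simp
  \<comment> \<open>An operation of \<open>S\<close> on \<open>TO (Fr ss)\<close> is the composite
    of its generic operation with the given tuple, so \<open>composition\<close> together with \<mu>
    after \<eta> shows that evaluation preserves it.\<close>
  have c: "c ss xs \<in> hom A (TO (Fr ss)) ?X" if xs: "xs \<in> tup ?X ss" for ss xs
    unfolding c_def
  proof (rule mkarr_hom[OF S _ X])
    note ss = tup_sorts[OF X xs]
    note TM = TO_model[OF Fr[OF ss]]
    show "is_pmodel S (TO (Fr ss))" using TM .
    show "q B ss xs s m \<in> car ?X s" if "m \<in> car (TO (Fr ss)) s" for s m using q_car(1)[OF Bt ss tX[OF xs] that] by simp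
    fix g ws assume g: "g \<in> funs (sgn S)" and ws: "ws \<in> tup (TO (Fr ss)) (farity (sgn S) g)"
    let ?tt = "farity (sgn S) g" and ?s = "fsort (sgn S) g"
    let ?o = "opn (Fr ?tt) g (gs ?tt)"
    note ew = ev[OF TM ws]
    have o: "ap (ev (TO (Fr ss)) ?tt ws) ?s ?o = opn (TO (Fr ss)) g ws" using ap_opn[OF S ew(1) g gs[OF farity_sorts[OF g]]] ew(2) by simp
    have ow: "opn (TO (Fr ss)) g ws \<in> car (TO (Fr ss)) ?s" using total_strD(2)[OF model_total[OF S TM] g ws] .
    have "opn ?X g (hmap (q B ss xs) ?tt ws) = opn B (\<rho> g) (hmap (q B ss xs) ?tt ws)" using g by (simp add: opn_red)
    also have "\<dots> = q B ss xs ?s (ap (\<mu> (Fr ss)) ?s (ap (TA (ev (TO (Fr ss)) ?tt ws)) ?s (ap (\<eta> (Fr ?tt)) ?s ?o)))"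
      unfolding \<rho>_def by (rule comp[OF xs farity_sorts[OF g] generic_op_car[OF g] ws])
    also have "\<dots> = q B ss xs ?s (opn (TO (Fr ss)) g ws)"
      using \<eta>_el[OF ew(1) generic_value_car[OF g]] o \<mu>_\<eta>[OF Fr[OF ss] ow] by simp
    finally show "q B ss xs ?s (opn (TO (Fr ss)) g ws) = opn ?X g (hmap (q B ss xs) ?tt ws)" by simp
  qed
  have cq: "ap (c ss xs) s w = q B ss xs s w" if "w \<in> car (TO (Fr ss)) s" for ss xs s w using that by (simp add: c_def)
  \<comment> \<open>Both arrows start at a free model and are compared on generators, where the
    claim is \<open>projection\<close>.\<close>
  have c\<eta>: "Comp A (c ss xs) (\<eta> (Fr ss)) = ev ?X ss xs" if xs: "xs \<in> tup ?X ss" for ss xs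
  proof -
    note ss = tup_sorts[OF X xs]
    note e = \<eta>_hom[OF Fr[OF ss]] and cc = c[OF xs]
    have "hmap (ap (Comp A (c ss xs) (\<eta> (Fr ss)))) ss (gs ss) = xs"
    proof (rule nth_equalityI)
      have l: "length xs = length ss" "length (gs ss) = length ss" using xs gs[OF ss] by (simp_all add: in_tup)
      then show "length (hmap (ap (Comp A (c ss xs) (\<eta> (Fr ss)))) ss (gs ss)) = length xs" by simp
      fix i assume "i < length (hmap (ap (Comp A (c ss xs) (\<eta> (Fr ss)))) ss (gs ss))"
      then have i: "i < length ss" using l by simp
      have g: "gs ss ! i \<in> car (Fr ss) (ss ! i)" using gs[OF ss] i by (simp add: in_tup)
      show "hmap (ap (Comp A (c ss xs) (\<eta> (Fr ss)))) ss (gs ss) ! i = xs ! i"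
        using ap_Comp[OF e cc g] cq[OF ap_car[OF e g]] projection[OF B ss tX[OF xs] i] i l by simp
    qed
    then show ?thesis using ev_unique[OF A.Comp_in[OF e cc] ss] by simp
  qed
  \<comment> \<open>An arrow \<open>u\<close> between free models is a substitution:
    \<open>TA u\<close> is multiplication after the monad applied to \<eta> after \<open>u\<close>.
    The tuple \<open>?ws\<close> of images of generators brings the claim into the form of
    \<open>composition\<close>, and \<open>c\<eta>\<close> evaluates the substituted operations back
    to \<open>xs\<close>.\<close>
  have cnat: "Comp A (c tt ys) (TA u) = c ss xs"
    if xs: "xs \<in> tup ?X ss" and ys: "ys \<in> tup ?X tt" and u: "u \<in> hom A (Fr ss) (Fr tt)" and uc: "Comp A (ev ?X tt ys) u = ev ?X ss xs" for ss xs tt ys u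
  proof (rule arr_eqI[OF A.Comp_in[OF TA_hom[OF u] c[OF ys]] c[OF xs]])
    note ss = tup_sorts[OF X xs] and tt = tup_sorts[OF X ys]
    note Ft = Fr[OF tt] and eu = A.Comp_in[OF u \<eta>_hom[OF Fr[OF tt]]]
    fix s w assume w: "w \<in> car (TO (Fr ss)) s"
    let ?ws = "hmap (ap (Comp A (\<eta> (Fr tt)) u)) ss (gs ss)"
    have ws: "?ws \<in> tup (TO (Fr tt)) ss" using ap_tup[OF eu gs[OF ss]] .
    have e: "ev (TO (Fr tt)) ss ?ws = Comp A (\<eta> (Fr tt)) u" by (rule ev_unique[OF eu ss])
    have uw: "ap (TA u) s w \<in> car (TO (Fr tt)) s" using ap_car[OF TA_hom[OF u] w] .
    have "hmap (q B tt ys) ss ?ws = hmap (ap (c tt ys)) ss ?ws" using ws by (rule hmap_cong) (simp add: cq)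
    also have "\<dots> = hmap (ap (Comp A (c tt ys) (Comp A (\<eta> (Fr tt)) u))) ss (gs ss)"
      using hmap_Comp[OF eu c[OF ys] gs[OF ss]] by simp
    also have "Comp A (c tt ys) (Comp A (\<eta> (Fr tt)) u) = ev ?X ss xs"
      using A.assoc[OF u \<eta>_hom[OF Ft] c[OF ys]] c\<eta>[OF ys] uc by simp
    also have "hmap (ap (ev ?X ss xs)) ss (gs ss) = xs" by (rule ev(2)[OF X xs])
    finally have "opn B (sym ss s w) xs = q B tt ys s (ap (\<mu> (Fr tt)) s (ap (TA (Comp A (\<eta> (Fr tt)) u)) s w))"
      using comp[OF ys ss w ws] e by simp
    also have "\<dots> = q B tt ys s (ap (TA u) s w)"
      using TA_comp[OF u \<eta>_hom[OF Ft]] ap_Comp[OF TA_hom[OF u] TA_hom[OF \<eta>_hom[OF Ft]] w] \<mu>_T\<eta>[OF Ft uw] by simp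
    finally show "ap (Comp A (c tt ys) (TA u)) s w = ap (c ss xs) s w"
      using ap_Comp[OF TA_hom[OF u] c[OF ys] w] cq[OF uw] cq[OF w] by simp
  qed
  note co = preserves_weak_coproducts[OF pres category_over[OF X] small_over[OF X] weak_coproducts_over[OF X] over_functor[OF X] over_colimit[OF X]]
  \<comment> \<open>The arrows of \<open>over\<close> are exactly the pairs of tuples related by a
    homomorphism as in \<open>cnat\<close>, so the components form a cocone on the image of the
    canonical diagram.\<close>
  have "is_cocone (over ?X) A (comp_func (comp_func U F) over_diag) ?X (\<lambda>(ss, xs). c ss xs)"
    unfolding is_cocone_def
  proof (intro conjI ballI)
    show "?X \<in> Obj A" using X by simp
    show "(case p of (ss, xs) \<Rightarrow> c ss xs) \<in> hom A (Ob (comp_func (comp_func U F) over_diag) p) ?X" if "p \<in> Obj (over ?X)" for p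
      using that c by (cases p) simp
    fix k assume k: "k \<in> Arr (over ?X)"
    obtain ss xs tt ys where p: "Dom (over ?X) k = (ss, xs)" "Cod (over ?X) k = (tt, ys)" by (cases "Dom (over ?X) k"; cases "Cod (over ?X) k")
    then have "k \<in> hom (over ?X) (ss, xs) (tt, ys)" using k by (simp add: hom_def)
    then obtain u where u: "k = ((ss, xs), u, (tt, ys))" "xs \<in> tup ?X ss" "ys \<in> tup ?X tt" "u \<in> hom A (Fr ss) (Fr tt)"
      "Comp A (ev ?X tt ys) u = ev ?X ss xs" unfolding hom_over by blast
    show "Comp A (case Cod (over ?X) k of (ss, xs) \<Rightarrow> c ss xs) (Ar (comp_func (comp_func U F) over_diag) k) =
      (case Dom (over ?X) k of (ss, xs) \<Rightarrow> c ss xs)"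
      using cnat[OF u(2-5)] u(1) by simp
  qed
  then have "\<exists>!h. h \<in> hom A (TO ?X) ?X \<and> (\<forall>p\<in>Obj (over ?X). Comp A h (Ar (comp_func U F) (case p of (ss, xs) \<Rightarrow> ev ?X ss xs)) = (case p of (ss, xs) \<Rightarrow> c ss xs))"
    using co unfolding is_colimit_def by simp
  then obtain a where a: "a \<in> hom A (TO ?X) ?X"
    and a': "\<forall>p\<in>Obj (over ?X). Comp A a (Ar (comp_func U F) (case p of (ss, xs) \<Rightarrow> ev ?X ss xs)) = (case p of (ss, xs) \<Rightarrow> c ss xs)"
    by (rule ex1_conjE)
  have ac: "Comp A a (TA (ev ?X ss xs)) = c ss xs" if "xs \<in> tup ?X ss" for ss xs
  proof -
    have "(ss, xs) \<in> Obj (over ?X)" using that by simp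
    from bspec[OF a' this] show ?thesis by simp
  qed
  have a1: "Comp A a (\<eta> ?X) = Id A ?X"
  proof (rule colimit_jointly_epic[OF A.category_axioms over_colimit[OF X] _ _ _ category_over[OF X] over_functor[OF X]])
    show "Comp A a (\<eta> ?X) \<in> hom A ?X ?X" using A.Comp_in[OF \<eta>_hom[OF X] a] .
    show "Id A ?X \<in> hom A ?X ?X" using A.Id_in X by simp
    fix p assume "p \<in> Obj (over ?X)"
    then obtain ss xs where p: "p = (ss, xs)" "xs \<in> tup ?X ss" by (cases p) auto
    note e = ev(1)[OF X p(2)]
    have "Comp A (Comp A a (\<eta> ?X)) (ev ?X ss xs) = Comp A (Comp A a (TA (ev ?X ss xs))) (\<eta> (Fr ss))"
      using A.assoc[OF e \<eta>_hom[OF X] a] \<eta>_nat[OF e] A.assoc[OF \<eta>_hom[OF Fr[OF tup_sorts[OF X p(2)]]] TA_hom[OF e] a] by simp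
    then show "Comp A (Comp A a (\<eta> ?X)) (case p of (ss, xs) \<Rightarrow> ev ?X ss xs) = Comp A (Id A ?X) (case p of (ss, xs) \<Rightarrow> ev ?X ss xs)"
      using ac[OF p(2)] c\<eta>[OF p(2)] A.Id_left[OF e] p(1) by simp
  qed
  \<comment> \<open>Restricting to \<open>TO (TO (Fr ss))\<close> replaces \<open>a\<close> on the
    inner level by \<open>c ss xs\<close> and reduces associativity to the statement that
    \<open>c ss xs\<close> is compatible with \<mu> and \<open>a\<close>.\<close>
  have a2: "Comp A a (\<mu> ?X) = Comp A a (TA a)"
  proof (rule TT_joint[OF X A.Comp_in[OF \<mu>_hom[OF X] a] A.Comp_in[OF TA_hom[OF a] a]])
    fix ss xs assume xs: "xs \<in> tup ?X ss"
    note ss = tup_sorts[OF X xs]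
    note FM = Fr[OF ss]
    note TM = TO_model[OF FM] and e = ev(1)[OF X xs]
    note Te = TA_hom[OF e] and cx = c[OF xs]
    have l: "Comp A (Comp A a (\<mu> ?X)) (TA (TA (ev ?X ss xs))) = Comp A (c ss xs) (\<mu> (Fr ss))"
      using A.assoc[OF TA_hom[OF Te] \<mu>_hom[OF X] a] \<mu>_nat[OF e] A.assoc[OF \<mu>_hom[OF FM] Te a] ac[OF xs] by simp
    have r: "Comp A (Comp A a (TA a)) (TA (TA (ev ?X ss xs))) = Comp A a (TA (c ss xs))"
      using A.assoc[OF TA_hom[OF Te] TA_hom[OF a] a] TA_comp[OF Te a] ac[OF xs] by simp
    have "Comp A (c ss xs) (\<mu> (Fr ss)) = Comp A a (TA (c ss xs))"
    \<comment> \<open>A second restriction, now along tuples \<open>ws\<close> of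
      \<open>TO (Fr ss)\<close>; after it, elementwise comparison of the two sides is precisely
      \<open>composition\<close>.\<close>
    proof (rule T_joint[OF TM A.Comp_in[OF \<mu>_hom[OF FM] cx] A.Comp_in[OF TA_hom[OF cx] a]])
      fix tt ws assume ws: "ws \<in> tup (TO (Fr ss)) tt"
      note ew = ev(1)[OF TM ws] and tt = tup_sorts[OF TM ws]
      note Tw = TA_hom[OF ew]
      have t: "hmap (ap (c ss xs)) tt ws \<in> tup ?X tt" using ap_tup[OF cx ws] .
      have "Comp A (Comp A a (TA (c ss xs))) (TA (ev (TO (Fr ss)) tt ws)) = c tt (hmap (ap (c ss xs)) tt ws)"
        using A.assoc[OF Tw TA_hom[OF cx] a] TA_comp[OF ew cx] ev_comp[OF TM ws cx] ac[OF t] by simp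
      moreover have "Comp A (Comp A (c ss xs) (\<mu> (Fr ss))) (TA (ev (TO (Fr ss)) tt ws)) = c tt (hmap (ap (c ss xs)) tt ws)"
      proof (rule arr_eqI[OF A.Comp_in[OF Tw A.Comp_in[OF \<mu>_hom[OF FM] cx]] c[OF t]])
        fix s v assume v: "v \<in> car (TO (Fr tt)) s"
        have v': "ap (TA (ev (TO (Fr ss)) tt ws)) s v \<in> car (TO (TO (Fr ss))) s" using ap_car[OF Tw v] .
        have v'': "ap (\<mu> (Fr ss)) s (ap (TA (ev (TO (Fr ss)) tt ws)) s v) \<in> car (TO (Fr ss)) s" using ap_car[OF \<mu>_hom[OF FM] v'] .
        have h: "hmap (q B ss xs) tt ws = hmap (ap (c ss xs)) tt ws" using ws by (rule hmap_cong) (simp add: cq)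
        show "ap (Comp A (Comp A (c ss xs) (\<mu> (Fr ss))) (TA (ev (TO (Fr ss)) tt ws))) s v = ap (c tt (hmap (ap (c ss xs)) tt ws)) s v"
          using ap_Comp[OF Tw A.Comp_in[OF \<mu>_hom[OF FM] cx] v] ap_Comp[OF \<mu>_hom[OF FM] cx v'] cq[OF v''] cq[OF v] comp[OF xs tt v ws] h by simp
      qed
      ultimately show "Comp A (Comp A (c ss xs) (\<mu> (Fr ss))) (TA (ev (TO (Fr ss)) tt ws)) = Comp A (Comp A a (TA (c ss xs))) (TA (ev (TO (Fr ss)) tt ws))" by simp
    qed
    then show "Comp A (Comp A a (\<mu> ?X)) (TA (TA (ev ?X ss xs))) = Comp A (Comp A a (TA a)) (TA (TA (ev ?X ss xs)))" using l r by simp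
  qed
  have Xa: "(?X, a) \<in> EM_algebras A Mon" using X a a1 a2 by (simp add: EM_algebras_def)
  have "mst ?X a = B"
  proof (rule total_str_ext[OF total_mst[OF Xa] Bt])
    fix f xs assume f: "f \<in> funs sgT" and xs: "xs \<in> tup (mst ?X a) (farity sgT f)"
    obtain ss s w where sw: "f = sym ss s w" "(ss, s, w) \<in> opset" using sgT_cases[OF f] .
    have xs: "xs \<in> tup ?X ss" using xs sgT_sym(2)[OF sw(2)] sw(1) by simp
    have w: "w \<in> car (TO (Fr ss)) s" using opsetD[OF sw(2)] by blast
    show "opn (mst ?X a) f xs = opn B f xs"
      using opn_mst[OF sw(2) xs] ap_Comp[OF TA_hom[OF ev(1)[OF X xs]] a w] ac[OF xs] cq[OF w] sw(1) by simp
  qed simp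
  then show ?thesis using Xa by blast
qed

section \<open>Equivalence of algebras for the monad with models of its theory\<close>

definition \<Phi> where "\<Phi> = \<lparr>Ob = (\<lambda>(X, a). mst X a), Ar = (\<lambda>((X, a), h, (Y, b)). (mst X a, ap h, mst Y b))\<rparr>"

lemma \<Phi>_sel [simp]: "Ob \<Phi> (X, a) = mst X a" "Ar \<Phi> ((X, a), h, (Y, b)) = (mst X a, ap h, mst Y b)"
  by (simp_all add: \<Phi>_def)

lemma mst_hom: assumes h: "h \<in> hom A X Y" and Xa: "(X, a) \<in> EM_algebras A Mon" and Yb: "(Y, b) \<in> EM_algebras A Mon"
    and hab: "Comp A h a = Comp A b (TA h)"
  shows "(mst X a, ap h, mst Y b) \<in> hom (PMod Th) (mst X a) (mst Y b)"
proof -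
  note X = EM_algebraD(1)[OF Xa] and a = EM_algebraD(2)[OF Xa] and b = EM_algebraD(2)[OF Yb]
  have hc: "ap h s m \<in> car Y s" if "m \<in> car X s" for s m using ap_car[OF h that] .
  have "ap h (fsort sgT f) (opn (mst X a) f ms) = opn (mst Y b) f (hmap (ap h) (farity sgT f) ms)"
    if f: "f \<in> funs sgT" and ms: "ms \<in> tup (mst X a) (farity sgT f)" for f ms
  proof -
    obtain ss s w where sw: "f = sym ss s w" "(ss, s, w) \<in> opset" using sgT_cases[OF f] .
    have ms: "ms \<in> tup X ss" using ms sgT_sym(2)[OF sw(2)] sw(1) by simp
    have w: "w \<in> car (TO (Fr ss)) s" using opsetD[OF sw(2)] by blast
    note e = ev(1)[OF X ms]
    have w': "ap (TA (ev X ss ms)) s w \<in> car (TO X) s" using ap_car[OF TA_hom[OF e] w] .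
    have "ap h s (ap a s (ap (TA (ev X ss ms)) s w)) = ap b s (ap (TA h) s (ap (TA (ev X ss ms)) s w))"
      using ap_Comp[OF a h w'] ap_Comp[OF TA_hom[OF h] b w'] hab by simp
    also have "ap (TA h) s (ap (TA (ev X ss ms)) s w) = ap (TA (ev Y ss (hmap (ap h) ss ms))) s w"
      using ap_Comp[OF TA_hom[OF e] TA_hom[OF h] w] TA_comp[OF e h] ev_comp[OF X ms h] by simp
    finally show ?thesis
      using opn_mst[OF sw(2) ms, of a] opn_mst[OF sw(2) ap_tup[OF h ms], of b] sgT_sym[OF sw(2)] sw(1) by simp
  qed
  moreover have "restrict (ap h s) (car X s) = ap h s" for s
    using h by (auto simp: hom_PMod is_hom_def PiE_def extensional_restrict)
  ultimately show ?thesis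
    using total_homI[OF total_mst[OF Xa] total_mst[OF Yb], of "ap h"] hc mst_model[OF Xa] mst_model[OF Yb] by (simp add: hom_PMod)
qed

lemma \<Phi>_functor: "is_functor (EM_cat A Mon) (PMod Th) \<Phi>"
  unfolding is_functor_def
proof (intro conjI ballI impI)
  show "Ob \<Phi> p \<in> Obj (PMod Th)" if "p \<in> Obj (EM_cat A Mon)" for p
    using that mst_model by (cases p) simp
  show "Ar \<Phi> k \<in> hom (PMod Th) (Ob \<Phi> p) (Ob \<Phi> p')" if "k \<in> hom (EM_cat A Mon) p p'" for p p' k
    using that mst_hom by (cases p; cases p') (auto simp: hom_EM)
  show "Ar \<Phi> (Id (EM_cat A Mon) p) = Id (PMod Th) (Ob \<Phi> p)" for p
    by (cases p) (simp add: PMod_def)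
  fix k l assume kl: "k \<in> Arr (EM_cat A Mon)" "l \<in> Arr (EM_cat A Mon)"
  obtain X a f Y b Y' b' g Z c where k: "k = ((X, a), f, (Y, b))" and l: "l = ((Y', b'), g, (Z, c))" by (cases k; cases l) auto
  have f: "f \<in> hom A X Y" and g: "g \<in> hom A Y' Z" using kl unfolding k l EM_cat_def by auto
  obtain f' g' where "f = (X, f', Y)" "g = (Y', g', Z)" using f g unfolding hom_PMod by blast
  then show "Ar \<Phi> (Comp (EM_cat A Mon) l k) = Comp (PMod Th) (Ar \<Phi> l) (Ar \<Phi> k)"
    unfolding k l by (simp add: PMod_def)
qed

text \<open>Both categories have homomorphisms with the same underlying functions, which settles
  faithfulness. On objects, \<open>algebra_of_model\<close> returns the given model itself, so
  identities witness essential surjectivity.\<close>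

lemma \<Phi>_equivalence: "is_equivalence (EM_cat A Mon) (PMod Th :: ('s, 'u, 'u, 'u) pstructure_cat) \<Phi>"
proof (rule is_equivalenceI[OF category_EM_Mon category_PMod \<Phi>_functor])
  show "fully_faithful (EM_cat A Mon) (PMod Th) \<Phi>"
  proof (rule fully_faithfulI[OF \<Phi>_functor category_EM_Mon])
    fix p p' k l assume k: "k \<in> hom (EM_cat A Mon) p p'" and l: "l \<in> hom (EM_cat A Mon) p p'" and e: "Ar \<Phi> k = Ar \<Phi> l"
    obtain X a Y b where p: "p = (X, a)" "p' = (Y, b)" by (cases p; cases p')
    obtain f g where f: "k = ((X, a), f, (Y, b))" "f \<in> hom A X Y" and g: "l = ((X, a), g, (Y, b))" "g \<in> hom A X Y"
      using k l unfolding p hom_EM by blast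
    have "ap f = ap g" using e f g by simp
    moreover have "f = (X, ap f, Y)" using f(2) unfolding hom_PMod by blast
    moreover have "g = (X, ap g, Y)" using g(2) unfolding hom_PMod by blast
    ultimately have "f = g" by metis
    then show "k = l" using f g by simp
  next
    fix p p' k assume p: "p \<in> Obj (EM_cat A Mon)" and p': "p' \<in> Obj (EM_cat A Mon)" and k: "k \<in> hom (PMod Th) (Ob \<Phi> p) (Ob \<Phi> p')"
    obtain X a where Xa: "p = (X, a)" "(X, a) \<in> EM_algebras A Mon" using p by (cases p) auto
    obtain Y b where Yb: "p' = (Y, b)" "(Y, b) \<in> EM_algebras A Mon" using p' by (cases p') auto
    note X = EM_algebraD(1)[OF Xa(2)] and a = EM_algebraD(2)[OF Xa(2)] and b = EM_algebraD(2)[OF Yb(2)]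
    have k': "k \<in> hom (PMod Th) (mst X a) (mst Y b)" using k Xa(1) Yb(1) by simp
    let ?h = "Ar (redf (sgn S) \<rho>) k"
    have h: "?h \<in> hom A X Y"
      using redf_hom[OF S theory_morphism_red[OF S equational_Th theory_morphism_\<rho>] k'] red_mst[OF Xa(2)] red_mst[OF Yb(2)] by simp
    have hk: "ap ?h = ap k" by simp
    \<comment> \<open>By joint epicness the algebra square is checked on each
      \<open>TO (Fr ss)\<close>. At an element \<open>w\<close> it says that \<open>k\<close>
      preserves the operation named by \<open>w\<close>.\<close>
    have "Comp A ?h a = Comp A b (TA ?h)"
    proof (rule T_joint[OF X A.Comp_in[OF a h] A.Comp_in[OF TA_hom[OF h] b]])
      fix ss xs assume xs: "xs \<in> tup X ss"
      note ss = tup_sorts[OF X xs] and e = ev(1)[OF X xs]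
      note Te = TA_hom[OF e]
      show "Comp A (Comp A ?h a) (TA (ev X ss xs)) = Comp A (Comp A b (TA ?h)) (TA (ev X ss xs))"
      proof (rule arr_eqI[OF A.Comp_in[OF Te A.Comp_in[OF a h]] A.Comp_in[OF Te A.Comp_in[OF TA_hom[OF h] b]]])
        fix s w assume w: "w \<in> car (TO (Fr ss)) s"
        have w': "ap (TA (ev X ss xs)) s w \<in> car (TO X) s" using ap_car[OF Te w] .
        note o = opsetI[OF ss w]
        have "ap (Comp A (Comp A ?h a) (TA (ev X ss xs))) s w = ap k s (opn (mst X a) (sym ss s w) xs)"
          using ap_Comp[OF Te A.Comp_in[OF a h] w] ap_Comp[OF a h w'] opn_mst[OF o xs, of a] by simp
        also have "\<dots> = opn (mst Y b) (sym ss s w) (hmap (ap k) ss xs)"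
          using ap_opn[OF equational_Th k', of "sym ss s w" xs] sgT_sym[OF o] xs by simp
        also have "\<dots> = ap b s (ap (TA (ev Y ss (hmap (ap ?h) ss xs))) s w)"
          using opn_mst[OF o ap_tup[OF h xs], of b] by simp
        also have "\<dots> = ap (Comp A (Comp A b (TA ?h)) (TA (ev X ss xs))) s w"
          using ap_Comp[OF Te A.Comp_in[OF TA_hom[OF h] b] w] ap_Comp[OF TA_hom[OF h] b w'] ap_Comp[OF Te TA_hom[OF h] w] TA_comp[OF e h] ev_comp[OF X xs h] by simp
        finally show "ap (Comp A (Comp A ?h a) (TA (ev X ss xs))) s w = ap (Comp A (Comp A b (TA ?h)) (TA (ev X ss xs))) s w" .
      qed
    qed
    then have "((X, a), ?h, (Y, b)) \<in> hom (EM_cat A Mon) p p'" using Xa Yb h by (simp add: hom_EM)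
    moreover have "Ar \<Phi> ((X, a), ?h, (Y, b)) = k"
    proof -
      have "k = (mst X a, ap k, mst Y b)" using k' by (simp add: hom_PMod)
      then show ?thesis by simp
    qed
    ultimately show "\<exists>f\<in>hom (EM_cat A Mon) p p'. Ar \<Phi> f = k" by blast
  qed
  show "ess_surj (EM_cat A Mon) (PMod Th :: ('s, 'u, 'u, 'u) pstructure_cat) \<Phi>"
    unfolding ess_surj_def
  proof
    interpret E: category "PMod Th :: ('s, 'u, 'u, 'u) pstructure_cat" by (rule category_PMod)
    fix B assume B: "B \<in> Obj (PMod Th :: ('s, 'u, 'u, 'u) pstructure_cat)"
    then obtain a where a: "(rd B, a) \<in> EM_algebras A Mon" "mst (rd B) a = B" using algebra_of_model[OF B[unfolded Obj_PMod]] by blast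
    have "iso_arr (PMod Th) (Id (PMod Th) B)"
      using E.iso_arr_iff[OF E.Id_in[OF B]] E.Id_in[OF B] E.Id_left[OF E.Id_in[OF B]] by blast
    then show "\<exists>c\<in>Obj (EM_cat A Mon). \<exists>f\<in>hom (PMod Th) (Ob \<Phi> c) B. iso_arr (PMod Th) f"
      using a E.Id_in[OF B] by (intro bexI[of _ "(rd B, a)"] bexI[of _ "Id (PMod Th) B"]) simp_all
  qed
qed

end

section \<open>Relative algebraic theories with total operators\<close>

lemma theory_of_monadic:
  fixes S :: "('s, 'f, 'r) pht" and C :: "('o, 'a) cat"
  assumes u: "universe TYPE('u)" and S: "equational_theory TYPE('u) S" and C: "category C"
    and m: "monadic_sifted TYPE('u) C (PMod S :: ('s, 'f, 'r, 'u) pstructure_cat)"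
  shows "\<exists>(T :: ('s, 'u, 'u) pht) \<rho>f \<rho>r. equational_theory TYPE('u) T \<and> theory_morphism TYPE('u) S T \<rho>f \<rho>r \<and>
    equivalent_cats C (PMod T :: ('s, 'u, 'u, 'u) pstructure_cat)"
proof -
  let ?A = "PMod S :: ('s, 'f, 'r, 'u) pstructure_cat"
  interpret univ "TYPE('u)" by unfold_locales (rule u)
  obtain F U \<eta> \<epsilon> where ma: "monadic_adjunction C ?A F U \<eta> \<epsilon>"
    and pr: "preserves_sifted_colimits TYPE('u) ?A ?A (endo (induced_monad F U \<eta> \<epsilon>))"
    using m unfolding monadic_sifted_def by blast
  have adj: "adjunction C ?A F U \<eta> \<epsilon>" and eq: "is_equivalence C (EM_cat ?A (induced_monad F U \<eta> \<epsilon>)) (comparison C U \<epsilon>)"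
    using ma by (auto simp: monadic_adjunction_def)
  define P where "P ss G xs \<longleftrightarrow> is_pmodel S (G :: ('s, 'f, 'r, 'u) pstructure) \<and> xs \<in> tup G ss \<and>
    (\<forall>M ms. is_pmodel S M \<longrightarrow> ms \<in> tup M ss \<longrightarrow> (\<exists>!h. h \<in> hom (PMod S) G M \<and> hmap (ap h) ss xs = ms))" for ss G xs
  \<comment> \<open>Free models exist only for lists of sorts of the signature; the implication lets
    one choice function be defined on all lists.\<close>
  have "\<exists>G xs. set ss \<subseteq> sorts (sgn S) \<longrightarrow> P ss G xs" for ss
    using free_on_sorts[OF S, of ss] unfolding P_def by (cases "set ss \<subseteq> sorts (sgn S)") simp_all
  then obtain Fr gs where Fr: "\<And>ss. set ss \<subseteq> sorts (sgn S) \<longrightarrow> P ss (Fr ss) (gs ss)" by metis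
  interpret adj C ?A F U \<eta> \<epsilon> by (intro adj.intro adj_axioms.intro C category_PMod adj)
  interpret sifted_monad "TYPE('u)" S Fr gs C F U \<eta> \<epsilon>
  proof unfold_locales
    show "equational_theory TYPE('u) S" by (rule S)
    show "is_pmodel S (Fr ss)" if "set ss \<subseteq> sorts (sgn S)" for ss using Fr that P_def by blast
    show "gs ss \<in> tup (Fr ss) ss" if "set ss \<subseteq> sorts (sgn S)" for ss using Fr that P_def by blast
    show "\<exists>!h. h \<in> hom (PMod S) (Fr ss) M \<and> hmap (ap h) ss (gs ss) = ms"
      if "set ss \<subseteq> sorts (sgn S)" "is_pmodel S M" "ms \<in> tup M ss" for ss M ms
      using Fr[of ss] that unfolding P_def by simp
    show "preserves_sifted_colimits TYPE('u) ?A ?A (comp_func U F)" using pr by simp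
  qed
  have "equivalent_cats C (PMod Th :: ('s, 'u, 'u, 'u) pstructure_cat)"
    by (rule equivalent_cats_trans[OF C category_EM_Mon category_PMod])
      (use eq \<Phi>_equivalence in \<open>auto simp: equivalent_cats_def\<close>)
  then show ?thesis using equational_Th theory_morphism_\<rho> by blast
qed

section \<open>Relative algebraic theories and equational theories over the base\<close>

context univ begin

lemma arity_map_ext: "arity_map \<Sigma> (ext_sig \<Sigma> \<Omega>) Inl"
  by (simp add: arity_map_def ext_sig_def)

lemma reduct_eq:
  assumes "is_pstructure (ext_sig \<Sigma> \<Omega>) A" "rels \<Sigma> = {}"
  shows "reduct A = red \<Sigma> Inl A"
proof -
  have "fint A (Inl f) ms = None" if "f \<notin> funs \<Sigma>" for f ms
    using fintD(1)[OF assms(1), of "Inl f" ms] that by (cases "fint A (Inl f) ms") (auto simp: ext_sig_def)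
  then have "(\<lambda>f. fint A (Inl f)) = (\<lambda>f. if f \<in> funs \<Sigma> then fint A (Inl f) else (\<lambda>_. None))" by (auto simp: fun_eq_iff)
  moreover have "rint A = (\<lambda>_. {})" using assms by (auto simp: is_pstructure_def ext_sig_def)
  ultimately show ?thesis unfolding reduct_def red_def by simp
qed

lemma total_defd_sequent:
  assumes f: "f \<in> funs \<Sigma>" and sg: "is_signature TYPE('u) \<Sigma>"
  shows "wf_sequent \<Sigma> (Sequent (generic_ctx (farity \<Sigma> f)) Top (defd (App f (map Var (generic_ctx (farity \<Sigma> f))))))"
    and "total_str \<Sigma> M \<Longrightarrow> valid M (Sequent (generic_ctx (farity \<Sigma> f)) Top (defd (App f (map Var (generic_ctx (farity \<Sigma> f))))))"
proof -
  let ?c = "generic_ctx (farity \<Sigma> f)"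
  have "wf_tm \<Sigma> ?c (App f (map Var ?c)) (fsort \<Sigma> f)"
    by (rule wf_tm.intros(2)[OF f]) (use wf_Vars[of \<Sigma> ?c] in \<open>simp add: generic_ctx(2)\<close>)
  moreover have "wf_ctx \<Sigma> ?c" by (rule wf_generic) (use f sg in \<open>simp add: is_signature_def\<close>)
  ultimately show "wf_sequent \<Sigma> (Sequent ?c Top (defd (App f (map Var ?c))))" by (auto simp: wf_sequent_def)
  show "valid M (Sequent ?c Top (defd (App f (map Var ?c))))" if "total_str \<Sigma> M"
    unfolding valid_defd_iff[OF generic_ctx(1)] generic_ctx(2) using total_strD(1)[OF that f] by blast
qed

lemma ext_signature:
  assumes "is_signature TYPE('u) (sgn S)" "is_relsig TYPE('u) S \<Omega>"
  shows "is_signature TYPE('u) (ext_sig (sgn S) \<Omega>)"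
proof -
  have "set (farity (ext_sig (sgn S) \<Omega>) f) \<subseteq> sorts (sgn S) \<and> fsort (ext_sig (sgn S) \<Omega>) f \<in> sorts (sgn S)"
    if "f \<in> funs (ext_sig (sgn S) \<Omega>)" for f
  proof (cases f)
    case (Inl g)
    then have "g \<in> funs (sgn S)" using that by (auto simp: ext_sig_def)
    then show ?thesis using assms(1) by (simp add: Inl ext_sig_def is_signature_def)
  next
    case (Inr \<omega>)
    then have "\<omega> \<in> ops \<Omega>" using that by (auto simp: ext_sig_def)
    then show ?thesis using assms(2) by (simp add: Inr ext_sig_def is_relsig_def wf_ctx_def)
  qed
  then show ?thesis
    using assms by (simp add: is_signature_def is_relsig_def ext_sig_def small_Un small_image)
qed

text \<open>\<open>alg_pht\<close> is not of equational form, as its axioms for the domains of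
  operators have premises. The theory \<open>T\<close> instead collects all premise-free sequents
  valid in the algebras. No information is lost: with total operators the arity formulas hold
  identically, so the domain axioms can be recovered, and the two categories coincide.\<close>

lemma Alg_as_models:
  fixes S :: "('s, 'f, 'r) pht" and \<Omega> :: "('s, 'f, 'r, 'w) relsig"
  assumes S: "equational_theory TYPE('u) S" and rel: "relative_algebraic_theory TYPE('u) S \<Omega> E"
    and tot: "\<forall>\<omega> \<in> ops \<Omega>. total_op TYPE('u) S \<Omega> E \<omega>" and E: "\<forall>e \<in> E. prem e = Top"
  shows "\<exists>T :: ('s, 'f + 'w, 'r) pht. equational_theory TYPE('u) T \<and> model_morphism TYPE('u) S T Inl \<and>
    (Alg S \<Omega> E :: ('s, 'f + 'w, 'r, 'u) pstructure_cat) = PMod T"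
proof -
  let ?\<Sigma> = "ext_sig (sgn S) \<Omega>"
  define \<A> :: "('s, 'f + 'w, 'r, 'u) pstructure set" where "\<A> = {A. is_algebra S \<Omega> A \<and> (\<forall>e \<in> E. valid A e)}"
  define T :: "('s, 'f + 'w, 'r) pht" where "T = \<lparr>sgn = ?\<Sigma>, axs = {e. wf_sequent ?\<Sigma> e \<and> prem e = Top \<and> (\<forall>A \<in> \<A>. valid A e)}\<rparr>"
  have rS: "rels (sgn S) = {}" and sgS: "is_signature TYPE('u) (sgn S)"
    and axS: "\<And>e. e \<in> axs S \<Longrightarrow> wf_sequent (sgn S) e \<and> prem e = Top"
    using S by (auto simp: equational_theory_def is_pht_def)
  have rs: "is_relsig TYPE('u) S \<Omega>" using rel by (simp add: relative_algebraic_theory_def)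
  have sg: "is_signature TYPE('u) ?\<Sigma>" by (rule ext_signature[OF sgS rs])
  note am = arity_map_ext[of "sgn S" \<Omega>]
  have rs\<omega>: "wf_ctx (sgn S) (fst (opar \<Omega> \<omega>))" "wf_horn (sgn S) (fst (opar \<Omega> \<omega>)) (snd (opar \<Omega> \<omega>))" if "\<omega> \<in> ops \<Omega>" for \<omega>
    using rs that by (auto simp: is_relsig_def)
  have dist: "distinct (fst (opar \<Omega> \<omega>))" if "\<omega> \<in> ops \<Omega>" for \<omega> using rs\<omega>(1)[OF that] by (simp add: wf_ctx_def)
  have AD: "is_pstructure ?\<Sigma> A" "is_pmodel S (red (sgn S) Inl A)"
    "\<And>\<omega>. \<omega> \<in> ops \<Omega> \<Longrightarrow> dom (fint A (Inr \<omega>)) = interp (red (sgn S) Inl A) (fst (opar \<Omega> \<omega>)) (snd (opar \<Omega> \<omega>))"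
    "\<And>e. e \<in> E \<Longrightarrow> valid A e" if "A \<in> \<A>" for A
    using that reduct_eq[of "sgn S" \<Omega> A] rS by (auto simp: \<A>_def is_algebra_def)
  have op_iff: "holds A (fst (opar \<Omega> \<omega>)) ms (op_defd \<Omega> \<omega>) \<longleftrightarrow> (\<exists>m. fint A (Inr \<omega>) ms = Some m)"
    if "\<omega> \<in> ops \<Omega>" "ms \<in> tup A (map fst (fst (opar \<Omega> \<omega>)))" for A :: "('s, 'f + 'w, 'r, 'u) pstructure" and \<omega> ms
    using tval_App_Var[OF dist[OF that(1)], of ms A "Inr \<omega>"] that(2) by (simp add: op_defd_def in_tup del: tval.simps)
  have int: "ms \<in> interp (red (sgn S) Inl A) (fst (opar \<Omega> \<omega>)) (snd (opar \<Omega> \<omega>)) \<longleftrightarrow>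
      ms \<in> tup A (map fst (fst (opar \<Omega> \<omega>))) \<and> holds A (fst (opar \<Omega> \<omega>)) ms (lift_horn (snd (opar \<Omega> \<omega>)))"
    if "\<omega> \<in> ops \<Omega>" for A :: "('s, 'f + 'w, 'r, 'u) pstructure" and \<omega> ms
    using holds_red[OF rS rs\<omega>(2)[OF that], of Inl A ms id] by (simp add: interp_def comp_def)
  have alg_model: "is_pmodel (alg_pht S \<Omega> E) A" if A: "A \<in> \<A>" for A
    unfolding is_pmodel_def
  proof (intro conjI ballI)
    show "is_pstructure (sgn (alg_pht S \<Omega> E)) A" using AD(1)[OF A] by (simp add: alg_pht_def)
    fix e assume "e \<in> axs (alg_pht S \<Omega> E)"
    then consider d where "d \<in> axs S" "e = map_sequent Inl id d"
      | \<omega> where "\<omega> \<in> ops \<Omega>" "e = Sequent (fst (opar \<Omega> \<omega>)) (op_defd \<Omega> \<omega>) (lift_horn (snd (opar \<Omega> \<omega>))) \<or>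
           e = Sequent (fst (opar \<Omega> \<omega>)) (lift_horn (snd (opar \<Omega> \<omega>))) (op_defd \<Omega> \<omega>)"
      | "e \<in> E" by (auto simp: alg_pht_def split: prod.splits)
    then show "valid A e"
    proof cases
      case 1
      then show ?thesis using AD(2)[OF A] valid_red[OF rS, of d Inl A id] axS by (auto simp: is_pmodel_def)
    next
      case 2
      have "holds A (fst (opar \<Omega> \<omega>)) ms (op_defd \<Omega> \<omega>) \<longleftrightarrow> holds A (fst (opar \<Omega> \<omega>)) ms (lift_horn (snd (opar \<Omega> \<omega>)))"
        if ms: "ms \<in> tup A (map fst (fst (opar \<Omega> \<omega>)))" for ms
        using op_iff[OF 2(1) ms] AD(3)[OF A 2(1)] int[OF 2(1), of ms A] ms by (auto simp: dom_def)
      then show ?thesis using 2(2) by (auto simp: valid_def interp_def comp_def)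
    next
      case 3
      then show ?thesis using AD(4)[OF A] by blast
    qed
  qed
  have At: "total_str ?\<Sigma> A" if A: "A \<in> \<A>" for A
    unfolding total_str_def
  proof (intro conjI ballI AD(1)[OF A])
    show "rels ?\<Sigma> = {}" using rS by (simp add: ext_sig_def)
    fix f ms assume f: "f \<in> funs ?\<Sigma>" and ms: "ms \<in> tup A (farity ?\<Sigma> f)"
    show "\<exists>m. fint A f ms = Some m"
    proof (cases f)
      case (Inl g)
      then have g: "g \<in> funs (sgn S)" using f by (auto simp: ext_sig_def)
      have "ms \<in> tup (red (sgn S) Inl A) (farity (sgn S) g)" using ms by (simp add: Inl ext_sig_def)
      then show ?thesis using total_strD(1)[OF model_total[OF S AD(2)[OF A]] g] by (simp add: Inl fint_red[OF g])
    next
      case (Inr \<omega>)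
      then have o: "\<omega> \<in> ops \<Omega>" using f by (auto simp: ext_sig_def)
      have "valid A (Sequent (fst (opar \<Omega> \<omega>)) Top (op_defd \<Omega> \<omega>))"
        using tot o alg_model[OF A] by (simp add: total_op_def phl_theorem_def)
      then show ?thesis
        unfolding op_defd_def valid_defd_iff[OF dist[OF o]] using ms by (simp add: Inr ext_sig_def)
    qed
  qed
  have eqT: "equational_theory TYPE('u) T"
    unfolding equational_theory_def
  proof (intro conjI ballI)
    show "is_pht TYPE('u) T" using sg by (auto simp: is_pht_def T_def)
    show "rels (sgn T) = {}" using rS by (simp add: T_def ext_sig_def)
    show "prem e = Top" if "e \<in> axs T" for e using that by (auto simp: T_def)
    fix f assume "f \<in> funs (sgn T)"
    then have f: "f \<in> funs ?\<Sigma>" by (simp add: T_def)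
    let ?e = "Sequent (generic_ctx (farity ?\<Sigma> f)) Top (defd (App f (map Var (generic_ctx (farity ?\<Sigma> f))))) :: ('s, 'f + 'w, 'r) sequent"
    have "?e \<in> axs T" using total_defd_sequent(1)[OF f sg] total_defd_sequent(2)[OF f sg At] by (simp add: T_def)
    then have "phl_theorem TYPE('u) T ?e" by (simp add: phl_theorem_def is_pmodel_def) (simp add: T_def)
    then show "total_fun TYPE('u) T f" by (simp add: total_fun_def T_def)
  qed
  have TA: "A \<in> \<A>" if A: "is_pmodel T A" for A
  proof -
    have t: "total_str ?\<Sigma> A" using model_total[OF eqT A] by (simp add: T_def)
    have ps: "is_pstructure ?\<Sigma> A" using t by (simp add: total_str_def)
    have val: "valid A e" if "wf_sequent ?\<Sigma> e" "prem e = Top" "\<And>B. B \<in> \<A> \<Longrightarrow> valid B e" for e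
      using A that by (simp add: is_pmodel_def T_def)
    have m: "is_pmodel S (red (sgn S) Inl A)"
    proof (rule modelI[OF total_red[OF am rS t]])
      fix e assume e: "e \<in> axs S"
      have p: "prem (map_sequent Inl id e :: ('s, 'f + 'w, 'r) sequent) = Top" using axS[OF e] by (cases e) simp
      have "valid A (map_sequent Inl id e)"
      proof (rule val[OF wf_map_sequent[OF am rS] p])
        show "wf_sequent (sgn S) e" using axS[OF e] by simp
        show "valid B (map_sequent Inl id e)" if "B \<in> \<A>" for B
          using AD(2)[OF that] valid_red[OF rS, of e Inl B id] axS[OF e] e by (simp add: is_pmodel_def)
      qed
      then show "valid (red (sgn S) Inl A) e" using valid_red[OF rS, of e Inl A id] axS[OF e] by simp
    qed
    have "dom (fint A (Inr \<omega>)) = interp (red (sgn S) Inl A) (fst (opar \<Omega> \<omega>)) (snd (opar \<Omega> \<omega>))" if o: "\<omega> \<in> ops \<Omega>" for \<omega>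
    proof -
      let ?xs = "fst (opar \<Omega> \<omega>)"
      \<comment> \<open>In an algebra the domain of \<open>\<omega>\<close> is the interpretation of
        its arity formula. Totality makes it the whole product, so the formula without premise is an
        axiom of \<open>T\<close> and describes the domain in every model.\<close>
      let ?e = "Sequent ?xs Top (lift_horn (snd (opar \<Omega> \<omega>))) :: ('s, 'f + 'w, 'r) sequent"
      have f: "Inr \<omega> \<in> funs ?\<Sigma>" "farity ?\<Sigma> (Inr \<omega>) = map fst ?xs" using o by (simp_all add: ext_sig_def)
      have "wf_sequent ?\<Sigma> ?e"
        using rs\<omega>[OF o] wf_map_horn[OF am rS, of ?xs _ id] by (simp add: wf_sequent_def wf_ctx_def) (simp add: ext_sig_def)
      moreover have "valid B ?e" if B: "B \<in> \<A>" for B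
      proof -
        have "holds B ?xs ms (lift_horn (snd (opar \<Omega> \<omega>)))" if "ms \<in> tup B (map fst ?xs)" for ms
          using total_strD(1)[OF At[OF B] f(1), of ms] that f(2) AD(3)[OF B o] int[OF o, of ms B] by (auto simp: dom_def)
        then show ?thesis by (simp add: valid_Top)
      qed
      ultimately have "valid A ?e" by (intro val) simp_all
      then have 1: "holds A ?xs ms (lift_horn (snd (opar \<Omega> \<omega>)))" if "ms \<in> tup A (map fst ?xs)" for ms
        using that by (simp add: valid_Top)
      have 2: "ms \<in> dom (fint A (Inr \<omega>)) \<longleftrightarrow> ms \<in> tup A (map fst ?xs)" for ms
        using total_strD(1)[OF t f(1), of ms] fintD(2)[OF ps, of "Inr \<omega>" ms] f(2) by auto
      show ?thesis using 1 2 int[OF o, of _ A] by blast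
    qed
    moreover have "valid A e" if e: "e \<in> E" for e
    proof (rule val)
      show "wf_sequent ?\<Sigma> e" using rel e by (simp add: relative_algebraic_theory_def relative_judgment_def)
      show "prem e = Top" using E e by blast
      show "valid B e" if "B \<in> \<A>" for B using AD(4)[OF that e] .
    qed
    ultimately show ?thesis using ps m reduct_eq[OF ps rS] by (simp add: \<A>_def is_algebra_def)
  qed
  have "is_pmodel T A" if "A \<in> \<A>" for A
    unfolding is_pmodel_def using AD(1)[OF that] that by (simp add: T_def)
  then have "is_pmodel T A \<longleftrightarrow> A \<in> \<A>" for A using TA by blast
  then have "Alg S \<Omega> E = (PMod T :: ('s, 'f + 'w, 'r, 'u) pstructure_cat)"
    by (simp add: Alg_def PMod_def T_def \<A>_def[symmetric])
  moreover have "model_morphism TYPE('u) S T Inl"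
    unfolding model_morphism_def using am AD(2)[OF TA] by (simp add: T_def)
  ultimately show ?thesis using eqT by blast
qed

text \<open>Every symbol of \<open>T\<close> is added as an operator whose arity formula is
  \<open>Top\<close>. The base symbols are then present twice, as themselves and through
  \<open>\<rho>\<close>; equations in \<open>E\<close> identify the two copies, so that an algebra
  carries no more data than a model of \<open>T\<close>.\<close>

lemma models_as_Alg:
  fixes S :: "('s, 'f, 'r) pht" and T :: "('s, 'w, 'q) pht"
  assumes S: "equational_theory TYPE('u) S" and T: "equational_theory TYPE('u) T" and m: "model_morphism TYPE('u) S T \<rho>"
  shows "\<exists>(\<Omega> :: ('s, 'f, 'r, 'w) relsig) E. relative_algebraic_theory TYPE('u) S \<Omega> E \<and>
    (\<forall>\<omega> \<in> ops \<Omega>. total_op TYPE('u) S \<Omega> E \<omega>) \<and> (\<forall>e \<in> E. prem e = Top) \<and>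
    equivalent_cats (PMod T :: ('s, 'w, 'q, 'u) pstructure_cat) (Alg S \<Omega> E :: ('s, 'f + 'w, 'r, 'u) pstructure_cat) \<and>
    category (Alg S \<Omega> E :: ('s, 'f + 'w, 'r, 'u) pstructure_cat)"
proof -
  define \<Omega> :: "('s, 'f, 'r, 'w) relsig" where
    "\<Omega> = \<lparr>ops = funs (sgn T), opar = (\<lambda>g. (generic_ctx (farity (sgn T) g), Top)), optype = fsort (sgn T)\<rparr>"
  let ?\<Sigma> = "ext_sig (sgn S) \<Omega>"
  have rS: "rels (sgn S) = {}" and sgS: "is_signature TYPE('u) (sgn S)" and rT: "rels (sgn T) = {}" and sgT: "is_signature TYPE('u) (sgn T)"
    and axT: "\<And>e. e \<in> axs T \<Longrightarrow> wf_sequent (sgn T) e \<and> prem e = Top"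
    using S T by (auto simp: equational_theory_def is_pht_def)
  have am: "arity_map (sgn S) (sgn T) \<rho>" using m by (simp add: model_morphism_def)
  have srt: "sorts (sgn S) = sorts (sgn T)" using am by (simp add: arity_map_def)
  have rs: "is_relsig TYPE('u) S \<Omega>"
    using sgT wf_generic[of _ "sgn S"] srt by (auto simp: is_relsig_def \<Omega>_def is_signature_def)
  have sg: "is_signature TYPE('u) ?\<Sigma>" by (rule ext_signature[OF sgS rs])
  have aml: "arity_map (sgn S) ?\<Sigma> Inl" by (rule arity_map_ext)
  have amr: "arity_map (sgn T) ?\<Sigma> Inr" using srt by (simp add: arity_map_def ext_sig_def \<Omega>_def generic_ctx)
  \<comment> \<open>The expansion of a model of \<open>T\<close> that interprets a base symbol
    \<open>f\<close> by \<open>\<rho> f\<close>. \<open>E\<close> consists of everything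
    premise-free that holds in all these expansions, including the renamed axioms of
    \<open>T\<close> and the equations between \<open>f\<close> and \<open>\<rho> f\<close>.\<close>
  define X :: "('s, 'w, 'q, 'u) pstructure \<Rightarrow> ('s, 'f + 'w, 'r, 'u) pstructure" where
    "X M = \<lparr>car = car M, fint = case_sum (\<lambda>f. if f \<in> funs (sgn S) then fint M (\<rho> f) else (\<lambda>_. None)) (fint M), rint = (\<lambda>_. {})\<rparr>" for M
  have carX: "car (X M) = car M" for M by (simp add: X_def)
  define E :: "('s, 'f + 'w, 'r) sequent set" where
    "E = {e. wf_sequent ?\<Sigma> e \<and> prem e = Top \<and> (\<forall>M :: ('s, 'w, 'q, 'u) pstructure. is_pmodel T M \<longrightarrow> valid (X M) e)}"
  have rel: "relative_algebraic_theory TYPE('u) S \<Omega> E"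
    using rs by (auto simp: relative_algebraic_theory_def relative_judgment_def E_def intro!: exI[of _ Top])
  have tot: "total_op TYPE('u) S \<Omega> E \<omega>" if o: "\<omega> \<in> ops \<Omega>" for \<omega>
  proof -
    have f: "Inr \<omega> \<in> funs ?\<Sigma>" and fa: "farity ?\<Sigma> (Inr \<omega>) = farity (sgn T) \<omega>" and op: "fst (opar \<Omega> \<omega>) = generic_ctx (farity (sgn T) \<omega>)"
      using o by (simp_all add: ext_sig_def \<Omega>_def generic_ctx)
    let ?e = "Sequent (fst (opar \<Omega> \<omega>)) Top (op_defd \<Omega> \<omega>) :: ('s, 'f + 'w, 'r) sequent"
    have "wf_sequent ?\<Sigma> ?e" using total_defd_sequent(1)[OF f sg] unfolding fa op op_defd_def .
    \<comment> \<open>With \<open>Top\<close> as arity formula, totality of the operator is itself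
      one of the defining axioms of \<open>alg_pht\<close>.\<close>
    moreover have "?e \<in> axs (alg_pht S \<Omega> E)" using o by (force simp: alg_pht_def \<Omega>_def)
    moreover have "sgn (alg_pht S \<Omega> E) = ?\<Sigma>" by (simp add: alg_pht_def)
    ultimately show ?thesis by (simp add: total_op_def phl_theorem_def is_pmodel_def)
  qed
  have redr: "red (sgn T) Inr (X M) = M" and redl: "red (sgn S) Inl (X M) = red (sgn S) \<rho> M" and Xt: "total_str ?\<Sigma> (X M)"
    if M: "is_pmodel T M" for M :: "('s, 'w, 'q, 'u) pstructure"
  proof -
    have Mt: "total_str (sgn T) M" using model_total[OF T M] .
    have rt: "total_str (sgn S) (red (sgn S) \<rho> M :: ('s, 'f, 'r, 'u) pstructure)" using total_red[OF am rS Mt] .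
    show "red (sgn S) Inl (X M) = red (sgn S) \<rho> M" by (auto simp: red_def X_def fun_eq_iff)
    show Xt: "total_str ?\<Sigma> (X M)"
      unfolding total_str_def is_pstructure_def
    proof (intro conjI allI ballI impI)
      show "small TYPE('u) (car (X M) s)" for s using Mt by (simp add: carX total_str_def is_pstructure_def)
      show "car (X M) s = {}" if "s \<notin> sorts ?\<Sigma>" for s using Mt that srt by (simp add: carX total_str_def is_pstructure_def ext_sig_def)
      show "rels ?\<Sigma> = {}" using rS by (simp add: ext_sig_def)
      have *: "fint (X M) (Inl f) = fint (red (sgn S) \<rho> M :: ('s, 'f, 'r, 'u) pstructure) f" "fint (X M) (Inr g) = fint M g" for f g
        by (simp_all add: X_def red_def)
      show "f \<in> funs ?\<Sigma>" "ms \<in> tup (X M) (farity ?\<Sigma> f)" "k \<in> car (X M) (fsort ?\<Sigma> f)" if "fint (X M) f ms = Some k" for f ms k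
        using that rt Mt by (cases f; auto simp: * carX total_str_def is_pstructure_def ext_sig_def \<Omega>_def generic_ctx)+
      show "\<exists>k. fint (X M) f ms = Some k" if "f \<in> funs ?\<Sigma>" "ms \<in> tup (X M) (farity ?\<Sigma> f)" for f ms
        using that rt Mt by (cases f) (auto simp: * carX total_str_def ext_sig_def \<Omega>_def generic_ctx)
    qed (auto simp: X_def)
    show "red (sgn T) Inr (X M) = M"
      by (rule total_str_ext[OF total_red[OF amr rT Xt] Mt]) (auto simp: carX opn_red X_def opn_def)
  qed
  define \<A> :: "('s, 'f + 'w, 'r, 'u) pstructure set" where "\<A> = {A. is_algebra S \<Omega> A \<and> (\<forall>e \<in> E. valid A e)}"
  have XA: "X M \<in> \<A>" if M: "is_pmodel T M" for M
  proof -
    note t = Xt[OF M]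
    have ps: "is_pstructure ?\<Sigma> (X M)" using t by (simp add: total_str_def)
    have red: "reduct (X M) = red (sgn S) \<rho> M" using reduct_eq[OF ps rS] redl[OF M] by simp
    have "dom (fint (X M) (Inr \<omega>)) = interp (reduct (X M)) (fst (opar \<Omega> \<omega>)) (snd (opar \<Omega> \<omega>))" if o: "\<omega> \<in> ops \<Omega>" for \<omega>
    proof -
      have f: "Inr \<omega> \<in> funs ?\<Sigma>" "farity ?\<Sigma> (Inr \<omega>) = farity (sgn T) \<omega>" using o by (simp_all add: ext_sig_def \<Omega>_def generic_ctx)
      have "ms \<in> dom (fint (X M) (Inr \<omega>)) \<longleftrightarrow> ms \<in> tup (X M) (farity (sgn T) \<omega>)" for ms
        using total_strD(1)[OF t f(1), of ms] fintD(2)[OF ps, of "Inr \<omega>" ms] f(2) by auto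
      moreover have "interp (reduct (X M)) (fst (opar \<Omega> \<omega>)) (snd (opar \<Omega> \<omega>)) = tup (X M) (farity (sgn T) \<omega>)"
        using tup_fst[of "red (sgn S) \<rho> M" "generic_ctx (farity (sgn T) \<omega>)"] unfolding red by (simp add: \<Omega>_def interp_def generic_ctx(2) carX)
      ultimately show ?thesis by blast
    qed
    moreover have "is_pmodel S (red (sgn S) \<rho> M)" using m M by (simp add: model_morphism_def)
    ultimately show ?thesis using ps M by (auto simp: \<A>_def is_algebra_def red E_def)
  qed
  have AX: "is_pmodel T (red (sgn T) Inr A) \<and> X (red (sgn T) Inr A) = A" if A: "A \<in> \<A>" for A
  proof -
    have ps: "is_pstructure ?\<Sigma> A" using A by (simp add: \<A>_def is_algebra_def)
    note red = reduct_eq[OF ps rS]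
    have mS: "is_pmodel S (red (sgn S) Inl A)" using A by (simp add: \<A>_def is_algebra_def red)
    have EA: "valid A e" if "e \<in> E" for e using A that by (simp add: \<A>_def)
    have At: "total_str ?\<Sigma> A"
      unfolding total_str_def
    proof (intro conjI ballI ps)
      show "rels ?\<Sigma> = {}" using rS by (simp add: ext_sig_def)
      fix f ms assume f: "f \<in> funs ?\<Sigma>" and ms: "ms \<in> tup A (farity ?\<Sigma> f)"
      have "valid (X M) (Sequent (generic_ctx (farity ?\<Sigma> f)) Top (defd (App f (map Var (generic_ctx (farity ?\<Sigma> f))))))" if "is_pmodel T M" for M
        by (rule total_defd_sequent(2)[OF f sg Xt[OF that]])
      then have "Sequent (generic_ctx (farity ?\<Sigma> f)) Top (defd (App f (map Var (generic_ctx (farity ?\<Sigma> f))))) \<in> E"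
        using total_defd_sequent(1)[OF f sg] by (simp add: E_def)
      from EA[OF this] show "\<exists>m. fint A f ms = Some m"
        unfolding valid_defd_iff[OF generic_ctx(1)] generic_ctx(2) using ms by blast
    qed
    let ?M = "red (sgn T) Inr A :: ('s, 'w, 'q, 'u) pstructure"
    have M: "is_pmodel T ?M"
    proof (rule modelI[OF total_red[OF amr rT At]])
      fix e assume e: "e \<in> axs T"
      have p: "prem (map_sequent Inr r e :: ('s, 'f + 'w, 'r) sequent) = Top" for r using axT[OF e] by (cases e) simp
      \<comment> \<open>The signature of \<open>T\<close> has no relation symbols, so any value
        serves as their renaming.\<close>
      define r :: "'q \<Rightarrow> 'r" where "r = (\<lambda>_. undefined)"
      have "valid (X M) (map_sequent Inr r e)" if "is_pmodel T M" for M
        using that e valid_red[OF rT, of e Inr "X M" r] axT[OF e] redr[OF that] by (simp add: is_pmodel_def)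
      then have "map_sequent Inr r e \<in> E" using wf_map_sequent[OF amr rT, of e r] axT[OF e] p by (simp add: E_def)
      from EA[OF this] show "valid ?M e" using valid_red[OF rT, of e Inr A r] axT[OF e] by simp
    qed
    have "X ?M = A"
    proof (rule total_str_ext[OF Xt[OF M] At])
      show "car (X ?M) = car A" by (simp add: carX)
      fix f ms assume f: "f \<in> funs ?\<Sigma>" and "ms \<in> tup (X ?M) (farity ?\<Sigma> f)"
      then have ms: "ms \<in> tup A (farity ?\<Sigma> f)" by (simp add: carX)
      show "opn (X ?M) f ms = opn A f ms"
      proof (cases f)
        case (Inr g)
        then have "g \<in> funs (sgn T)" using f by (auto simp: ext_sig_def \<Omega>_def)
        then show ?thesis by (simp add: Inr X_def opn_def fint_red)
      next
        case (Inl g)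
        then have g: "g \<in> funs (sgn S)" using f by (auto simp: ext_sig_def)
        let ?c = "generic_ctx (farity (sgn S) g)"
        \<comment> \<open>This equation belongs to \<open>E\<close> because every expansion
          satisfies it by construction; in an algebra it forces the base operation to be the one
          reconstructed by \<open>X\<close>.\<close>
        let ?e = "Sequent ?c Top (Eq (App (Inl g) (map Var ?c)) (App (Inr (\<rho> g)) (map Var ?c))) :: ('s, 'f + 'w, 'r) sequent"
        have \<rho>g: "\<rho> g \<in> funs (sgn T)" "farity (sgn T) (\<rho> g) = farity (sgn S) g" "fsort (sgn T) (\<rho> g) = fsort (sgn S) g"
          using am g by (auto simp: arity_map_def)
        have fl: "Inl g \<in> funs ?\<Sigma>" "farity ?\<Sigma> (Inl g) = farity (sgn S) g" "fsort ?\<Sigma> (Inl g) = fsort (sgn S) g"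
          and fr: "Inr (\<rho> g) \<in> funs ?\<Sigma>" "farity ?\<Sigma> (Inr (\<rho> g)) = farity (sgn S) g" "fsort ?\<Sigma> (Inr (\<rho> g)) = fsort (sgn S) g"
          using g \<rho>g by (simp_all add: ext_sig_def \<Omega>_def generic_ctx)
        have wV: "list_all2 (wf_tm ?\<Sigma> ?c) (map Var ?c) (farity (sgn S) g)" using wf_Vars[of ?\<Sigma> ?c] by (simp add: generic_ctx(2))
        have "wf_tm ?\<Sigma> ?c (App (Inl g) (map Var ?c)) (fsort (sgn S) g)" "wf_tm ?\<Sigma> ?c (App (Inr (\<rho> g)) (map Var ?c)) (fsort (sgn S) g)"
          using wf_tm.intros(2)[OF fl(1), of ?c "map Var ?c"] wf_tm.intros(2)[OF fr(1), of ?c "map Var ?c"] wV fl fr by simp_all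
        moreover have "wf_ctx ?\<Sigma> ?c"
        proof (rule wf_generic)
          have "set (farity ?\<Sigma> (Inl g)) \<subseteq> sorts ?\<Sigma>" using sg fl(1) by (simp only: is_signature_def)
          then show "set (farity (sgn S) g) \<subseteq> sorts ?\<Sigma>" by (simp only: fl(2))
        qed
        ultimately have wf: "wf_sequent ?\<Sigma> ?e" by (auto simp: wf_sequent_def)
        have iff: "valid B ?e \<longleftrightarrow> (\<forall>ms \<in> tup B (farity (sgn S) g). opn B (Inl g) ms = opn B (Inr (\<rho> g)) ms)" if B: "total_str ?\<Sigma> B"
          for B :: "('s, 'f + 'w, 'r, 'u) pstructure"
        proof -
          have "tval B ?c ms (App h (map Var ?c)) = fint B h ms" if "ms \<in> tup B (farity (sgn S) g)" for ms h
            by (rule tval_App_Var[OF generic_ctx(1)]) (use that in \<open>simp add: in_tup generic_ctx\<close>)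
          then show ?thesis
            using total_strD(1)[OF B fl(1)] total_strD(1)[OF B fr(1)] fl(2) fr(2)
            by (auto simp: valid_Top generic_ctx(2) simp del: tval.simps)
        qed
        have "valid (X M) ?e" if "is_pmodel T M" for M
          unfolding iff[OF Xt[OF that]] using g by (simp add: X_def opn_def)
        then have "?e \<in> E" using wf by (simp add: E_def)
        then have "opn A (Inl g) ms = opn A (Inr (\<rho> g)) ms" using EA iff[OF At] ms fl(2) Inl by simp
        then show ?thesis using g \<rho>g(1) by (simp add: Inl X_def opn_def fint_red)
      qed
    qed
    then show ?thesis using M by simp
  qed
  let ?P = "PMod T :: ('s, 'w, 'q, 'u) pstructure_cat" and ?B = "Alg S \<Omega> E :: ('s, 'f + 'w, 'r, 'u) pstructure_cat"
  have Bdef: "?B = pstructure_cat ?\<Sigma> \<A>" by (simp add: Alg_def \<A>_def)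
  have cB: "category ?B" unfolding Bdef by (rule category_pcat) (simp add: \<A>_def is_algebra_def)
  have hom_iff: "is_hom ?\<Sigma> (X M) (X N) h \<longleftrightarrow> is_hom (sgn T) M N h" if M: "is_pmodel T M" and N: "is_pmodel T N" for M N h
  proof
    show "is_hom (sgn T) M N h" if "is_hom ?\<Sigma> (X M) (X N) h"
      using hom_red[OF amr rT that] redr[OF M] redr[OF N] by simp
    assume h: "is_hom (sgn T) M N h"
    have h': "is_hom (sgn S) (red (sgn S) \<rho> M :: ('s, 'f, 'r, 'u) pstructure) (red (sgn S) \<rho> N) h" by (rule hom_red[OF am rS h])
    show "is_hom ?\<Sigma> (X M) (X N) h"
      unfolding is_hom_def
    proof (intro conjI allI ballI impI)
      show "h s \<in> car (X M) s \<rightarrow>\<^sub>E car (X N) s" for s using h by (simp add: carX is_hom_def)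
      fix f ms k assume f: "f \<in> funs ?\<Sigma>" and k: "fint (X M) f ms = Some k"
      show "fint (X N) f (hmap h (farity ?\<Sigma> f) ms) = Some (h (fsort ?\<Sigma> f) k)"
      proof (cases f)
        case (Inl g)
        then have g: "g \<in> funs (sgn S)" using f by (auto simp: ext_sig_def)
        then show ?thesis using k h' by (simp add: Inl X_def ext_sig_def is_hom_def fint_red)
      next
        case (Inr g)
        then have g: "g \<in> funs (sgn T)" using f by (auto simp: ext_sig_def \<Omega>_def)
        then show ?thesis using k h by (simp add: Inr X_def ext_sig_def \<Omega>_def generic_ctx is_hom_def)
      qed
    qed (use rS in \<open>simp add: ext_sig_def\<close>)
  qed
  define \<Psi> where "\<Psi> = \<lparr>Ob = X, Ar = (\<lambda>(M, h, N). (X M, h :: 's \<Rightarrow> 'u \<Rightarrow> 'u, X N))\<rparr>"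
  have \<Psi> [simp]: "Ob \<Psi> = X" "Ar \<Psi> (M, h, N) = (X M, h, X N)" for M h N by (simp_all add: \<Psi>_def)
  have homB: "(X M, h, X N) \<in> hom ?B (X M) (X N) \<longleftrightarrow> (M, h, N) \<in> hom ?P M N" if "is_pmodel T M" "is_pmodel T N" for M h N
    using that XA hom_iff[OF that] by (simp add: Bdef hom_pcat hom_PMod)
  have F: "is_functor ?P ?B \<Psi>"
    unfolding is_functor_def
  proof (intro conjI ballI impI)
    show "Ob \<Psi> M \<in> Obj ?B" if "M \<in> Obj ?P" for M using that XA by (simp add: Bdef)
    show "Ar \<Psi> f \<in> hom ?B (Ob \<Psi> M) (Ob \<Psi> N)" if f: "f \<in> hom ?P M N" for M N f
    proof -
      obtain h where h: "f = (M, h, N)" and MN: "is_pmodel T M" "is_pmodel T N" using f unfolding hom_PMod by blast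
      show ?thesis using f homB[OF MN] unfolding h by simp
    qed
    show "Ar \<Psi> (Id ?P M) = Id ?B (Ob \<Psi> M)" for M by (simp add: PMod_def Bdef carX)
    show "Ar \<Psi> (Comp ?P g f) = Comp ?B (Ar \<Psi> g) (Ar \<Psi> f)" for f g
      by (cases f; cases g) (simp add: PMod_def Bdef carX)
  qed
  have "is_equivalence ?P ?B \<Psi>"
  proof (rule is_equivalenceI[OF category_PMod cB F])
    show "fully_faithful ?P ?B \<Psi>"
    proof (rule fully_faithfulI[OF F category_PMod])
      fix M N f g assume f: "f \<in> hom ?P M N" and g: "g \<in> hom ?P M N" and e: "Ar \<Psi> f = Ar \<Psi> g"
      obtain h k where "f = (M, h, N)" "g = (M, k, N)" using f g unfolding hom_PMod by blast
      then show "f = g" using e by simp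
    next
      fix M N k assume MN: "M \<in> Obj ?P" "N \<in> Obj ?P" and k: "k \<in> hom ?B (Ob \<Psi> M) (Ob \<Psi> N)"
      obtain h where h: "k = (X M, h, X N)" using k unfolding Bdef hom_pcat by auto
      have "(M, h, N) \<in> hom ?P M N" using homB k MN h by simp
      then show "\<exists>f\<in>hom ?P M N. Ar \<Psi> f = k" using h by (intro bexI[of _ "(M, h, N)"]) simp_all
    qed
    show "ess_surj ?P ?B \<Psi>"
      unfolding ess_surj_def
    proof
      interpret B: category ?B by (rule cB)
      fix A assume A: "A \<in> Obj ?B"
      then have "A \<in> \<A>" by (simp add: Bdef)
      from AX[OF this] have a: "red (sgn T) Inr A \<in> Obj ?P" "X (red (sgn T) Inr A) = A" by auto
      have "iso_arr ?B (Id ?B A)"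
        using B.iso_arr_iff[OF B.Id_in[OF A]] B.Id_in[OF A] B.Id_left[OF B.Id_in[OF A]] by blast
      then show "\<exists>c\<in>Obj ?P. \<exists>f\<in>hom ?B (Ob \<Psi> c) A. iso_arr ?B f"
        using a B.Id_in[OF A] by (intro bexI[OF _ a(1)] bexI[of _ "Id ?B A"]) simp_all
    qed
  qed
  then have "equivalent_cats ?P ?B" by (auto simp: equivalent_cats_def)
  moreover have "\<forall>e\<in>E. prem e = Top" by (simp add: E_def)
  ultimately show ?thesis using rel tot cB by blast
qed

end

theorem theorem5p16:
  fixes S :: "('s, 'f, 'r) pht"
    and C :: "('o, 'a) cat"
  assumes "universe TYPE('u)"
    and "equational_theory TYPE('u) S"
    and "category C"
  shows
    "(monadic_sifted TYPE('u) C (PMod S :: ('s, 'f, 'r, 'u) pstructure_cat)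
       \<longleftrightarrow>
      (\<exists>(\<Omega> :: ('s, 'f, 'r, 'u) relsig) E.
         relative_algebraic_theory TYPE('u) S \<Omega> E \<and>
         (\<forall>\<omega> \<in> ops \<Omega>. total_op TYPE('u) S \<Omega> E \<omega>) \<and>
         (\<forall>e \<in> E. prem e = Top) \<and>
         equivalent_cats C (Alg S \<Omega> E :: ('s, 'f + 'u, 'r, 'u) pstructure_cat)))
     \<and>
     (monadic_sifted TYPE('u) C (PMod S :: ('s, 'f, 'r, 'u) pstructure_cat)
       \<longleftrightarrow>
      (\<exists>(T :: ('s, 'u, 'u) pht) \<rho>f \<rho>r.
         equational_theory TYPE('u) T \<and>
         theory_morphism TYPE('u) S T \<rho>f \<rho>r \<and>
         equivalent_cats C (PMod T :: ('s, 'u, 'u, 'u) pstructure_cat)))"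
    (is "(?i \<longleftrightarrow> ?ii) \<and> (?i \<longleftrightarrow> ?iii)")
proof -
  interpret univ "TYPE('u)" by unfold_locales (rule assms(1))
  note S = assms(2) and C = assms(3)
  have "?ii" if iii: ?iii
  proof -
    obtain T :: "('s, 'u, 'u) pht" and \<rho>f \<rho>r where T: "equational_theory TYPE('u) T" "theory_morphism TYPE('u) S T \<rho>f \<rho>r"
      and e: "equivalent_cats C (PMod T :: ('s, 'u, 'u, 'u) pstructure_cat)" using iii by blast
    obtain \<Omega> :: "('s, 'f, 'r, 'u) relsig" and E where "relative_algebraic_theory TYPE('u) S \<Omega> E"
      "\<forall>\<omega> \<in> ops \<Omega>. total_op TYPE('u) S \<Omega> E \<omega>" "\<forall>e \<in> E. prem e = Top"
      and e': "equivalent_cats (PMod T :: ('s, 'u, 'u, 'u) pstructure_cat) (Alg S \<Omega> E :: ('s, 'f + 'u, 'r, 'u) pstructure_cat)"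
        "category (Alg S \<Omega> E :: ('s, 'f + 'u, 'r, 'u) pstructure_cat)"
      using models_as_Alg[OF S T(1) theory_morphism_red[OF S T]] by blast
    then show ?thesis using equivalent_cats_trans[OF C category_PMod e'(2) e e'(1)] by blast
  qed
  moreover have "?i" if ii: ?ii
  proof -
    obtain \<Omega> :: "('s, 'f, 'r, 'u) relsig" and E where O: "relative_algebraic_theory TYPE('u) S \<Omega> E"
      "\<forall>\<omega> \<in> ops \<Omega>. total_op TYPE('u) S \<Omega> E \<omega>" "\<forall>e \<in> E. prem e = Top"
      and e: "equivalent_cats C (Alg S \<Omega> E :: ('s, 'f + 'u, 'r, 'u) pstructure_cat)" using ii by blast
    obtain T :: "('s, 'f + 'u, 'r) pht" where T: "equational_theory TYPE('u) T" "model_morphism TYPE('u) S T Inl"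
      and eq: "(Alg S \<Omega> E :: ('s, 'f + 'u, 'r, 'u) pstructure_cat) = PMod T" using Alg_as_models[OF S O] by blast
    \<comment> \<open>The category of algebras equals a category of models, so the given equivalence
      can be rewritten; the symbols of this theory have type \<open>'f + 'u\<close>.\<close>
    show ?thesis by (rule monadic_of_equivalence[OF S T C e[unfolded eq]])
  qed
  moreover have "?iii" if ?i by (rule theory_of_monadic[OF assms(1) S C that])
  ultimately show ?thesis by blast
qed

end
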